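(* Let $\pmb k$ be a field, $A$ a standard-graded Artinian Gorenstein $\pmb k$-algebra, $S=\operatorname{Sym}_{\bullet}^{\pmb k}A_1$ the standard-graded polynomial ring, $I$ the kernel of the natural surjection $S\to A$, $d=\dim_{\pmb k}A_1$, and $n$ the least index with $I_n\neq 0$. Assume that $3\le d$ and $2\le n$. Let $U$ be a free $\mathbb Z$-module of rank $d$, let $\mathfrak R$ and the complex $(\mathbb B,b)$ of free $\mathfrak R$-modules be as defined in the context (for these $U,d,n$ and for any choice of $x_1,x_1^*$), let $\alpha:\pmb k\otimes_{\mathbb Z} U\to S_1$ be any vector space isomorphism, let $\phi\in D_{2n-2}^{\pmb k}(S_1^* )$ be a Macaulay inverse system for $A$, and let $\rho:\mathfrak R\to S$ be the ring homomorphism which corresponds to the data $(\alpha,\phi)$. If the minimal homogeneous resolution of $A$ by free $S$-modules is Gorenstein-linear, then ${\mathbf B}=S\otimes_{\rho}\mathbb B$ is a minimal homogeneous resolution of $A$ by free $S$-modules. Furthermore, ${\mathbf B}$ is explicitly constructed in a polynomial manner from the coefficients of $\phi$: the entries of the matrices of its differentials are the images under $\rho$ of the entries of the explicitly given maps $b_r$, hence polynomials with integer coefficients in the elements $\alpha(1\otimes x_i)$ of $S_1$ and the coefficients of $\phi$.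
   Context: Gorenstein-linear: a homogeneous complex of free modules over a graded ring $R$ is Gorenstein-linear if it has the form $0\to R(-2n-t+2)^{s_t}\to R(-n-t+2)^{s_{t-1}}\to\dots\to R(-n-1)^{s_2}\to R(-n)^{s_1}\to R^{s_0}$ for some integers $n,t,s_i$. Macaulay inverse system: for $V$ a $\pmb k$-vector space with $\pmb k$-dual $V^*$, $\operatorname{Sym}^{\pmb k}_\bullet V$ acts on the divided power module $D^{\pmb k}_\bullet(V^* )$ (the graded dual of $\operatorname{Sym}^{\pmb k}_\bullet V$) by contraction; $\phi$ is a Macaulay inverse system for $A=S/I$ if $I=\operatorname{ann}(\phi)=\{\mu\in S\mid \mu(\phi)=0\}$. Correspondence $(\alpha,\phi)\mapsto\rho$: $\rho:\mathfrak R\to S$ is the unique ring homomorphism with $\rho(u)=\alpha(1\otimes u)$ for $u\in U=\mathfrak R_{(1,0)}$ and $\rho(\mu)=\phi\big(\operatorname{Sym}(\alpha)(1\otimes\mu)\big)\in\pmb k=S_0$ for $\mu\in \operatorname{Sym}_{2n-2}U=\mathfrak R_{(0,1)}$. Notation. Unadorned $\otimes,\bigwedge,\operatorname{Sym},D$ (divided powers), $(\ )^*$ are over $\mathbb Z$. $U$ is a free $\mathbb Z$-module of rank $d$. $\operatorname{Sym}_\bullet U$ acts on $D_\bullet(U^* )$ (the graded dual of $\operatorname{Sym}_\bullet U$) by contraction, $[\mu(\nu)](\mu')=\nu(\mu\mu')$. $U^*$ acts on $\bigwedge^\bullet U$ by $u^*(u_1\wedge\dots\wedge u_r)=\sum_i(-1)^{i+1}u^*(u_i)\,u_1\wedge\dots\widehat{u_i}\dots\wedge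 u_r$. $\mathfrak R=\operatorname{Sym}_\bullet(U\oplus\operatorname{Sym}_{2n-2}U)$ is bigraded with $\mathfrak R_{(1,0)}=U$ and $\mathfrak R_{(0,1)}=\operatorname{Sym}_{2n-2}U$. $\Phi\in\mathfrak R\otimes D_{2n-2}(U^* )$ is the element corresponding to the inclusion $\operatorname{Sym}_{2n-2}U=\mathfrak R_{(0,1)}\subseteq\mathfrak R$. $p:\operatorname{Sym}_{n-1}U\to\mathfrak R\otimes D_{n-1}(U^* )$ is $p(\mu)=\mu(\Phi)$; $\pmb\delta\in\mathfrak R$ is the determinant of $p$ with respect to a basis of $\operatorname{Sym}_{n-1}U$ and the dual basis of $D_{n-1}(U^* )$; $q:D_{n-1}(U^* )\to\mathfrak R\otimes\operatorname{Sym}_{n-1}U$ is the classical adjoint of $p$, i.e. the unique homomorphism with $[q(\nu)](\Phi)=\pmb\delta\nu$ for all $\nu$. Fix $x_1\in U$, $x_1^*\in U^*$ with $x_1^*(x_1)=1$; $U_0=\ker(x_1^* )$, so $U=\mathbb Zx_1\oplus U_0$; $U_0^*=\{u^*\in U^*\mid u^*(x_1)=0\}$. $\widetilde\Phi\in\mathfrak R\otimes D_{2n-1}(U^* )$ is the unique element with $x_1(\widetilde\Phi)=\Phi$ and $\mu(\widetilde\Phi)=0$ for all $\mu\in\operatorname{Sym}_{2n-1}(U_0)$. Let $x_2,\dots,x_d$ be a basis of $U_0$ and $x_1^*,\dots,x_d^*$ the basis of $U^*$ dual to $x_1,\dots,x_d$ (the constructions do not depend on this basis). $\binom{x_2,\dots,x_d}{s}$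 is the set of monomials of degree $s$ in $x_2,\dots,x_d$; for a monomial $m=x_1^{a_1}\cdots x_d^{a_d}$, $m^*={x_1^*}^{(a_1)}\cdots{x_d^*}^{(a_d)}$. Put $\kappa(\theta\otimes\mu)=\sum_{i=1}^d x_i^*(\theta)\otimes x_i\mu$ on $\bigwedge^aU\otimes\operatorname{Sym}_bU$ and $\eta(\theta\otimes\nu)=\sum_{i=1}^d x_i^*(\theta)\otimes x_i(\nu)$ on $\bigwedge^aU\otimes D_b(U^* )$; $L_{a,b}U_0=\ker(\kappa:\bigwedge^aU_0\otimes\operatorname{Sym}_bU_0\to\bigwedge^{a-1}U_0\otimes\operatorname{Sym}_{b+1}U_0)$, $K_{a,b}U_0=\ker(\eta:\bigwedge^aU_0\otimes D_b(U_0^* )\to\bigwedge^{a-1}U_0\otimes D_{b-1}(U_0^* ))$. All maps are extended $\mathfrak R$-linearly; an element of $\operatorname{Sym}_\bullet U$ is viewed in $\mathfrak R$ (via $U=\mathfrak R_{(1,0)}$) when a value in $\mathfrak R$ is required. The complex $(\mathbb B,b)$: $0\to B_d\to\dots\to B_0$. $B_0=\mathfrak R$; $B_r=\mathfrak R\otimes(K_{r-1,n-1}U_0\oplus L_{r-1,n}U_0)$ for $1\le r\le d-1$; $B_d=\mathfrak R\otimes\bigwedge^{d-1}U_0$. Let $\operatorname{proj}:\operatorname{Sym}_{n-1}U\to\operatorname{Sym}_{n-1}U_0$ be induced by the projection $U\to U_0$ killing $x_1$, and $\mathrm{Kos}(\theta)=\sum_{i=1}^dx_i\otimes x_i^*(\theta)$.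 $b_1(\nu)=x_1q(\nu)$ for $\nu\in K_{0,n-1}U_0=D_{n-1}(U_0^* )$ and $b_1(\mu)=\pmb\delta\mu-x_1q(\mu(\widetilde\Phi))$ for $\mu\in L_{0,n}U_0=\operatorname{Sym}_nU_0$. For $2\le r\le d-1$ and $\sum_i\theta_i\otimes\nu_i\in K_{r-1,n-1}U_0$: $b_r(\sum_i\theta_i\otimes\nu_i)$ has component $-x_1\otimes\sum_i\eta(\theta_i\otimes[q(\nu_i)](\widetilde\Phi))+\pmb\delta\sum_i\mathrm{Kos}(\theta_i)\otimes\nu_i$ in $\mathfrak R\otimes K_{r-2,n-1}U_0$ and component $-x_1\otimes\sum_i\kappa(\theta_i\otimes\operatorname{proj}(q(\nu_i)))$ in $\mathfrak R\otimes L_{r-2,n}U_0$. For $2\le r\le d-1$ and $\sum_i\theta_i\otimes\mu_i\in L_{r-1,n}U_0$: $b_r(\sum_i\theta_i\otimes\mu_i)$ has component $x_1\otimes\sum_i\eta(\theta_i\otimes[q(\mu_i(\widetilde\Phi))](\widetilde\Phi))$ in $\mathfrak R\otimes K_{r-2,n-1}U_0$ and component $x_1\otimes\sum_i\kappa(\theta_i\otimes\operatorname{proj}(q(\mu_i(\widetilde\Phi))))+\pmb\delta\sum_i\mathrm{Kos}(\theta_i)\otimes\mu_i$ in $\mathfrak R\otimes L_{r-2,n}U_0$. For $\omega\in\bigwedge^{d-1}U_0$: $b_d(\omega)$ has component $\sum_{m\in\binom{x_2,\dots,x_d}{n}}[\pmb\delta m-x_1q(m(\widetilde\Phi))]\otimes\eta(\omega\otimes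 m^* )$ in $\mathfrak R\otimes K_{d-2,n-1}U_0$ and component $-\sum_{m\in\binom{x_2,\dots,x_d}{n-1}}x_1q(m^* )\otimes\kappa(\omega\otimes m)$ in $\mathfrak R\otimes L_{d-2,n}U_0$. *)

theory Defs
  imports "HOL-Library.Poly_Mapping" "HOL-Library.Cardinality" "Jordan_Normal_Form.Determinant"
begin

section \<open>Monomials and polynomials\<close>

text \<open>The rank \<open>d\<close> is the cardinality of a finite linearly ordered index type \<open>'d\<close>; the least
  index \<open>i1\<close> plays the role of the index \<open>1\<close>.  The linear order only enters through signs in
  the exterior algebra and through an enumeration of the monomials.\<close>

type_synonym 'd mono = "'d \<Rightarrow>\<^sub>0 nat"

definition i1 :: "'d::{finite,linorder}" where
  "i1 = Min UNIV"

definition mdeg :: "'d::finite mono \<Rightarrow> nat" where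
  "mdeg m = (\<Sum>i\<in>UNIV. Poly_Mapping.lookup m i)"

definition ei :: "'d \<Rightarrow> 'd mono" where
  "ei i = Poly_Mapping.single i 1"

definition monoms :: "nat \<Rightarrow> 'd::finite mono set" where
  "monoms j = {m. mdeg m = j}"

definition monoms0 :: "nat \<Rightarrow> 'd::{finite,linorder} mono set" where
  "monoms0 j = {m \<in> monoms j. Poly_Mapping.lookup m i1 = 0}"

text \<open>\<open>S\<close> is the polynomial ring in variables indexed by \<open>'d\<close>.\<close>

type_synonym ('d, 'k) S = "'d mono \<Rightarrow>\<^sub>0 'k"

definition constS :: "'k::zero \<Rightarrow> ('d, 'k) S" where
  "constS c = Poly_Mapping.single 0 c"

definition homogS :: "int \<Rightarrow> ('d::finite, 'k::zero) S \<Rightarrow> bool" where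
  "homogS z f \<longleftrightarrow> (\<forall>m\<in>Poly_Mapping.keys f. int (mdeg m) = z)"


section \<open>Standard-graded Artinian Gorenstein algebras\<close>

text \<open>The algebra is the whole type \<open>'a\<close>, its degree \<open>i\<close> component is \<open>G i\<close>.\<close>

definition standard_graded_algebra ::
  "('k::field \<Rightarrow> 'a::comm_ring_1 \<Rightarrow> 'a) \<Rightarrow> (nat \<Rightarrow> 'a set) \<Rightarrow> bool" where
  "standard_graded_algebra scale G \<longleftrightarrow>
     vector_space scale \<and>
     (\<forall>c x y. scale c x * y = scale c (x * y)) \<and>
     (\<forall>i. module.subspace scale (G i)) \<and>
     (\<forall>x. \<exists>!c. (\<forall>i. c i \<in> G i) \<and> finite {i. c i \<noteq> 0} \<and> x = (\<Sum>i | c i \<noteq> 0. c i)) \<and>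
     (\<forall>i j. \<forall>x\<in>G i. \<forall>y\<in>G j. x * y \<in> G (i + j)) \<and>
     G 0 = range (\<lambda>c. scale c 1) \<and>
     (\<forall>i. G (Suc i) = module.span scale {x * y | x y. x \<in> G 1 \<and> y \<in> G i}) \<and>
     (\<exists>B. finite B \<and> module.span scale B = G 1)"

definition artinian :: "'a::comm_ring_1 itself \<Rightarrow> bool" where
  "artinian _ \<longleftrightarrow>
     \<not> (\<exists>J :: nat \<Rightarrow> 'a set. (\<forall>i. module.subspace (*) (J i)) \<and> (\<forall>i. J (Suc i) \<subset> J i))"

definition socle :: "(nat \<Rightarrow> 'a::comm_ring_1 set) \<Rightarrow> 'a set" where
  "socle G = {x. \<forall>i>0. \<forall>y\<in>G i. x * y = 0}"

text \<open>An Artinian graded algebra with \<open>G 0\<close> a field is local with maximal ideal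
  \<open>\<Oplus>i>0. G i\<close>; it is Gorenstein when its socle is one-dimensional.\<close>

definition artinian_gorenstein ::
  "('k::field \<Rightarrow> 'a::comm_ring_1 \<Rightarrow> 'a) \<Rightarrow> (nat \<Rightarrow> 'a set) \<Rightarrow> bool" where
  "artinian_gorenstein scale G \<longleftrightarrow>
     standard_graded_algebra scale G \<and> artinian TYPE('a) \<and>
     vector_space.dim scale (socle G) = 1"

text \<open>\<open>a\<close> is a basis of the degree one component.  It identifies the symmetric algebra of this
  component with \<open>('d, 'k) S\<close>, and the natural surjection becomes evaluation at \<open>a\<close>.\<close>

definition basis_deg1 ::
  "('k::field \<Rightarrow> 'a::comm_ring_1 \<Rightarrow> 'a) \<Rightarrow> (nat \<Rightarrow> 'a set) \<Rightarrow> ('d \<Rightarrow> 'a) \<Rightarrow> bool" where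
  "basis_deg1 scale G a \<longleftrightarrow>
     inj a \<and> \<not> module.dependent scale (range a) \<and> module.span scale (range a) = G 1"

definition nat_surj ::
  "('k::field \<Rightarrow> 'a::comm_ring_1 \<Rightarrow> 'a) \<Rightarrow> ('d::finite \<Rightarrow> 'a) \<Rightarrow> ('d, 'k) S \<Rightarrow> 'a" where
  "nat_surj scale a f = (\<Sum>m\<in>Poly_Mapping.keys f. scale (Poly_Mapping.lookup f m) (\<Prod>i\<in>UNIV. a i ^ Poly_Mapping.lookup m i))"

definition least_degree :: "('d::finite, 'k::zero) S set \<Rightarrow> nat \<Rightarrow> bool" where
  "least_degree I n \<longleftrightarrow>
     (\<exists>f\<in>I. f \<noteq> 0 \<and> homogS (int n) f) \<and> (\<forall>j<n. \<forall>f\<in>I. homogS (int j) f \<longrightarrow> f = 0)"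


section \<open>Minimal homogeneous resolutions\<close>

text \<open>A graded free module \<open>\<Oplus>j. S(-c\<^sub>j)\<close> is given by the list of the integers
  \<open>c\<^sub>j\<close>.  A complex is given by such lists \<open>F r\<close> and matrices \<open>M r\<close>, for \<open>r \<ge> 1\<close>, of maps from
  the \<open>r\<close>-th to the \<open>(r-1)\<close>-st module.\<close>

definition homogeneous_maps ::
  "(nat \<Rightarrow> int list) \<Rightarrow> (nat \<Rightarrow> ('d::finite, 'k::field) S mat) \<Rightarrow> bool" where
  "homogeneous_maps F M \<longleftrightarrow>
     (\<forall>r\<ge>1. M r \<in> carrier_mat (length (F (r - 1))) (length (F r)) \<and>
        (\<forall>i<length (F (r - 1)). \<forall>j<length (F r). homogS (F r ! j - F (r - 1) ! i) (M r $$ (i, j))))"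

definition mat_image :: "'r::comm_ring_1 mat \<Rightarrow> 'r vec set" where
  "mat_image P = (\<lambda>v. P *\<^sub>v v) ` carrier_vec (dim_col P)"

definition mat_ker :: "'r::comm_ring_1 mat \<Rightarrow> 'r vec set" where
  "mat_ker P = {v \<in> carrier_vec (dim_col P). P *\<^sub>v v = 0\<^sub>v (dim_row P)}"

text \<open>\<open>A\<close> is an \<open>S\<close>-module through \<open>\<pi> : S \<rightarrow> A\<close>; an \<open>S\<close>-linear map from a free module
  to \<open>A\<close> is given by the list \<open>g\<close> of the images of the basis elements.\<close>

definition augmentation ::
  "(('d, 'k) S \<Rightarrow> 'a::comm_ring_1) \<Rightarrow> 'a list \<Rightarrow> ('d, 'k) S vec \<Rightarrow> 'a" where
  "augmentation \<pi> g v = (\<Sum>i<length g. \<pi> (v $ i) * g ! i)"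

definition homogeneous_free_resolution ::
  "(('d::finite, 'k::field) S \<Rightarrow> 'a::comm_ring_1) \<Rightarrow> (nat \<Rightarrow> 'a set) \<Rightarrow>
   (nat \<Rightarrow> int list) \<Rightarrow> (nat \<Rightarrow> ('d, 'k) S mat) \<Rightarrow> bool" where
  "homogeneous_free_resolution \<pi> G F M \<longleftrightarrow>
     homogeneous_maps F M \<and>
     (\<exists>g. length g = length (F 0) \<and>
        (\<forall>i<length g. g ! i \<in> (if F 0 ! i \<ge> 0 then G (nat (F 0 ! i)) else {0})) \<and>
        augmentation \<pi> g ` carrier_vec (length (F 0)) = UNIV \<and>
        {v \<in> carrier_vec (length (F 0)). augmentation \<pi> g v = 0} = mat_image (M 1)) \<and>
     (\<forall>r\<ge>1. mat_ker (M r) = mat_image (M (Suc r)))"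

text \<open>Minimality: the differentials have entries in the ideal generated by the variables, that is,
  without constant term.\<close>

definition minimal_homogeneous_resolution ::
  "(('d::finite, 'k::field) S \<Rightarrow> 'a::comm_ring_1) \<Rightarrow> (nat \<Rightarrow> 'a set) \<Rightarrow>
   (nat \<Rightarrow> int list) \<Rightarrow> (nat \<Rightarrow> ('d, 'k) S mat) \<Rightarrow> bool" where
  "minimal_homogeneous_resolution \<pi> G F M \<longleftrightarrow>
     homogeneous_free_resolution \<pi> G F M \<and>
     (\<forall>r\<ge>1. \<forall>i<dim_row (M r). \<forall>j<dim_col (M r). Poly_Mapping.lookup (M r $$ (i, j)) 0 = 0)"

definition gorenstein_linear :: "(nat \<Rightarrow> int list) \<Rightarrow> bool" where
  "gorenstein_linear F \<longleftrightarrow>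
     (\<exists>(n::int) (t::nat) (s :: nat \<Rightarrow> nat). t \<ge> 1 \<and>
        F 0 = replicate (s 0) 0 \<and>
        (\<forall>r. 1 \<le> r \<and> r < t \<longrightarrow> F r = replicate (s r) (n + int r - 1)) \<and>
        F t = replicate (s t) (2 * n + int t - 2) \<and>
        (\<forall>r>t. F r = []))"


section \<open>Macaulay inverse systems\<close>

text \<open>The graded dual of \<open>S\<close> consists of the linear functionals vanishing in almost all
  degrees.  The component of degree \<open>j\<close>, which is the \<open>j\<close>-th divided power of the dual of \<open>S\<^sub>1\<close>,
  consists of those vanishing outside degree \<open>j\<close>.\<close>

definition divided_power_dual :: "nat \<Rightarrow> (('d::finite, 'k::field) S \<Rightarrow> 'k) set" where
  "divided_power_dual j = {\<phi>. (\<forall>f g. \<phi> (f + g) = \<phi> f + \<phi> g) \<and> (\<forall>c f. \<phi> (constS c * f) = c * \<phi> f) \<and>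
     (\<forall>l f. l \<noteq> j \<and> homogS (int l) f \<longrightarrow> \<phi> f = 0)}"

definition contractS :: "('d, 'k::field) S \<Rightarrow> (('d, 'k) S \<Rightarrow> 'k) \<Rightarrow> ('d, 'k) S \<Rightarrow> 'k" where
  "contractS \<mu> \<phi> = (\<lambda>\<mu>'. \<phi> (\<mu> * \<mu>'))"

definition annS :: "(('d, 'k::field) S \<Rightarrow> 'k) \<Rightarrow> ('d, 'k) S set" where
  "annS \<phi> = {\<mu>. contractS \<mu> \<phi> = (\<lambda>_. 0)}"


section \<open>The ring of the generic complex\<close>

text \<open>\<open>U\<close> is \<open>'d \<Rightarrow> int\<close>, with a basis \<open>x\<close> adapted to \<open>x1\<close> and \<open>x1s\<close> (a functional on \<open>U\<close>
  given by its values on the standard basis): \<open>x i1 = x1\<close>, and the other \<open>x i\<close> form a basis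
  of the kernel of \<open>x1s\<close>.\<close>

definition adapted_basis ::
  "('d::{finite,linorder} \<Rightarrow> int) \<Rightarrow> ('d \<Rightarrow> int) \<Rightarrow> ('d \<Rightarrow> 'd \<Rightarrow> int) \<Rightarrow> bool" where
  "adapted_basis x1 x1s x \<longleftrightarrow>
     x i1 = x1 \<and>
     (\<forall>i. i \<noteq> i1 \<longrightarrow> (\<Sum>l\<in>UNIV. x1s l * x i l) = 0) \<and>
     (\<forall>u. (\<Sum>l\<in>UNIV. x1s l * u l) = 0 \<longrightarrow>
        (\<exists>!c. c i1 = 0 \<and> u = (\<lambda>l. \<Sum>i\<in>UNIV. c i * x i l)))"

text \<open>The symmetric algebra of \<open>U\<close> is the polynomial ring on the basis \<open>x\<close>, and \<open>\<RR>\<close>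
  is the polynomial ring over the integers in the variables \<open>Xvar i\<close>, for the \<open>x i\<close>, and \<open>Tvar m\<close>, for
  the monomials \<open>m\<close> of degree \<open>2n-2\<close>.  The type has a variable \<open>Tvar m\<close> for every monomial \<open>m\<close>;
  \<open>Rring n\<close> is the subring in which only those of degree \<open>2n-2\<close> occur.\<close>

type_synonym 'd R = "('d + 'd mono \<Rightarrow>\<^sub>0 nat) \<Rightarrow>\<^sub>0 int"

definition Xvar :: "'d \<Rightarrow> 'd R" where
  "Xvar i = Poly_Mapping.single (Poly_Mapping.single (Inl i) 1) 1"

definition Tvar :: "'d mono \<Rightarrow> 'd R" where
  "Tvar m = Poly_Mapping.single (Poly_Mapping.single (Inr m) 1) 1"

definition Rring :: "nat \<Rightarrow> 'd::finite R set" where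
  "Rring n = {P. \<forall>w\<in>Poly_Mapping.keys P. \<forall>m. Inr m \<in> Poly_Mapping.keys w \<longrightarrow> mdeg m = 2 * n - 2}"

definition evalR :: "('d + 'd mono \<Rightarrow> 's::comm_ring_1) \<Rightarrow> 'd R \<Rightarrow> 's" where
  "evalR h P = (\<Sum>w\<in>Poly_Mapping.keys P. of_int (Poly_Mapping.lookup P w) * (\<Prod>v\<in>Poly_Mapping.keys w. h v ^ Poly_Mapping.lookup w v))"

definition linear_iso_deg1 :: "(('d::finite \<Rightarrow> 'k::field) \<Rightarrow> ('d, 'k) S) \<Rightarrow> bool" where
  "linear_iso_deg1 \<alpha> \<longleftrightarrow>
     (\<forall>v w. \<alpha> (\<lambda>i. v i + w i) = \<alpha> v + \<alpha> w) \<and>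
     (\<forall>c v. \<alpha> (\<lambda>i. c * v i) = constS c * \<alpha> v) \<and>
     bij_betw \<alpha> UNIV {f. homogS 1 f}"

text \<open>\<open>one_tensor u\<close> is \<open>1 \<otimes> u\<close>, where \<open>\<^bold>k \<otimes> U\<close> is \<open>'d \<Rightarrow> 'k\<close>.  \<open>sym_alpha x \<alpha> m\<close> is
  \<open>Sym(\<alpha>)(1 \<otimes> m)\<close> for a monomial \<open>m\<close> in the basis \<open>x\<close>.\<close>

definition one_tensor :: "('d \<Rightarrow> int) \<Rightarrow> 'd \<Rightarrow> 'k::field" where
  "one_tensor u = (\<lambda>l. of_int (u l))"

definition sym_alpha ::
  "('d::finite \<Rightarrow> 'd \<Rightarrow> int) \<Rightarrow> (('d \<Rightarrow> 'k::field) \<Rightarrow> ('d, 'k) S) \<Rightarrow> 'd mono \<Rightarrow> ('d, 'k) S" where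
  "sym_alpha x \<alpha> m = (\<Prod>i\<in>UNIV. \<alpha> (one_tensor (x i)) ^ Poly_Mapping.lookup m i)"

definition corresponds ::
  "nat \<Rightarrow> ('d::finite \<Rightarrow> 'd \<Rightarrow> int) \<Rightarrow> (('d \<Rightarrow> 'k::field) \<Rightarrow> ('d, 'k) S) \<Rightarrow> (('d, 'k) S \<Rightarrow> 'k) \<Rightarrow>
   ('d R \<Rightarrow> ('d, 'k) S) \<Rightarrow> bool" where
  "corresponds n x \<alpha> \<phi> \<rho> \<longleftrightarrow>
     \<rho> 1 = 1 \<and>
     (\<forall>P\<in>Rring n. \<forall>Q\<in>Rring n. \<rho> (P + Q) = \<rho> P + \<rho> Q \<and> \<rho> (P * Q) = \<rho> P * \<rho> Q) \<and>
     (\<forall>c :: 'd \<Rightarrow> int. \<rho> (\<Sum>i\<in>UNIV. of_int (c i) * Xvar i) =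
        \<alpha> (one_tensor (\<lambda>l. \<Sum>i\<in>UNIV. c i * x i l))) \<and>
     (\<forall>c :: 'd mono \<Rightarrow> int. \<rho> (\<Sum>m\<in>monoms (2 * n - 2). of_int (c m) * Tvar m) =
        constS (\<phi> (\<Sum>m\<in>monoms (2 * n - 2). of_int (c m) * sym_alpha x \<alpha> m)))"


section \<open>Generic data\<close>

text \<open>For a ring \<open>'r\<close>, both \<open>'r \<otimes> Sym\<^sub>j U\<close> and \<open>'r \<otimes> D\<^sub>j(U\<^sup>*)\<close> are represented by functions
  \<open>'d mono \<Rightarrow> 'r\<close> vanishing outside \<open>monoms j\<close>: the coefficients with respect to the monomials \<open>m\<close> in
  the first case, with respect to the dual basis \<open>m\<^sup>*\<close> (so the value of the functional at \<open>m\<close>)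
  in the second case.\<close>

text \<open>The action of \<open>\<mu>\<close>, homogeneous of degree \<open>j\<close>.\<close>

definition act :: "nat \<Rightarrow> ('d::finite mono \<Rightarrow> 'r::comm_ring_1) \<Rightarrow> ('d mono \<Rightarrow> 'r) \<Rightarrow> 'd mono \<Rightarrow> 'r" where
  "act j \<mu> \<nu> = (\<lambda>m'. \<Sum>m\<in>monoms j. \<mu> m * \<nu> (m + m'))"

definition unit_mono :: "'d mono \<Rightarrow> 'd mono \<Rightarrow> 'r::comm_ring_1" where
  "unit_mono m = (\<lambda>m'. if m' = m then 1 else 0)"

definition Phi :: "nat \<Rightarrow> 'd::finite mono \<Rightarrow> 'd R" where
  "Phi n = (\<lambda>m. if m \<in> monoms (2 * n - 2) then Tvar m else 0)"

definition Phi_tilde :: "nat \<Rightarrow> 'd::{finite,linorder} mono \<Rightarrow> 'd R" where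
  "Phi_tilde n = (\<lambda>m. if m \<in> monoms (2 * n - 1) \<and> Poly_Mapping.lookup m i1 > 0 then Tvar (m - ei i1) else 0)"

definition mlist :: "nat \<Rightarrow> 'd::{finite,linorder} mono list" where
  "mlist j = sorted_list_of_set (monoms j)"

text \<open>The matrix of \<open>p\<close>: \<open>p(m)\<close> has value \<open>\<Phi>(m m')\<close> at \<open>m'\<close>.\<close>

definition p_mat :: "nat \<Rightarrow> 'd::{finite,linorder} R mat" where
  "p_mat n = (let ms = mlist (n - 1) in
     mat (length ms) (length ms) (\<lambda>(i, j). act (n - 1) (unit_mono (ms ! j)) (Phi n) (ms ! i)))"

definition delta :: "nat \<Rightarrow> 'd::{finite,linorder} R" where
  "delta n = det (p_mat n)"

definition q_map :: "nat \<Rightarrow> ('d::{finite,linorder} mono \<Rightarrow> 'd R) \<Rightarrow> 'd mono \<Rightarrow> 'd R" where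
  "q_map n \<nu> = (let ms = mlist (n - 1) in
     (\<lambda>m. \<Sum>i<length ms. \<Sum>j<length ms.
        adj_mat (p_mat n) $$ (i, j) * \<nu> (ms ! j) * unit_mono (ms ! i) m))"

definition proj0 :: "('d::{finite,linorder} mono \<Rightarrow> 'r::comm_ring_1) \<Rightarrow> 'd mono \<Rightarrow> 'r" where
  "proj0 \<mu> = (\<lambda>m. if Poly_Mapping.lookup m i1 = 0 then \<mu> m else 0)"

text \<open>The value in \<open>\<RR>\<close> of an element of \<open>\<RR> \<otimes> Sym\<^sub>j U\<close>.\<close>

definition value_R :: "nat \<Rightarrow> ('d::finite mono \<Rightarrow> 'd R) \<Rightarrow> 'd R" where
  "value_R j \<mu> = (\<Sum>m\<in>monoms j. \<mu> m * (\<Prod>i\<in>UNIV. Xvar i ^ Poly_Mapping.lookup m i))"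


section \<open>Exterior powers\<close>

text \<open>A finite set \<open>A = {i\<^sub>1 < \<dots> < i\<^sub>a}\<close> of indices stands for \<open>x\<^sub>A = x\<^bsub>i\<^sub>1\<^esub> \<and> \<dots> \<and> x\<^bsub>i\<^sub>a\<^esub>\<close>, and a
  function \<open>w\<close> on index sets stands for \<open>\<Sum>A. x\<^sub>A \<otimes> w A\<close>.  One has
  \<open>x\<^sub>i\<^sup>*(x\<^sub>A) = ext_sign i A x\<^bsub>A-{i}\<^esub>\<close> for \<open>i \<in> A\<close>; below, \<open>insert i B\<close> with \<open>i \<notin> B\<close> is the set
  whose contraction with \<open>x\<^sub>i\<^sup>*\<close> involves \<open>B\<close>.\<close>

definition ext_sign :: "'d::{finite,linorder} \<Rightarrow> 'd set \<Rightarrow> 'r::comm_ring_1" where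
  "ext_sign i A = (-1) ^ card {j \<in> A. j < i}"

definition kappa ::
  "('d::{finite,linorder} set \<Rightarrow> 'd mono \<Rightarrow> 'r::comm_ring_1) \<Rightarrow> 'd set \<Rightarrow> 'd mono \<Rightarrow> 'r" where
  "kappa w = (\<lambda>B m. \<Sum>i | i \<notin> B \<and> Poly_Mapping.lookup m i > 0. ext_sign i B * w (insert i B) (m - ei i))"

definition eta ::
  "('d::{finite,linorder} set \<Rightarrow> 'd mono \<Rightarrow> 'r::comm_ring_1) \<Rightarrow> 'd set \<Rightarrow> 'd mono \<Rightarrow> 'r" where
  "eta w = (\<lambda>B m. \<Sum>i | i \<notin> B. ext_sign i B * w (insert i B) (m + ei i))"

definition Kos ::
  "('d::{finite,linorder} set \<Rightarrow> 'd mono \<Rightarrow> 'd R) \<Rightarrow> 'd set \<Rightarrow> 'd mono \<Rightarrow> 'd R" where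
  "Kos w = (\<lambda>B m. \<Sum>i | i \<notin> B. ext_sign i B * Xvar i * w (insert i B) m)"

text \<open>The common coordinate description of \<open>\<And>\<^sup>a U\<^sub>0 \<otimes> Sym\<^sub>b U\<^sub>0\<close> and
  \<open>\<And>\<^sup>a U\<^sub>0 \<otimes> D\<^sub>b(U\<^sub>0\<^sup>*)\<close>.\<close>

definition ext_tensor0 ::
  "nat \<Rightarrow> nat \<Rightarrow> ('d::{finite,linorder} set \<Rightarrow> 'd mono \<Rightarrow> int) set" where
  "ext_tensor0 a b = {w. \<forall>A m. w A m \<noteq> 0 \<longrightarrow> i1 \<notin> A \<and> card A = a \<and> m \<in> monoms0 b}"

definition Lmod :: "nat \<Rightarrow> nat \<Rightarrow> ('d::{finite,linorder} set \<Rightarrow> 'd mono \<Rightarrow> int) set" where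
  "Lmod a b = {w \<in> ext_tensor0 a b. kappa w = (\<lambda>_ _. 0)}"

definition Kmod :: "nat \<Rightarrow> nat \<Rightarrow> ('d::{finite,linorder} set \<Rightarrow> 'd mono \<Rightarrow> int) set" where
  "Kmod a b = {w \<in> ext_tensor0 a b. eta w = (\<lambda>_ _. 0)}"


section \<open>The generic complex\<close>

text \<open>All modules \<open>B\<^sub>r\<close> live in one space of coordinate functions: \<open>One\<close> for \<open>B\<^sub>0 = \<RR>\<close>, \<open>KC\<close>
  and \<open>LC\<close> for the \<open>K\<close>- and the \<open>L\<close>-summand of the middle modules, \<open>WC\<close> for \<open>\<And>\<^bsup>d-1\<^esup>U\<^sub>0\<close>.\<close>

datatype 'd coord = One | KC "'d set" "'d mono" | LC "'d set" "'d mono" | WC "'d set"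

definition Kpart :: "('d coord \<Rightarrow> 'r) \<Rightarrow> 'd set \<Rightarrow> 'd mono \<Rightarrow> 'r" where
  "Kpart z = (\<lambda>A m. z (KC A m))"

definition Lpart :: "('d coord \<Rightarrow> 'r) \<Rightarrow> 'd set \<Rightarrow> 'd mono \<Rightarrow> 'r" where
  "Lpart z = (\<lambda>A m. z (LC A m))"

definition of_KL ::
  "('d set \<Rightarrow> 'd mono \<Rightarrow> 'r::zero) \<Rightarrow> ('d set \<Rightarrow> 'd mono \<Rightarrow> 'r) \<Rightarrow> 'd coord \<Rightarrow> 'r" where
  "of_KL w v = (\<lambda>k. case k of KC A m \<Rightarrow> w A m | LC A m \<Rightarrow> v A m | _ \<Rightarrow> 0)"

text \<open>The free \<open>\<int>\<close>-module \<open>lattice n r\<close> with \<open>B\<^sub>r = \<RR> \<otimes> lattice n r\<close>.\<close>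

definition lattice :: "nat \<Rightarrow> nat \<Rightarrow> ('d::{finite,linorder} coord \<Rightarrow> int) set" where
  "lattice n r =
     (if r = 0 then {z. \<forall>k. z k \<noteq> 0 \<longrightarrow> k = One}
      else if r < CARD('d) then {of_KL w v | w v. w \<in> Kmod (r - 1) (n - 1) \<and> v \<in> Lmod (r - 1) n}
      else if r = CARD('d) then
        {z. \<forall>k. z k \<noteq> 0 \<longrightarrow> (\<exists>A. k = WC A \<and> i1 \<notin> A \<and> card A = CARD('d) - 1)}
      else {\<lambda>_. 0})"

definition b_first :: "nat \<Rightarrow> ('d::{finite,linorder} coord \<Rightarrow> 'd R) \<Rightarrow> 'd coord \<Rightarrow> 'd R" where
  "b_first n z = (let \<nu> = Kpart z {}; \<mu> = Lpart z {} in
     (\<lambda>k. if k = One then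
          Xvar i1 * value_R (n - 1) (q_map n \<nu>)
          + (delta n * value_R n \<mu> - Xvar i1 * value_R (n - 1) (q_map n (act n \<mu> (Phi_tilde n))))
        else 0))"

definition b_mid :: "nat \<Rightarrow> ('d::{finite,linorder} coord \<Rightarrow> 'd R) \<Rightarrow> 'd coord \<Rightarrow> 'd R" where
  "b_mid n z = (let w = Kpart z; v = Lpart z;
       qK = (\<lambda>A. q_map n (w A));
       qL = (\<lambda>A. q_map n (act n (v A) (Phi_tilde n))) in
     of_KL
       (\<lambda>B m. (- Xvar i1 * eta (\<lambda>A. act (n - 1) (qK A) (Phi_tilde n)) B m + delta n * Kos w B m)
            + Xvar i1 * eta (\<lambda>A. act (n - 1) (qL A) (Phi_tilde n)) B m)
       (\<lambda>B m. - Xvar i1 * kappa (\<lambda>A. proj0 (qK A)) B m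
            + (Xvar i1 * kappa (\<lambda>A. proj0 (qL A)) B m + delta n * Kos v B m)))"

definition b_last :: "nat \<Rightarrow> ('d::{finite,linorder} coord \<Rightarrow> 'd R) \<Rightarrow> 'd coord \<Rightarrow> 'd R" where
  "b_last n z = (let \<omega> = (\<lambda>A. z (WC A)) in
     of_KL
       (\<lambda>B m'. \<Sum>m\<in>monoms0 n.
          (delta n * value_R n (unit_mono m)
             - Xvar i1 * value_R (n - 1) (q_map n (act n (unit_mono m) (Phi_tilde n))))
          * eta (\<lambda>A l. \<omega> A * unit_mono m l) B m')
       (\<lambda>B m'. - (\<Sum>m\<in>monoms0 (n - 1).
          Xvar i1 * value_R (n - 1) (q_map n (unit_mono m)) * kappa (\<lambda>A l. \<omega> A * unit_mono m l) B m')))"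

definition b_map :: "nat \<Rightarrow> nat \<Rightarrow> ('d::{finite,linorder} coord \<Rightarrow> 'd R) \<Rightarrow> 'd coord \<Rightarrow> 'd R" where
  "b_map n r z =
     (if r = 1 then b_first n z
      else if 2 \<le> r \<and> r < CARD('d) then b_mid n z
      else if r = CARD('d) then b_last n z
      else (\<lambda>_. 0))"


section \<open>Matrices and base change\<close>

definition lattice_basis :: "('c \<Rightarrow> int) list \<Rightarrow> ('c \<Rightarrow> int) set \<Rightarrow> bool" where
  "lattice_basis es \<Lambda> \<longleftrightarrow>
     set es \<subseteq> \<Lambda> \<and>
     (\<forall>z\<in>\<Lambda>. \<exists>!c. c \<in> carrier_vec (length es) \<and> z = (\<lambda>k. \<Sum>i<length es. c $ i * (es ! i) k))"

definition complex_bases ::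
  "nat \<Rightarrow> (nat \<Rightarrow> ('d::{finite,linorder} coord \<Rightarrow> int) list) \<Rightarrow> bool" where
  "complex_bases n E \<longleftrightarrow> (\<forall>r. lattice_basis (E r) (lattice n r))"

text \<open>The elements \<open>1 \<otimes> e\<close>, for \<open>e\<close> in \<open>E r\<close>, form a basis of the free \<open>\<RR>\<close>-module \<open>B\<^sub>r\<close>; \<open>D r\<close>
  is the matrix of \<open>b\<^sub>r\<close> with respect to these bases.\<close>

definition complex_matrices ::
  "nat \<Rightarrow> (nat \<Rightarrow> ('d::{finite,linorder} coord \<Rightarrow> int) list) \<Rightarrow> (nat \<Rightarrow> 'd R mat) \<Rightarrow> bool" where
  "complex_matrices n E D \<longleftrightarrow>
     (\<forall>r\<ge>1. D r \<in> carrier_mat (length (E (r - 1))) (length (E r)) \<and>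
        (\<forall>j<length (E r). b_map n r (\<lambda>k. of_int ((E r ! j) k)) =
           (\<lambda>k. \<Sum>i<length (E (r - 1)). D r $$ (i, j) * of_int ((E (r - 1) ! i) k))))"

text \<open>The base change \<open>S \<otimes>\<^sub>\<rho> B\<close> is the complex of free \<open>S\<close>-modules with the
  matrices \<open>map_mat \<rho> (D r)\<close>.  The generators of \<open>S \<otimes>\<^sub>\<rho> B\<^sub>r\<close> have degree \<open>0\<close> for \<open>r = 0\<close>,
  \<open>n + r - 1\<close> for \<open>1 \<le> r < d\<close>, and \<open>2n + d - 2\<close> for \<open>r = d\<close>.\<close>

definition base_change_degrees ::
  "nat \<Rightarrow> (nat \<Rightarrow> ('d::{finite,linorder} coord \<Rightarrow> int) list) \<Rightarrow> nat \<Rightarrow> int list" where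
  "base_change_degrees n E r = replicate (length (E r))
     (if r = 0 then 0
      else if r < CARD('d) then int n + int r - 1
      else 2 * int n + int (CARD('d)) - 2)"

definition base_change_matrices ::
  "('d R \<Rightarrow> ('d, 'k) S) \<Rightarrow> (nat \<Rightarrow> 'd R mat) \<Rightarrow> nat \<Rightarrow> ('d, 'k) S mat" where
  "base_change_matrices \<rho> D r = map_mat \<rho> (D r)"


section \<open>The explicit formulas have the characterizing properties\<close>

lemma mdeg_add: "mdeg (m + m') = mdeg m + mdeg m'"
  by (simp add: mdeg_def lookup_add sum.distrib)

lemma mdeg_ei [simp]: "mdeg (ei i :: 'd::finite mono) = 1"
  by (simp add: mdeg_def ei_def lookup_single when_def)

lemma mdeg_eq_0_iff: "mdeg m = 0 \<longleftrightarrow> m = 0"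
  by (auto simp: mdeg_def poly_mapping_eq_iff fun_eq_iff)

lemma ei_add_diff: "Poly_Mapping.lookup m i > 0 \<Longrightarrow> ei i + (m - ei i) = m"
  by (rule poly_mapping_eqI) (auto simp: ei_def lookup_add lookup_minus lookup_single when_def)

lemma finite_monoms [simp]: "finite (monoms j :: 'd::finite mono set)"
proof -
  have "finite (Poly_Mapping.lookup ` (monoms j :: 'd mono set))"
  proof (rule finite_subset)
    show "Poly_Mapping.lookup ` (monoms j :: 'd mono set) \<subseteq> UNIV \<rightarrow>\<^sub>E {..j}"
    proof (auto simp: monoms_def mdeg_def PiE_def)
      fix m :: "'d mono" and i
      show "Poly_Mapping.lookup m i \<le> (\<Sum>i\<in>UNIV. Poly_Mapping.lookup m i)"
        by (rule member_le_sum) auto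
    qed
    show "finite (UNIV \<rightarrow>\<^sub>E {..j} :: ('d \<Rightarrow> nat) set)"
      by (rule finite_PiE) auto
  qed
  thus ?thesis
    by (rule finite_imageD) (simp add: inj_on_def lookup_inject)
qed

lemma act_unit_mono:
  "m \<in> monoms j \<Longrightarrow> act j (unit_mono m) \<nu> m' = \<nu> (m + m')"
  by (simp add: act_def unit_mono_def if_distrib[of "\<lambda>t. t * _"] cong: if_cong)

text \<open>The defining properties of \<open>Phi_tilde\<close>, and its uniqueness.\<close>

lemma Phi_tilde_x1:
  fixes n :: nat
  assumes "n \<ge> 1"
  shows "act 1 (unit_mono (ei i1)) (Phi_tilde n) = (Phi n :: 'd::{finite,linorder} mono \<Rightarrow> 'd R)"
proof
  fix m :: "'d mono"
  have "ei i1 \<in> (monoms 1 :: 'd mono set)" by (simp add: monoms_def)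
  then have "act 1 (unit_mono (ei i1)) (Phi_tilde n) m = (Phi_tilde n (ei i1 + m) :: 'd R)"
    by (rule act_unit_mono)
  moreover have "ei i1 + m \<in> monoms (2 * n - 1) \<longleftrightarrow> m \<in> monoms (2 * n - 2)"
    using assms by (simp add: monoms_def mdeg_add) linarith
  moreover have "Poly_Mapping.lookup (ei i1 + m) i1 > 0"
    by (simp add: lookup_add ei_def lookup_single)
  ultimately show "act 1 (unit_mono (ei i1)) (Phi_tilde n) m = (Phi n m :: 'd R)"
    by (simp add: Phi_tilde_def Phi_def)
qed

lemma Phi_tilde_Sym_U0:
  fixes \<mu> :: "'d::{finite,linorder} mono \<Rightarrow> 'd R"
  assumes "\<And>m. m \<notin> monoms0 (2 * n - 1) \<Longrightarrow> \<mu> m = 0"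
  shows "act (2 * n - 1) \<mu> (Phi_tilde n) m' = 0"
  unfolding act_def
proof (rule sum.neutral, rule ballI)
  fix m :: "'d mono" assume "m \<in> monoms (2 * n - 1)"
  show "\<mu> m * Phi_tilde n (m + m') = 0"
  proof (cases "m \<in> monoms0 (2 * n - 1)")
    case True
    then show ?thesis
      by (auto simp: Phi_tilde_def monoms0_def monoms_def mdeg_add mdeg_eq_0_iff)
  qed (simp add: assms)
qed

lemma Phi_tilde_unique:
  fixes \<nu> :: "'d::{finite,linorder} mono \<Rightarrow> 'd R"
  assumes n: "n \<ge> 1"
    and z: "\<And>m. m \<notin> monoms (2 * n - 1) \<Longrightarrow> \<nu> m = 0"
    and x1: "act 1 (unit_mono (ei i1)) \<nu> = Phi n"
    and U0: "\<And>\<mu>. (\<And>m. m \<notin> monoms0 (2 * n - 1) \<Longrightarrow> \<mu> m = 0) \<Longrightarrow> act (2 * n - 1) \<mu> \<nu> 0 = 0"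
  shows "\<nu> = Phi_tilde n"
proof
  fix m :: "'d mono"
  consider "m \<notin> monoms (2 * n - 1)" | "m \<in> monoms0 (2 * n - 1)"
    | "m \<in> monoms (2 * n - 1)" "Poly_Mapping.lookup m i1 > 0"
    by (auto simp: monoms0_def)
  then show "\<nu> m = Phi_tilde n m"
  proof cases
    case 2
    then have "act (2 * n - 1) (unit_mono m) \<nu> 0 = 0"
      by (intro U0) (auto simp: unit_mono_def)
    moreover have "m \<in> monoms (2 * n - 1)" "Poly_Mapping.lookup m i1 = 0"
      using 2 by (simp_all add: monoms0_def)
    ultimately show ?thesis
      by (simp add: act_unit_mono Phi_tilde_def)
  next
    case 3
    have e: "ei i1 \<in> (monoms 1 :: 'd mono set)" by (simp add: monoms_def)
    have "\<nu> (ei i1 + (m - ei i1)) = Phi_tilde n (ei i1 + (m - ei i1))"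
      using fun_cong[OF trans[OF x1 Phi_tilde_x1[OF n, symmetric]], of "m - ei i1"]
      unfolding act_unit_mono[OF e] .
    then show ?thesis unfolding ei_add_diff[OF 3(2)] .
  next
    case 1
    then show ?thesis using z[OF 1] by (simp add: Phi_tilde_def)
  qed
qed

text \<open>The property characterizing \<open>q_map\<close>.\<close>

lemma q_map_Phi:
  fixes m' :: "'d::{finite,linorder} mono"
  assumes m': "m' \<in> monoms (n - 1)"
  shows "act (n - 1) (q_map n \<nu>) (Phi n) m' = delta n * \<nu> m'"
proof -
  define ms :: "'d mono list" where "ms = mlist (n - 1)"
  define N where "N = length ms"
  have set_ms: "set ms = monoms (n - 1)" and dist: "distinct ms"
    unfolding ms_def mlist_def by (rule set_sorted_list_of_set, rule finite_monoms) (rule distinct_sorted_list_of_set)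
  have "m' \<in> set ms" using m' by (simp only: set_ms)
  then have "\<exists>k<N. ms ! k = m'" by (simp only: in_set_conv_nth N_def)
  then obtain k where k: "k < N" "ms ! k = m'" by (elim exE conjE) (rule that)
  have P: "p_mat n = mat N N (\<lambda>(i, j). Phi n (ms ! j + ms ! i))"
    unfolding p_mat_def Let_def ms_def[symmetric] N_def[symmetric]
  proof (rule cong_mat)
    fix i j assume "i < N" "j < N"
    then have "ms ! j \<in> monoms (n - 1)" using set_ms N_def nth_mem by blast
    then show "(case (i, j) of (i, j) \<Rightarrow> act (n - 1) (unit_mono (ms ! j)) (Phi n) (ms ! i)) =
      (case (i, j) of (i, j) \<Rightarrow> Phi n (ms ! j + ms ! i))"
      by (simp add: act_unit_mono)
  qed auto
  have Pc: "(p_mat n :: 'd R mat) \<in> carrier_mat N N" unfolding P by simp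
  note adj = adj_mat[OF Pc]
  have q: "q_map n \<nu> (ms ! i) = (\<Sum>j<N. adj_mat (p_mat n) $$ (i, j) * \<nu> (ms ! j))" if "i < N" for i
  proof -
    have "q_map n \<nu> (ms ! i) =
      (\<Sum>i'<N. if i' = i then (\<Sum>j<N. adj_mat (p_mat n) $$ (i', j) * \<nu> (ms ! j)) else 0)"
      unfolding q_map_def Let_def ms_def[symmetric] N_def[symmetric]
    proof (rule sum.cong[OF refl])
      fix i' assume "i' \<in> {..<N}"
      then have "ms ! i = ms ! i' \<longleftrightarrow> i' = i"
        using that dist by (auto simp: N_def nth_eq_iff_index_eq)
      then show "(\<Sum>j<N. adj_mat (p_mat n) $$ (i', j) * \<nu> (ms ! j) * unit_mono (ms ! i') (ms ! i)) =
        (if i' = i then (\<Sum>j<N. adj_mat (p_mat n) $$ (i', j) * \<nu> (ms ! j)) else 0)"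
        by (cases "i' = i") (simp_all add: unit_mono_def)
    qed
    then show ?thesis using that by simp
  qed
  have bij: "bij_betw ((!) ms) {..<N} (set ms)"
    by (rule bij_betw_nth[OF dist]) (simp_all add: N_def)
  have "act (n - 1) (q_map n \<nu>) (Phi n) m' = (\<Sum>i<N. q_map n \<nu> (ms ! i) * Phi n (ms ! i + ms ! k))"
    unfolding act_def set_ms[symmetric] k(2)[symmetric]
    by (rule sum.reindex_bij_betw[OF bij, symmetric])
  also have "\<dots> = (\<Sum>i<N. \<Sum>j<N. p_mat n $$ (k, i) * adj_mat (p_mat n) $$ (i, j) * \<nu> (ms ! j))"
    proof (rule sum.cong[OF refl])
    fix i assume "i \<in> {..<N}"
    then have i: "i < N" by simp
    have "Phi n (ms ! i + ms ! k) = p_mat n $$ (k, i)" using i k(1) unfolding P by simp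
    then show "q_map n \<nu> (ms ! i) * Phi n (ms ! i + ms ! k) =
      (\<Sum>j<N. p_mat n $$ (k, i) * adj_mat (p_mat n) $$ (i, j) * \<nu> (ms ! j))"
      unfolding q[OF i] by (simp only: sum_distrib_right) (simp only: mult_ac)
  qed
  also have "\<dots> = (\<Sum>j<N. \<Sum>i<N. p_mat n $$ (k, i) * adj_mat (p_mat n) $$ (i, j) * \<nu> (ms ! j))"
    by (rule sum.swap)
  also have "\<dots> = (\<Sum>j<N. (p_mat n * adj_mat (p_mat n)) $$ (k, j) * \<nu> (ms ! j))"
  proof (rule sum.cong[OF refl])
    fix j assume "j \<in> {..<N}"
    then have "((p_mat n :: 'd R mat) * adj_mat (p_mat n)) $$ (k, j) =
      (\<Sum>i<N. p_mat n $$ (k, i) * adj_mat (p_mat n) $$ (i, j))"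
      using k(1) carrier_matD[OF Pc] carrier_matD[OF adj(1)]
      by (simp add: scalar_prod_def atLeast0LessThan)
    then show "(\<Sum>i<N. p_mat n $$ (k, i) * adj_mat (p_mat n) $$ (i, j) * \<nu> (ms ! j)) =
      (p_mat n * adj_mat (p_mat n)) $$ (k, j) * \<nu> (ms ! j)"
      by (simp only: sum_distrib_right)
  qed
  also have "\<dots> = (\<Sum>j<N. if j = k then delta n * \<nu> (ms ! j) else 0)"
    unfolding adj(2) by (rule sum.cong[OF refl]) (use k(1) in \<open>auto simp: delta_def\<close>)
  also have "\<dots> = delta n * \<nu> m'" using k by simp
  finally show ?thesis .
qed

end

theory Submission
  imports Defs
begin

text \<open>
  A graded automorphism of \<open>S\<close> carries the variables to the elements \<open>\<alpha>(1 \<otimes> x\<^sub>i)\<close>, so it suffices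
  to treat the specialization of the generic complex that sends \<open>x\<^sub>i\<close> to the \<open>i\<close>-th variable. There
  \<open>\<delta>\<close> becomes a nonzero constant: a vector in the kernel of the Hankel-type matrix of \<open>\<phi>\<close> would be a
  form of degree \<open>n-1\<close> annihilating \<open>\<phi>\<close>.

  For an element of the \<open>r\<close>-th module with components \<open>k\<close>, \<open>v\<close> put \<open>u = q(k - v(\<Phi>~))\<close>. Then the middle
  differentials are \<open>(\<delta> Kos k - x\<^sub>1 \<eta>(u(\<Phi>~)), \<delta> Kos v - x\<^sub>1 \<kappa>(proj u))\<close>, and \<open>b \<circ> b = 0\<close> follows from the
  anticommutation of \<open>Kos\<close>, \<open>\<kappa>\<close> and \<open>\<eta>\<close>.

  Modulo \<open>x\<^sub>1\<close> the complex is, up to the factor \<open>\<delta>\<close>, the direct sum of the linear Koszul strands on the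
  \<open>L\<close>- and \<open>K\<close>-modules of \<open>U\<^sub>0\<close>. Their exactness comes from explicit contracting homotopies, and
  exactness over \<open>S\<close> follows by dividing by \<open>x\<^sub>1\<close> and induction on the degree. The image of \<open>b\<^sub>1\<close> is
  contained in \<open>ann \<phi>\<close>; modulo this image a form of degree \<open>n + t\<close> is \<open>x\<^sub>1\<^bsup>t+1\<^esup>\<close> times a form of degree
  \<open>n - 1\<close>, which gives the converse inclusion.
\<close>

section \<open>Contraction operators on exterior powers\<close>

text \<open>The \<open>K\<close>- and \<open>L\<close>-modules are kernels over the integers, and
  kernels need not survive base change. The usual contraction of a Koszul complex divides by a total
  degree; selecting a least index instead works in every characteristic and splits the kernels
  integrally. Reduction modulo x_1 loses two things. The reduction of b_1 sees only the
  \<open>L\<close>-part of a cycle; the condition on the \<open>K\<close>-part returns after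
  dividing by x_1 and contracting \<Phi>, because the image of b_1 contracts \<Phi> to zero.
  Moreover x_1 q(\<nu>) is a generator only for \<nu> not involving x_1; for other \<nu> a higher
  power of x_1 is required, which is why the comparison with the annihilator is organized by powers
  of x_1. The rank one module at the left end accounts for the cycles of the last
  \<open>K\<close>-strand that do not come from the kernel of \<eta>. Finally, exactness of the
  strands is proved for arbitrary coefficient functions, so each preimage is cut off at a degree
  bound to become polynomial, and division by x_1 lowers that bound.\<close>

text \<open>The common shape of Kos, \<kappa> and \<eta>: the sum over i of contraction by the dual
  vector of x_i on the exterior factor, tensored with \<open>T i\<close> on the other factor. Signs
  are then treated once for all three.\<close>

definition ext_contract :: "('d::{finite,linorder} \<Rightarrow> ('m \<Rightarrow> 'r::comm_ring_1) \<Rightarrow> 'm \<Rightarrow> 'r) \<Rightarrow>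
   ('d set \<Rightarrow> 'm \<Rightarrow> 'r) \<Rightarrow> 'd set \<Rightarrow> 'm \<Rightarrow> 'r" where
  "ext_contract T w = (\<lambda>B m. \<Sum>i\<in>-B. ext_sign i B * T i (w (insert i B)) m)"

definition lin_op :: "(('m \<Rightarrow> 'r::comm_ring_1) \<Rightarrow> 'p \<Rightarrow> 'r) \<Rightarrow> bool" where
  "lin_op L \<longleftrightarrow> (\<forall>c f g. L (\<lambda>m. c * f m + g m) = (\<lambda>p. c * L f p + L g p))"

lemma lin_opD: "lin_op L \<Longrightarrow> L (\<lambda>m. c * f m + g m) p = c * L f p + L g p"
  unfolding lin_op_def by metis

lemma lin_op_zero: assumes "lin_op L" shows "L (\<lambda>_. 0) p = 0"
proof -
  have "L (\<lambda>m. (-1) * 0 + 0) p = (-1) * L (\<lambda>_. 0) p + L (\<lambda>_. 0) p"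
    by (rule lin_opD[OF assms])
  thus ?thesis by simp
qed

lemma lin_op_scale: assumes "lin_op L" shows "L (\<lambda>m. c * f m) p = c * L f p"
  using lin_opD[OF assms, of c f "\<lambda>_. 0" p] by (simp add: lin_op_zero[OF assms])

lemma lin_op_add: assumes "lin_op L" shows "L (\<lambda>m. f m + g m) p = L f p + L g p"
  using lin_opD[OF assms, of 1 f g p] by simp

lemma lin_op_diff: assumes "lin_op L" shows "L (\<lambda>m. f m - g m) p = L f p - L g p"
  using lin_opD[OF assms, of "-1" g f p] by simp

lemma lin_op_sum:
  assumes "lin_op L"
  shows "L (\<lambda>m. \<Sum>i\<in>C. c i * f i m) p = (\<Sum>i\<in>C. c i * L (f i) p)"
proof (induct C rule: infinite_finite_induct)
  case (insert i C)
  then show ?case using lin_opD[OF assms, of "c i" "f i" "\<lambda>m. \<Sum>i\<in>C. c i * f i m" p] by simp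
qed (simp_all add: lin_op_zero[OF assms])

definition mono_mul :: "'d \<Rightarrow> ('d mono \<Rightarrow> 'r::comm_ring_1) \<Rightarrow> 'd mono \<Rightarrow> 'r" where
  "mono_mul i f = (\<lambda>m. if Poly_Mapping.lookup m i > 0 then f (m - ei i) else 0)"

definition mono_div :: "'d \<Rightarrow> ('d mono \<Rightarrow> 'r::comm_ring_1) \<Rightarrow> 'd mono \<Rightarrow> 'r" where
  "mono_div i f = (\<lambda>m. f (m + ei i))"

definition coef_mul :: "('d \<Rightarrow> 'r) \<Rightarrow> 'd \<Rightarrow> ('m \<Rightarrow> 'r::comm_ring_1) \<Rightarrow> 'm \<Rightarrow> 'r" where
  "coef_mul X i f = (\<lambda>m. X i * f m)"

definition KosX :: "('d::{finite,linorder} \<Rightarrow> 'r::comm_ring_1) \<Rightarrow> ('d set \<Rightarrow> 'm \<Rightarrow> 'r) \<Rightarrow> 'd set \<Rightarrow> 'm \<Rightarrow> 'r" where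
  "KosX X = ext_contract (coef_mul X)"

lemma Kos_eq_KosX: "Kos = KosX Xvar"
  by (intro ext) (simp add: Kos_def KosX_def ext_contract_def coef_mul_def mult.assoc Compl_eq)

lemma eta_eq_ext_contract: "eta = ext_contract mono_div"
  by (intro ext) (simp add: eta_def ext_contract_def mono_div_def Compl_eq)

lemma kappa_eq_ext_contract: "kappa = ext_contract mono_mul"
proof (intro ext)
  fix w :: "'a set \<Rightarrow> 'a mono \<Rightarrow> 'b" and B m
  show "kappa w B m = ext_contract mono_mul w B m"
    unfolding kappa_def ext_contract_def mono_mul_def
    by (rule sum.mono_neutral_cong_left) auto
qed

lemma lin_op_mono_mul: "lin_op (mono_mul i)"
  by (auto simp: lin_op_def mono_mul_def)
lemma lin_op_mono_div: "lin_op (mono_div i)"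
  by (auto simp: lin_op_def mono_div_def)
lemma lin_op_coef_mul: "lin_op (coef_mul X i)"
  by (auto simp: lin_op_def coef_mul_def algebra_simps)

text \<open>Of two distinct indices only the larger one counts the other among its predecessors, so
  exactly one of the two products changes sign.\<close>

lemma ext_sign_insert:
  fixes i j :: "'d::{finite,linorder}"
  assumes "i \<notin> B" "j \<notin> B" "i \<noteq> j"
  shows "(ext_sign i B * ext_sign j (insert i B) :: 'r::comm_ring_1) = - (ext_sign j B * ext_sign i (insert j B))"
proof -
  have e: "ext_sign l (insert k B) = (if k < l then - ext_sign l B else ext_sign l B :: 'r)" if "k \<notin> B" for k l
  proof -
    have "{j \<in> insert k B. j < l} = (if k < l then insert k {j \<in> B. j < l} else {j \<in> B. j < l})" by auto
    thus ?thesis using that by (simp add: ext_sign_def)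
  qed
  show ?thesis using assms by (auto simp: e not_less)
qed

text \<open>The summands with j < i cancel those with i < j after exchanging the names of the
  indices. Arguing from 2 S = 0 would fail in characteristic 2.\<close>

lemma sum_antisym_zero:
  fixes F :: "'d::linorder \<Rightarrow> 'd \<Rightarrow> 'r::comm_ring_1"
  assumes "finite C" and anti: "\<And>i j. i \<in> C \<Longrightarrow> j \<in> C \<Longrightarrow> i \<noteq> j \<Longrightarrow> F i j = - F j i"
  shows "(\<Sum>i\<in>C. \<Sum>j\<in>C - {i}. F i j) = 0"
proof -
  have 1: "(\<Sum>j\<in>C - {i}. F i j) = (\<Sum>j\<in>C. if j < i then F i j else 0) + (\<Sum>j\<in>C. if i < j then F i j else 0)" if "i \<in> C" for i
  proof -
    have "(\<Sum>j\<in>C - {i}. F i j) = (\<Sum>j\<in>C. (if j < i then F i j else 0) + (if i < j then F i j else 0))"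
      using assms(1) by (intro sum.mono_neutral_cong_left) auto
    thus ?thesis by (simp add: sum.distrib)
  qed
  have "(\<Sum>i\<in>C. \<Sum>j\<in>C. if j < i then F i j else 0) = (\<Sum>j\<in>C. \<Sum>i\<in>C. if j < i then F i j else 0)"
    by (rule sum.swap)
  also have "\<dots> = (\<Sum>j\<in>C. \<Sum>i\<in>C. - (if j < i then F j i else 0))"
  proof (intro sum.cong refl)
    fix j i assume "j \<in> C" "i \<in> C"
    then show "(if j < i then F i j else 0) = - (if j < i then F j i else 0)"
      using anti[of i j] by (cases "j < i") auto
  qed
  finally show ?thesis by (simp add: 1 sum.distrib sum_negf)
qed

text \<open>The inner index is taken outside \<open>insert i B\<close>, so no diagonal term i = j
  arises.\<close>

lemma ext_contract_ext_contract:
  assumes T: "\<And>i. lin_op (T i)"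
  shows "ext_contract T (ext_contract T' w) B m =
    (\<Sum>i\<in>-B. \<Sum>j\<in>-B-{i}. ext_sign i B * ext_sign j (insert i B) * T i (T' j (w (insert j (insert i B)))) m)"
  unfolding ext_contract_def
proof (rule sum.cong[OF refl])
  fix i assume "i \<in> - B"
  have e: "- insert i B = -B-{i}" by auto
  show "ext_sign i B * T i (\<lambda>m. \<Sum>ia\<in>- insert i B. ext_sign ia (insert i B) * T' ia (w (insert ia (insert i B))) m) m =
         (\<Sum>j\<in>- B - {i}. ext_sign i B * ext_sign j (insert i B) * T i (T' j (w (insert j (insert i B)))) m)"
    unfolding e lin_op_sum[OF T] by (simp add: sum_distrib_left mult.assoc)
qed

lemma ext_contract_square:
  fixes T :: "'d::{finite,linorder} \<Rightarrow> ('m \<Rightarrow> 'r::comm_ring_1) \<Rightarrow> 'm \<Rightarrow> 'r"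
  assumes T: "\<And>i. lin_op (T i)" and c: "\<And>i j f. T i (T j f) = T j (T i f)"
  shows "ext_contract T (ext_contract T w) = (\<lambda>_ _. 0)"
proof (intro ext)
  fix B m
  show "ext_contract T (ext_contract T w) B m = 0"
    unfolding ext_contract_ext_contract[OF T]
  proof (rule sum_antisym_zero)
    fix i j assume "i \<in> -B" "j \<in> -B" "i \<noteq> j"
    then show "ext_sign i B * ext_sign j (insert i B) * T i (T j (w (insert j (insert i B)))) m =
           - (ext_sign j B * ext_sign i (insert j B) * T j (T i (w (insert i (insert j B)))) m)"
      using ext_sign_insert[of i B j, where 'r='r] by (simp add: c[of i j] insert_commute)
  qed simp
qed

text \<open>Both composites are sums over ordered pairs of distinct indices, and adding them makes
  the summand antisymmetric.\<close>

lemma ext_contract_anticommute: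
  fixes T T' :: "'d::{finite,linorder} \<Rightarrow> ('m \<Rightarrow> 'r::comm_ring_1) \<Rightarrow> 'm \<Rightarrow> 'r"
  assumes T: "\<And>i. lin_op (T i)" and T': "\<And>i. lin_op (T' i)" and c: "\<And>i j f. i \<noteq> j \<Longrightarrow> T i (T' j f) = T' j (T i f)"
  shows "ext_contract T (ext_contract T' w) B m = - ext_contract T' (ext_contract T w) B m"
proof -
  have "ext_contract T (ext_contract T' w) B m + ext_contract T' (ext_contract T w) B m = 0"
    unfolding ext_contract_ext_contract[OF T] ext_contract_ext_contract[OF T'] sum.distrib[symmetric]
  proof (rule sum_antisym_zero)
    fix i j assume "i \<in> -B" "j \<in> -B" "i \<noteq> j"
    then show "ext_sign i B * ext_sign j (insert i B) * T i (T' j (w (insert j (insert i B)))) m +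
           ext_sign i B * ext_sign j (insert i B) * T' i (T j (w (insert j (insert i B)))) m =
           - (ext_sign j B * ext_sign i (insert j B) * T j (T' i (w (insert i (insert j B)))) m +
              ext_sign j B * ext_sign i (insert j B) * T' j (T i (w (insert i (insert j B)))) m)"
      using ext_sign_insert[of i B j, where 'r='r] by (simp add: c insert_commute)
  qed simp
  thus ?thesis by (simp add: eq_neg_iff_add_eq_0)
qed

lemma mono_mul_commute: "mono_mul i (mono_mul j f) = mono_mul j (mono_mul i f)"
proof (cases "i = j")
  case False
  have "m - ei i - ei j = m - ei j - ei i" for m :: "'a mono"
    by (rule poly_mapping_eqI) (simp add: lookup_minus)
  with False show ?thesis
    by (intro ext) (auto simp: mono_mul_def lookup_minus ei_def lookup_single when_def)
qed simp

lemma mono_div_commute: "mono_div i (mono_div j f) = mono_div j (mono_div i f)"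
  by (simp add: mono_div_def add_ac)

lemma kappa_kappa: "kappa (kappa w) = (\<lambda>_ _. 0)"
  unfolding kappa_eq_ext_contract by (rule ext_contract_square) (simp_all add: lin_op_mono_mul mono_mul_commute)
lemma eta_eta: "eta (eta w) = (\<lambda>_ _. 0)"
  unfolding eta_eq_ext_contract by (rule ext_contract_square) (simp_all add: lin_op_mono_div mono_div_commute)
lemma KosX_KosX: "KosX X (KosX X w) = (\<lambda>_ _. 0)"
  unfolding KosX_def by (rule ext_contract_square) (simp_all add: lin_op_coef_mul, simp add: coef_mul_def mult_ac)
lemma kappa_KosX: "kappa (KosX X w) B m = - KosX X (kappa w) B m"
  unfolding KosX_def kappa_eq_ext_contract by (rule ext_contract_anticommute) (auto simp: lin_op_coef_mul lin_op_mono_mul, auto simp add: coef_mul_def mono_mul_def)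
lemma eta_KosX: "eta (KosX X w) B m = - KosX X (eta w) B m"
  unfolding KosX_def eta_eq_ext_contract by (rule ext_contract_anticommute) (auto simp: lin_op_coef_mul lin_op_mono_div, auto simp add: coef_mul_def mono_div_def)

text \<open>Lets an operator on the second factor pass through a contraction. It is applied to q, to
  the projection onto \<open>Sym U\<^sub>0\<close>, to contraction of a fixed functional and to
  evaluation in the ring.\<close>

lemma ext_contract_intertwine:
  assumes L: "lin_op L" and c: "\<And>i. i \<notin> B \<Longrightarrow> T' i (L' (w (insert i B))) p = L (T i (w (insert i B))) p"
  shows "ext_contract T' (\<lambda>A. L' (w A)) B p = L (ext_contract T w B) p"
proof -
  have "ext_contract T w B = (\<lambda>m. \<Sum>i\<in>-B. ext_sign i B * T i (w (insert i B)) m)" by (simp add: ext_contract_def)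
  thus ?thesis by (simp add: lin_op_sum[OF L] ext_contract_def c)
qed

section \<open>Koszul homotopies and exactness over a field\<close>

text \<open>The contracting homotopies move the least index \<open>i\<close> occurring in a basis element between the exterior and the symmetric
  factor. For \<open>\<eta>\<close> the exterior factor is replaced by its complement in the indices of \<open>U\<^sub>0\<close>; this is why \<open>- insert i1 A\<close> occurs.\<close>
definition kappa_contr :: "('d::{finite,linorder} set \<Rightarrow> 'd mono \<Rightarrow> 'r::comm_ring_1) \<Rightarrow> 'd set \<Rightarrow> 'd mono \<Rightarrow> 'r" where
  "kappa_contr w = (\<lambda>A m. let i = Min (A \<union> Poly_Mapping.keys m) in
     if i \<in> A then w (A - {i}) (m + ei i) else 0)"

definition eta_contr :: "('d::{finite,linorder} set \<Rightarrow> 'd mono \<Rightarrow> 'r::comm_ring_1) \<Rightarrow> 'd set \<Rightarrow> 'd mono \<Rightarrow> 'r" where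
  "eta_contr w = (\<lambda>A m. let i = Min (- insert i1 A \<union> Poly_Mapping.keys m) in
     if i1 \<notin> A \<and> i \<in> A \<and> i \<in> Poly_Mapping.keys m then ext_sign i A * w (A - {i}) (m - ei i) else 0)"

lemma lookup_ei: "Poly_Mapping.lookup (ei i) j = (if i = j then 1 else 0)"
  by (simp add: ei_def lookup_single when_def)

lemma keys_add_ei: "Poly_Mapping.keys (m + ei i) = insert i (Poly_Mapping.keys m)"
  by (auto simp: in_keys_iff lookup_add lookup_ei split: if_splits)

lemma add_diff_ei_swap:
  "j \<in> Poly_Mapping.keys m \<Longrightarrow> i \<noteq> j \<Longrightarrow> m - ei j + ei i = m + ei i - ei j"
  by (rule poly_mapping_eqI) (auto simp: lookup_add lookup_minus lookup_ei)

lemma diff_ei_add: "j \<in> Poly_Mapping.keys m \<Longrightarrow> m - ei j + ei j = m"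
  by (rule poly_mapping_eqI) (auto simp: lookup_add lookup_minus lookup_ei in_keys_iff)

lemma ei_shift_left: "j \<in> Poly_Mapping.keys x \<Longrightarrow> x - ei j + (y + ei j) = x + y"
  by (rule poly_mapping_eqI) (auto simp: lookup_add lookup_minus lookup_ei in_keys_iff)
lemma ei_shift_right: "j \<in> Poly_Mapping.keys y \<Longrightarrow> x + ei j + (y - ei j) = x + y"
  by (rule poly_mapping_eqI) (auto simp: lookup_add lookup_minus lookup_ei in_keys_iff)

lemma ext_sign_square [simp]: "ext_sign i A * ext_sign i A = (1 :: 'r::comm_ring_1)"
  by (simp add: ext_sign_def flip: power_mult_distrib)

lemma ext_sign_square_left [simp]: "ext_sign i A * (ext_sign i A * c) = (c :: 'r::comm_ring_1)"
  by (simp flip: mult.assoc)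

lemma ext_sign_remove:
  "ext_sign j (B - {i}) = (if i \<in> B \<and> i < j then - ext_sign j B else ext_sign j B :: 'r::comm_ring_1)"
proof (cases "i \<in> B \<and> i < j")
  case True
  hence "{k \<in> B. k < j} = insert i {k \<in> B - {i}. k < j}" by auto
  hence "card {k \<in> B. k < j} = Suc (card {k \<in> B - {i}. k < j})" by simp
  with True show ?thesis by (simp add: ext_sign_def)
next
  case False
  hence "{k \<in> B - {i}. k < j} = {k \<in> B. k < j}" by auto
  with False show ?thesis by (auto simp add: ext_sign_def)
qed

lemma ext_sign_insert_ge: "\<not> k < l \<Longrightarrow> ext_sign l (insert k B) = ext_sign l B"
  unfolding ext_sign_def by (rule arg_cong[where f="\<lambda>S. (-1) ^ card S"]) auto

lemma ext_sign_least: "(\<And>j. j \<in> A \<Longrightarrow> i \<le> j) \<Longrightarrow> ext_sign i A = 1"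
proof -
  assume "\<And>j. j \<in> A \<Longrightarrow> i \<le> j"
  hence "{j \<in> A. j < i} = {}" by (auto dest: leD)
  thus ?thesis by (simp only: ext_sign_def card.empty power_0)
qed

lemma kappa_sum: "kappa w B m = (\<Sum>j\<in>-B \<inter> Poly_Mapping.keys m. ext_sign j B * w (insert j B) (m - ei j))"
  unfolding kappa_def by (rule sum.cong) (auto simp: in_keys_iff)
lemma eta_sum: "eta w B m = (\<Sum>j\<in>-B. ext_sign j B * w (insert j B) (m + ei j))"
  unfolding eta_def by (rule sum.cong) auto

lemma kappa_nz: "kappa w B m \<noteq> 0 \<Longrightarrow> \<exists>j. j \<notin> B \<and> j \<in> Poly_Mapping.keys m \<and> w (insert j B) (m - ei j) \<noteq> 0"
  unfolding kappa_sum by (rule ccontr, erule notE, rule sum.neutral) auto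
lemma eta_nz: "eta w B m \<noteq> 0 \<Longrightarrow> \<exists>j. j \<notin> B \<and> w (insert j B) (m + ei j) \<noteq> 0"
  unfolding eta_sum by (rule ccontr, erule notE, rule sum.neutral) auto

text \<open>Moving an index between the exterior and the symmetric factor leaves the set
  \<open>S\<close> unchanged, so its least element i is the same in every term. If i lies outside
  \<open>B\<close>, only j = i contributes to the first composite and the second is zero. If i lies
  in \<open>B\<close>, the second composite yields \<open>w B m\<close> at j = i, and its other
  terms cancel the first composite.\<close>

lemma kappa_homotopy:
  fixes w :: "'d::{finite,linorder} set \<Rightarrow> 'd mono \<Rightarrow> 'r::comm_ring_1"
  assumes ne: "B \<noteq> {} \<or> m \<noteq> 0"
  shows "kappa (kappa_contr w) B m + kappa_contr (kappa w) B m = w B m"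
proof -
  define S where "S = B \<union> Poly_Mapping.keys m"
  define i where "i = Min S"
  have S: "finite S" "S \<noteq> {}" using ne by (auto simp: S_def)
  have iS: "i \<in> S" and ile: "\<And>j. j \<in> S \<Longrightarrow> i \<le> j" unfolding i_def using S by auto
  show ?thesis
  proof (cases "i \<in> B")
    case False
    hence im: "i \<in> Poly_Mapping.keys m" using iS by (auto simp: S_def)
    have t: "kappa_contr w (insert j B) (m - ei j) = (if j = i then w B m else 0)" if j: "j \<in> -B \<inter> Poly_Mapping.keys m" for j
    proof -
      have "insert j B \<union> Poly_Mapping.keys (m - ei j) = S"
        using j by (auto simp: S_def in_keys_iff lookup_minus lookup_ei split: if_splits)
      hence "kappa_contr w (insert j B) (m - ei j) = (if i \<in> insert j B then w (insert j B - {i}) (m - ei j + ei i) else 0)"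
        by (simp only: kappa_contr_def Let_def i_def[symmetric])
      thus ?thesis using j False by (auto simp: diff_ei_add)
    qed
    have "kappa (kappa_contr w) B m = (\<Sum>j\<in>-B \<inter> Poly_Mapping.keys m. if j = i then ext_sign i B * w B m else 0)"
      unfolding kappa_sum by (rule sum.cong[OF refl]) (simp add: t)
    also have "\<dots> = ext_sign i B * w B m" using False im by simp
    also have "ext_sign i B = (1::'r)" by (rule ext_sign_least) (use ile in \<open>auto simp: S_def\<close>)
    finally show ?thesis using False by (simp add: kappa_contr_def Let_def S_def[symmetric] i_def[symmetric])
  next
    case True
    define G where "G j = ext_sign j B * w (insert j (B - {i})) (m + ei i - ei j)" for j
    have sgi: "ext_sign i A = (1::'r)" if "A \<subseteq> S" for A
      by (rule ext_sign_least) (use ile that in auto)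
    have 1: "kappa (kappa_contr w) B m = (\<Sum>j\<in>-B \<inter> Poly_Mapping.keys m. G j)"
      unfolding kappa_sum
    proof (rule sum.cong[OF refl])
      fix j assume j: "j \<in> -B \<inter> Poly_Mapping.keys m"
      have "insert j B \<union> Poly_Mapping.keys (m - ei j) = S"
        using j by (auto simp: S_def in_keys_iff lookup_minus lookup_ei split: if_splits)
      hence "kappa_contr w (insert j B) (m - ei j) = (if i \<in> insert j B then w (insert j B - {i}) (m - ei j + ei i) else 0)"
        by (simp only: kappa_contr_def Let_def i_def[symmetric])
      moreover have "insert j B - {i} = insert j (B - {i})" using True j by auto
      moreover have "i \<noteq> j" using True j by auto
      ultimately show "ext_sign j B * kappa_contr w (insert j B) (m - ei j) = G j"
        using j True by (simp add: G_def add_diff_ei_swap)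
    qed
    have "kappa_contr (kappa w) B m = kappa w (B - {i}) (m + ei i)"
      using True by (simp add: kappa_contr_def Let_def S_def[symmetric] i_def[symmetric])
    also have "\<dots> = (\<Sum>j\<in>insert i (-B \<inter> Poly_Mapping.keys m).
        ext_sign j (B - {i}) * w (insert j (B - {i})) (m + ei i - ei j))"
      unfolding kappa_sum using True by (intro sum.cong) (auto simp: keys_add_ei)
    also have "\<dots> = w B m + (\<Sum>j\<in>-B \<inter> Poly_Mapping.keys m. ext_sign j (B - {i}) * w (insert j (B - {i})) (m + ei i - ei j))"
      using True sgi[of "B - {i}"] by (subst sum.insert) (auto simp: S_def insert_absorb subset_iff)
    also have "(\<Sum>j\<in>-B \<inter> Poly_Mapping.keys m. ext_sign j (B - {i}) * w (insert j (B - {i})) (m + ei i - ei j)) =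
       (\<Sum>j\<in>-B \<inter> Poly_Mapping.keys m. - G j)"
    proof (rule sum.cong[OF refl])
      fix j assume j: "j \<in> -B \<inter> Poly_Mapping.keys m"
      hence "i < j" using ile[of j] True by (auto simp: S_def less_le)
      thus "ext_sign j (B - {i}) * w (insert j (B - {i})) (m + ei i - ei j) = - G j"
        using True by (simp add: G_def ext_sign_remove)
    qed
    finally show ?thesis by (simp add: 1 sum_negf)
  qed
qed

text \<open>The dual argument: the invariant set consists of the complement of \<open>B\<close>
  among the indices of \<open>U\<^sub>0\<close> and the support of m. The excluded position, the
  full exterior power with m = 0, is the one where this set is empty.\<close>

lemma eta_homotopy:
  fixes w :: "'d::{finite,linorder} set \<Rightarrow> 'd mono \<Rightarrow> 'r::comm_ring_1"
  assumes ne: "B \<noteq> -{i1} \<or> m \<noteq> 0" and B: "i1 \<notin> B" and m: "Poly_Mapping.lookup m i1 = 0"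
    and w: "\<And>A m. i1 \<in> A \<Longrightarrow> w A m = 0"
  shows "eta (eta_contr w) B m + eta_contr (eta w) B m = w B m"
proof -
  define S where "S = - insert i1 B \<union> Poly_Mapping.keys m"
  define i where "i = Min S"
  have S: "finite S" "S \<noteq> {}" using ne B by (auto simp: S_def)
  have iS: "i \<in> S" and ile: "\<And>j. j \<in> S \<Longrightarrow> i \<le> j" unfolding i_def using S by auto
  have i1S: "i1 \<notin> S" using B m by (auto simp: S_def in_keys_iff)
  have Sj: "- insert i1 (insert j B) \<union> Poly_Mapping.keys (m + ei j) = S" if "j \<in> -B" "j \<noteq> i1" for j
    using that by (auto simp: S_def keys_add_ei)
  have hgj: "eta_contr w (insert j B) (m + ei j) = (if i1 \<notin> insert j B \<and> i \<in> insert j B \<and> i \<in> Poly_Mapping.keys (m + ei j)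
      then ext_sign i (insert j B) * w (insert j B - {i}) (m + ei j - ei i) else 0)" if "j \<in> -B" "j \<noteq> i1" for j
    by (simp only: eta_contr_def Let_def Sj[OF that] i_def[symmetric])
  have z: "eta_contr w (insert j B) (m + ei j) = 0" if "j = i1" for j using that by (simp add: eta_contr_def)
  show ?thesis
  proof (cases "i \<in> B")
    case False
    have ii1: "i \<noteq> i1" using iS i1S by auto
    have t: "eta_contr w (insert j B) (m + ei j) = (if j = i then ext_sign i (insert i B) * w B m else 0)" if j: "j \<in> -B" for j
    proof (cases "j = i1")
      case True with z ii1 show ?thesis by auto
    next
      case False
      thus ?thesis using j \<open>i \<notin> B\<close> B by (auto simp: hgj keys_add_ei)
    qed
    have "eta (eta_contr w) B m = (\<Sum>j\<in>-B. if j = i then ext_sign i B * (ext_sign i (insert i B) * w B m) else 0)"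
      unfolding eta_sum by (rule sum.cong[OF refl]) (simp add: t)
    also have "\<dots> = w B m" using False by (simp add: ext_sign_insert_ge)
    finally show ?thesis using False by (simp add: eta_contr_def Let_def S_def[symmetric] i_def[symmetric])
  next
    case True
    hence im: "i \<in> Poly_Mapping.keys m" using iS by (auto simp: S_def)
    define G where "G j = ext_sign j B * (ext_sign i B * w (insert j (B - {i})) (m + ei j - ei i))" for j
    have 1: "eta (eta_contr w) B m = (\<Sum>j\<in>-insert i1 B. G j)"
    proof -
      have "eta (eta_contr w) B m = (\<Sum>j\<in>-insert i1 B. ext_sign j B * eta_contr w (insert j B) (m + ei j))"
        unfolding eta_sum by (rule sum.mono_neutral_right) (auto simp: z)
      also have "\<dots> = (\<Sum>j\<in>-insert i1 B. G j)"
      proof (rule sum.cong[OF refl])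
        fix j assume j: "j \<in> - insert i1 B"
        hence "i < j" using ile[of j] True by (auto simp: S_def less_le)
        hence "ext_sign i (insert j B) = (ext_sign i B :: 'r)" by (intro ext_sign_insert_ge) auto
        moreover have "insert j B - {i} = insert j (B - {i})" using True j by auto
        ultimately show "ext_sign j B * eta_contr w (insert j B) (m + ei j) = G j"
          using j True B im by (simp add: hgj G_def keys_add_ei) blast
      qed
      finally show ?thesis .
    qed
    have "eta_contr (eta w) B m = ext_sign i B * eta w (B - {i}) (m - ei i)"
      using True B im by (simp add: eta_contr_def Let_def S_def[symmetric] i_def[symmetric])
    also have "eta w (B - {i}) (m - ei i) = (\<Sum>j\<in>insert i (-insert i1 B).
        ext_sign j (B - {i}) * w (insert j (B - {i})) (m - ei i + ei j))"
      unfolding eta_sum using True B by (intro sum.mono_neutral_right) (auto simp: w)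
    also have "\<dots> = ext_sign i (B - {i}) * w B m + (\<Sum>j\<in>-insert i1 B. ext_sign j (B - {i}) * w (insert j (B - {i})) (m - ei i + ei j))"
      using True im by (subst sum.insert) (auto simp: insert_absorb diff_ei_add)
    also have "(\<Sum>j\<in>-insert i1 B. ext_sign j (B - {i}) * w (insert j (B - {i})) (m - ei i + ei j)) =
       (\<Sum>j\<in>-insert i1 B. - (ext_sign i B * G j))"
    proof (rule sum.cong[OF refl])
      fix j assume j: "j \<in> -insert i1 B"
      hence "i < j" using ile[of j] True by (auto simp: S_def less_le)
      thus "ext_sign j (B - {i}) * w (insert j (B - {i})) (m - ei i + ei j) = - (ext_sign i B * G j)"
        using True im by (simp add: G_def ext_sign_remove add_diff_ei_swap mult.left_commute)
    qed
    finally show ?thesis by (simp add: 1 sum_negf distrib_left right_diff_distrib ext_sign_remove sum_distrib_left[symmetric])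
  qed
qed

text \<open>A function \<open>W\<close> of \<open>A\<close> and \<open>(l, m)\<close> stands for an element of \<open>\<And>U\<^sub>0 \<otimes> Sym U\<^sub>0 \<otimes> Sym U\<^sub>0\<close> or \<open>\<And>U\<^sub>0 \<otimes> Sym U\<^sub>0 \<otimes> D(U\<^sub>0\<^sup>*)\<close>: here \<open>l\<close> is a
  monomial of the coefficient in \<open>S\<close>, so that \<open>Kos\<close> acts on coefficients as \<open>kap1\<close>.\<close>
definition kap1 :: "('d::{finite,linorder} set \<Rightarrow> 'd mono \<times> 'd mono \<Rightarrow> 'r::comm_ring_1) \<Rightarrow> 'd set \<Rightarrow> 'd mono \<times> 'd mono \<Rightarrow> 'r" where
  "kap1 W = (\<lambda>A (l, m). kappa (\<lambda>A l. W A (l, m)) A l)"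
definition kap2 :: "('d::{finite,linorder} set \<Rightarrow> 'd mono \<times> 'd mono \<Rightarrow> 'r::comm_ring_1) \<Rightarrow> 'd set \<Rightarrow> 'd mono \<times> 'd mono \<Rightarrow> 'r" where
  "kap2 W = (\<lambda>A (l, m). kappa (\<lambda>A m. W A (l, m)) A m)"
definition eta2 :: "('d::{finite,linorder} set \<Rightarrow> 'd mono \<times> 'd mono \<Rightarrow> 'r::comm_ring_1) \<Rightarrow> 'd set \<Rightarrow> 'd mono \<times> 'd mono \<Rightarrow> 'r" where
  "eta2 W = (\<lambda>A (l, m). eta (\<lambda>A m. W A (l, m)) A m)"

definition op1 :: "(('p \<Rightarrow> 'r) \<Rightarrow> 'p \<Rightarrow> 'r) \<Rightarrow> ('p \<times> 'q \<Rightarrow> 'r) \<Rightarrow> 'p \<times> 'q \<Rightarrow> 'r" where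
  "op1 T f = (\<lambda>(l, m). T (\<lambda>l. f (l, m)) l)"
definition op2 :: "(('q \<Rightarrow> 'r) \<Rightarrow> 'q \<Rightarrow> 'r) \<Rightarrow> ('p \<times> 'q \<Rightarrow> 'r) \<Rightarrow> 'p \<times> 'q \<Rightarrow> 'r" where
  "op2 T f = (\<lambda>(l, m). T (\<lambda>m. f (l, m)) m)"

lemma lin_op_op1: "lin_op T \<Longrightarrow> lin_op (op1 T)"
  unfolding lin_op_def op1_def by (simp add: fun_eq_iff)
lemma lin_op_op2: "lin_op T \<Longrightarrow> lin_op (op2 T)"
  unfolding lin_op_def op2_def by (simp add: fun_eq_iff)

lemma kap1_ext_contract: "kap1 = ext_contract (\<lambda>i. op1 (mono_mul i))"
  by (intro ext) (auto simp: kap1_def kappa_eq_ext_contract ext_contract_def op1_def)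
lemma kap2_ext_contract: "kap2 = ext_contract (\<lambda>i. op2 (mono_mul i))"
  by (intro ext) (auto simp: kap2_def kappa_eq_ext_contract ext_contract_def op2_def)
lemma eta2_ext_contract: "eta2 = ext_contract (\<lambda>i. op2 (mono_div i))"
  by (intro ext) (auto simp: eta2_def eta_eq_ext_contract ext_contract_def op2_def)

lemma kap1_kap1: "kap1 (kap1 W) = (\<lambda>_ _. 0)"
  by (intro ext) (auto simp: kap1_def kappa_kappa)
lemma kap2_kap2: "kap2 (kap2 W) = (\<lambda>_ _. 0)"
  by (intro ext) (auto simp: kap2_def kappa_kappa)
lemma eta2_eta2: "eta2 (eta2 W) = (\<lambda>_ _. 0)"
  by (intro ext) (auto simp: eta2_def eta_eta)
lemma kap1_kap2: "kap1 (kap2 W) A p = - kap2 (kap1 W) A p"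
  unfolding kap1_ext_contract kap2_ext_contract
  by (rule ext_contract_anticommute) (auto simp: lin_op_op1 lin_op_op2 lin_op_mono_mul, auto simp: op1_def op2_def mono_mul_def)
lemma kap1_eta2: "kap1 (eta2 W) A p = - eta2 (kap1 W) A p"
  unfolding kap1_ext_contract eta2_ext_contract
  by (rule ext_contract_anticommute) (auto simp: lin_op_op1 lin_op_op2 lin_op_mono_mul lin_op_mono_div, auto simp: op1_def op2_def mono_mul_def mono_div_def)

lemma ext_contract_lin: assumes "\<And>i. lin_op (T i)"
  shows "ext_contract T (\<lambda>A m. c * w A m + v A m) B m = c * ext_contract T w B m + ext_contract T v B m"
  by (simp add: ext_contract_def lin_opD[OF assms] sum.distrib sum_distrib_left distrib_left mult_ac)

lemma kap1_lin: "kap1 (\<lambda>A p. c * W A p + V A p) A p = c * kap1 W A p + kap1 V A p"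
  unfolding kap1_ext_contract by (rule ext_contract_lin) (simp add: lin_op_op1 lin_op_mono_mul)
lemma kap2_lin: "kap2 (\<lambda>A p. c * W A p + V A p) A p = c * kap2 W A p + kap2 V A p"
  unfolding kap2_ext_contract by (rule ext_contract_lin) (simp add: lin_op_op2 lin_op_mono_mul)
lemma eta2_lin: "eta2 (\<lambda>A p. c * W A p + V A p) A p = c * eta2 W A p + eta2 V A p"
  unfolding eta2_ext_contract by (rule ext_contract_lin) (simp add: lin_op_op2 lin_op_mono_div)

section \<open>Koszul exactness in each of the two symmetric factors\<close>

text \<open>The exterior degree and the degree of the second monomial are fixed. The first monomial
  has arbitrary degree but is free of x_1, since it stands for a coefficient modulo x_1.\<close>

definition sup0 :: "nat \<Rightarrow> nat \<Rightarrow> ('d::{finite,linorder} set \<Rightarrow> 'd mono \<times> 'd mono \<Rightarrow> 'r::comm_ring_1) \<Rightarrow> bool" where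
  "sup0 a b W \<longleftrightarrow> (\<forall>A l m. W A (l, m) \<noteq> 0 \<longrightarrow> i1 \<notin> A \<and> card A = a \<and> m \<in> monoms0 b \<and> Poly_Mapping.lookup l i1 = 0)"

lemma monoms0_add_ei: "i \<noteq> i1 \<Longrightarrow> m + ei i \<in> monoms0 (Suc b) \<longleftrightarrow> m \<in> monoms0 b"
  by (auto simp: monoms0_def monoms_def mdeg_add lookup_add lookup_ei)

lemma monoms0_add_ei': "m + ei i \<in> monoms0 b \<Longrightarrow> i \<noteq> i1 \<and> (\<exists>c. b = Suc c \<and> m \<in> monoms0 c)"
  by (cases b) (auto simp: monoms0_def monoms_def mdeg_add lookup_add lookup_ei)

lemma monoms0_diff_ei: "j \<in> Poly_Mapping.keys m \<Longrightarrow> j \<noteq> i1 \<Longrightarrow> m - ei j \<in> monoms0 b \<longleftrightarrow> m \<in> monoms0 (Suc b)"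
  using monoms0_add_ei[of j "m - ei j" b] by (simp add: diff_ei_add)

lemma lookup_i1_diff: "j \<noteq> i1 \<Longrightarrow> Poly_Mapping.lookup (l - ei j) i1 = Poly_Mapping.lookup l i1"
  by (simp add: lookup_minus lookup_ei)

lemma card_remove1: "i \<in> A \<Longrightarrow> card (A - {i}) = a \<Longrightarrow> card A = Suc a" for A :: "'d::finite set"
  by (metis card_Suc_Diff1 finite)

lemma kap1_sup: assumes V: "sup0 (Suc a) b V" shows "sup0 a b (kap1 V)"
  unfolding sup0_def
proof (intro allI impI)
  fix A l m assume "kap1 V A (l, m) \<noteq> 0"
  then obtain j where j: "j \<notin> A" "j \<in> Poly_Mapping.keys l" "V (insert j A) (l - ei j, m) \<noteq> 0"
    unfolding kap1_def using kappa_nz[of "\<lambda>A l. V A (l, m)" A l] by auto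
  with V have *: "i1 \<notin> insert j A" "card (insert j A) = Suc a" "m \<in> monoms0 b" "Poly_Mapping.lookup (l - ei j) i1 = 0"
    unfolding sup0_def by blast+
  thus "i1 \<notin> A \<and> card A = a \<and> m \<in> monoms0 b \<and> Poly_Mapping.lookup l i1 = 0"
    using j by (auto simp: lookup_i1_diff)
qed

lemma kap2_sup: assumes V: "sup0 (Suc a) b V" shows "sup0 a (Suc b) (kap2 V)"
  unfolding sup0_def
proof (intro allI impI)
  fix A l m assume "kap2 V A (l, m) \<noteq> 0"
  then obtain j where j: "j \<notin> A" "j \<in> Poly_Mapping.keys m" "V (insert j A) (l, m - ei j) \<noteq> 0"
    unfolding kap2_def using kappa_nz[of "\<lambda>A m. V A (l, m)" A m] by auto
  with V have *: "i1 \<notin> insert j A" "card (insert j A) = Suc a" "m - ei j \<in> monoms0 b" "Poly_Mapping.lookup l i1 = 0"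
    unfolding sup0_def by blast+
  thus "i1 \<notin> A \<and> card A = a \<and> m \<in> monoms0 (Suc b) \<and> Poly_Mapping.lookup l i1 = 0"
    using j by (auto simp: monoms0_diff_ei)
qed

lemma eta2_sup: assumes V: "sup0 (Suc a) (Suc b) V" shows "sup0 a b (eta2 V)"
  unfolding sup0_def
proof (intro allI impI)
  fix A l m assume "eta2 V A (l, m) \<noteq> 0"
  then obtain j where j: "j \<notin> A" "V (insert j A) (l, m + ei j) \<noteq> 0"
    unfolding eta2_def using eta_nz[of "\<lambda>A m. V A (l, m)" A m] by auto
  with V have *: "i1 \<notin> insert j A" "card (insert j A) = Suc a" "m + ei j \<in> monoms0 (Suc b)" "Poly_Mapping.lookup l i1 = 0"
    unfolding sup0_def by blast+
  thus "i1 \<notin> A \<and> card A = a \<and> m \<in> monoms0 b \<and> Poly_Mapping.lookup l i1 = 0"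
    using j by (auto simp: monoms0_add_ei)
qed

lemma eta2_sup_0: assumes V: "sup0 a 0 V" shows "eta2 V = (\<lambda>_ _. 0)"
proof (intro ext, clarify)
  fix A l m
  have "V (insert j A) (l, m + ei j) = 0" for j
  proof (rule ccontr)
    assume "V (insert j A) (l, m + ei j) \<noteq> 0"
    with V have "m + ei j \<in> monoms0 0" unfolding sup0_def by blast
    thus False by (auto simp: monoms0_def monoms_def mdeg_add)
  qed
  thus "eta2 V A (l, m) = 0" by (simp add: eta2_def eta_sum)
qed

lemma sup0_lin: "sup0 a b V \<Longrightarrow> sup0 a b W \<Longrightarrow> sup0 a b (\<lambda>A p. c * V A p + W A p)"
  unfolding sup0_def by (metis add.right_neutral mult_zero_right)

lemma card_Compl_i1: "card (-{i1 :: 'd::{finite,linorder}}) = CARD('d) - 1"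
  by (simp add: Compl_eq_Diff_UNIV card_Diff_subset)

text \<open>The homotopy identity fails only at the empty set and the monomial 1, the position of
  the augmentation; the last assumption clears it.\<close>

lemma kap1_exact:
  fixes W :: "'d::{finite,linorder} set \<Rightarrow> 'd mono \<times> 'd mono \<Rightarrow> 'r::comm_ring_1"
  assumes W: "sup0 a b W" and z: "kap1 W = (\<lambda>_ _. 0)" and 0: "a = 0 \<Longrightarrow> \<forall>m. W {} (0, m) = 0"
  shows "\<exists>V. sup0 (Suc a) b V \<and> W = kap1 V"
proof (intro exI conjI ext)
  define V where "V = (\<lambda>A (l, m). kappa_contr (\<lambda>A l. W A (l, m)) A l)"
  show "sup0 (Suc a) b V"
    unfolding sup0_def
  proof (intro allI impI)
    fix A l m assume "V A (l, m) \<noteq> 0"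
    then obtain i where i: "i \<in> A" "W (A - {i}) (l + ei i, m) \<noteq> 0"
      unfolding V_def kappa_contr_def by (auto simp: Let_def split: if_splits)
    with W have "i1 \<notin> A - {i}" "card (A - {i}) = a" "m \<in> monoms0 b" "Poly_Mapping.lookup (l + ei i) i1 = 0"
      unfolding sup0_def by blast+
    thus "i1 \<notin> A \<and> card A = Suc a \<and> m \<in> monoms0 b \<and> Poly_Mapping.lookup l i1 = 0"
      using i card_remove1[OF i(1), of a] by (auto simp: lookup_add lookup_ei simp del: card_Diff_singleton card_Diff_insert split: if_splits)
  qed
  fix A :: "'d set" and p :: "'d mono \<times> 'd mono"
  obtain l m where p: "p = (l, m)" by (cases p)
  have z': "kappa (\<lambda>A l. W A (l, m)) = (\<lambda>_ _. 0)"
    by (intro ext) (use z in \<open>auto simp: kap1_def fun_eq_iff\<close>)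
  show "W A p = kap1 V A p"
  proof (cases "A \<noteq> {} \<or> l \<noteq> 0")
    case True
    show ?thesis using kappa_homotopy[OF True, of "\<lambda>A l. W A (l, m)"]
      unfolding p z' by (simp add: kap1_def V_def kappa_contr_def)
  next
    case False
    have "W {} (0, m) = 0"
    proof (rule ccontr)
      assume *: "W {} (0, m) \<noteq> 0"
      with W have "card ({} :: 'd set) = a" unfolding sup0_def by blast
      with * 0 show False by simp
    qed
    thus ?thesis using False by (simp add: p kap1_def kappa_def)
  qed
qed

text \<open>The homotopy lowers the degree of the second monomial, so for b = 0 the preimage it
  provides is zero.\<close>

lemma kap2_exact:
  fixes W :: "'d::{finite,linorder} set \<Rightarrow> 'd mono \<times> 'd mono \<Rightarrow> 'r::comm_ring_1"
  assumes W: "sup0 a b W" and z: "kap2 W = (\<lambda>_ _. 0)" and ab: "a \<noteq> 0 \<or> b \<noteq> 0"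
  shows "\<exists>V. (\<forall>c. b = Suc c \<longrightarrow> sup0 (Suc a) c V) \<and> (b = 0 \<longrightarrow> V = (\<lambda>_ _. 0)) \<and> W = kap2 V"
proof -
  define V where "V = (\<lambda>A (l, m). kappa_contr (\<lambda>A m. W A (l, m)) A m)"
  have s: "\<exists>c. b = Suc c \<and> i1 \<notin> A \<and> card A = Suc a \<and> m \<in> monoms0 c \<and> Poly_Mapping.lookup l i1 = 0" if "V A (l, m) \<noteq> 0" for A l m
  proof -
    from that obtain i where i: "i \<in> A" "W (A - {i}) (l, m + ei i) \<noteq> 0"
      unfolding V_def kappa_contr_def by (auto simp: Let_def split: if_splits)
    with W have "i1 \<notin> A - {i}" "card (A - {i}) = a" "m + ei i \<in> monoms0 b" "Poly_Mapping.lookup l i1 = 0"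
      unfolding sup0_def by blast+
    thus ?thesis using i card_remove1[OF i(1), of a] monoms0_add_ei'[of m i b] by (auto simp del: card_Diff_singleton card_Diff_insert)
  qed
  have "W = kap2 V"
  proof (intro ext)
    fix A :: "'d set" and p :: "'d mono \<times> 'd mono"
  obtain l m where p: "p = (l, m)" by (cases p)
    have z': "kappa (\<lambda>A m. W A (l, m)) = (\<lambda>_ _. 0)"
      by (intro ext) (use z in \<open>auto simp: kap2_def fun_eq_iff\<close>)
    show "W A p = kap2 V A p"
    proof (cases "A \<noteq> {} \<or> m \<noteq> 0")
      case True
      show ?thesis using kappa_homotopy[OF True, of "\<lambda>A m. W A (l, m)"]
        unfolding p z' by (simp add: kap2_def V_def kappa_contr_def)
    next
      case False
      have "W {} (l, 0) = 0"
      proof (rule ccontr)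
        assume "W {} (l, 0) \<noteq> 0"
        with W have "card ({} :: 'd set) = a" "(0 :: 'd mono) \<in> monoms0 b" unfolding sup0_def by blast+
        with ab show False by (auto simp: monoms0_def monoms_def mdeg_def)
      qed
      thus ?thesis using False by (simp add: p kap2_def kappa_def)
    qed
  qed
  moreover have "\<forall>c. b = Suc c \<longrightarrow> sup0 (Suc a) c V" unfolding sup0_def using s by blast
  moreover have "b = 0 \<longrightarrow> V = (\<lambda>_ _. 0)" using s by (auto simp: fun_eq_iff)
  ultimately show ?thesis by blast
qed

lemma eta_contr_zero: "eta_contr (\<lambda>_ _. 0) = (\<lambda>_ _. 0)"
  by (intro ext) (simp add: eta_contr_def Let_def)

text \<open>The bound on \<open>a\<close> keeps the exterior degree below d - 1, so the position
  excluded in \<open>eta_homotopy\<close> is not met.\<close>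

lemma eta2_exact:
  fixes W :: "'d::{finite,linorder} set \<Rightarrow> 'd mono \<times> 'd mono \<Rightarrow> 'r::comm_ring_1"
  assumes W: "sup0 a b W" and z: "eta2 W = (\<lambda>_ _. 0)" and a: "a + 2 \<le> CARD('d)"
  shows "\<exists>V. sup0 (Suc a) (Suc b) V \<and> W = eta2 V"
proof (intro exI conjI ext)
  define V where "V = (\<lambda>A (l, m). eta_contr (\<lambda>A m. W A (l, m)) A m)"
  show V: "sup0 (Suc a) (Suc b) V"
    unfolding sup0_def
  proof (intro allI impI)
    fix A l m assume "V A (l, m) \<noteq> 0"
    then obtain i where i: "i1 \<notin> A" "i \<in> A" "i \<in> Poly_Mapping.keys m" "W (A - {i}) (l, m - ei i) \<noteq> 0"
      unfolding V_def eta_contr_def by (auto simp: Let_def dest: mult_not_zero split: if_splits)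
    with W have "card (A - {i}) = a" "m - ei i \<in> monoms0 b" "Poly_Mapping.lookup l i1 = 0"
      unfolding sup0_def by blast+
    thus "i1 \<notin> A \<and> card A = Suc a \<and> m \<in> monoms0 (Suc b) \<and> Poly_Mapping.lookup l i1 = 0"
      using i card_remove1[OF i(2), of a] monoms0_diff_ei[of i m b] by (auto simp del: card_Diff_singleton card_Diff_insert)
  qed
  fix A :: "'d set" and p :: "'d mono \<times> 'd mono"
  obtain l m where p: "p = (l, m)" by (cases p)
  have z': "eta (\<lambda>A m. W A (l, m)) = (\<lambda>_ _. 0)"
    by (intro ext) (use z in \<open>auto simp: eta2_def fun_eq_iff\<close>)
  show "W A p = eta2 V A p"
  proof (cases "i1 \<notin> A \<and> card A = a \<and> m \<in> monoms0 b \<and> Poly_Mapping.lookup l i1 = 0")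
    case True
    have "A \<noteq> -{i1}" using True a by (auto simp: card_Compl_i1)
    moreover have "W B (l, k) = 0" if "i1 \<in> B" for B k using W that unfolding sup0_def by blast
    ultimately show ?thesis using eta_homotopy[of A m "\<lambda>A m. W A (l, m)"] True
      unfolding p z' by (simp add: eta2_def V_def eta_contr_zero monoms0_def)
  next
    case False
    with W have "W A (l, m) = 0" unfolding sup0_def by blast
    moreover from False eta2_sup[OF V] have "eta2 V A (l, m) = 0" unfolding sup0_def by blast
    ultimately show ?thesis by (simp add: p)
  qed
qed

lemma kappa_zero [simp]: "kappa (\<lambda>_ _. 0) = (\<lambda>_ _. 0)"
  by (intro ext) (simp add: kappa_def)
lemma eta_zero [simp]: "eta (\<lambda>_ _. 0) = (\<lambda>_ _. 0)"
  by (intro ext) (simp add: eta_def)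
lemma kap2_zero [simp]: "kap2 (\<lambda>_ _. 0) = (\<lambda>_ _. 0)"
  by (intro ext) (auto simp: kap2_def)

lemma kap1_diff: "kap1 (\<lambda>A p. W A p - V A p) = (\<lambda>A p. kap1 W A p - kap1 V A p)"
  using kap1_lin[of "-1" V W] by (intro ext) simp
lemma kap2_diff: "kap2 (\<lambda>A p. W A p - V A p) = (\<lambda>A p. kap2 W A p - kap2 V A p)"
  using kap2_lin[of "-1" V W] by (intro ext) simp
lemma kap1_add: "kap1 (\<lambda>A p. W A p + V A p) = (\<lambda>A p. kap1 W A p + kap1 V A p)"
  using kap1_lin[of "1" W V] by (intro ext) simp
lemma eta2_add: "eta2 (\<lambda>A p. W A p + V A p) = (\<lambda>A p. eta2 W A p + eta2 V A p)"
  using eta2_lin[of "1" W V] by (intro ext) simp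
lemma sup0_diff: "sup0 a b V \<Longrightarrow> sup0 a b W \<Longrightarrow> sup0 a b (\<lambda>A p. V A p - W A p)"
  using sup0_lin[of a b W V "-1"] by simp
lemma sup0_add: "sup0 a b V \<Longrightarrow> sup0 a b W \<Longrightarrow> sup0 a b (\<lambda>A p. V A p + W A p)"
  using sup0_lin[of a b V W "1"] by simp

section \<open>Exactness of the linear strands\<close>

text \<open>Multiplication of polynomials, the augmentation of the \<open>L\<close>-strand.\<close>

definition msum :: "('d mono \<times> 'd mono \<Rightarrow> 'r::comm_ring_1) \<Rightarrow> 'd mono \<Rightarrow> 'r" where
  "msum f N = (\<Sum>p\<in>{(l, m). l + m = N}. f p)"

text \<open>Contraction of a functional of degree \<open>b\<close> by a polynomial, the augmentation
  of the \<open>K\<close>-strand. The degree condition on l keeps the sum finite.\<close>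

definition mcon :: "nat \<Rightarrow> ('d::finite mono \<times> 'd mono \<Rightarrow> 'r::comm_ring_1) \<Rightarrow> 'd mono \<Rightarrow> 'r" where
  "mcon b f N = (\<Sum>l | mdeg l + mdeg N = b. f (l, l + N))"

lemma finite_add_eq: "finite {(l, m). l + m = (N :: 'd::finite mono)}"
proof (rule finite_subset)
  show "{(l, m). l + m = N} \<subseteq> (\<Union>i\<le>mdeg N. monoms i) \<times> (\<Union>i\<le>mdeg N. monoms i)"
    by (auto simp: monoms_def mdeg_add)
qed auto

lemma finite_mdeg_add_eq: "finite {l :: 'd::finite mono. mdeg l + c = b}"
  by (rule finite_subset[OF _ finite_monoms[of "b - c"]]) (auto simp: monoms_def)

text \<open>Multiplication does not see into which factor x_j was put; the sums match by moving
  \<open>ei j\<close> from one monomial to the other.\<close>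

lemma msum_kap1_kap2:
  fixes W :: "'d::{finite,linorder} set \<Rightarrow> 'd mono \<times> 'd mono \<Rightarrow> 'r::comm_ring_1"
  shows "msum (kap1 W {}) N = msum (kap2 W {}) N"
proof -
  define F where "F j p = ext_sign j {} * W {j} p" for j p
  let ?P = "{(l, m). l + m = N}"
  have k: "(kap1 W {} p :: 'r) = (\<Sum>j\<in>UNIV. if j \<in> Poly_Mapping.keys (fst p) then F j (fst p - ei j, snd p) else 0)"
    "(kap2 W {} p :: 'r) = (\<Sum>j\<in>UNIV. if j \<in> Poly_Mapping.keys (snd p) then F j (fst p, snd p - ei j) else 0)" for p
    unfolding kap1_def kap2_def kappa_sum
    by (auto simp: F_def split: prod.split intro!: sum.mono_neutral_cong_left)
  have 1: "msum (kap1 W {}) N = (\<Sum>j\<in>UNIV. \<Sum>p\<in>?P. if j \<in> Poly_Mapping.keys (fst p) then F j (fst p - ei j, snd p) else 0)"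
    unfolding msum_def k by (rule sum.swap)
  have 2: "msum (kap2 W {}) N = (\<Sum>j\<in>UNIV. \<Sum>p\<in>?P. if j \<in> Poly_Mapping.keys (snd p) then F j (fst p, snd p - ei j) else 0)"
    unfolding msum_def k by (rule sum.swap)
  have "(\<Sum>p\<in>?P. if j \<in> Poly_Mapping.keys (fst p) then F j (fst p - ei j, snd p) else 0) =
     (\<Sum>p\<in>?P. if j \<in> Poly_Mapping.keys (snd p) then F j (fst p, snd p - ei j) else 0)" for j
  proof -
    have "(\<Sum>p\<in>?P. if j \<in> Poly_Mapping.keys (fst p) then F j (fst p - ei j, snd p) else 0) =
      (\<Sum>p | p \<in> ?P \<and> j \<in> Poly_Mapping.keys (fst p). F j (fst p - ei j, snd p))"
      using finite_add_eq[of N] by (intro sum.mono_neutral_cong_right) auto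
    also have "\<dots> = (\<Sum>p | p \<in> ?P \<and> j \<in> Poly_Mapping.keys (snd p). F j (fst p, snd p - ei j))"
      by (rule sum.reindex_bij_witness[of _ "\<lambda>(l, m). (l + ei j, m - ei j)" "\<lambda>(l, m). (l - ei j, m + ei j)"])
        (auto simp: diff_ei_add keys_add_ei ei_shift_left ei_shift_right)
    also have "\<dots> = (\<Sum>p\<in>?P. if j \<in> Poly_Mapping.keys (snd p) then F j (fst p, snd p - ei j) else 0)"
      using finite_add_eq[of N] by (intro sum.mono_neutral_cong_left) auto
    finally show ?thesis .
  qed
  thus ?thesis unfolding 1 2 by simp
qed

text \<open>Contraction by x_j l is contraction by l after contraction by x_j.\<close>

lemma mcon_kap1_eta2:
  fixes W :: "'d::{finite,linorder} set \<Rightarrow> 'd mono \<times> 'd mono \<Rightarrow> 'r::comm_ring_1"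
  shows "mcon (Suc b) (kap1 W {}) N = mcon b (eta2 W {}) N"
proof -
  have 1: "mcon (Suc b) (kap1 W {}) N = (\<Sum>j\<in>UNIV. \<Sum>l | mdeg l + mdeg N = Suc b.
       if j \<in> Poly_Mapping.keys l then ext_sign j {} * W {j} (l - ei j, l + N) else 0)"
  proof -
    have "mcon (Suc b) (kap1 W {}) N = (\<Sum>l | mdeg l + mdeg N = Suc b. \<Sum>j\<in>UNIV.
       if j \<in> Poly_Mapping.keys l then ext_sign j {} * W {j} (l - ei j, l + N) else 0)"
      unfolding mcon_def by (rule sum.cong[OF refl]) (auto simp: kap1_def kappa_sum intro!: sum.mono_neutral_cong_left)
    thus ?thesis by (simp only: sum.swap[of _ UNIV])
  qed
  have 2: "mcon b (eta2 W {}) N = (\<Sum>j\<in>UNIV. \<Sum>l | mdeg l + mdeg N = b. ext_sign j {} * W {j} (l, l + N + ei j))"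
    by (simp add: mcon_def eta2_def eta_sum sum.swap[of _ UNIV])
  have "(\<Sum>l | mdeg l + mdeg N = Suc b. if j \<in> Poly_Mapping.keys l then ext_sign j {} * W {j} (l - ei j, l + N) else 0) =
     (\<Sum>l | mdeg l + mdeg N = b. ext_sign j {} * W {j} (l, l + N + ei j))" for j
  proof -
    have "(\<Sum>l | mdeg l + mdeg N = Suc b. if j \<in> Poly_Mapping.keys l then ext_sign j {} * W {j} (l - ei j, l + N) else 0) =
      (\<Sum>l | mdeg l + mdeg N = Suc b \<and> j \<in> Poly_Mapping.keys l. ext_sign j {} * W {j} (l - ei j, l + N))"
      using finite_mdeg_add_eq[of "mdeg N" "Suc b"] by (intro sum.mono_neutral_cong_right) auto
    also have "\<dots> = (\<Sum>l | mdeg l + mdeg N = b. ext_sign j {} * W {j} (l, l + N + ei j))"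
    proof (rule sum.reindex_bij_witness[of _ "\<lambda>l. l + ei j" "\<lambda>l. l - ei j"], goal_cases)
      case (1 a) thus ?case by (simp add: diff_ei_add)
    next
      case (2 a)
      then have "mdeg (a - ei j + ei j) + mdeg N = Suc b" by (simp add: diff_ei_add)
      then show ?case by (simp add: mdeg_add)
    next
      case (5 a)
      then have "a - ei j + N + ei j = a + N" using ei_shift_left[of j a N] by (simp add: add.assoc)
      then show ?case by simp
    qed (auto simp: keys_add_ei mdeg_add)
    finally show ?thesis .
  qed
  thus ?thesis unfolding 1 2 by simp
qed

text \<open>A diagram chase in the double complex of the anticommuting maps \<open>kap1\<close> and
  \<open>kap2\<close>, by induction on \<open>b\<close>. If W = \<open>kap2 V\<close>, then
  \<open>kap1 V\<close> satisfies the same assumptions with smaller second degree, so it equals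
  \<open>kap1 Y\<close> with Y in the kernel of \<open>kap2\<close>. Now V - Y =
  \<open>kap1 Z\<close>, and applying \<open>kap2\<close> gives W = -
  \<open>kap1 (kap2 Z)\<close>.\<close>

lemma L_exact:
  fixes W :: "'d::{finite,linorder} set \<Rightarrow> 'd mono \<times> 'd mono \<Rightarrow> 'r::comm_ring_1"
  assumes "sup0 a b W" "kap2 W = (\<lambda>_ _. 0)" "kap1 W = (\<lambda>_ _. 0)" "a = 0 \<Longrightarrow> msum (W {}) = (\<lambda>_. 0)"
  shows "\<exists>Y. sup0 (Suc a) b Y \<and> kap2 Y = (\<lambda>_ _. 0) \<and> W = kap1 Y"
  using assms
proof (induction b arbitrary: W)
  case 0
  have "W = (\<lambda>_ _. 0)"
  proof (cases "a = 0")
    case False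
    then show ?thesis using kap2_exact[OF 0(1,2)] by auto
  next
    case True
    have "W A (l, m) = 0" for A l m
    proof (rule ccontr)
      assume *: "W A (l, m) \<noteq> 0"
      with 0(1) True have "card A = 0" "m \<in> monoms0 0" unfolding sup0_def by blast+
      hence A: "A = {}" "m = 0" by (auto simp: monoms0_def monoms_def mdeg_eq_0_iff)
      \<comment> \<open>For b = 0 the product l arises only from the pair (l, 0), so the
        augmentation is W itself.\<close>
      have "msum (W {}) l = (\<Sum>p\<in>{(l, 0)}. W {} p)"
        unfolding msum_def
      proof (rule sum.mono_neutral_cong_right[OF finite_add_eq])
        show "\<forall>p\<in>{(k, m). k + m = l} - {(l, 0)}. W {} p = 0"
        proof
          fix p assume p: "p \<in> {(k, m). k + m = l} - {(l, 0)}"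
          obtain k m where km: "p = (k, m)" by (cases p)
          show "W {} p = 0"
          proof (rule ccontr)
            assume "W {} p \<noteq> 0"
            with 0(1) True have "m \<in> monoms0 0" unfolding sup0_def km by blast
            thus False using p by (auto simp: km monoms0_def monoms_def mdeg_eq_0_iff)
          qed
        qed
      qed auto
      thus False using 0(4)[OF True] A * by simp
    qed
    thus ?thesis by (auto simp: fun_eq_iff)
  qed
  moreover have "sup0 (Suc a) 0 (\<lambda>_ _. 0)" by (simp add: sup0_def)
  moreover have "kap1 (\<lambda>_ _. 0) = (\<lambda>_ _. 0)" by (intro ext) (auto simp: kap1_def)
  ultimately show ?case by (metis kap2_zero)
next
  case (Suc b)
  obtain V where V: "sup0 (Suc a) b V" "W = kap2 V"
    using kap2_exact[OF Suc.prems(1,2)] by auto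
  have "\<exists>Y. sup0 (Suc a) b Y \<and> kap2 Y = (\<lambda>_ _. 0) \<and> kap1 V = kap1 Y"
  proof (rule Suc.IH)
    show "sup0 a b (kap1 V)" by (rule kap1_sup[OF V(1)])
    show "kap2 (kap1 V) = (\<lambda>_ _. 0)"
      by (intro ext) (metis V(2) Suc.prems(3) kap1_kap2 neg_0_equal_iff_equal)
    show "kap1 (kap1 V) = (\<lambda>_ _. 0)" by (rule kap1_kap1)
    assume "a = 0"
    thus "msum (kap1 V {}) = (\<lambda>_. 0)"
      using Suc.prems(4) V(2) msum_kap1_kap2[of V] by (auto simp: fun_eq_iff)
  qed
  then obtain Y where Y: "sup0 (Suc a) b Y" "kap2 Y = (\<lambda>_ _. 0)" "kap1 V = kap1 Y" by blast
  have "\<exists>Z. sup0 (Suc (Suc a)) b Z \<and> (\<lambda>A p. V A p - Y A p) = kap1 Z"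
    by (rule kap1_exact) (auto simp: sup0_diff V Y kap1_diff)
  then obtain Z where Z: "sup0 (Suc (Suc a)) b Z" "(\<lambda>A p. V A p - Y A p) = kap1 Z" by blast
  have "W A p = kap1 (\<lambda>A p. - kap2 Z A p) A p" for A p
  proof -
    have "W A p = kap2 (\<lambda>A p. V A p - Y A p) A p" by (simp add: V(2) kap2_diff Y(2))
    also have "\<dots> = - kap1 (kap2 Z) A p" unfolding Z(2) by (simp add: kap1_kap2)
    also have "\<dots> = kap1 (\<lambda>A p. - kap2 Z A p) A p" using kap1_lin[of "-1" "kap2 Z" "\<lambda>_ _. 0" A p] by (simp add: kap1_def case_prod_beta)
    finally show ?thesis .
  qed
  moreover have "sup0 (Suc a) (Suc b) (\<lambda>A p. - kap2 Z A p)"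
    using kap2_sup[OF Z(1)] by (simp add: sup0_def)
  moreover have "kap2 (\<lambda>A p. - kap2 Z A p) = (\<lambda>_ _. 0)"
    using kap2_lin[of "-1" "kap2 Z" "\<lambda>_ _. 0"] by (intro ext) (simp add: kap2_kap2)
  ultimately show ?case by (intro exI[of _ "\<lambda>A p. - kap2 Z A p"]) (auto simp: fun_eq_iff)
qed

text \<open>The same chase with \<eta> in place of the second \<kappa>, in the other order: first W
  = \<open>kap1 V\<close>, then V is corrected by some \<open>kap1 Z\<close> so as to lie in the
  kernel of \<open>eta2\<close>. The correction needs exactness of \<open>eta2\<close> in exterior
  degree a + 1, whence the bound a + 3.\<close>

lemma K_exact:
  fixes W :: "'d::{finite,linorder} set \<Rightarrow> 'd mono \<times> 'd mono \<Rightarrow> 'r::comm_ring_1"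
  assumes "sup0 a b W" "eta2 W = (\<lambda>_ _. 0)" "kap1 W = (\<lambda>_ _. 0)" "a = 0 \<Longrightarrow> mcon b (W {}) = (\<lambda>_. 0)"
    and a: "a + 3 \<le> CARD('d)"
  shows "\<exists>Y. sup0 (Suc a) b Y \<and> eta2 Y = (\<lambda>_ _. 0) \<and> W = kap1 Y"
  using assms(1-4)
proof (induction b arbitrary: W)
  case (0 W)
  have "\<exists>V. sup0 (Suc a) 0 V \<and> W = kap1 V"
  proof (rule kap1_exact[OF 0(1,3)], rule allI)
    fix m assume a0: "a = 0"
    show "W {} (0, m) = 0"
    proof (rule ccontr)
      assume *: "W {} (0, m) \<noteq> 0"
      with 0(1) have m: "mdeg m = 0" unfolding sup0_def monoms0_def monoms_def by blast
      have "mcon 0 (W {}) m = W {} (0, m)" by (simp add: mcon_def m mdeg_eq_0_iff)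
      thus False using 0(4)[OF a0] * by simp
    qed
  qed
  thus ?case using eta2_sup_0 by blast
next
  case (Suc b W)
  have "\<exists>V. sup0 (Suc a) (Suc b) V \<and> W = kap1 V"
  proof (rule kap1_exact[OF Suc.prems(1,3)], rule allI)
    fix m assume a0: "a = 0"
    show "W {} (0, m) = 0"
    proof (rule ccontr)
      assume *: "W {} (0, m) \<noteq> 0"
      with Suc.prems(1) have m: "mdeg m = Suc b" unfolding sup0_def monoms0_def monoms_def by blast
      \<comment> \<open>At a monomial of full degree only l = 0 enters the contraction, so the
        augmentation is the value of W that \<open>kap1_exact\<close> requires to vanish.\<close>
      have "mcon (Suc b) (W {}) m = W {} (0, m)" by (simp add: mcon_def m mdeg_eq_0_iff)
      thus False using Suc.prems(4)[OF a0] * by simp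
    qed
  qed
  then obtain V where V: "sup0 (Suc a) (Suc b) V" "W = kap1 V" by blast
  have "\<exists>Y. sup0 (Suc a) b Y \<and> eta2 Y = (\<lambda>_ _. 0) \<and> eta2 V = kap1 Y"
  proof (rule Suc.IH)
    show "sup0 a b (eta2 V)" by (rule eta2_sup[OF V(1)])
    show "kap1 (eta2 V) = (\<lambda>_ _. 0)"
      by (intro ext) (metis V(2) Suc.prems(2) kap1_eta2 neg_0_equal_iff_equal)
    show "eta2 (eta2 V) = (\<lambda>_ _. 0)" by (rule eta2_eta2)
    assume "a = 0"
    thus "mcon b (eta2 V {}) = (\<lambda>_. 0)"
      using Suc.prems(4) V(2) mcon_kap1_eta2[of b V] by (auto simp: fun_eq_iff)
  qed
  then obtain Y where Y: "sup0 (Suc a) b Y" "eta2 Y = (\<lambda>_ _. 0)" "eta2 V = kap1 Y" by blast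
  obtain Z where Z: "sup0 (Suc (Suc a)) (Suc b) Z" "Y = eta2 Z"
    using eta2_exact[OF Y(1,2)] a by auto
  have "sup0 (Suc a) (Suc b) (\<lambda>A p. V A p + kap1 Z A p)"
    by (rule sup0_add[OF V(1) kap1_sup[OF Z(1)]])
  moreover have "eta2 (\<lambda>A p. V A p + kap1 Z A p) = (\<lambda>_ _. 0)"
    using Y(3) kap1_eta2[of Z] by (intro ext) (simp add: eta2_add Z(2))
  moreover have "W = kap1 (\<lambda>A p. V A p + kap1 Z A p)"
    by (simp add: kap1_add kap1_kap1 V(2))
  ultimately show ?case by blast
qed

text \<open>For a = d - 2 the preimages lie in the top exterior degree, where for b = 0 the kernel
  of \<open>eta2\<close> is not an image, and the correction used in \<open>K_exact\<close> breaks
  down. What propagates upward from b = 0 is a single coefficient function s: the preimage is s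
  times the sum, over the monomials m of degree b, of m tensor the dual of m, on the full exterior
  power.\<close>

lemma K_top:
  fixes W :: "'d::{finite,linorder} set \<Rightarrow> 'd mono \<times> 'd mono \<Rightarrow> 'r::comm_ring_1"
  assumes "sup0 a b W" "eta2 W = (\<lambda>_ _. 0)" "kap1 W = (\<lambda>_ _. 0)"
    and a: "a + 2 = CARD('d)" "a \<noteq> 0"
  shows "\<exists>s. W = kap1 (\<lambda>A (l, m). if A = -{i1} \<and> m \<in> monoms0 b then (if \<exists>l'. l = l' + m then s (l - m) else 0) else 0)"
  using assms(1-3)
proof (induction b arbitrary: W)
  case (0 W)
  have "\<exists>V. sup0 (Suc a) 0 V \<and> W = kap1 V"
    by (rule kap1_exact[OF 0(1,3)]) (use a in auto)
  then obtain V where V: "sup0 (Suc a) 0 V" "W = kap1 V" by blast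
  have "V A (l, m) = (if A = -{i1} \<and> m \<in> monoms0 0 then (if \<exists>l'. l = l' + m then V (-{i1}) (l - m, 0) else 0) else 0)" for A l m
  proof (cases "A = -{i1} \<and> m \<in> monoms0 0")
    case True
    thus ?thesis by (auto simp: monoms0_def monoms_def mdeg_eq_0_iff)
  next
    case False
    have "V A (l, m) = 0"
    proof (rule ccontr)
      assume "V A (l, m) \<noteq> 0"
      with V(1) have *: "i1 \<notin> A" "card A = Suc a" "m \<in> monoms0 0" unfolding sup0_def by blast+
      hence "A = -{i1}" using a by (intro card_subset_eq) (auto simp: card_Compl_i1)
      with * False show False by auto
    qed
    thus ?thesis using False by auto
  qed
  hence "V = (\<lambda>A (l, m). if A = -{i1} \<and> m \<in> monoms0 0 then (if \<exists>l'. l = l' + m then V (-{i1}) (l - m, 0) else 0) else 0)"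
    by (auto simp: fun_eq_iff)
  with V(2) show ?case by (intro exI[of _ "\<lambda>l. V (-{i1}) (l, 0)"]) simp
next
  case (Suc b W)
  have "\<exists>V. sup0 (Suc a) (Suc b) V \<and> W = kap1 V"
    by (rule kap1_exact[OF Suc.prems(1,3)]) (use a in auto)
  then obtain V where V: "sup0 (Suc a) (Suc b) V" "W = kap1 V" by blast
  define U where "U b s = (\<lambda>(A :: 'd set) (l :: 'd mono, m :: 'd mono). if A = -{i1} \<and> m \<in> monoms0 b then (if \<exists>l'. l = l' + m then s (l - m) else 0) else (0::'r))" for b s
  have "\<exists>s. eta2 V = kap1 (U b s)"
    unfolding U_def
  proof (rule Suc.IH)
    show "sup0 a b (eta2 V)" by (rule eta2_sup[OF V(1)])
    show "kap1 (eta2 V) = (\<lambda>_ _. 0)"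
      by (intro ext) (metis V(2) Suc.prems(2) kap1_eta2 neg_0_equal_iff_equal)
    show "eta2 (eta2 V) = (\<lambda>_ _. 0)" by (rule eta2_eta2)
  qed
  then obtain s where s: "eta2 V = kap1 (U b s)" by blast
  have "V A (l, m) = U (Suc b) s A (l, m)" for A l m
  proof (cases "A = -{i1} \<and> m \<in> monoms0 (Suc b)")
    case False
    have "V A (l, m) = 0"
    proof (rule ccontr)
      assume "V A (l, m) \<noteq> 0"
      with V(1) have *: "i1 \<notin> A" "card A = Suc a" "m \<in> monoms0 (Suc b)" unfolding sup0_def by blast+
      hence "A = -{i1}" using a by (intro card_subset_eq) (auto simp: card_Compl_i1)
      with * False show False by auto
    qed
    thus ?thesis using False by (auto simp: U_def)
  next
    case True
    have "m \<noteq> 0" using True by (auto simp: monoms0_def monoms_def mdeg_def)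
    then obtain i where i: "i \<in> Poly_Mapping.keys m" using keys_eq_empty by blast
    define m' where "m' = m - ei i"
    have m: "m = m' + ei i" using i by (simp add: m'_def diff_ei_add)
    have ii: "i \<noteq> i1" "m' \<in> monoms0 b" using True monoms0_add_ei'[of m' i "Suc b"] by (auto simp: m)
    \<comment> \<open>With i removed from the full index set only j = i contributes to either sum,
      so the value of V at m can be read off from \<open>eta2 V = kap1 (U b s)\<close>.\<close>
    define B where "B = -{i1} - {i}"
    have iB: "i \<notin> B" "insert i B = -{i1}" using ii by (auto simp: B_def)
    have z: "V (insert j B) p = 0" if "j \<in> -B" "j \<noteq> i" for j p
    proof (rule ccontr)
      obtain l m where p: "p = (l, m)" by (cases p)
      have "j = i1" using that by (auto simp: B_def)
      assume "V (insert j B) p \<noteq> 0"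
      with V(1) have "i1 \<notin> insert j B" unfolding p sup0_def by blast
      thus False using \<open>j = i1\<close> by simp
    qed
    have zU: "U b s (insert j B) p = 0" if "j \<in> -B" "j \<noteq> i" for j p
    proof -
      have "j = i1" using that by (auto simp: B_def)
      hence "insert j B \<noteq> -{i1}" by blast
      thus ?thesis by (cases p) (simp add: U_def)
    qed
    have "eta2 V B (l, m') = (\<Sum>j\<in>{i}. ext_sign j B * V (insert j B) (l, m' + ei j))"
      unfolding eta2_def eta_sum prod.case using z iB by (intro sum.mono_neutral_right) auto
    hence 1: "eta2 V B (l, m') = ext_sign i B * V A (l, m)" using iB True by (simp add: m)
    have "kap1 (U b s) B (l, m') = (\<Sum>j\<in>{i} \<inter> Poly_Mapping.keys l. ext_sign j B * U b s (insert j B) (l - ei j, m'))"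
      unfolding kap1_def kappa_sum prod.case using zU iB by (intro sum.mono_neutral_right) auto
    also have "\<dots> = (if i \<in> Poly_Mapping.keys l then ext_sign i B * U b s (-{i1}) (l - ei i, m') else 0)"
      using iB by auto
    finally have "ext_sign i B * V A (l, m) = (if i \<in> Poly_Mapping.keys l then ext_sign i B * U b s (-{i1}) (l - ei i, m') else 0)"
      using s 1 by simp
    hence "ext_sign i B * (ext_sign i B * V A (l, m)) = (if i \<in> Poly_Mapping.keys l then ext_sign i B * (ext_sign i B * U b s (-{i1}) (l - ei i, m')) else 0)"
      by simp
    hence "V A (l, m) = (if i \<in> Poly_Mapping.keys l then U b s (-{i1}) (l - ei i, m') else 0)" by simp
    also have "\<dots> = U (Suc b) s A (l, m)"
    proof -
      have "(\<exists>l'. l = l' + m) \<longleftrightarrow> i \<in> Poly_Mapping.keys l \<and> (\<exists>l'. l - ei i = l' + m')" (is "?L \<longleftrightarrow> ?R")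
      proof
        assume ?L then obtain l' where "l = l' + m' + ei i" by (auto simp: m add.assoc)
        thus ?R by (auto simp: keys_add_ei)
      next
        assume ?R then obtain l' where "l - ei i + ei i = l' + m' + ei i" "i \<in> Poly_Mapping.keys l" by auto
        thus ?L by (auto simp: m diff_ei_add add.assoc)
      qed
      moreover have "l - ei i - m' = l - m" by (rule poly_mapping_eqI) (simp add: m lookup_minus lookup_add)
      ultimately show ?thesis using True ii by (simp add: U_def)
    qed
    finally show ?thesis .
  qed
  hence "V = U (Suc b) s" by (auto simp: fun_eq_iff)
  thus ?case using V(2) unfolding U_def by blast
qed

section \<open>Lattice bases and base change\<close>

lemma lattice_basisI:
  assumes "set es \<subseteq> \<Lambda>" "\<And>z. z \<in> \<Lambda> \<Longrightarrow> \<exists>c. z = (\<lambda>k. \<Sum>i<length es. c i * (es ! i) k)"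
    and ind: "\<And>c i. (\<And>k. (\<Sum>i<length es. c i * (es ! i) k) = 0) \<Longrightarrow> i < length es \<Longrightarrow> c i = 0"
  shows "lattice_basis es \<Lambda>"
  unfolding lattice_basis_def
proof (intro conjI ballI ex_ex1I)
  fix z assume "z \<in> \<Lambda>"
  then obtain c where c: "z = (\<lambda>k. \<Sum>i<length es. c i * (es ! i) k)" using assms(2) by blast
  show "\<exists>c. c \<in> carrier_vec (length es) \<and> z = (\<lambda>k. \<Sum>i<length es. c $ i * (es ! i) k)"
    by (rule exI[of _ "vec (length es) c"]) (auto simp: c intro!: sum.cong)
next
  fix z c d
  assume c: "c \<in> carrier_vec (length es) \<and> z = (\<lambda>k. \<Sum>i<length es. c $ i * (es ! i) k)"
    and d: "d \<in> carrier_vec (length es) \<and> z = (\<lambda>k. \<Sum>i<length es. d $ i * (es ! i) k)"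
  have "(\<Sum>i<length es. (c $ i - d $ i) * (es ! i) k) = 0" for k
    using c d by (simp add: left_diff_distrib sum_subtractf) metis
  from ind[OF this] show "c = d" using c d by (intro eq_vecI) auto
qed fact

lemma lattice_basis_indep:
  assumes b: "lattice_basis es \<Lambda>" and 0: "(\<lambda>_. 0) \<in> \<Lambda>" and s: "\<And>k. (\<Sum>i<length es. c i * (es ! i) k) = 0"
    and i: "i < length es"
  shows "c i = 0"
proof -
  from b 0 have "\<exists>!c. c \<in> carrier_vec (length es) \<and> (\<lambda>_. 0) = (\<lambda>k. \<Sum>i<length es. c $ i * (es ! i) k)"
    unfolding lattice_basis_def by blast
  moreover have "vec (length es) c \<in> carrier_vec (length es) \<and> (\<lambda>_. 0) = (\<lambda>k. \<Sum>i<length es. vec (length es) c $ i * (es ! i) k)"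
    using s by (auto simp: fun_eq_iff intro!: sum.cong)
  moreover have "0\<^sub>v (length es) \<in> carrier_vec (length es) \<and> (\<lambda>_. 0) = (\<lambda>k. \<Sum>i<length es. 0\<^sub>v (length es) $ i * (es ! i) k)"
    by (auto simp: fun_eq_iff)
  ultimately have "vec (length es) c = 0\<^sub>v (length es)" by blast
  hence "vec (length es) c $ i = 0\<^sub>v (length es) $ i" by simp
  thus ?thesis using i by simp
qed

lemma lattice_basis_span:
  assumes "lattice_basis es \<Lambda>" "z \<in> \<Lambda>"
  shows "\<exists>c. z = (\<lambda>k. \<Sum>i<length es. c i * (es ! i) k)"
  using assms unfolding lattice_basis_def by blast

text \<open>By induction on the set of coordinates: the values of \<open>\<Lambda>\<close> at one coordinate form a principal ideal, and an element with
  the generator as value is adjoined to a basis of the subgroup vanishing there.\<close>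
lemma subgroup_basis:
  fixes \<Lambda> :: "('c \<Rightarrow> int) set"
  assumes "finite P" "(\<lambda>_. 0) \<in> \<Lambda>" "\<And>z w t. z \<in> \<Lambda> \<Longrightarrow> w \<in> \<Lambda> \<Longrightarrow> (\<lambda>k. z k - t * w k) \<in> \<Lambda>"
    "\<And>z k. z \<in> \<Lambda> \<Longrightarrow> k \<notin> P \<Longrightarrow> z k = 0"
  shows "\<exists>es. lattice_basis es \<Lambda>"
  using assms
proof (induction P arbitrary: \<Lambda> rule: finite_induct)
  case empty
  then have "\<Lambda> = {\<lambda>_. 0}" by (auto simp: fun_eq_iff)
  hence "lattice_basis [] \<Lambda>" by (intro lattice_basisI) auto
  thus ?case ..
next
  case (insert q P)
  define M where "M = {z \<in> \<Lambda>. z q = 0}"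
  have "\<exists>es. lattice_basis es M"
  proof (rule insert.IH)
    show "(\<lambda>_. 0) \<in> M" using insert.prems(1) by (simp add: M_def)
    show "(\<lambda>k. z k - t * w k) \<in> M" if "z \<in> M" "w \<in> M" for z w t
      using that insert.prems(2) by (simp add: M_def)
    show "z k = 0" if "z \<in> M" "k \<notin> P" for z k
      using that insert.prems(3)[of z k] by (auto simp: M_def)
  qed
  then obtain es where es: "lattice_basis es M" by blast
  show ?case
  proof (cases "M = \<Lambda>")
    case True with es show ?thesis by blast
  next
    case False
    then obtain z1 where z1: "z1 \<in> \<Lambda>" "z1 q \<noteq> 0" by (auto simp: M_def)
    define Q where "Q g \<longleftrightarrow> g > 0 \<and> (\<exists>z\<in>\<Lambda>. z q = int g)" for g
    \<comment> \<open>The closure assumption provides the negative of \<open>z1\<close>, so some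
      positive value is attained at q.\<close>
    have "(\<lambda>k. 0 - 1 * z1 k) \<in> \<Lambda>" by (rule insert.prems(2)) (use z1 insert.prems(1) in auto)
    hence "\<exists>z\<in>\<Lambda>. z q = \<bar>z1 q\<bar>" using z1(1) by (cases "z1 q \<ge> 0") (auto intro: bexI[of _ z1])
    hence "Q (nat \<bar>z1 q\<bar>)" using z1 by (auto simp: Q_def)
    define g where "g = (LEAST g. Q g)"
    have "Q g" unfolding g_def by (rule LeastI) fact
    then obtain z0 where g: "g > 0" and z0: "z0 \<in> \<Lambda>" "z0 q = int g" by (auto simp: Q_def)
    have dv: "int g dvd z q" if "z \<in> \<Lambda>" for z
    proof (rule ccontr)
      assume nd: "\<not> int g dvd z q"
      define w where "w = (\<lambda>k. z k - (z q div int g) * z0 k)"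
      have "w \<in> \<Lambda>" unfolding w_def by (rule insert.prems(2)[OF that z0(1)])
      moreover have wq: "w q = z q mod int g" by (simp add: w_def z0(2) minus_div_mult_eq_mod)
      moreover have "z q mod int g > 0"
      proof -
        have "z q mod int g \<ge> 0" using g by simp
        moreover have "z q mod int g \<noteq> 0" using nd by auto
        ultimately show ?thesis by linarith
      qed
      ultimately have "Q (nat (w q))" unfolding Q_def by (intro conjI bexI[of _ w]) simp_all
      hence "g \<le> nat (w q)" unfolding g_def by (rule Least_le)
      moreover have "w q < int g" using g by (simp add: wq)
      ultimately show False using wq \<open>z q mod int g > 0\<close> by simp
    qed
    have "lattice_basis (es @ [z0]) \<Lambda>"
    proof (rule lattice_basisI)
      show "set (es @ [z0]) \<subseteq> \<Lambda>" using es z0 by (auto simp: lattice_basis_def M_def)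
    next
      fix z assume z: "z \<in> \<Lambda>"
      define t where "t = z q div int g"
      have "(\<lambda>k. z k - t * z0 k) \<in> M"
        using insert.prems(2)[OF z z0(1)] dv[OF z] by (simp add: M_def t_def z0(2))
      then obtain c where c: "(\<lambda>k. z k - t * z0 k) = (\<lambda>k. \<Sum>i<length es. c i * (es ! i) k)"
        using lattice_basis_span[OF es] by blast
      show "\<exists>c. z = (\<lambda>k. \<Sum>i<length (es @ [z0]). c i * ((es @ [z0]) ! i) k)"
      proof (intro exI ext)
        fix k
        have "z k = (\<Sum>i<length es. c i * (es ! i) k) + t * z0 k" using fun_cong[OF c, of k] by simp
        thus "z k = (\<Sum>i<length (es @ [z0]). (c(length es := t)) i * ((es @ [z0]) ! i) k)"
          by (simp add: nth_append)
      qed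
    next
      fix c i assume s: "\<And>k. (\<Sum>i<length (es @ [z0]). c i * ((es @ [z0]) ! i) k) = 0"
        and i: "i < length (es @ [z0])"
      have s': "(\<Sum>i<length es. c i * (es ! i) k) + c (length es) * z0 k = 0" for k
        using s[of k] by (simp add: nth_append)
      have "(\<Sum>i<length es. c i * (es ! i) q) = 0"
        using es by (intro sum.neutral) (auto simp: lattice_basis_def M_def subset_iff)
      hence cl: "c (length es) = 0" using s'[of q] g z0 by simp
      have "(\<lambda>_. 0) \<in> M" using insert.prems(1) by (simp add: M_def)
      hence "i < length es \<Longrightarrow> c i = 0" using lattice_basis_indep[OF es, of c i] s' cl by simp
      thus "c i = 0" using cl i by (cases "i = length es") auto
    qed
    thus ?thesis ..
  qed
qed

text \<open>The expansion of z with its own values as coefficients expresses an integral projection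
  onto the lattice. Writing the \<open>d p\<close> in the basis turns it into integer linear forms
  \<open>t i\<close> that compute coordinates and that make sense over every ring.\<close>

lemma base_change_coords:
  fixes \<Lambda> :: "('c \<Rightarrow> int) set"
  assumes b: "lattice_basis es \<Lambda>" and 0: "(\<lambda>_. 0) \<in> \<Lambda>" and Q: "finite Q" "\<And>p. p \<in> Q \<Longrightarrow> d p \<in> \<Lambda>"
    and ex: "\<And>z. z \<in> \<Lambda> \<Longrightarrow> z = (\<lambda>k. \<Sum>p\<in>Q. z p * d p k)"
  shows "\<exists>t. (\<forall>i<length es. \<forall>j<length es. (\<Sum>p\<in>Q. t i p * (es ! j) p) = (if i = j then 1 else 0)) \<and>
     (\<forall>p\<in>Q. \<forall>k. d p k = (\<Sum>i<length es. t i p * (es ! i) k))"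
proof -
  have "\<forall>p\<in>Q. \<exists>c. d p = (\<lambda>k. \<Sum>i<length es. c i * (es ! i) k)"
    using lattice_basis_span[OF b] Q by blast
  then obtain c where c: "\<And>p. p \<in> Q \<Longrightarrow> d p = (\<lambda>k. \<Sum>i<length es. c p i * (es ! i) k)" by metis
  have "(\<Sum>p\<in>Q. c p i * (es ! j) p) = (if i = j then 1 else 0)" if i: "i < length es" and j: "j < length es" for i j
  proof -
    have "es ! j \<in> \<Lambda>" using b j by (auto simp: lattice_basis_def)
    have "(\<Sum>i<length es. ((\<Sum>p\<in>Q. c p i * (es ! j) p) - (if i = j then 1 else 0)) * (es ! i) k) = 0" for k
    proof -
      have "(es ! j) k = (\<Sum>p\<in>Q. (es ! j) p * (\<Sum>i<length es. c p i * (es ! i) k))"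
        using fun_cong[OF ex[OF \<open>es ! j \<in> \<Lambda>\<close>], of k] c by simp
      also have "\<dots> = (\<Sum>i<length es. (\<Sum>p\<in>Q. c p i * (es ! j) p) * (es ! i) k)"
        by (simp add: sum_distrib_left sum_distrib_right sum.swap[of _ _ Q] mult_ac)
      finally show ?thesis using j by (simp add: left_diff_distrib sum_subtractf if_distrib[of "\<lambda>x. x * _"] cong: if_cong)
    qed
    from lattice_basis_indep[OF b 0 this i] show ?thesis by simp
  qed
  thus ?thesis using c by (intro exI[of _ "\<lambda>i p. c p i"]) auto
qed

lemma base_change_expand:
  fixes z :: "'c \<Rightarrow> 'r::comm_ring_1"
  assumes d: "\<And>p k. p \<in> Q \<Longrightarrow> d p k = (\<Sum>i<N. t i p * (es ! i) k)"
    and z: "z = (\<lambda>k. \<Sum>p\<in>Q. z p * of_int (d p k))"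
  shows "z k = (\<Sum>i<N. (\<Sum>p\<in>Q. of_int (t i p) * z p) * of_int ((es ! i) k))"
proof -
  have "z k = (\<Sum>p\<in>Q. z p * of_int (\<Sum>i<N. t i p * (es ! i) k))"
    by (subst z) (simp add: d)
  thus ?thesis by (simp add: sum_distrib_left sum_distrib_right sum.swap[of _ _ Q] mult_ac)
qed

section \<open>The kernels and the lattices over an arbitrary ring\<close>

definition ext0 :: "nat \<Rightarrow> nat \<Rightarrow> ('d::{finite,linorder} set \<Rightarrow> 'd mono \<Rightarrow> 'r::comm_ring_1) \<Rightarrow> bool" where
  "ext0 a b w \<longleftrightarrow> (\<forall>A m. w A m \<noteq> 0 \<longrightarrow> i1 \<notin> A \<and> card A = a \<and> m \<in> monoms0 b)"

lemma ext0_D: "ext0 a b w \<Longrightarrow> \<not> (i1 \<notin> A \<and> card A = a \<and> m \<in> monoms0 b) \<Longrightarrow> w A m = 0"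
  unfolding ext0_def by blast

lemma ext0_kappa: assumes "ext0 (Suc a) b w" shows "ext0 a (Suc b) (kappa w)"
  unfolding ext0_def
proof (intro allI impI)
  fix A m assume "kappa w A m \<noteq> 0"
  then obtain j where j: "j \<notin> A" "j \<in> Poly_Mapping.keys m" "w (insert j A) (m - ei j) \<noteq> 0"
    using kappa_nz[of w A m] by auto
  with assms have "i1 \<notin> insert j A" "card (insert j A) = Suc a" "m - ei j \<in> monoms0 b"
    unfolding ext0_def by blast+
  thus "i1 \<notin> A \<and> card A = a \<and> m \<in> monoms0 (Suc b)"
    using j by (auto simp: monoms0_diff_ei)
qed

lemma ext0_eta: assumes "ext0 (Suc a) (Suc b) w" shows "ext0 a b (eta w)"
  unfolding ext0_def
proof (intro allI impI)
  fix A m assume "eta w A m \<noteq> 0"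
  then obtain j where j: "j \<notin> A" "w (insert j A) (m + ei j) \<noteq> 0"
    using eta_nz[of w A m] by auto
  with assms have "i1 \<notin> insert j A" "card (insert j A) = Suc a" "m + ei j \<in> monoms0 (Suc b)"
    unfolding ext0_def by blast+
  thus "i1 \<notin> A \<and> card A = a \<and> m \<in> monoms0 b"
    using j by (auto simp: monoms0_add_ei)
qed

lemma ext0_kappa_contr: assumes "ext0 a (Suc b) w" shows "ext0 (Suc a) b (kappa_contr w)"
  unfolding ext0_def
proof (intro allI impI)
  fix A m assume "kappa_contr w A m \<noteq> 0"
  then obtain i where i: "i \<in> A" "w (A - {i}) (m + ei i) \<noteq> 0"
    unfolding kappa_contr_def by (auto simp: Let_def split: if_splits)
  with assms have "i1 \<notin> A - {i}" "card (A - {i}) = a" "m + ei i \<in> monoms0 (Suc b)"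
    unfolding ext0_def by blast+
  thus "i1 \<notin> A \<and> card A = Suc a \<and> m \<in> monoms0 b"
    using i card_remove1[OF i(1), of a] monoms0_add_ei'[of m i "Suc b"]
    by (auto simp del: card_Diff_singleton card_Diff_insert)
qed

lemma ext0_eta_contr: assumes "ext0 a b w" shows "ext0 (Suc a) (Suc b) (eta_contr w)"
  unfolding ext0_def
proof (intro allI impI)
  fix A m assume "eta_contr w A m \<noteq> 0"
  then obtain i where i: "i1 \<notin> A" "i \<in> A" "i \<in> Poly_Mapping.keys m" "w (A - {i}) (m - ei i) \<noteq> 0"
    unfolding eta_contr_def by (auto simp: Let_def dest: mult_not_zero split: if_splits)
  with assms have "card (A - {i}) = a" "m - ei i \<in> monoms0 b"
    unfolding ext0_def by blast+
  thus "i1 \<notin> A \<and> card A = Suc a \<and> m \<in> monoms0 (Suc b)"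
    using i card_remove1[OF i(2), of a] monoms0_diff_ei[of i m b]
    by (auto simp del: card_Diff_singleton card_Diff_insert)
qed

text \<open>On the kernel of \<kappa> the homotopy identity has only one composite left. At m = 0,
  where it may fail, w vanishes because its symmetric degree is positive.\<close>

lemma ker_kappa_expand:
  assumes w: "ext0 a (Suc b) w" and z: "kappa w = (\<lambda>_ _. 0)"
  shows "w = kappa (kappa_contr w)"
proof (intro ext)
  fix A m
  show "w A m = kappa (kappa_contr w) A m"
  proof (cases "m = 0")
    case True
    hence "w A m = 0" by (intro ext0_D[OF w]) (auto simp: monoms0_def monoms_def mdeg_def)
    thus ?thesis using True by (simp add: kappa_def)
  next
    case False
    thus ?thesis using kappa_homotopy[of A m w] z by (simp add: kappa_contr_def Let_def)
  qed
qed

lemma ker_eta_expand: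
  fixes w :: "'d::{finite,linorder} set \<Rightarrow> 'd mono \<Rightarrow> 'r::comm_ring_1"
  assumes w: "ext0 a b w" and z: "eta w = (\<lambda>_ _. 0)" and a: "a + 2 \<le> CARD('d)"
  shows "w = eta (eta_contr w)"
proof (intro ext)
  fix A :: "'d set" and m :: "'d mono"
  show "w A m = eta (eta_contr w) A m"
  proof (cases "i1 \<notin> A \<and> card A = a \<and> m \<in> monoms0 b")
    case True
    have "A \<noteq> -{i1}" using True a by (auto simp: card_Compl_i1)
    moreover have "w B k = 0" if "i1 \<in> B" for B k using that by (intro ext0_D[OF w]) auto
    ultimately show ?thesis using eta_homotopy[of A m w] True
      unfolding z by (simp add: eta_contr_zero monoms0_def)
  next
    case False
    thus ?thesis using ext0_D[OF w] ext0_D[OF ext0_eta[OF ext0_eta_contr[OF w]]] by simp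
  qed
qed

definition lin2 :: "(('a \<Rightarrow> 'm \<Rightarrow> 'r::comm_ring_1) \<Rightarrow> 'b \<Rightarrow> 'p \<Rightarrow> 'r) \<Rightarrow> bool" where
  "lin2 F \<longleftrightarrow> (\<forall>c w v. F (\<lambda>A m. c * w A m + v A m) = (\<lambda>A m. c * F w A m + F v A m))"

lemma lin2_sum:
  assumes F: "lin2 F"
  shows "F (\<lambda>A m. \<Sum>i\<in>C. c i * f i A m) = (\<lambda>A m. \<Sum>i\<in>C. c i * F (f i) A m)"
proof -
  have 0: "F (\<lambda>_ _. 0) = (\<lambda>_ _. 0)"
  proof -
    show ?thesis using F[unfolded lin2_def, rule_format, of "-1" "\<lambda>_ _. 0" "\<lambda>_ _. 0"] by simp
  qed
  show ?thesis
  proof (induct C rule: infinite_finite_induct)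
    case (insert i C)
    have "F (\<lambda>A m. c i * f i A m + (\<Sum>i\<in>C. c i * f i A m)) = (\<lambda>A m. c i * F (f i) A m + F (\<lambda>A m. \<Sum>i\<in>C. c i * f i A m) A m)"
      using F[unfolded lin2_def, rule_format, of "c i" "f i" "\<lambda>A m. \<Sum>i\<in>C. c i * f i A m"] .
    with insert show ?case by simp
  qed (simp_all add: 0)
qed

lemma lin2_kappa: "lin2 kappa"
  unfolding lin2_def kappa_eq_ext_contract by (intro allI ext ext_contract_lin lin_op_mono_mul)
lemma lin2_eta: "lin2 eta"
  unfolding lin2_def eta_eq_ext_contract by (intro allI ext ext_contract_lin lin_op_mono_div)
lemma lin2_kappa_contr: "lin2 kappa_contr"
  unfolding lin2_def by (intro allI ext) (simp add: kappa_contr_def Let_def)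
lemma lin2_eta_contr: "lin2 eta_contr"
  unfolding lin2_def by (intro allI ext) (simp add: eta_contr_def Let_def algebra_simps)
lemma lin2_comp: "lin2 F \<Longrightarrow> lin2 G \<Longrightarrow> lin2 (\<lambda>w. F (G w))"
  unfolding lin2_def by simp

context comm_ring_hom begin
lemma hom_ext_sign: "hom (ext_sign i A) = ext_sign i A"
  by (simp add: ext_sign_def hom_distribs)
lemma hom_kappa: "hom (kappa w A m) = kappa (\<lambda>A m. hom (w A m)) A m"
  by (simp add: kappa_def hom_distribs hom_ext_sign)
lemma hom_eta: "hom (eta w A m) = eta (\<lambda>A m. hom (w A m)) A m"
  by (simp add: eta_def hom_distribs hom_ext_sign)
lemma hom_kappa_contr: "hom (kappa_contr w A m) = kappa_contr (\<lambda>A m. hom (w A m)) A m"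
  by (simp add: kappa_contr_def Let_def)
lemma hom_eta_contr: "hom (eta_contr w A m) = eta_contr (\<lambda>A m. hom (w A m)) A m"
  by (simp add: eta_contr_def Let_def hom_distribs hom_ext_sign)
end

definition ind2 :: "'a \<Rightarrow> 'm \<Rightarrow> 'a \<Rightarrow> 'm \<Rightarrow> 'r::comm_ring_1" where
  "ind2 A m = (\<lambda>B k. if B = A \<and> k = m then 1 else 0)"

definition Qset :: "nat \<Rightarrow> nat \<Rightarrow> ('d::{finite,linorder} set \<times> 'd mono) set" where
  "Qset a b = {(A, m). i1 \<notin> A \<and> card A = a \<and> m \<in> monoms0 b}"

lemma finite_monoms0 [simp]: "finite (monoms0 b)"
  by (simp add: monoms0_def)

lemma finite_Qset: "finite (Qset a b :: ('d::{finite,linorder} set \<times> 'd mono) set)"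
  by (rule finite_subset[of _ "UNIV \<times> monoms0 b"]) (auto simp: Qset_def)

lemma ext0_ind2: "(A, m) \<in> Qset a b \<Longrightarrow> ext0 a b (ind2 A m)"
  by (auto simp: ext0_def ind2_def Qset_def)

lemma ext0_ind2_expand:
  assumes "ext0 a b w"
  shows "w = (\<lambda>B k. \<Sum>(A, m)\<in>Qset a b. w A m * of_int (ind2 A m B k))"
proof (intro ext)
  fix B k
  have "(\<Sum>(A, m)\<in>Qset a b. w A m * of_int (ind2 A m B k)) = (\<Sum>p\<in>Qset a b. if p = (B, k) then w B k else 0)"
    by (rule sum.cong) (auto simp: ind2_def split: if_splits)
  also have "\<dots> = w B k"
    using ext0_D[OF assms, of B k] by (simp add: finite_Qset) (auto simp: Qset_def)
  finally show "w B k = (\<Sum>(A, m)\<in>Qset a b. w A m * of_int (ind2 A m B k))" by simp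
qed

text \<open>\<open>F'\<close> is the operator \<open>F\<close> over the integers. Its values on the
  coordinate vectors are integral, and by linearity they generate the fixed elements of
  \<open>F\<close> over every ring.\<close>

lemma lin2_expand:
  fixes w :: "'d::{finite,linorder} set \<Rightarrow> 'd mono \<Rightarrow> 'r::comm_ring_1"
  assumes F: "lin2 (F :: _ \<Rightarrow> 'd::{finite,linorder} set \<Rightarrow> 'd mono \<Rightarrow> 'r)" and w: "ext0 a b w" "w = F w"
    and h: "\<And>v B k. of_int (F' v B k) = F (\<lambda>A m. of_int (v A m)) B k"
  shows "w B k = (\<Sum>(A, m)\<in>Qset a b. w A m * of_int (F' (ind2 A m) B k))"
proof -
  have "F w = F (\<lambda>B k. \<Sum>p\<in>Qset a b. w (fst p) (snd p) * of_int (ind2 (fst p) (snd p) B k))"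
    by (rule arg_cong[where f=F]) (use ext0_ind2_expand[OF w(1)] in \<open>simp add: case_prod_beta\<close>)
  hence "w B k = F (\<lambda>B k. \<Sum>p\<in>Qset a b. w (fst p) (snd p) * of_int (ind2 (fst p) (snd p) B k)) B k"
    using w(2) by metis
  thus ?thesis unfolding lin2_sum[OF F] h by (simp add: case_prod_beta)
qed

lemma L_expand:
  fixes w :: "'d::{finite,linorder} set \<Rightarrow> 'd mono \<Rightarrow> 'r::comm_ring_1"
  assumes "ext0 a (Suc b) w" "kappa w = (\<lambda>_ _. 0)"
  shows "w B k = (\<Sum>(A, m)\<in>Qset a (Suc b). w A m * of_int (kappa (kappa_contr (ind2 A m)) B k))"
  by (rule lin2_expand[where F="\<lambda>w. kappa (kappa_contr w)"])
    (use assms ker_kappa_expand[OF assms] in \<open>simp_all add: lin2_comp lin2_kappa lin2_kappa_contr of_int_hom.hom_kappa of_int_hom.hom_kappa_contr\<close>)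

lemma K_expand:
  fixes w :: "'d::{finite,linorder} set \<Rightarrow> 'd mono \<Rightarrow> 'r::comm_ring_1"
  assumes "ext0 a b w" "eta w = (\<lambda>_ _. 0)" "a + 2 \<le> CARD('d)"
  shows "w B k = (\<Sum>(A, m)\<in>Qset a b. w A m * of_int (eta (eta_contr (ind2 A m)) B k))"
  by (rule lin2_expand[where F="\<lambda>w. eta (eta_contr w)"])
    (use assms ker_eta_expand[OF assms] in \<open>simp_all add: lin2_comp lin2_eta lin2_eta_contr of_int_hom.hom_eta of_int_hom.hom_eta_contr\<close>)

text \<open>The submodule of \<open>'r\<close>-valued coordinate functions playing the role of \<open>'r \<otimes> lattice n r\<close>.\<close>
definition latG :: "nat \<Rightarrow> nat \<Rightarrow> ('d::{finite,linorder} coord \<Rightarrow> 'r::comm_ring_1) set" where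
  "latG n r =
     (if r = 0 then {z. \<forall>k. z k \<noteq> 0 \<longrightarrow> k = One}
      else if r < CARD('d) then {z. ext0 (r - 1) (n - 1) (Kpart z) \<and> eta (Kpart z) = (\<lambda>_ _. 0) \<and>
         ext0 (r - 1) n (Lpart z) \<and> kappa (Lpart z) = (\<lambda>_ _. 0) \<and> z One = 0 \<and> (\<forall>A. z (WC A) = 0)}
      else if r = CARD('d) then
        {z. \<forall>k. z k \<noteq> 0 \<longrightarrow> (\<exists>A. k = WC A \<and> i1 \<notin> A \<and> card A = CARD('d) - 1)}
      else {\<lambda>_. 0})"

lemma of_KL_simps [simp]:
  "of_KL w v (KC A m) = w A m" "of_KL w v (LC A m) = v A m" "of_KL w v One = 0" "of_KL w v (WC A) = 0"
  "Kpart (of_KL w v) = w" "Lpart (of_KL w v) = v"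
  by (simp_all add: of_KL_def Kpart_def Lpart_def)

lemma of_KL_eqI: "z One = 0 \<Longrightarrow> (\<And>A. z (WC A) = 0) \<Longrightarrow> z = of_KL (Kpart z) (Lpart z)"
  by (intro ext, case_tac x) (auto simp: Kpart_def Lpart_def)

lemma lattice_eq_latG: "lattice n r = latG n r"
proof -
  have eq: "{of_KL w v |w v. w \<in> Kmod (r - 1) (n - 1) \<and> v \<in> Lmod (r - 1) n} =
    {z. ext0 (r - 1) (n - 1) (Kpart z) \<and> eta (Kpart z) = (\<lambda>_ _. 0) \<and>
         ext0 (r - 1) n (Lpart z) \<and> kappa (Lpart z) = (\<lambda>_ _. 0) \<and> z One = 0 \<and> (\<forall>A. z (WC A) = 0)}" (is "?L = ?R")
  proof
    show "?L \<subseteq> ?R" by (auto simp: Kmod_def Lmod_def ext_tensor0_def ext0_def)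
    show "?R \<subseteq> ?L"
    proof
      fix z assume z: "z \<in> ?R"
      hence "z = of_KL (Kpart z) (Lpart z)" by (intro of_KL_eqI) auto
      thus "z \<in> ?L" using z by (auto simp: Kmod_def Lmod_def ext_tensor0_def ext0_def)
    qed
  qed
  show ?thesis unfolding lattice_def latG_def eq by (rule refl)
qed

definition latQ :: "nat \<Rightarrow> nat \<Rightarrow> 'd::{finite,linorder} coord set" where
  "latQ n r = (if r = 0 then {One}
      else if r < CARD('d) then (\<lambda>(A, m). KC A m) ` Qset (r - 1) (n - 1) \<union> (\<lambda>(A, m). LC A m) ` Qset (r - 1) n
      else if r = CARD('d) then WC ` {A. i1 \<notin> A \<and> card A = CARD('d) - 1}
      else {})"

text \<open>The homotopies are defined over the integers, so \<open>\<kappa> \<circ> kappa_contr\<close> and \<open>\<eta> \<circ> eta_contr\<close> are projections onto the \<open>L\<close>- and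
  \<open>K\<close>-modules; the images of the coordinate vectors span the lattice, and also \<open>latG\<close> over every ring.\<close>
definition latd :: "'d::{finite,linorder} coord \<Rightarrow> 'd coord \<Rightarrow> int" where
  "latd p = (case p of KC A m \<Rightarrow> of_KL (eta (eta_contr (ind2 A m))) (\<lambda>_ _. 0)
     | LC A m \<Rightarrow> of_KL (\<lambda>_ _. 0) (kappa (kappa_contr (ind2 A m)))
     | _ \<Rightarrow> (\<lambda>k. if k = p then 1 else 0))"

lemma finite_latQ: "finite (latQ n r)"
  by (auto simp: latQ_def finite_Qset)

lemma ext0_zero: "ext0 a b (\<lambda>_ _. 0)" by (simp add: ext0_def)

lemma latd_in_lattice: assumes "p \<in> latQ n r" "n \<ge> 1" shows "latd p \<in> lattice n r"
proof -
  from assms(2) obtain c where n: "n = Suc c" by (cases n) auto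
  show ?thesis using assms(1)
    unfolding lattice_eq_latG latQ_def n
    by (auto simp: latG_def latd_def eta_eta kappa_kappa ext0_zero split: if_splits
       intro!: ext0_eta[OF ext0_eta_contr[OF ext0_ind2]] ext0_kappa[OF ext0_kappa_contr[OF ext0_ind2]])
qed

lemma latG_expand:
  fixes z :: "'d::{finite,linorder} coord \<Rightarrow> 'r::comm_ring_1"
  assumes z: "z \<in> latG n r" and n: "n \<ge> 1"
  shows "z = (\<lambda>k. \<Sum>p\<in>latQ n r. z p * of_int (latd p k))"
proof
  fix k
  from n obtain c where n: "n = Suc c" by (cases n) auto
  consider "r = 0" | "r > 0" "r < CARD('d)" | "r = CARD('d)" "r > 0" | "r > CARD('d)" by fastforce
  thus "z k = (\<Sum>p\<in>latQ n r. z p * of_int (latd p k))"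
  proof cases
    case 1
    thus ?thesis using z by (auto simp: latG_def latQ_def latd_def)
  next
    case 2
    let ?K = "(\<lambda>(A, m). KC A m) ` Qset (r - 1) c :: 'd coord set" and ?L = "(\<lambda>(A, m). LC A m) ` Qset (r - 1) (Suc c) :: 'd coord set"
    have s: "(\<Sum>p\<in>latQ n r. z p * of_int (latd p k)) = (\<Sum>p\<in>?K. z p * of_int (latd p k)) + (\<Sum>p\<in>?L. z p * of_int (latd p k))"
      using 2 by (auto simp: latQ_def n finite_Qset intro!: sum.union_disjoint)
    have sK: "(\<Sum>p\<in>?K. z p * of_int (latd p k)) = (\<Sum>(A, m)\<in>Qset (r - 1) c. z (KC A m) * of_int (latd (KC A m) k))"
      by (subst sum.reindex) (auto simp: inj_on_def intro!: sum.cong)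
    have sL: "(\<Sum>p\<in>?L. z p * of_int (latd p k)) = (\<Sum>(A, m)\<in>Qset (r - 1) (Suc c). z (LC A m) * of_int (latd (LC A m) k))"
      by (subst sum.reindex) (auto simp: inj_on_def intro!: sum.cong)
    have zz: "ext0 (r - 1) c (Kpart z)" "eta (Kpart z) = (\<lambda>_ _. 0)" "ext0 (r - 1) (Suc c) (Lpart z)" "kappa (Lpart z) = (\<lambda>_ _. 0)"
      "z One = 0" "\<And>A. z (WC A) = 0" using z 2 by (simp_all add: latG_def n)
    show ?thesis
    proof (cases k)
      case (KC B m)
      thus ?thesis unfolding s sK sL using K_expand[OF zz(1,2), of B m] 2 by (simp add: latd_def Kpart_def case_prod_beta)
    next
      case (LC B m)
      thus ?thesis unfolding s sK sL using L_expand[OF zz(3,4), of B m] 2 by (simp add: latd_def Lpart_def case_prod_beta)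
    next
      case One
      thus ?thesis unfolding s sK sL by (simp add: latd_def zz case_prod_beta)
    next
      case (WC B)
      thus ?thesis unfolding s sK sL by (simp add: latd_def zz case_prod_beta)
    qed
  next
    case 3
    have "(\<Sum>p\<in>latQ n r. z p * of_int (latd p k)) = (\<Sum>p\<in>latQ n r. if p = k then z k else 0)"
    proof (rule sum.cong[OF refl])
      fix p :: "'d coord" assume "p \<in> latQ n r"
      then obtain A where "p = WC A" using 3 by (auto simp: latQ_def)
      thus "z p * of_int (latd p k) = (if p = k then z k else 0)" by (auto simp: latd_def)
    qed
    also have "\<dots> = z k"
    proof -
      have "k \<notin> latQ n r \<Longrightarrow> z k = 0" using z 3 by (auto simp: latG_def latQ_def)
      thus ?thesis by (simp add: finite_latQ)
    qed
    finally show ?thesis by simp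
  next
    case 4
    thus ?thesis using z by (simp add: latG_def latQ_def)
  qed
qed

lemma of_int_latG:
  fixes e :: "'a::{finite,linorder} coord \<Rightarrow> int"
  assumes "e \<in> lattice n r" shows "(\<lambda>k. of_int (e k) :: 'r::comm_ring_1) \<in> latG n r"
proof -
  have 1: "Kpart (\<lambda>k. of_int (e k) :: 'r) = (\<lambda>A m. of_int (Kpart e A m))" "Lpart (\<lambda>k. of_int (e k) :: 'r) = (\<lambda>A m. of_int (Lpart e A m))"
    by (simp_all add: Kpart_def Lpart_def)
  have 2: "ext0 a b w \<Longrightarrow> ext0 a b (\<lambda>A m. of_int (w A m) :: 'r)" for a b w
    unfolding ext0_def by (metis of_int_0)
  have 3: "eta (\<lambda>A m. of_int (w A m) :: 'r) = (\<lambda>A m. of_int (eta w A m))"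
    "kappa (\<lambda>A m. of_int (w A m) :: 'r) = (\<lambda>A m. of_int (kappa w A m))" for w :: "'a set \<Rightarrow> 'a mono \<Rightarrow> int"
    by (simp_all add: of_int_hom.hom_eta of_int_hom.hom_kappa)
  have 4: "of_int (e k) \<noteq> (0::'r) \<Longrightarrow> e k \<noteq> 0" for k by auto
  consider "r = 0" | "r > 0" "r < CARD('a)" | "r = CARD('a)" "r > 0" | "r > CARD('a)" by fastforce
  thus ?thesis
    by cases (use assms 4 in \<open>simp_all add: lattice_eq_latG latG_def 1 2 3\<close>)
qed

lemma latG_lin:
  fixes z w :: "'a::{finite,linorder} coord \<Rightarrow> 'b::comm_ring_1"
  assumes z: "z \<in> latG n r" "w \<in> latG n r" shows "(\<lambda>k. c * z k + w k) \<in> latG n r"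
proof -
  have e1: "Kpart (\<lambda>k. c * z k + w k) = (\<lambda>A m. c * Kpart z A m + Kpart w A m)"
    "Lpart (\<lambda>k. c * z k + w k) = (\<lambda>A m. c * Lpart z A m + Lpart w A m)" by (simp_all add: Kpart_def Lpart_def)
  have e': "ext0 a b w \<Longrightarrow> ext0 a b v \<Longrightarrow> ext0 a b (\<lambda>A m. c * w A m + v A m)" for a b and w v :: "'a set \<Rightarrow> 'a mono \<Rightarrow> 'b"
    unfolding ext0_def by (metis add.right_neutral mult_zero_right)
  have e3: "eta (\<lambda>A m. c * w A m + v A m) = (\<lambda>A m. c * eta w A m + eta v A m)"
    "kappa (\<lambda>A m. c * w A m + v A m) = (\<lambda>A m. c * kappa w A m + kappa v A m)" for w v :: "'a set \<Rightarrow> 'a mono \<Rightarrow> 'b"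
    using lin2_eta lin2_kappa unfolding lin2_def by blast+
  have e4: "c * z k + w k \<noteq> 0 \<Longrightarrow> z k \<noteq> 0 \<or> w k \<noteq> 0" for k by auto
  consider "r = 0" | "r > 0" "r < CARD('a)" | "r = CARD('a)" "r > 0" | "r > CARD('a)" by fastforce
  thus ?thesis
  proof cases
    case 2 with z show ?thesis by (simp add: latG_def e1 e' e3)
  qed (use z e4 in \<open>simp_all add: latG_def\<close>, blast+)
qed

lemma zero_latG: "(\<lambda>_. 0) \<in> latG n r"
  by (auto simp: latG_def Kpart_def Lpart_def ext0_zero)

lemma lattice_has_basis: assumes "n \<ge> 1" shows "\<exists>es. lattice_basis es (lattice n r :: ('d::{finite,linorder} coord \<Rightarrow> int) set)"
proof (rule subgroup_basis)
  let ?P = "\<Union>p\<in>latQ n r. {k. latd p k \<noteq> 0} :: 'd coord set"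
  show "finite (latQ n r \<union> (\<lambda>(A, m). KC A m) ` Qset (r - 1) (n - 1) \<union> (\<lambda>(A, m). LC A m) ` Qset (r - 1) n :: 'd coord set)"
    by (simp add: finite_latQ finite_Qset)
  show "(\<lambda>_. 0) \<in> (lattice n r :: ('d coord \<Rightarrow> int) set)" by (simp add: lattice_eq_latG zero_latG)
next
  fix z w :: "'d coord \<Rightarrow> int" and t assume "z \<in> lattice n r" "w \<in> lattice n r"
  thus "(\<lambda>k. z k - t * w k) \<in> lattice n r"
    using latG_lin[of w n r z "-t"] by (simp add: lattice_eq_latG)
next
  fix z :: "'d coord \<Rightarrow> int" and k :: "'d coord"
  assume "z \<in> lattice n r" "k \<notin> latQ n r \<union> (\<lambda>(A, m). KC A m) ` Qset (r - 1) (n - 1) \<union> (\<lambda>(A, m). LC A m) ` Qset (r - 1) n"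
  thus "z k = 0" unfolding lattice_eq_latG latG_def latQ_def
    by (cases k) (auto simp: Qset_def Kpart_def ext0_def Lpart_def image_iff split: if_splits)
qed

section \<open>The complex of generic data\<close>

text \<open>Keeps \<open>n - 1\<close> from turning into \<open>n - Suc 0\<close>.\<close>
declare One_nat_def [simp del]

lemma KosX_nz: "KosX X w B m \<noteq> 0 \<Longrightarrow> \<exists>j. j \<notin> B \<and> w (insert j B) m \<noteq> 0"
  unfolding KosX_def ext_contract_def coef_mul_def by (rule ccontr, erule notE, rule sum.neutral) auto

lemma lin2_scale: assumes "lin2 F" shows "F (\<lambda>A m. c * w A m) B p = c * F w B p"
  using lin2_sum[OF assms, of "\<lambda>_. c" "\<lambda>_. w" "{()}"] by simp
lemma lin2_diff: assumes "lin2 F" shows "F (\<lambda>A m. w A m - v A m) B p = F w B p - F v B p"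
  using assms[unfolded lin2_def, rule_format, of "-1" v w] by simp
lemma lin2_zero: assumes "lin2 F" shows "F (\<lambda>_ _. 0) = (\<lambda>_ _. 0)"
  using lin2_sum[OF assms, of "\<lambda>_. 0" "\<lambda>_. (\<lambda>_ _. 0)" "{}"] by simp

lemma lin2_KosX: "lin2 (KosX X)"
  unfolding lin2_def KosX_def by (intro allI ext ext_contract_lin lin_op_coef_mul)

lemmas eta_lin = lin2_eta[unfolded lin2_def, rule_format] and kappa_lin = lin2_kappa[unfolded lin2_def, rule_format]
  and KosX_lin = lin2_KosX[unfolded lin2_def, rule_format]

lemmas kappa_scale = lin2_scale[OF lin2_kappa] and kappa_diff = lin2_diff[OF lin2_kappa]
lemmas eta_scale = lin2_scale[OF lin2_eta] and eta_diff = lin2_diff[OF lin2_eta]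
lemmas KosX_scale = lin2_scale[OF lin2_KosX] and KosX_diff = lin2_diff[OF lin2_KosX]

lemma ext0_KosX: assumes "ext0 (Suc a) b w" shows "ext0 a b (KosX X w)"
  unfolding ext0_def
proof (intro allI impI)
  fix A m assume "KosX X w A m \<noteq> 0"
  from KosX_nz[OF this] obtain j where j: "j \<notin> A" "w (insert j A) m \<noteq> 0" by blast
  with assms have "i1 \<notin> insert j A" "card (insert j A) = Suc a" "m \<in> monoms0 b"
    unfolding ext0_def by blast+
  thus "i1 \<notin> A \<and> card A = a \<and> m \<in> monoms0 b" using j by auto
qed

lemma ext0_lin: "ext0 a b w \<Longrightarrow> ext0 a b v \<Longrightarrow> ext0 a b (\<lambda>A m. c * w A m - e * v A m)"
  unfolding ext0_def by (metis diff_zero mult_zero_right)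

lemma KosX_intertwine: assumes "lin_op L" shows "KosX X (\<lambda>A. L (w A)) B p = L (KosX X w B) p"
  unfolding KosX_def by (rule ext_contract_intertwine[OF assms]) (simp add: coef_mul_def lin_op_scale[OF assms])

lemma lin_op_act: "lin_op (\<lambda>f. act j f \<nu>)"
  by (auto simp: lin_op_def act_def algebra_simps sum.distrib sum_distrib_left)

lemma lin_op_proj0: "lin_op proj0"
  by (auto simp: lin_op_def proj0_def)

section \<open>Contraction of functionals against \<kappa>, Kos and the projection\<close>

lemma act_mono_mul:
  fixes f \<nu> :: "'d::finite mono \<Rightarrow> 'r::comm_ring_1"
  shows "act (Suc b) (mono_mul i f) \<nu> m = act b f \<nu> (m + ei i)"
proof -
  have "act (Suc b) (mono_mul i f) \<nu> m = (\<Sum>N | N \<in> monoms (Suc b) \<and> i \<in> Poly_Mapping.keys N. f (N - ei i) * \<nu> (N + m))"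
    unfolding act_def by (rule sum.mono_neutral_cong_right) (auto simp: mono_mul_def in_keys_iff)
  also have "\<dots> = (\<Sum>N\<in>monoms b. f N * \<nu> (N + (m + ei i)))"
  proof (rule sum.reindex_bij_witness[of _ "\<lambda>N. N + ei i" "\<lambda>N. N - ei i"], goal_cases)
    case (2 N)
    then have "mdeg (N - ei i + ei i) = Suc b" by (simp add: diff_ei_add monoms_def)
    then show ?case by (simp add: mdeg_add monoms_def)
  next
    case (5 N) then show ?case using ei_shift_left[of i N m] by (simp add: add_ac)
  qed (auto simp: diff_ei_add monoms_def mdeg_add keys_add_ei)
  finally show ?thesis by (simp add: act_def)
qed

lemma act_shift: "act b f \<nu> (m + e) = act b f (\<lambda>m. \<nu> (m + e)) m"
  by (simp add: act_def add.assoc)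

text \<open>Multiplying by x_i before contracting a functional amounts to contracting by x_i
  afterwards. Through this identity the \<open>L\<close>-components of a boundary meet its
  \<open>K\<close>-components when b \<circ> b is computed.\<close>

lemma act_kappa: "act (Suc b) (kappa w B) \<nu> m = eta (\<lambda>A. act b (w A) \<nu>) B m"
  unfolding kappa_eq_ext_contract eta_eq_ext_contract
  by (rule ext_contract_intertwine[symmetric, OF lin_op_act]) (simp add: act_mono_mul mono_div_def)

lemma act_KosX: "act b (KosX X w B) \<nu> m = KosX X (\<lambda>A. act b (w A) \<nu>) B m"
  by (rule KosX_intertwine[symmetric, OF lin_op_act])

lemma proj0_KosX: "proj0 (KosX X w B) m = KosX X (\<lambda>A. proj0 (w A)) B m"
  by (rule KosX_intertwine[symmetric, OF lin_op_proj0])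

text \<open>The projection kills x_1 and commutes with multiplication by every other x_i; the
  assumption removes the term with i = \<open>i1\<close>.\<close>

lemma proj0_kappa: assumes "\<And>A m. i1 \<in> A \<Longrightarrow> w A m = 0"
  shows "proj0 (kappa w B) m = kappa (\<lambda>A. proj0 (w A)) B m"
  unfolding kappa_eq_ext_contract
proof (rule ext_contract_intertwine[symmetric, OF lin_op_proj0])
  fix i assume "i \<notin> B"
  show "mono_mul i (proj0 (w (insert i B))) m = proj0 (mono_mul i (w (insert i B))) m"
  proof (cases "i = i1")
    case True
    hence "w (insert i B) = (\<lambda>_. 0)" using assms by (intro ext) simp
    thus ?thesis by (simp add: mono_mul_def proj0_def)
  qed (auto simp: mono_mul_def proj0_def lookup_i1_diff)
qed

lemma proj0_split: "f m = proj0 f m + mono_mul i1 (mono_div i1 f) m"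
  by (auto simp: proj0_def mono_mul_def mono_div_def diff_ei_add in_keys_iff)

text \<open>\<open>Q\<close> is the matrix of \<open>q\<close>, \<open>dl\<close> is \<open>\<delta>\<close> and \<open>Ft\<close> is \<open>\<Phi>~\<close>. The last two assumptions say that \<open>Q\<close> is \<open>\<delta>\<close> times a two-sided inverse
  of \<open>p\<close>, because \<open>Ft (M + N + ei i1)\<close> is the value of \<open>\<Phi>\<close> at \<open>M + N\<close>.\<close>
locale generic_data =
  fixes n :: nat and X :: "'d::{finite,linorder} \<Rightarrow> 'r::comm_ring_1" and Q :: "'d mono \<Rightarrow> 'd mono \<Rightarrow> 'r"
    and dl :: 'r and Ft :: "'d mono \<Rightarrow> 'r"
  assumes n2: "n \<ge> 2"
    and Ft: "Ft m \<noteq> 0 \<Longrightarrow> m \<in> monoms (2 * n - 1)"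
    and pq: "N \<in> monoms (n - 1) \<Longrightarrow> N' \<in> monoms (n - 1) \<Longrightarrow>
       (\<Sum>M\<in>monoms (n - 1). Q M N' * Ft (M + N + ei i1)) = (if N = N' then dl else 0)"
    and qp: "N \<in> monoms (n - 1) \<Longrightarrow> N' \<in> monoms (n - 1) \<Longrightarrow>
       (\<Sum>M\<in>monoms (n - 1). Q N M * Ft (M + N' + ei i1)) = (if N = N' then dl else 0)"
begin

text \<open>The functional \<Phi> itself, recovered from \<Phi>~ as its contraction by x_1.\<close>

definition F1 where "F1 m = Ft (m + ei i1)"

definition q_fun where "q_fun \<nu> M = (if M \<in> monoms (n - 1) then \<Sum>N\<in>monoms (n - 1). Q M N * \<nu> N else 0)"

definition Xp where "Xp m = (\<Prod>i\<in>UNIV. X i ^ Poly_Mapping.lookup m i)"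

definition val where "val j \<mu> = (\<Sum>m\<in>monoms j. \<mu> m * Xp m)"

definition Dz where "Dz z A m = Kpart z A m - act n (Lpart z A) Ft m"

definition Uz where "Uz z A = q_fun (Dz z A)"

definition bmid where "bmid z = of_KL
    (\<lambda>B m. dl * KosX X (Kpart z) B m - X i1 * eta (\<lambda>A. act (n - 1) (Uz z A) Ft) B m)
    (\<lambda>B m. dl * KosX X (Lpart z) B m - X i1 * kappa (\<lambda>A. proj0 (Uz z A)) B m)"

definition bfirst where "bfirst z (k :: 'd coord) = (if k = One then dl * val n (Lpart z {}) + X i1 * val (n - 1) (Uz z {}) else 0)"

text \<open>\<open>q_dual M\<close> is the value of \<open>q(M\<^sup>*)\<close>, and \<open>L_gen m\<close> is \<open>b\<^sub>1(m)\<close> for a monomial \<open>m\<close> in the \<open>L\<close>-summand.\<close>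
definition q_dual where "q_dual M = (if M \<in> monoms (n - 1) then \<Sum>N\<in>monoms (n - 1). Q N M * Xp N else 0)"

definition L_gen where "L_gen m = (if m \<in> monoms0 n then dl * Xp m - X i1 * act (n - 1) q_dual Ft m else 0)"

definition btop where "btop z = of_KL (eta (\<lambda>A m. z (WC A) * L_gen m))
    (\<lambda>B m. - X i1 * kappa (\<lambda>A m. z (WC A) * proj0 q_dual m) B m)"

definition bd where "bd r z = (if r = 1 then bfirst z else if 2 \<le> r \<and> r < CARD('d) then bmid z
    else if r = CARD('d) then btop z else (\<lambda>_. 0))"

lemma n_simps: "Suc (n - 1) = n" "Suc (n - 2) = n - 1" "n - 1 - 1 = n - 2" using n2 by simp_all

lemma lin_op_q_fun: "lin_op q_fun"
  by (simp add: lin_op_def q_fun_def fun_eq_iff distrib_left sum.distrib sum_distrib_left mult_ac)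

lemma q_fun_cong: "(\<And>N. N \<in> monoms (n - 1) \<Longrightarrow> f N = g N) \<Longrightarrow> q_fun f = q_fun g"
  by (intro ext) (simp add: q_fun_def)

lemma act_q_fun: assumes "m \<in> monoms (n - 1)" shows "act (n - 1) (q_fun \<nu>) F1 m = dl * \<nu> m"
proof -
  have "act (n - 1) (q_fun \<nu>) F1 m = (\<Sum>M\<in>monoms (n - 1). \<Sum>N\<in>monoms (n - 1). \<nu> N * (Q M N * Ft (M + m + ei i1)))"
    unfolding act_def q_fun_def F1_def by (rule sum.cong) (auto simp: sum_distrib_right sum_distrib_left mult_ac)
  also have "\<dots> = (\<Sum>N\<in>monoms (n - 1). \<nu> N * (if m = N then dl else 0))"
    by (subst sum.swap) (simp add: sum_distrib_left[symmetric] pq[OF assms])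
  also have "\<dots> = dl * \<nu> m" using assms by (simp add: if_distrib[of "\<lambda>x. _ * x"] mult.commute cong: if_cong)
  finally show ?thesis .
qed

lemma q_fun_act: assumes "M \<in> monoms (n - 1)" shows "q_fun (act (n - 1) \<mu> F1) M = dl * \<mu> M"
proof -
  have "q_fun (act (n - 1) \<mu> F1) M = (\<Sum>N\<in>monoms (n - 1). \<Sum>K\<in>monoms (n - 1). \<mu> K * (Q M N * Ft (N + K + ei i1)))"
    using assms unfolding act_def q_fun_def F1_def by (simp add: sum_distrib_left mult_ac add_ac)
  also have "\<dots> = (\<Sum>K\<in>monoms (n - 1). \<mu> K * (if M = K then dl else 0))"
    by (subst sum.swap) (simp add: sum_distrib_left[symmetric] qp[OF assms])
  also have "\<dots> = dl * \<mu> M" using assms by (simp add: if_distrib[of "\<lambda>x. _ * x"] mult.commute cong: if_cong)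
  finally show ?thesis .
qed

lemma Xp_add_ei: "Xp (m + ei i) = X i * Xp m"
proof -
  have "Xp (m + ei i) = (\<Prod>j\<in>UNIV. X j ^ Poly_Mapping.lookup m j * (if j = i then X i else 1))"
    unfolding Xp_def by (rule prod.cong) (auto simp: lookup_add lookup_ei power_add)
  thus ?thesis by (simp add: prod.distrib Xp_def mult.commute)
qed

text \<open>In \<open>q_dual\<close> it is the column index of Q that gets paired with \<Phi>, so
  \<open>qp\<close> is the inverse law that applies. As coefficients of an element of degree n - 1,
  the \<open>q_dual\<close> contract \<Phi> to \<delta> times the evaluation of monomials.\<close>

lemma act_q_dual: assumes "m \<in> monoms (n - 1)" shows "act (n - 1) q_dual F1 m = dl * Xp m"
proof -
  have "act (n - 1) q_dual F1 m = (\<Sum>M\<in>monoms (n - 1). \<Sum>N\<in>monoms (n - 1). Xp N * (Q N M * Ft (M + m + ei i1)))"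
    unfolding act_def q_dual_def F1_def by (rule sum.cong) (auto simp: sum_distrib_right sum_distrib_left mult_ac)
  also have "\<dots> = (\<Sum>N\<in>monoms (n - 1). Xp N * (if N = m then dl else 0))"
    by (subst sum.swap) (simp add: sum_distrib_left[symmetric] qp assms)
  also have "\<dots> = dl * Xp m" using assms by (simp add: if_distrib[of "\<lambda>x. _ * x"] mult.commute cong: if_cong)
  finally show ?thesis .
qed

lemma val_mono_mul: "val (Suc j) (mono_mul i f) = X i * val j f"
proof -
  have "val (Suc j) (mono_mul i f) = (\<Sum>N | N \<in> monoms (Suc j) \<and> i \<in> Poly_Mapping.keys N. f (N - ei i) * Xp N)"
    unfolding val_def by (rule sum.mono_neutral_cong_right) (auto simp: mono_mul_def in_keys_iff)
  also have "\<dots> = (\<Sum>N\<in>monoms j. f N * Xp (N + ei i))"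
  proof (rule sum.reindex_bij_witness[of _ "\<lambda>N. N + ei i" "\<lambda>N. N - ei i"], goal_cases)
    case (2 N)
    then have "mdeg (N - ei i + ei i) = Suc j" by (simp add: diff_ei_add monoms_def)
    then show ?case by (simp add: mdeg_add monoms_def)
  qed (auto simp: diff_ei_add monoms_def mdeg_add keys_add_ei)
  finally show ?thesis by (simp add: Xp_add_ei val_def sum_distrib_left mult_ac)
qed

lemma lin_op_val: "lin_op (\<lambda>f _. val j f)"
  by (auto simp: lin_op_def val_def algebra_simps sum.distrib sum_distrib_left)

lemmas val_scale = lin_op_scale[OF lin_op_val] and val_diff = lin_op_diff[OF lin_op_val] and val_add = lin_op_add[OF lin_op_val]

text \<open>The value of x_j m is \<open>X j\<close> times the value of m, so evaluation turns
  \<kappa> into Kos.\<close>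

lemma val_kappa: "val (Suc j) (kappa w B) = val j (KosX X w B)"
proof -
  have "ext_contract (coef_mul X) (\<lambda>A _. val j (w A)) B p = val (Suc j) (ext_contract mono_mul w B)" for p :: unit
    by (rule ext_contract_intertwine[OF lin_op_val]) (simp add: coef_mul_def val_mono_mul)
  moreover have "ext_contract (coef_mul X) (\<lambda>A _. val j (w A)) B p = val j (ext_contract (coef_mul X) w B)" for p :: unit
    by (rule ext_contract_intertwine[OF lin_op_val]) (simp add: coef_mul_def val_scale)
  ultimately show ?thesis by (simp add: kappa_eq_ext_contract KosX_def)
qed

lemmas act_kappa_n = act_kappa[of "n - 1", unfolded n_simps] act_kappa[of "n - 2", unfolded n_simps]
lemmas val_kappa_n = val_kappa[of "n - 1", unfolded n_simps] val_kappa[of "n - 2", unfolded n_simps]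
lemmas act_mono_mul_n = act_mono_mul[of "n - 2", unfolded n_simps]
lemmas val_mono_mul_n = val_mono_mul[of "n - 2", unfolded n_simps]

lemma Ft_deg: "N \<in> monoms (n - 1) \<Longrightarrow> Ft (N + m) \<noteq> 0 \<Longrightarrow> m \<in> monoms n"
  using Ft[of "N + m"] n2 by (auto simp: monoms_def mdeg_add)

lemma act_deg: assumes "act (n - 1) f Ft m \<noteq> 0" shows "m \<in> monoms n"
proof -
  obtain N where "N \<in> monoms (n - 1)" "f N * Ft (N + m) \<noteq> 0"
    using assms unfolding act_def by (auto elim: sum.not_neutral_contains_not_neutral)
  moreover from this have "Ft (N + m) \<noteq> 0" by auto
  ultimately show ?thesis using Ft_deg by blast
qed

lemma Uz_zero: "(\<And>m. Dz z A m = 0) \<Longrightarrow> Uz z A M = 0"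
  by (simp add: Uz_def q_fun_def)

lemma Uz_outside: "M \<notin> monoms (n - 1) \<Longrightarrow> Uz z A M = 0"
  by (simp add: Uz_def q_fun_def)

section \<open>The first and the middle differentials\<close>

context
  fixes z :: "'d coord \<Rightarrow> 'r" and a :: nat
  assumes K: "ext0 (Suc a) (n - 1) (Kpart z)" and eK: "eta (Kpart z) = (\<lambda>_ _. 0)"
    and L: "ext0 (Suc a) n (Lpart z)" and kL: "kappa (Lpart z) = (\<lambda>_ _. 0)"
begin

lemma Uz_ext: "Uz z A M \<noteq> 0 \<Longrightarrow> i1 \<notin> A \<and> card A = Suc a \<and> M \<in> monoms (n - 1)"
proof -
  assume nz: "Uz z A M \<noteq> 0"
  have "i1 \<notin> A \<and> card A = Suc a"
  proof (rule ccontr)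
    assume *: "\<not> (i1 \<notin> A \<and> card A = Suc a)"
    have "Dz z A m = 0" for m
      using ext0_D[OF K, of A] ext0_D[OF L, of A] * by (auto simp: Dz_def act_def)
    thus False using Uz_zero nz by blast
  qed
  thus ?thesis using nz Uz_outside by blast
qed

text \<open>The functional u(\<Phi>~) involves x_1, but its \<eta>-image does not: contracting
  further by x_1 gives u(\<Phi>) = \<delta> (k - v(\<Phi>~)), and \<eta> kills this because \<eta> k
  = 0 and \<kappa> v = 0.\<close>

lemma ext0_eta_act_U: "ext0 a (n - 1) (eta (\<lambda>A. act (n - 1) (Uz z A) Ft))"
  unfolding ext0_def
proof (intro allI impI)
  fix B m assume nz: "eta (\<lambda>A. act (n - 1) (Uz z A) Ft) B m \<noteq> 0"
  then obtain j where j: "j \<notin> B" "act (n - 1) (Uz z (insert j B)) Ft (m + ei j) \<noteq> 0"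
    using eta_nz[of _ B m] by blast
  then obtain N where "Uz z (insert j B) N \<noteq> 0"
    unfolding act_def by (metis (no_types, lifting) mult_zero_left sum.neutral)
  hence 1: "i1 \<notin> insert j B" "card (insert j B) = Suc a" using Uz_ext by blast+
  have m: "mdeg m = n - 1" using act_deg[OF j(2)] by (simp add: monoms_def mdeg_add)
  have "Poly_Mapping.lookup m i1 = 0"
  proof (rule ccontr)
    assume "Poly_Mapping.lookup m i1 \<noteq> 0"
    then obtain m' where m': "m = m' + ei i1" using diff_ei_add[of i1 m] by (metis in_keys_iff)
    have d: "m' + ei j \<in> monoms (n - 1)" for j using m by (simp add: m' monoms_def mdeg_add)
    have "eta (\<lambda>A. act (n - 1) (Uz z A) Ft) B m = (\<Sum>j\<in>-B. ext_sign j B * act (n - 1) (Uz z (insert j B)) F1 (m' + ei j))"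
      unfolding eta_sum F1_def act_shift[symmetric] by (simp add: m' add_ac)
    also have "\<dots> = (\<Sum>j\<in>-B. ext_sign j B * (dl * Dz z (insert j B) (m' + ei j)))"
      unfolding Uz_def by (simp add: act_q_fun[OF d])
    also have "\<dots> = dl * eta (Dz z) B m'" by (simp add: eta_sum sum_distrib_left mult_ac)
    also have "eta (Dz z) B m' = eta (Kpart z) B m' - act (Suc n) (kappa (Lpart z) B) Ft m'"
      unfolding Dz_def[abs_def] by (simp add: eta_diff act_kappa)
    also have "\<dots> = 0" by (simp add: eK kL act_def)
    finally show False using nz by simp
  qed
  thus "i1 \<notin> B \<and> card B = a \<and> m \<in> monoms0 (n - 1)" using 1 j m by (auto simp: monoms0_def monoms_def)
qed

lemma ext0_proj_U: "ext0 (Suc a) (n - 1) (\<lambda>A. proj0 (Uz z A))"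
  unfolding ext0_def using Uz_ext by (auto simp: proj0_def monoms0_def split: if_splits)

lemma bmid_closed:
  shows "ext0 a (n - 1) (Kpart (bmid z))" "eta (Kpart (bmid z)) = (\<lambda>_ _. 0)"
    "ext0 a n (Lpart (bmid z))" "kappa (Lpart (bmid z)) = (\<lambda>_ _. 0)"
proof -
  have n': "Suc (n - 1) = n" using n2 by simp
  show "ext0 a (n - 1) (Kpart (bmid z))"
    unfolding bmid_def of_KL_simps by (intro ext0_lin ext0_KosX K ext0_eta_act_U)
  show "ext0 a n (Lpart (bmid z))"
    unfolding bmid_def of_KL_simps
    by (intro ext0_lin ext0_KosX L) (use ext0_kappa[OF ext0_proj_U] n' in simp)
  show "eta (Kpart (bmid z)) = (\<lambda>_ _. 0)"
    unfolding bmid_def of_KL_simps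
    by (intro ext) (simp add: eta_diff eta_scale eta_eta eta_KosX eK lin2_zero[OF lin2_KosX])
  show "kappa (Lpart (bmid z)) = (\<lambda>_ _. 0)"
    unfolding bmid_def of_KL_simps
    by (intro ext) (simp add: kappa_diff kappa_scale kappa_kappa kappa_KosX kL lin2_zero[OF lin2_KosX])
qed

text \<open>Write u = proj u + x_1 u_1. The terms of the two components that carry x_1 combine to
  \<eta>(u(\<Phi>~)) - \<eta>((proj u)(\<Phi>~)) = \<kappa>(u_1)(\<Phi>), and q returns \<delta>
  \<kappa>(u_1) from this. Thus the passage from u to the next u is explicit, which makes b \<circ>
  b computable.\<close>

lemma Uz_bmid: "Uz (bmid z) B M = dl * (KosX X (Uz z) B M - X i1 * kappa (\<lambda>A. mono_div i1 (Uz z A)) B M)"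
proof (cases "M \<in> monoms (n - 1)")
  case False
  have "KosX X (Uz z) B M = 0" using Uz_outside[OF False] by (simp add: KosX_def ext_contract_def coef_mul_def)
  moreover have "kappa (\<lambda>A. mono_div i1 (Uz z A)) B M = 0"
  proof (rule ccontr)
    assume "kappa (\<lambda>A. mono_div i1 (Uz z A)) B M \<noteq> 0"
    then obtain j where j: "j \<in> Poly_Mapping.keys M" "mono_div i1 (Uz z (insert j B)) (M - ei j) \<noteq> 0"
      using kappa_nz[of _ B M] by blast
    hence "M - ei j + ei i1 \<in> monoms (n - 1)" using Uz_outside unfolding mono_div_def by blast
    moreover have "mdeg (M - ei j + ei j) = mdeg (M - ei j + ei i1)" by (simp add: mdeg_add)
    ultimately show False using False j by (simp add: diff_ei_add monoms_def)
  qed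
  ultimately show ?thesis using Uz_outside[OF False] by simp
next
  case True
  define u1 where "u1 = (\<lambda>A. mono_div i1 (Uz z A))"
  have split: "act (n - 1) (Uz z A) Ft m - act (n - 1) (proj0 (Uz z A)) Ft m = act (n - 2) (u1 A) F1 m" for A m
  proof -
    have "act (n - 1) (Uz z A) Ft m - act (n - 1) (proj0 (Uz z A)) Ft m = act (n - 1) (\<lambda>m. Uz z A m - proj0 (Uz z A) m) Ft m"
      by (rule lin_op_diff[symmetric, OF lin_op_act])
    also have "(\<lambda>m. Uz z A m - proj0 (Uz z A) m) = mono_mul i1 (u1 A)"
      by (intro ext) (subst proj0_split[of "Uz z A"], simp add: u1_def)
    also have "act (n - 1) (mono_mul i1 (u1 A)) Ft m = act (n - 2) (u1 A) F1 m"
      unfolding act_mono_mul_n act_shift F1_def ..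
    finally show ?thesis .
  qed
  have D: "Dz (bmid z) B m = dl * KosX X (Dz z) B m - X i1 * act (n - 1) (kappa u1 B) F1 m" for m
  proof -
    have "Dz (bmid z) B m = dl * KosX X (Kpart z) B m - X i1 * eta (\<lambda>A. act (n - 1) (Uz z A) Ft) B m
       - (dl * act n (KosX X (Lpart z) B) Ft m - X i1 * act n (kappa (\<lambda>A. proj0 (Uz z A)) B) Ft m)"
      unfolding Dz_def bmid_def of_KL_simps lin_op_diff[OF lin_op_act] lin_op_scale[OF lin_op_act] ..
    also have "act n (KosX X (Lpart z) B) Ft m = KosX X (\<lambda>A. act n (Lpart z A) Ft) B m" by (rule act_KosX)
    also have "act n (kappa (\<lambda>A. proj0 (Uz z A)) B) Ft m = eta (\<lambda>A. act (n - 1) (proj0 (Uz z A)) Ft) B m"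
      by (simp add: act_kappa_n)
    finally have "Dz (bmid z) B m = dl * (KosX X (Kpart z) B m - KosX X (\<lambda>A. act n (Lpart z A) Ft) B m)
       - X i1 * (eta (\<lambda>A. act (n - 1) (Uz z A) Ft) B m - eta (\<lambda>A. act (n - 1) (proj0 (Uz z A)) Ft) B m)"
      by (simp add: algebra_simps)
    also have "KosX X (Kpart z) B m - KosX X (\<lambda>A. act n (Lpart z A) Ft) B m = KosX X (Dz z) B m"
      unfolding Dz_def[abs_def] KosX_diff ..
    also have "eta (\<lambda>A. act (n - 1) (Uz z A) Ft) B m - eta (\<lambda>A. act (n - 1) (proj0 (Uz z A)) Ft) B m = act (n - 1) (kappa u1 B) F1 m"
      unfolding eta_diff[symmetric] by (simp add: split act_kappa_n)
    finally show ?thesis .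
  qed
  have "Uz (bmid z) B M = q_fun (\<lambda>m. dl * KosX X (Dz z) B m - X i1 * act (n - 1) (kappa u1 B) F1 m) M"
    unfolding Uz_def D[abs_def] ..
  also have "\<dots> = dl * q_fun (KosX X (Dz z) B) M - X i1 * q_fun (act (n - 1) (kappa u1 B) F1) M"
    unfolding lin_op_diff[OF lin_op_q_fun] lin_op_scale[OF lin_op_q_fun] ..
  also have "q_fun (KosX X (Dz z) B) M = KosX X (Uz z) B M"
    unfolding Uz_def[abs_def] by (rule KosX_intertwine[symmetric, OF lin_op_q_fun])
  also have "q_fun (act (n - 1) (kappa u1 B) F1) M = dl * kappa u1 B M" by (rule q_fun_act[OF True])
  finally show ?thesis unfolding u1_def by (simp add: algebra_simps)
qed

lemma mono_div_Uz_0: "i1 \<in> A \<Longrightarrow> mono_div i1 (Uz z A) m = 0"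
  unfolding mono_div_def using Uz_ext by blast

text \<open>Inserting the formula for the next u leaves only squares and anticommutators of Kos,
  \<kappa> and \<eta>.\<close>

lemma bmid_bmid: "bmid (bmid z) = (\<lambda>_. 0)"
proof -
  define u1 where "u1 = (\<lambda>A. mono_div i1 (Uz z A))"
  have U: "Uz (bmid z) A = (\<lambda>M. dl * (KosX X (Uz z) A M - X i1 * kappa u1 A M))" for A
    unfolding u1_def by (intro ext) (rule Uz_bmid)
  have a: "act (n - 1) (Uz (bmid z) A) Ft m = dl * (KosX X (\<lambda>A. act (n - 1) (Uz z A) Ft) A m - X i1 * eta (\<lambda>A. act (n - 2) (u1 A) Ft) A m)" for A m
    unfolding U lin_op_scale[OF lin_op_act] lin_op_diff[OF lin_op_act] act_KosX by (simp add: act_kappa_n)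
  have K: "Kpart (bmid (bmid z)) B m = 0" for B m
    unfolding bmid_def[of "bmid z"] of_KL_simps a
    unfolding bmid_def of_KL_simps
    by (simp add: eta_scale eta_diff KosX_scale KosX_diff KosX_KosX eta_eta eta_KosX)
  have p: "proj0 (Uz (bmid z) A) m = dl * (KosX X (\<lambda>A. proj0 (Uz z A)) A m - X i1 * kappa (\<lambda>A. proj0 (u1 A)) A m)" for A m
  proof -
    have "proj0 (kappa u1 A) m = kappa (\<lambda>A. proj0 (u1 A)) A m"
      by (rule proj0_kappa) (simp add: u1_def mono_div_Uz_0)
    thus ?thesis unfolding U lin_op_scale[OF lin_op_proj0] lin_op_diff[OF lin_op_proj0] proj0_KosX by simp
  qed
  have L: "Lpart (bmid (bmid z)) B m = 0" for B m
    unfolding bmid_def[of "bmid z"] of_KL_simps p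
    unfolding bmid_def of_KL_simps
    by (simp add: kappa_scale kappa_diff KosX_scale KosX_diff KosX_KosX kappa_kappa kappa_KosX)
  have "bmid (bmid z) = of_KL (Kpart (bmid (bmid z))) (Lpart (bmid (bmid z)))"
    by (rule of_KL_eqI) (simp_all add: bmid_def)
  also have "\<dots> = (\<lambda>_. 0)" unfolding K[abs_def] L[abs_def] by (intro ext) (simp add: of_KL_def split: coord.split)
  finally show ?thesis .
qed

text \<open>Since evaluation turns \<kappa> into Kos, the terms in proj u and the terms in u_1 of
  the decomposition u = proj u + x_1 u_1 cancel separately.\<close>

lemma bfirst_bmid: "bfirst (bmid z) = (\<lambda>_. 0)"
proof -
  define u1 where "u1 = (\<lambda>A. mono_div i1 (Uz z A))"
  have U: "Uz (bmid z) {} = (\<lambda>M. dl * (KosX X (Uz z) {} M - X i1 * kappa u1 {} M))"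
    unfolding u1_def by (intro ext) (rule Uz_bmid)
  have 1: "val (n - 1) (Uz (bmid z) {}) = dl * (val (n - 1) (KosX X (Uz z) {}) - X i1 * val (n - 2) (KosX X u1 {}))"
    unfolding U val_scale val_diff by (simp add: val_kappa_n)
  have 2: "val n (Lpart (bmid z) {}) = dl * val (Suc n) (kappa (Lpart z) {}) - X i1 * val (n - 1) (KosX X (\<lambda>A. proj0 (Uz z A)) {})"
    unfolding bmid_def of_KL_simps val_scale val_diff by (simp add: val_kappa_n val_kappa[of n])
  have "KosX X (Uz z) {} = (\<lambda>m. KosX X (\<lambda>A. proj0 (Uz z A)) {} m + KosX X (\<lambda>A. mono_mul i1 (u1 A)) {} m)"
  proof
    fix m
    have "Uz z = (\<lambda>A m. 1 * proj0 (Uz z A) m + mono_mul i1 (u1 A) m)"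
      unfolding u1_def by (intro ext) (simp add: proj0_split[symmetric])
    hence "KosX X (Uz z) {} m = KosX X (\<lambda>A m. 1 * proj0 (Uz z A) m + mono_mul i1 (u1 A) m) {} m" by (rule arg_cong)
    also have "\<dots> = 1 * KosX X (\<lambda>A. proj0 (Uz z A)) {} m + KosX X (\<lambda>A. mono_mul i1 (u1 A)) {} m"
      by (simp only: KosX_lin)
    finally show "KosX X (Uz z) {} m = KosX X (\<lambda>A. proj0 (Uz z A)) {} m + KosX X (\<lambda>A. mono_mul i1 (u1 A)) {} m" by simp
  qed
  hence "val (n - 1) (KosX X (Uz z) {}) = val (n - 1) (KosX X (\<lambda>A. proj0 (Uz z A)) {}) + val (n - 1) (KosX X (\<lambda>A. mono_mul i1 (u1 A)) {})"
    by (simp add: val_add)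
  also have "KosX X (\<lambda>A. mono_mul i1 (u1 A)) {} = mono_mul i1 (KosX X u1 {})"
    by (intro ext) (rule KosX_intertwine[OF lin_op_mono_mul])
  finally have 3: "val (n - 1) (KosX X (Uz z) {}) = val (n - 1) (KosX X (\<lambda>A. proj0 (Uz z A)) {}) + X i1 * val (n - 2) (KosX X u1 {})"
    by (simp add: val_mono_mul_n)
  have "val (Suc n) (kappa (Lpart z) {}) = 0" by (simp add: kL val_def)
  thus ?thesis unfolding bfirst_def 1 2 3 by (intro ext) (simp add: algebra_simps)
qed

end

lemma ext0_scale: assumes "\<And>A. z (WC A) \<noteq> 0 \<Longrightarrow> i1 \<notin> A \<and> card A = a" "\<And>m. f m \<noteq> 0 \<Longrightarrow> m \<in> monoms0 b"
  shows "ext0 a b (\<lambda>A m. z (WC A) * f m)"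
  unfolding ext0_def using assms by (metis mult_not_zero)

section \<open>The last differential\<close>

context
  fixes z :: "'d coord \<Rightarrow> 'r" and a :: nat
  assumes W: "\<And>A. z (WC A) \<noteq> 0 \<Longrightarrow> i1 \<notin> A \<and> card A = Suc a"
begin

lemma btop_closed:
  shows "ext0 a (n - 1) (Kpart (btop z))" "eta (Kpart (btop z)) = (\<lambda>_ _. 0)"
    "ext0 a n (Lpart (btop z))" "kappa (Lpart (btop z)) = (\<lambda>_ _. 0)"
proof -
  have n': "Suc (n - 1) = n" using n2 by simp
  have "ext0 (Suc a) (Suc (n - 1)) (\<lambda>A m. z (WC A) * L_gen m)"
    by (rule ext0_scale[OF W]) (auto simp: L_gen_def n' split: if_splits)
  from ext0_eta[OF this] show "ext0 a (n - 1) (Kpart (btop z))" by (simp add: btop_def)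
  show "eta (Kpart (btop z)) = (\<lambda>_ _. 0)" by (simp add: btop_def eta_eta)
  have "ext0 (Suc a) (n - 1) (\<lambda>A m. z (WC A) * proj0 q_dual m)"
    by (rule ext0_scale[OF W]) (auto simp: proj0_def q_dual_def monoms0_def split: if_splits)
  from ext0_lin[OF ext0_zero ext0_kappa[OF this], of 0 "X i1"] show "ext0 a n (Lpart (btop z))" by (simp add: btop_def n')
  show "kappa (Lpart (btop z)) = (\<lambda>_ _. 0)"
    unfolding btop_def of_KL_simps kappa_scale[abs_def] by (simp add: kappa_kappa)
qed

text \<open>At monomials divisible by x_1 \<open>L_gen\<close> is zero by definition, and the
  right-hand side agrees: for m = m' x_1 the contraction becomes one of \<Phi>, and
  \<open>act_q_dual\<close> evaluates it to \<delta> times the value of m' x_j.\<close>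

lemma L_gen_eq:
  assumes "m \<in> monoms (n - 1)" "j \<noteq> i1"
  shows "L_gen (m + ei j) = dl * (X j * Xp m) - X i1 * act (n - 1) q_dual Ft (m + ei j)"
proof (cases "Poly_Mapping.lookup m i1 = 0")
  case True
  hence "m + ei j \<in> monoms0 n" using assms n2
    by (auto simp: monoms0_def monoms_def mdeg_add lookup_add lookup_ei)
  thus ?thesis by (simp add: L_gen_def Xp_add_ei)
next
  case False
  then obtain m' where m': "m = m' + ei i1" using diff_ei_add[of i1 m] by (metis in_keys_iff)
  have "L_gen (m + ei j) = 0" using False by (simp add: L_gen_def monoms0_def lookup_add)
  moreover have "act (n - 1) q_dual Ft (m + ei j) = act (n - 1) q_dual F1 (m' + ei j)"
    unfolding F1_def act_shift[symmetric] by (simp add: m' add_ac)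
  moreover have "\<dots> = dl * (X j * Xp m')"
    using assms by (subst act_q_dual) (auto simp: Xp_add_ei m' monoms_def mdeg_add)
  ultimately show ?thesis by (simp add: m' Xp_add_ei mult_ac)
qed

lemma eta_L_gen:
  assumes m: "m \<in> monoms (n - 1)"
  shows "eta (\<lambda>A m. z (WC A) * L_gen m) B m = dl * KosX X (\<lambda>A m. z (WC A) * Xp m) B m
     - X i1 * eta (\<lambda>A m. z (WC A) * act (n - 1) q_dual Ft m) B m"
proof -
  have "eta (\<lambda>A m. z (WC A) * L_gen m) B m = (\<Sum>j\<in>-B. dl * (ext_sign j B * (X j * (z (WC (insert j B)) * Xp m)))
     - X i1 * (ext_sign j B * (z (WC (insert j B)) * act (n - 1) q_dual Ft (m + ei j))))"
    unfolding eta_sum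
  proof (rule sum.cong[OF refl])
    fix j
    show "ext_sign j B * (z (WC (insert j B)) * L_gen (m + ei j)) = dl * (ext_sign j B * (X j * (z (WC (insert j B)) * Xp m)))
     - X i1 * (ext_sign j B * (z (WC (insert j B)) * act (n - 1) q_dual Ft (m + ei j)))"
    proof (cases "j = i1")
      case True
      hence "z (WC (insert j B)) = 0" using W by blast
      thus ?thesis by simp
    next
      case False
      show ?thesis unfolding L_gen_eq[OF m False] by (simp add: algebra_simps)
    qed
  qed
  thus ?thesis by (simp add: sum_subtractf sum_distrib_left[symmetric] KosX_def ext_contract_def coef_mul_def eta_sum)
qed

text \<open>The element y contracts \<Phi> to \<open>Dz (btop z)\<close> in degree n - 1, so q
  yields u = \<delta> y without any division. Here \<open>T1\<close> is the quotient by x_1 of the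
  part of \<open>q_dual\<close> that is divisible by x_1.\<close>

lemma bmid_btop: "bmid (btop z) = (\<lambda>_. 0)"
proof -
  define T1 where "T1 = mono_div i1 q_dual"
  define y where "y A M = KosX X (\<lambda>A m. z (WC A) * q_dual m) A M - X i1 * kappa (\<lambda>A m. z (WC A) * T1 m) A M" for A M
  define WT where "WT = act (n - 1) q_dual Ft"
  define PT where "PT = act (n - 1) (proj0 q_dual) Ft"
  have actc: "act j (\<lambda>m. r * f m) \<nu> m = r * act j f \<nu> m" for j r f \<nu> m by (rule lin_op_scale[OF lin_op_act])
  have actc': "act j (\<lambda>m. r * f m) \<nu> = (\<lambda>m. r * act j f \<nu> m)" for j r f \<nu> by (intro ext) (rule actc)
  have sp: "act (n - 2) T1 F1 m = WT m - PT m" for m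
  proof -
    have "WT m - PT m = act (n - 1) (\<lambda>m. q_dual m - proj0 q_dual m) Ft m"
      unfolding WT_def PT_def by (simp add: lin_op_diff[OF lin_op_act])
    also have "(\<lambda>m. q_dual m - proj0 q_dual m) = mono_mul i1 T1"
      by (intro ext) (subst proj0_split[of q_dual], simp add: T1_def)
    also have "act (n - 1) (mono_mul i1 T1) Ft m = act (n - 2) T1 F1 m" unfolding act_mono_mul_n act_shift F1_def ..
    finally show ?thesis by simp
  qed
  have yF: "act (n - 1) (y B) \<nu> m = KosX X (\<lambda>A m. z (WC A) * act (n - 1) q_dual \<nu> m) B m
      - X i1 * eta (\<lambda>A m. z (WC A) * act (n - 2) T1 \<nu> m) B m" for B \<nu> m
    unfolding y_def[abs_def] lin_op_scale[OF lin_op_act] lin_op_diff[OF lin_op_act] act_KosX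
    by (simp add: act_kappa_n actc')
  have D: "Dz (btop z) B m = act (n - 1) (y B) F1 m" if m: "m \<in> monoms (n - 1)" for B m
  proof -
    have "Dz (btop z) B m = eta (\<lambda>A m. z (WC A) * L_gen m) B m - (- X i1 * eta (\<lambda>A m. z (WC A) * PT m) B m)"
      unfolding Dz_def btop_def of_KL_simps actc PT_def by (simp add: act_kappa_n actc')
    also have "\<dots> = dl * KosX X (\<lambda>A m. z (WC A) * Xp m) B m
     - X i1 * (eta (\<lambda>A m. z (WC A) * WT m) B m - eta (\<lambda>A m. z (WC A) * PT m) B m)"
      unfolding eta_L_gen[OF m] WT_def by (simp add: algebra_simps)
    also have "eta (\<lambda>A m. z (WC A) * WT m) B m - eta (\<lambda>A m. z (WC A) * PT m) B m = eta (\<lambda>A m. z (WC A) * act (n - 2) T1 F1 m) B m"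
      unfolding eta_diff[symmetric] sp by (simp add: algebra_simps)
    also have "dl * KosX X (\<lambda>A m. z (WC A) * Xp m) B m = KosX X (\<lambda>A m. z (WC A) * act (n - 1) q_dual F1 m) B m"
      unfolding KosX_scale[symmetric] by (simp add: KosX_def ext_contract_def coef_mul_def act_q_dual[OF m] mult_ac)
    finally show ?thesis unfolding yF .
  qed
  have U: "Uz (btop z) B = (\<lambda>M. dl * y B M)" for B
  proof
    fix M
    have "Uz (btop z) B M = q_fun (act (n - 1) (y B) F1) M" unfolding Uz_def by (subst q_fun_cong[OF D]) auto
    also have "\<dots> = dl * y B M"
    proof (cases "M \<in> monoms (n - 1)")
      case True thus ?thesis by (rule q_fun_act)
    next
      case False
      have "q_dual M = 0" using False by (simp add: q_dual_def)
      moreover have "kappa (\<lambda>A m. z (WC A) * T1 m) B M = 0"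
      proof (rule ccontr)
        assume "kappa (\<lambda>A m. z (WC A) * T1 m) B M \<noteq> 0"
        then obtain j where j: "j \<in> Poly_Mapping.keys M" "z (WC (insert j B)) * T1 (M - ei j) \<noteq> 0"
          using kappa_nz[of _ B M] by blast
        hence "M - ei j + ei i1 \<in> monoms (n - 1)" unfolding T1_def mono_div_def q_dual_def by (auto split: if_splits)
        moreover have "mdeg (M - ei j + ei j) = mdeg (M - ei j + ei i1)" by (simp add: mdeg_add)
        ultimately show False using False j by (simp add: diff_ei_add monoms_def)
      qed
      ultimately show ?thesis using False by (simp add: y_def q_fun_def KosX_def ext_contract_def coef_mul_def)
    qed
    finally show "Uz (btop z) B M = dl * y B M" .
  qed
  have K0: "Kpart (bmid (btop z)) B m = dl * KosX X (\<lambda>A m. eta (\<lambda>A m. z (WC A) * L_gen m) A m + X i1 * eta (\<lambda>A m. z (WC A) * WT m) A m) B m" for B m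
  proof -
    have "Kpart (bmid (btop z)) B m = dl * KosX X (eta (\<lambda>A m. z (WC A) * L_gen m)) B m - X i1 * eta (\<lambda>A m. dl * act (n - 1) (y A) Ft m) B m"
      unfolding bmid_def of_KL_simps U actc by (simp add: btop_def)
    also have "eta (\<lambda>A m. dl * act (n - 1) (y A) Ft m) B m = - dl * KosX X (eta (\<lambda>A m. z (WC A) * WT m)) B m"
      unfolding yF WT_def by (simp add: eta_scale eta_diff eta_eta eta_KosX)
    also have "dl * KosX X (eta (\<lambda>A m. z (WC A) * L_gen m)) B m - X i1 * (- dl * KosX X (eta (\<lambda>A m. z (WC A) * WT m)) B m)
       = dl * KosX X (\<lambda>A m. eta (\<lambda>A m. z (WC A) * L_gen m) A m + X i1 * eta (\<lambda>A m. z (WC A) * WT m) A m) B m"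
    proof -
      have "KosX X (\<lambda>A m. X i1 * eta (\<lambda>A m. z (WC A) * WT m) A m + eta (\<lambda>A m. z (WC A) * L_gen m) A m) B m
        = X i1 * KosX X (eta (\<lambda>A m. z (WC A) * WT m)) B m + KosX X (eta (\<lambda>A m. z (WC A) * L_gen m)) B m"
        by (simp only: KosX_lin)
      thus ?thesis by (simp add: add.commute algebra_simps)
    qed
    finally show ?thesis .
  qed
  have K: "Kpart (bmid (btop z)) B m = 0" for B m
  proof (cases "m \<in> monoms (n - 1)")
    case False
    hence z1: "eta (\<lambda>A m. z (WC A) * L_gen m) A m = 0" for A
    proof -
      have "L_gen (m + ei j) = 0" for j using False by (auto simp: L_gen_def monoms0_def monoms_def mdeg_add)
      thus ?thesis by (simp add: eta_sum)
    qed
    have z2: "eta (\<lambda>A m. z (WC A) * WT m) A m = 0" for A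
    proof -
      have "WT (m + ei j) = 0" for j unfolding WT_def
        using act_deg[of q_dual "m + ei j"] False by (cases "act (n - 1) q_dual Ft (m + ei j) = 0") (auto simp: monoms_def mdeg_add)
      thus ?thesis by (simp add: eta_sum)
    qed
    show ?thesis unfolding K0 by (simp add: z1 z2 KosX_def ext_contract_def coef_mul_def)
  next
    case True
    \<comment> \<open>In degree n - 1 \<open>eta_L_gen\<close> merges the two \<eta>-terms into
      \<delta> Kos, and a second Kos annihilates it.\<close>
    have "Kpart (bmid (btop z)) B m = dl * KosX X (\<lambda>A m. dl * KosX X (\<lambda>A m. z (WC A) * Xp m) A m) B m"
      unfolding K0 KosX_def[of X] ext_contract_def coef_mul_def using eta_L_gen[OF True]
      by (simp add: WT_def KosX_def ext_contract_def coef_mul_def)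
    thus ?thesis by (simp add: KosX_scale KosX_KosX)
  qed
  have p: "proj0 (Uz (btop z) A) m = dl * (KosX X (\<lambda>A m. z (WC A) * proj0 q_dual m) A m - X i1 * kappa (\<lambda>A m. z (WC A) * proj0 T1 m) A m)" for A m
  proof -
    have s: "proj0 (\<lambda>m. r * f m) m = r * proj0 f m" for r :: 'r and f m by (simp add: proj0_def)
    have "proj0 (kappa (\<lambda>A m. z (WC A) * T1 m) A) m = kappa (\<lambda>A. proj0 (\<lambda>m. z (WC A) * T1 m)) A m"
      by (rule proj0_kappa) (use W in \<open>metis mult_zero_left\<close>)
    thus ?thesis unfolding U y_def lin_op_scale[OF lin_op_proj0] lin_op_diff[OF lin_op_proj0] proj0_KosX by (simp add: s[abs_def])
  qed
  have L: "Lpart (bmid (btop z)) B m = 0" for B m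
    unfolding bmid_def[of "btop z"] of_KL_simps p
    unfolding btop_def of_KL_simps
    by (simp add: kappa_scale kappa_diff KosX_scale KosX_diff KosX_KosX kappa_kappa kappa_KosX
      lin2_scale[OF lin2_KosX, of _ "- X i1", simplified] del: mult_minus_left, simp add: algebra_simps)
  have "bmid (btop z) = of_KL (Kpart (bmid (btop z))) (Lpart (bmid (btop z)))"
    by (rule of_KL_eqI) (simp_all add: bmid_def)
  also have "\<dots> = (\<lambda>_. 0)" unfolding K[abs_def] L[abs_def] by (intro ext) (simp add: of_KL_def split: coord.split)
  finally show ?thesis .
qed

end

lemma bd_closed:
  assumes z: "z \<in> latG n r" and r: "r \<ge> 1" and d: "CARD('d) \<ge> 3"
  shows "bd r z \<in> latG n (r - 1)"
proof -
  consider "r = 1" | "2 \<le> r" "r < CARD('d)" | "r = CARD('d)" | "r > CARD('d)" using r by linarith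
  thus ?thesis
  proof cases
    case 1 thus ?thesis using d by (auto simp: bd_def latG_def bfirst_def)
  next
    case 2
    then have "r = Suc (Suc (r - 2))" by simp
    then obtain a where a: "r = Suc (Suc a)" by blast
    have "ext0 (Suc a) (n - 1) (Kpart z)" "eta (Kpart z) = (\<lambda>_ _. 0)" "ext0 (Suc a) n (Lpart z)" "kappa (Lpart z) = (\<lambda>_ _. 0)"
      using z 2 by (simp_all add: latG_def a)
    from bmid_closed[OF this] show ?thesis using 2 by (simp add: latG_def bd_def a) (simp add: bmid_def)
  next
    case 3
    then have "r = Suc (Suc (r - 2))" using d by simp
    then obtain a where a: "r = Suc (Suc a)" by blast
    have "\<And>A. z (WC A) \<noteq> 0 \<Longrightarrow> i1 \<notin> A \<and> card A = Suc a" using z 3 by (auto simp: latG_def a)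
    moreover have "CARD('d) - 2 = a" using 3 a by simp
    ultimately show ?thesis using btop_closed[of z a] 3 d by (simp add: latG_def bd_def) (simp add: btop_def)
  next
    case 4 thus ?thesis using d by (simp add: bd_def zero_latG)
  qed
qed

lemma Uz_lin: "Uz (\<lambda>k. c * z k + w k) A = (\<lambda>M. c * Uz z A M + Uz w A M)"
proof -
  have D: "Dz (\<lambda>k. c * z k + w k) A = (\<lambda>m. c * Dz z A m + Dz w A m)"
    unfolding Dz_def Kpart_def Lpart_def lin_opD[OF lin_op_act] by (intro ext) (simp add: algebra_simps)
  show ?thesis unfolding Uz_def D by (intro ext) (rule lin_opD[OF lin_op_q_fun])
qed

lemma KL_lin: "Kpart (\<lambda>k. c * z k + w k) = (\<lambda>A m. c * Kpart z A m + Kpart w A m)"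
  "Lpart (\<lambda>k. c * z k + w k) = (\<lambda>A m. c * Lpart z A m + Lpart w A m)"
  by (simp_all add: Kpart_def Lpart_def)

lemma bmid_lin: "bmid (\<lambda>k. c * z k + w k) k = c * bmid z k + bmid w k"
proof -
  have 1: "act j (\<lambda>m. c * f m + g m) \<nu> = (\<lambda>m. c * act j f \<nu> m + act j g \<nu> m)" for j f g \<nu>
    by (intro ext) (rule lin_opD[OF lin_op_act])
  have 2: "proj0 (\<lambda>m. c * f m + g m) = (\<lambda>m. c * proj0 f m + proj0 g m)" for f g
    by (intro ext) (rule lin_opD[OF lin_op_proj0])
  show ?thesis
    by (cases k) (simp_all add: bmid_def Uz_lin KL_lin 1 2 eta_lin kappa_lin KosX_lin, simp_all add: algebra_simps)
qed

lemma bfirst_lin: "bfirst (\<lambda>k. c * z k + w k) k = c * bfirst z k + bfirst w k"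
  unfolding bfirst_def Uz_lin KL_lin lin_opD[OF lin_op_val] by (simp add: algebra_simps)

lemma btop_lin: "btop (\<lambda>k. c * z k + w k) k = c * btop z k + btop w k"
proof -
  have 1: "(\<lambda>A m. (c * z (WC A) + w (WC A)) * f m) = (\<lambda>A m. c * (z (WC A) * f m) + w (WC A) * f m)" for f :: "'d mono \<Rightarrow> 'r"
    by (simp add: algebra_simps)
  show ?thesis
    by (cases k) (simp_all add: btop_def 1 eta_lin kappa_lin, simp_all add: algebra_simps)
qed

lemma bd_lin: "bd r (\<lambda>k. c * z k + w k) k = c * bd r z k + bd r w k"
  by (simp add: bd_def bmid_lin bfirst_lin btop_lin)

lemma bd_zero: "bd r (\<lambda>_. 0) = (\<lambda>_. 0)"
  using bd_lin[of r "-1" "\<lambda>_. 0" "\<lambda>_. 0"] by (intro ext) simp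

lemma bd_bd:
  assumes z: "z \<in> latG n (Suc r)" and r: "r \<ge> 1" and d: "CARD('d) \<ge> 3"
  shows "bd r (bd (Suc r) z) = (\<lambda>_. 0)"
proof -
  consider "Suc r < CARD('d)" | "Suc r = CARD('d)" | "Suc r > CARD('d)" by linarith
  thus ?thesis
  proof cases
    case 1
    have "r = Suc (r - 1)" using r by simp
    then obtain a where a: "r = Suc a" by blast
    have h: "ext0 (Suc a) (n - 1) (Kpart z)" "eta (Kpart z) = (\<lambda>_ _. 0)" "ext0 (Suc a) n (Lpart z)" "kappa (Lpart z) = (\<lambda>_ _. 0)"
      using z 1 by (simp_all add: latG_def a)
    have "bd (Suc r) z = bmid z" using 1 r by (simp add: bd_def)
    thus ?thesis using 1 r bmid_bmid[OF h] bfirst_bmid[OF h] by (cases "r = 1") (simp_all add: bd_def)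
  next
    case 2
    have "r = Suc (r - 1)" using r by simp
    then obtain a where a: "r = Suc a" by blast
    have "\<And>A. z (WC A) \<noteq> 0 \<Longrightarrow> i1 \<notin> A \<and> card A = Suc a" using z 2 by (auto simp: latG_def a)
    from bmid_btop[of z a, OF this] show ?thesis using 2 d by (simp add: bd_def a)
  next
    case 3
    hence "bd (Suc r) z = (\<lambda>_. 0)" using d by (simp add: bd_def)
    thus ?thesis by (simp only: bd_zero)
  qed
qed

end

section \<open>Exactness over a polynomial ring: the middle degrees\<close>

lemma kap1_zero [simp]: "kap1 (\<lambda>_ _. 0) = (\<lambda>_ _. 0)"
  by (intro ext) (auto simp: kap1_def)
lemma eta2_zero [simp]: "eta2 (\<lambda>_ _. 0) = (\<lambda>_ _. 0)"
  by (intro ext) (auto simp: eta2_def)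

definition Xs :: "'d \<Rightarrow> ('d, 'k::field) S" where
  "Xs i = Poly_Mapping.single (ei i) 1"

lemma poly_mapping_expand: "f = (\<Sum>m\<in>Poly_Mapping.keys f. Poly_Mapping.single m (Poly_Mapping.lookup f m))"
  by (rule poly_mapping_eqI) (auto simp: lookup_sum lookup_single when_def in_keys_iff)

lemma lookup_single_mult:
  fixes f :: "('d, 'k::field) S"
  shows "Poly_Mapping.lookup (Poly_Mapping.single k c * f) (k + y) = c * Poly_Mapping.lookup f y"
    and "(\<nexists>y. x = k + y) \<Longrightarrow> Poly_Mapping.lookup (Poly_Mapping.single k c * f) x = 0"
proof -
  have e: "Poly_Mapping.lookup (Poly_Mapping.single k c * f) x =
    (\<Sum>m\<in>Poly_Mapping.keys f. c * Poly_Mapping.lookup f m when k + m = x)" for x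
    by (subst (1) poly_mapping_expand[of f])
      (simp add: sum_distrib_left mult_single lookup_sum lookup_single)
  show "Poly_Mapping.lookup (Poly_Mapping.single k c * f) (k + y) = c * Poly_Mapping.lookup f y"
    unfolding e by (auto simp: when_def in_keys_iff)
  show "(\<nexists>y. x = k + y) \<Longrightarrow> Poly_Mapping.lookup (Poly_Mapping.single k c * f) x = 0"
    unfolding e by (auto simp: when_def intro!: sum.neutral)
qed

lemma lookup_constS_mult [simp]: "Poly_Mapping.lookup (constS c * f) l = c * Poly_Mapping.lookup f l"
  for f :: "('d, 'k::field) S"
  using lookup_single_mult(1)[of 0 c f l] by (simp add: constS_def)

lemma lookup_Xs_mult: "Poly_Mapping.lookup (Xs i * f) l = mono_mul i (Poly_Mapping.lookup f) l"
  for f :: "('d, 'k::field) S"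
proof (cases "i \<in> Poly_Mapping.keys l")
  case True
  thus ?thesis using lookup_single_mult(1)[of "ei i" 1 f "l - ei i"]
    by (simp add: Xs_def mono_mul_def in_keys_iff ei_add_diff)
next
  case False
  have "\<nexists>y. l = ei i + y" using False by (auto simp: in_keys_iff lookup_add lookup_ei)
  thus ?thesis using False lookup_single_mult(2)[of l "ei i" 1 f] by (simp add: Xs_def mono_mul_def in_keys_iff)
qed

lemma comm_ring_hom_constS: "comm_ring_hom (constS :: 'k::field \<Rightarrow> ('d, 'k) S)"
  by unfold_locales (simp_all add: constS_def single_add mult_single)

interpretation constS: comm_ring_hom "constS :: 'k::field \<Rightarrow> ('d, 'k) S"
  by (rule comm_ring_hom_constS)

lemma lookup_ext_sign_mult [simp]:
  "Poly_Mapping.lookup (ext_sign i A * f) l = ext_sign i A * Poly_Mapping.lookup f l" for f :: "('d, 'k::field) S"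
  using lookup_constS_mult[of "ext_sign i A" f l] by (simp add: constS.hom_ext_sign)

definition lookup2 :: "('d set \<Rightarrow> 'd mono \<Rightarrow> ('d, 'k::field) S) \<Rightarrow> 'd set \<Rightarrow> 'd mono \<times> 'd mono \<Rightarrow> 'k" where
  "lookup2 w = (\<lambda>A (l, m). Poly_Mapping.lookup (w A m) l)"

lemma lookup2_KosX: "lookup2 (KosX Xs w) = kap1 (lookup2 w)"
  by (intro ext) (auto simp: lookup2_def KosX_def ext_contract_def coef_mul_def lookup_sum lookup_Xs_mult kap1_def kappa_eq_ext_contract)

lemma lookup2_kappa: "lookup2 (kappa w) = kap2 (lookup2 w)"
  by (intro ext) (auto simp: lookup2_def kappa_sum lookup_sum kap2_def)

lemma lookup2_eta: "lookup2 (eta w) = eta2 (lookup2 w)"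
  by (intro ext) (auto simp: lookup2_def eta_sum lookup_sum eta2_def)

text \<open>The reduction modulo \<open>x\<^sub>1\<close>.\<close>
definition lookup2_bar :: "('d::{finite,linorder} set \<Rightarrow> 'd mono \<Rightarrow> ('d, 'k::field) S) \<Rightarrow> 'd set \<Rightarrow> 'd mono \<times> 'd mono \<Rightarrow> 'k" where
  "lookup2_bar w = (\<lambda>A (l, m). if Poly_Mapping.lookup l i1 = 0 then Poly_Mapping.lookup (w A m) l else 0)"

lemma lookup2_bar_lookup2: "lookup2_bar w A (l, m) = (if Poly_Mapping.lookup l i1 = 0 then lookup2 w A (l, m) else 0)"
  by (simp add: lookup2_bar_def lookup2_def)

lemma lookup2_bar_sup0: "ext0 a b w \<Longrightarrow> sup0 a b (lookup2_bar w)"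
  unfolding sup0_def ext0_def by (auto simp: lookup2_bar_def split: if_splits) (metis lookup_zero)+

lemma lookup2_bar_kappa: "kap2 (lookup2_bar w) A (l, m) = (if Poly_Mapping.lookup l i1 = 0 then lookup2 (kappa w) A (l, m) else 0)"
  unfolding lookup2_kappa by (simp add: kap2_def lookup2_bar_lookup2 kappa_def)

lemma lookup2_bar_eta: "eta2 (lookup2_bar w) A (l, m) = (if Poly_Mapping.lookup l i1 = 0 then lookup2 (eta w) A (l, m) else 0)"
  unfolding lookup2_eta by (simp add: eta2_def lookup2_bar_lookup2 eta_def)

text \<open>Exterior indices avoid \<open>i1\<close>, so Kos multiplies only by variables other than
  x_1 and commutes with the reduction modulo x_1.\<close>

lemma lookup2_bar_KosX:
  assumes "\<And>A m. i1 \<in> A \<Longrightarrow> w A m = 0"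
  shows "kap1 (lookup2_bar w) A (l, m) = (if Poly_Mapping.lookup l i1 = 0 then lookup2 (KosX Xs w) A (l, m) else 0)"
proof -
  have "kap1 (lookup2_bar w) A (l, m) = (\<Sum>j\<in>- A \<inter> Poly_Mapping.keys l.
      if Poly_Mapping.lookup l i1 = 0 then ext_sign j A * lookup2 w (insert j A) (l - ei j, m) else 0)"
    unfolding kap1_def kappa_sum prod.case
  proof (rule sum.cong[OF refl])
    fix j assume "j \<in> - A \<inter> Poly_Mapping.keys l"
    show "ext_sign j A * lookup2_bar w (insert j A) (l - ei j, m) =
       (if Poly_Mapping.lookup l i1 = 0 then ext_sign j A * lookup2 w (insert j A) (l - ei j, m) else 0)"
    proof (cases "j = i1")
      case True
      hence "w (insert j A) m = 0" using assms by simp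
      thus ?thesis by (simp add: lookup2_bar_def lookup2_def)
    qed (simp add: lookup2_bar_lookup2 lookup_i1_diff)
  qed
  thus ?thesis unfolding lookup2_KosX by (simp add: kap1_def kappa_sum)
qed

section \<open>Degree bounds, homogeneity and division by a variable\<close>

definition deg_lt :: "nat \<Rightarrow> ('d::finite, 'k::field) S \<Rightarrow> bool" where
  "deg_lt s f \<longleftrightarrow> (\<forall>l. Poly_Mapping.lookup f l \<noteq> 0 \<longrightarrow> mdeg l < s)"

lemma deg_lt_0: "deg_lt s 0" by (simp add: deg_lt_def)
lemma deg_lt_add: "deg_lt s f \<Longrightarrow> deg_lt s g \<Longrightarrow> deg_lt s (f + g)"
  unfolding deg_lt_def lookup_add by (metis add.right_neutral)
lemma deg_lt_uminus: "deg_lt s f \<Longrightarrow> deg_lt s (- f)" by (simp add: deg_lt_def)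
lemma deg_lt_diff: "deg_lt s f \<Longrightarrow> deg_lt s g \<Longrightarrow> deg_lt s (f - g)"
  using deg_lt_add[of s f "- g"] deg_lt_uminus[of s g] by simp
lemma deg_lt_sum: "(\<And>i. i \<in> C \<Longrightarrow> deg_lt s (f i)) \<Longrightarrow> deg_lt s (sum f C)"
  by (induct C rule: infinite_finite_induct) (auto simp: deg_lt_0 deg_lt_add)
lemma deg_lt_mono: "deg_lt s f \<Longrightarrow> s \<le> t \<Longrightarrow> deg_lt t f" unfolding deg_lt_def by force
lemma deg_lt_constS: "deg_lt s f \<Longrightarrow> deg_lt s (constS c * f)" by (simp add: deg_lt_def)
lemma deg_lt_ext_sign: "deg_lt s f \<Longrightarrow> deg_lt s (ext_sign i A * f)"
  unfolding deg_lt_def by (auto simp: lookup_ext_sign_mult)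

lemma keys_mult_obtain:
  fixes f g :: "('d, 'k::field) S"
  assumes "Poly_Mapping.lookup (f * g) l \<noteq> 0"
  obtains a b where "l = a + b" "Poly_Mapping.lookup f a \<noteq> 0" "Poly_Mapping.lookup g b \<noteq> 0"
proof -
  have "l \<in> Poly_Mapping.keys (f * g)" using assms by (simp add: in_keys_iff)
  with keys_mult[of f g] show ?thesis using that by (auto simp: in_keys_iff)
qed

lemma deg_lt_mult_homog: assumes "deg_lt s f" "homogS (int t) g" shows "deg_lt (s + t) (f * g)"
  unfolding deg_lt_def
proof (intro allI impI)
  fix l assume "Poly_Mapping.lookup (f * g) l \<noteq> 0"
  then obtain a b where "l = a + b" "Poly_Mapping.lookup f a \<noteq> 0" "Poly_Mapping.lookup g b \<noteq> 0" by (rule keys_mult_obtain)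
  thus "mdeg l < s + t" using assms by (auto simp: deg_lt_def homogS_def in_keys_iff mdeg_add)
qed

lemma homogS_0: "homogS t 0" by (simp add: homogS_def)
lemma homogS_add: "homogS t f \<Longrightarrow> homogS t g \<Longrightarrow> homogS t (f + g)"
  unfolding homogS_def using keys_add[of f g] by blast
lemma homogS_uminus: "homogS t f \<Longrightarrow> homogS t (- f)" for f :: "('d::finite, 'k::field) S"
  by (auto simp: homogS_def in_keys_iff)
lemma homogS_diff: "homogS t f \<Longrightarrow> homogS t g \<Longrightarrow> homogS t (f - g)" for f :: "('d::finite, 'k::field) S"
  using homogS_add[of t f "- g"] homogS_uminus[of t g] by simp
lemma homogS_sum: "(\<And>i. i \<in> C \<Longrightarrow> homogS t (f i)) \<Longrightarrow> homogS t (sum f C)"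
  by (induct C rule: infinite_finite_induct) (auto simp: homogS_0 homogS_add)
lemma homogS_mult: "homogS s f \<Longrightarrow> homogS t g \<Longrightarrow> homogS (s + t) (f * g)" for f :: "('d::finite, 'k::field) S"
  unfolding homogS_def
proof
  assume h: "\<forall>m\<in>Poly_Mapping.keys f. int (mdeg m) = s" "\<forall>m\<in>Poly_Mapping.keys g. int (mdeg m) = t"
  fix l assume "l \<in> Poly_Mapping.keys (f * g)"
  hence "Poly_Mapping.lookup (f * g) l \<noteq> 0" by (simp add: in_keys_iff)
  then obtain a b where "l = a + b" "Poly_Mapping.lookup f a \<noteq> 0" "Poly_Mapping.lookup g b \<noteq> 0" by (rule keys_mult_obtain)
  thus "int (mdeg l) = s + t" using h by (simp add: in_keys_iff mdeg_add)
qed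
lemma homogS_constS: "homogS 0 (constS c)"
  by (auto simp: homogS_def constS_def mdeg_def)
lemma homogS_1: "homogS 0 1"
  by (simp add: homogS_def mdeg_def)
lemma homogS_Xs: "homogS 1 (Xs i)"
  by (auto simp: homogS_def Xs_def)
lemma homogS_constS_mult: "homogS t f \<Longrightarrow> homogS t (constS c * f)" for f :: "('d::finite, 'k::field) S"
  using homogS_mult[OF homogS_constS[of c], of t f] by simp
lemma homogS_ext_sign: "homogS t f \<Longrightarrow> homogS t (ext_sign i A * f)" for f :: "('d::{finite,linorder}, 'k::field) S"
  using homogS_constS_mult[of t f "ext_sign i A"] by (simp add: constS.hom_ext_sign)

lemma deg_lt_Xs: "deg_lt s f \<Longrightarrow> deg_lt (Suc s) (Xs i * f)"
  using deg_lt_mult_homog[of s f 1 "Xs i"] homogS_Xs[of i] unfolding Suc_eq_plus1 by (simp add: mult.commute)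

lemma deg_lt_bound: "\<exists>s. deg_lt s f"
proof -
  have "deg_lt (Suc (Max (insert 0 (mdeg ` Poly_Mapping.keys f)))) f"
    by (auto simp: deg_lt_def in_keys_iff less_Suc_eq_le intro!: Max_ge)
  thus ?thesis ..
qed

text \<open>The exactness lemmas for the strands return coefficient functions without any
  finiteness; truncation below degree s makes them polynomials.\<close>

definition mkS :: "nat \<Rightarrow> ('d::finite mono \<Rightarrow> 'k::field) \<Rightarrow> ('d, 'k) S" where
  "mkS s g = Abs_poly_mapping (\<lambda>l. if mdeg l < s then g l else 0)"

lemma lookup_mkS:
  fixes g :: "'d::finite mono \<Rightarrow> 'k::field"
  shows "Poly_Mapping.lookup (mkS s g) l = (if mdeg l < s then g l else 0)"
proof -
  have "finite {l :: 'd mono. (if mdeg l < s then g l else 0) \<noteq> 0}"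
  proof (rule finite_subset)
    show "{l :: 'd mono. (if mdeg l < s then g l else 0) \<noteq> 0} \<subseteq> (\<Union>i<s. monoms i)" by (auto simp: monoms_def split: if_splits)
  qed simp
  thus ?thesis by (simp add: mkS_def)
qed

lemma deg_lt_mkS: "deg_lt s (mkS s g)" by (simp add: deg_lt_def lookup_mkS)

text \<open>Monomials not divisible by x_i are discarded, so this inverts multiplication by x_i only
  on multiples of x_i.\<close>

definition divX :: "'d \<Rightarrow> ('d, 'k::field) S \<Rightarrow> ('d, 'k) S" where
  "divX i f = Poly_Mapping.map_key (\<lambda>l. l + ei i) f"

lemma lookup_divX: "Poly_Mapping.lookup (divX i f) l = Poly_Mapping.lookup f (l + ei i)"
  unfolding divX_def by (subst map_key.rep_eq) (auto simp: inj_on_def)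

lemma divX_0 [simp]: "divX i 0 = 0" by (rule poly_mapping_eqI) (simp add: lookup_divX)

lemma Xs_divX: assumes "\<And>l. Poly_Mapping.lookup l i = 0 \<Longrightarrow> Poly_Mapping.lookup f l = 0" shows "Xs i * divX i f = f"
proof (rule poly_mapping_eqI)
  fix l show "Poly_Mapping.lookup (Xs i * divX i f) l = Poly_Mapping.lookup f l"
    using assms[of l] by (auto simp: lookup_Xs_mult mono_mul_def lookup_divX diff_ei_add in_keys_iff)
qed

lemma deg_lt_divX: "deg_lt (Suc s) f \<Longrightarrow> deg_lt s (divX i f)"
  unfolding deg_lt_def lookup_divX by (metis Suc_less_SucD Suc_eq_plus1 mdeg_add mdeg_ei)

lemma Xs_cancel: assumes "Xs i * f = 0" shows "f = 0"
proof (rule poly_mapping_eqI)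
  fix l
  have "Poly_Mapping.lookup (Xs i * f) (l + ei i) = Poly_Mapping.lookup f l"
    by (simp add: lookup_Xs_mult mono_mul_def lookup_add lookup_ei)
  thus "Poly_Mapping.lookup f l = Poly_Mapping.lookup 0 l" using assms by simp
qed

lemma lookup_Xs_mult_0: "Poly_Mapping.lookup l i = 0 \<Longrightarrow> Poly_Mapping.lookup (Xs i * f) l = 0"
  for f :: "('d, 'k::field) S"
  by (simp add: lookup_Xs_mult mono_mul_def)

locale std_data =
  fixes n :: nat and Qk :: "'d::{finite,linorder} mono \<Rightarrow> 'd mono \<Rightarrow> 'k::field"
    and c :: 'k and ft :: "'d mono \<Rightarrow> 'k"
  assumes n2': "n \<ge> 2" and d3: "CARD('d) \<ge> 3" and c0: "c \<noteq> 0"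
    and ft: "ft m \<noteq> 0 \<Longrightarrow> m \<in> monoms (2 * n - 1)"
    and pqk: "N \<in> monoms (n - 1) \<Longrightarrow> N' \<in> monoms (n - 1) \<Longrightarrow>
       (\<Sum>M\<in>monoms (n - 1). Qk M N' * ft (M + N + ei i1)) = (if N = N' then c else 0)"
    and qpk: "N \<in> monoms (n - 1) \<Longrightarrow> N' \<in> monoms (n - 1) \<Longrightarrow>
       (\<Sum>M\<in>monoms (n - 1). Qk N M * ft (M + N' + ei i1)) = (if N = N' then c else 0)"
begin

sublocale G: generic_data n Xs "\<lambda>M N. constS (Qk M N)" "constS c" "\<lambda>m. constS (ft m)"
proof
  fix N N' :: "'d mono" assume N: "N \<in> monoms (n - 1)" "N' \<in> monoms (n - 1)"
  show "(\<Sum>M\<in>monoms (n - 1). constS (Qk M N') * constS (ft (M + N + ei i1))) = (if N = N' then constS c else 0)"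
    by (simp add: pqk[OF N] flip: constS.hom_mult constS.hom_sum)
  show "(\<Sum>M\<in>monoms (n - 1). constS (Qk N M) * constS (ft (M + N' + ei i1))) = (if N = N' then constS c else 0)"
    by (simp add: qpk[OF N] flip: constS.hom_mult constS.hom_sum)
next
  fix m assume "constS (ft m) \<noteq> 0"
  hence "ft m \<noteq> 0" by (metis constS.hom_zero)
  thus "m \<in> monoms (2 * n - 1)" by (rule ft)
qed (rule n2')

lemma homogS_Xp: "homogS (int (mdeg m)) (G.Xp m)"
proof -
  have pow: "homogS (int k) (Xs i ^ k :: ('d, 'k) S)" for i k
  proof (induct k)
    case 0 thus ?case using homogS_1 by simp
  next
    case (Suc k) thus ?case using homogS_mult[OF homogS_Xs Suc, of i] by simp
  qed
  have "homogS (int (\<Sum>i\<in>C. Poly_Mapping.lookup m i)) (\<Prod>i\<in>C. Xs i ^ Poly_Mapping.lookup m i :: ('d, 'k) S)" if "finite C" for C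
    using that
  proof (induct C rule: finite_induct)
    case empty thus ?case using homogS_1 by simp
  next
    case (insert i C)
    thus ?case using homogS_mult[OF pow[of "Poly_Mapping.lookup m i" i] insert(3)] by simp
  qed
  thus ?thesis by (simp add: G.Xp_def mdeg_def)
qed

lemma Xp_single: "G.Xp m = Poly_Mapping.single m 1"
proof (induction "mdeg m" arbitrary: m)
  case 0
  hence "m = 0" by (simp add: mdeg_eq_0_iff)
  thus ?case by (simp add: G.Xp_def)
next
  case (Suc k)
  then obtain i where i: "i \<in> Poly_Mapping.keys m" using mdeg_eq_0_iff[of m] keys_eq_empty by force
  define m' where "m' = m - ei i"
  have m: "m = m' + ei i" using i by (simp add: m'_def diff_ei_add)
  have "G.Xp m' = Poly_Mapping.single m' 1" using Suc by (simp add: m mdeg_add)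
  thus ?case unfolding m G.Xp_add_ei by (simp add: Xs_def mult_single add.commute)
qed

lemma homogS_q_dual: "homogS (int (n - 1)) (G.q_dual M)"
  unfolding G.q_dual_def by (auto intro!: homogS_sum homogS_constS_mult homogS_0 simp: homogS_Xp[unfolded] monoms_def) (metis homogS_Xp)

lemma homogS_act_q_dual: "homogS (int (n - 1)) (act (n - 1) G.q_dual (\<lambda>m. constS (ft m)) m)"
  unfolding act_def by (intro homogS_sum) (simp add: mult.commute[of "G.q_dual _"] homogS_constS_mult homogS_q_dual)

lemma homogS_L_gen: "homogS (int n) (G.L_gen m)"
proof -
  have 1: "m \<in> monoms0 n \<Longrightarrow> homogS (int n) (constS c * G.Xp m)"
    using homogS_constS_mult[OF homogS_Xp[of m], of c] by (simp add: monoms0_def monoms_def)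
  have "homogS (int n) (Xs i1 * act (n - 1) G.q_dual (\<lambda>m. constS (ft m)) m)"
    using homogS_mult[OF homogS_Xs homogS_act_q_dual, of i1 m] n2' by (simp add: of_nat_diff)
  with 1 show ?thesis by (auto simp: G.L_gen_def homogS_0 intro: homogS_diff)
qed

lemma latG_supp: "z \<in> latG n r \<Longrightarrow> k \<notin> latQ n r \<Longrightarrow> z k = 0"
  unfolding latG_def latQ_def
  by (cases k) (auto simp: Qset_def Kpart_def ext0_def Lpart_def image_iff split: if_splits)

definition deg_lt_all :: "nat \<Rightarrow> ('d coord \<Rightarrow> ('d, 'k) S) \<Rightarrow> bool" where "deg_lt_all s z \<longleftrightarrow> (\<forall>k. deg_lt s (z k))"

lemma latG_deg_lt_all: assumes "z \<in> latG n r" shows "\<exists>s. deg_lt_all s z"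
proof -
  have "\<forall>k. \<exists>s. deg_lt s (z k)" using deg_lt_bound by blast
  then obtain f where f: "\<And>k. deg_lt (f k) (z k)" by metis
  have "deg_lt (\<Sum>k\<in>latQ n r. f k) (z k)" for k
  proof (cases "k \<in> latQ n r")
    case True
    show ?thesis by (rule deg_lt_mono[OF f]) (use True finite_latQ[of n r] in \<open>auto intro: member_le_sum\<close>)
  next
    case False
    thus ?thesis using latG_supp[OF assms] by (simp add: deg_lt_0)
  qed
  thus ?thesis unfolding deg_lt_all_def by blast
qed

definition bar0 :: "('d coord \<Rightarrow> ('d, 'k) S) \<Rightarrow> bool" where
  "bar0 z \<longleftrightarrow> (\<forall>k l. Poly_Mapping.lookup l i1 = 0 \<longrightarrow> Poly_Mapping.lookup (z k) l = 0)"

lemma bar0_div: assumes "bar0 z" shows "z = (\<lambda>k. Xs i1 * divX i1 (z k))"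
  using assms unfolding bar0_def by (intro ext) (simp add: Xs_divX)

text \<open>Multiplication by x_1 is injective on S, so the linear conditions defining the module
  pass to the quotient.\<close>

lemma latG_divX: assumes z: "z \<in> latG n r" and b: "bar0 z" shows "(\<lambda>k. divX i1 (z k)) \<in> latG n r"
proof -
  let ?w = "\<lambda>k. divX i1 (z k)"
  have P: "Kpart z = (\<lambda>A m. Xs i1 * Kpart ?w A m)" "Lpart z = (\<lambda>A m. Xs i1 * Lpart ?w A m)"
    by (subst bar0_div[OF b], simp add: Kpart_def Lpart_def)+
  have 1: "eta (Kpart z) = (\<lambda>_ _. 0) \<Longrightarrow> eta (Kpart ?w) = (\<lambda>_ _. 0)"
  proof (intro ext)
    fix A m assume "eta (Kpart z) = (\<lambda>_ _. 0)"
    hence "Xs i1 * eta (Kpart ?w) A m = 0" unfolding P by (simp add: eta_scale[symmetric])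
    thus "eta (Kpart ?w) A m = 0" by (rule Xs_cancel)
  qed
  have 2: "kappa (Lpart z) = (\<lambda>_ _. 0) \<Longrightarrow> kappa (Lpart ?w) = (\<lambda>_ _. 0)"
  proof (intro ext)
    fix A m assume "kappa (Lpart z) = (\<lambda>_ _. 0)"
    hence "Xs i1 * kappa (Lpart ?w) A m = 0" unfolding P by (simp add: kappa_scale[symmetric])
    thus "kappa (Lpart ?w) A m = 0" by (rule Xs_cancel)
  qed
  have 3: "ext0 a b (Kpart z) \<Longrightarrow> ext0 a b (Kpart ?w)" "ext0 a b (Lpart z) \<Longrightarrow> ext0 a b (Lpart ?w)" for a b
    unfolding ext0_def Kpart_def Lpart_def by (metis divX_0)+
  have 4: "divX i1 (z k) \<noteq> 0 \<Longrightarrow> z k \<noteq> 0" for k by auto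
  consider "r = 0" | (m) "r > 0" "r < CARD('d)" | "r = CARD('d)" "r > 0" | "r > CARD('d)" by fastforce
  thus ?thesis
  proof cases
    case m with z 1 2 3 show ?thesis by (simp add: latG_def)
  qed (use z 4 in \<open>simp_all add: latG_def\<close>)
qed

text \<open>A cycle that is a boundary modulo \<open>x\<^sub>1\<close> differs from a boundary by \<open>x\<^sub>1\<close> times a cycle with coefficients of smaller degree.\<close>
lemma exact_from_step:
  assumes r: "r \<ge> 1" and step: "\<And>s z. z \<in> latG n r \<Longrightarrow> G.bd r z = (\<lambda>_. 0) \<Longrightarrow> deg_lt_all (Suc s) z \<Longrightarrow>
      \<exists>y\<in>latG n (Suc r). deg_lt_all (Suc s) (G.bd (Suc r) y) \<and> bar0 (\<lambda>k. z k - G.bd (Suc r) y k)"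
    and z: "z \<in> latG n r" "G.bd r z = (\<lambda>_. 0)"
  shows "\<exists>y\<in>latG n (Suc r). z = G.bd (Suc r) y"
proof -
  obtain s where "deg_lt_all s z" using latG_deg_lt_all[OF z(1)] by blast
  thus ?thesis using z
  proof (induction s arbitrary: z)
    case 0
    hence "z k = 0" for k by (intro poly_mapping_eqI) (auto simp: deg_lt_all_def deg_lt_def)
    hence "z = G.bd (Suc r) (\<lambda>_. 0)" by (auto simp: G.bd_zero)
    thus ?case using zero_latG by blast
  next
    case (Suc s z)
    obtain y where y: "y \<in> latG n (Suc r)" "deg_lt_all (Suc s) (G.bd (Suc r) y)" "bar0 (\<lambda>k. z k - G.bd (Suc r) y k)"
      using step[OF Suc.prems(2,3,1)] by blast
    define w where "w = (\<lambda>k. z k - G.bd (Suc r) y k)"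
    have by': "G.bd (Suc r) y \<in> latG n r" using G.bd_closed[OF y(1) _ d3] by simp
    have w: "w \<in> latG n r" using latG_lin[OF by' Suc.prems(2), of "-1"] by (simp add: w_def)
    define v where "v = (\<lambda>k. divX i1 (w k))"
    have wv: "w = (\<lambda>k. Xs i1 * v k)" unfolding v_def by (rule bar0_div) (use y(3) in \<open>simp add: w_def\<close>)
    have v: "v \<in> latG n r" unfolding v_def by (rule latG_divX[OF w]) (use y(3) in \<open>simp add: w_def\<close>)
    have "deg_lt_all (Suc s) w" using Suc.prems(1) y(2) unfolding deg_lt_all_def w_def by (auto intro: deg_lt_diff)
    hence dv: "deg_lt_all s v" unfolding deg_lt_all_def v_def by (auto intro: deg_lt_divX)
    have bw: "G.bd r w = (\<lambda>_. 0)"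
      using G.bd_lin[of r "-1" "G.bd (Suc r) y" z] G.bd_bd[OF y(1) r d3] Suc.prems(3)
      by (intro ext) (simp add: w_def)
    have "Xs i1 * G.bd r v k = 0" for k
      using G.bd_lin[of r "Xs i1" v "\<lambda>_. 0" k] bw unfolding wv by (simp add: G.bd_zero)
    hence "G.bd r v = (\<lambda>_. 0)" by (intro ext) (rule Xs_cancel)
    from Suc.IH[OF dv v this] obtain u where u: "u \<in> latG n (Suc r)" "v = G.bd (Suc r) u" by blast
    have "z k = G.bd (Suc r) (\<lambda>k. Xs i1 * u k + y k) k" for k
    proof -
      have "z k = w k + G.bd (Suc r) y k" by (simp add: w_def)
      also have "w k = Xs i1 * G.bd (Suc r) u k" using fun_cong[OF wv, of k] u(2) by simp
      finally show ?thesis by (simp only: G.bd_lin)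
    qed
    moreover have "(\<lambda>k. Xs i1 * u k + y k) \<in> latG n (Suc r)" by (rule latG_lin[OF u(1) y(1)])
    ultimately show ?case by blast
  qed
qed

lemma deg_lt_constS': "deg_lt s f \<Longrightarrow> deg_lt s (f * constS e)" for f :: "('d, 'k) S"
  by (subst mult.commute) (rule deg_lt_constS)

text \<open>Q and \<Phi>~ have constant values here. Hence in the middle differentials only Kos and
  the factor x_1 raise degrees, each by one.\<close>

lemma deg_lt_Uz: "deg_lt_all s z \<Longrightarrow> deg_lt s (G.Uz z A M)"
  unfolding G.Uz_def G.q_fun_def G.Dz_def act_def Kpart_def Lpart_def deg_lt_all_def
  by (auto intro!: deg_lt_sum deg_lt_constS deg_lt_constS' deg_lt_diff deg_lt_0)

lemma deg_lt_all_bmid: assumes "deg_lt_all s z" shows "deg_lt_all (Suc s) (G.bmid z)"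
  unfolding deg_lt_all_def
proof
  fix k
  have d: "\<And>k. deg_lt s (z k)" using assms by (simp add: deg_lt_all_def)
  show "deg_lt (Suc s) (G.bmid z k)"
    by (cases k) (auto simp: G.bmid_def KosX_def ext_contract_def coef_mul_def Kpart_def Lpart_def eta_sum kappa_sum act_def proj0_def
      intro!: deg_lt_diff deg_lt_constS deg_lt_constS' deg_lt_sum deg_lt_Xs deg_lt_ext_sign d deg_lt_0 deg_lt_Uz assms)
qed

lemma lookup_bmid:
  assumes "Poly_Mapping.lookup l i1 = 0"
  shows "Poly_Mapping.lookup (G.bmid z (KC B m)) l = c * lookup2 (KosX Xs (Kpart z)) B (l, m)"
    "Poly_Mapping.lookup (G.bmid z (LC B m)) l = c * lookup2 (KosX Xs (Lpart z)) B (l, m)"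
  using assms by (simp_all add: G.bmid_def lookup_minus lookup_Xs_mult_0 lookup2_def)

definition mkw :: "nat \<Rightarrow> ('d set \<Rightarrow> 'd mono \<times> 'd mono \<Rightarrow> 'k) \<Rightarrow> 'd set \<Rightarrow> 'd mono \<Rightarrow> ('d, 'k) S" where
  "mkw s Y = (\<lambda>A m. mkS s (\<lambda>l. Y A (l, m)))"

lemma lookup2_mkw: "lookup2 (mkw s Y) A (l, m) = (if mdeg l < s then Y A (l, m) else 0)"
  by (simp add: lookup2_def mkw_def lookup_mkS)

text \<open>\<open>kap1\<close> raises the degree of the coefficient monomial by one, so the cutoff
  s becomes s + 1.\<close>

lemma lookup2_Kos_mkw: "lookup2 (KosX Xs (mkw s Y)) A (l, m) = (if mdeg l < Suc s then kap1 Y A (l, m) else 0)"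
proof -
  have "Suc (mdeg (l - ei j)) = mdeg l" if "j \<in> Poly_Mapping.keys l" for j
    using mdeg_add[of "l - ei j" "ei j"] by (simp add: diff_ei_add[OF that])
  hence "mdeg (l - ei j) < s \<longleftrightarrow> mdeg l < Suc s" if "j \<in> Poly_Mapping.keys l" for j
    using that by (metis Suc_less_eq)
  hence "(\<Sum>j\<in>- A \<inter> Poly_Mapping.keys l. ext_sign j A * (if mdeg (l - ei j) < s then Y (insert j A) (l - ei j, m) else 0)) =
     (\<Sum>j\<in>- A \<inter> Poly_Mapping.keys l. if mdeg l < Suc s then ext_sign j A * Y (insert j A) (l - ei j, m) else 0)"
    by (intro sum.cong) auto
  thus ?thesis unfolding lookup2_KosX kap1_def kappa_sum prod.case lookup2_mkw by simp
qed

lemma mkw_closed: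
  assumes "sup0 a b Y"
  shows "ext0 a b (mkw s Y)" "eta2 Y = (\<lambda>_ _. 0) \<Longrightarrow> eta (mkw s Y) = (\<lambda>_ _. 0)"
    "kap2 Y = (\<lambda>_ _. 0) \<Longrightarrow> kappa (mkw s Y) = (\<lambda>_ _. 0)"
proof -
  show "ext0 a b (mkw s Y)"
    unfolding ext0_def
  proof (intro allI impI)
    fix A m assume "mkw s Y A m \<noteq> 0"
    then obtain l where "Poly_Mapping.lookup (mkw s Y A m) l \<noteq> 0" by (metis lookup_zero poly_mapping_eqI)
    hence "Y A (l, m) \<noteq> 0" by (auto simp: mkw_def lookup_mkS split: if_splits)
    with assms show "i1 \<notin> A \<and> card A = a \<and> m \<in> monoms0 b" unfolding sup0_def by blast
  qed
  have W: "(\<And>A l m. lookup2 w A (l, m) = 0) \<Longrightarrow> w = (\<lambda>_ _. 0)" for w :: "'d set \<Rightarrow> 'd mono \<Rightarrow> ('d, 'k) S"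
    by (intro ext poly_mapping_eqI) (simp add: lookup2_def)
  show "eta (mkw s Y) = (\<lambda>_ _. 0)" if "eta2 Y = (\<lambda>_ _. 0)"
  proof (rule W)
    fix A l m
    have "lookup2 (eta (mkw s Y)) A (l, m) = (if mdeg l < s then eta2 Y A (l, m) else 0)"
      unfolding lookup2_eta eta2_def eta_sum prod.case lookup2_mkw by simp
    thus "lookup2 (eta (mkw s Y)) A (l, m) = 0" by (simp add: that)
  qed
  show "kappa (mkw s Y) = (\<lambda>_ _. 0)" if "kap2 Y = (\<lambda>_ _. 0)"
  proof (rule W)
    fix A l m
    have "lookup2 (kappa (mkw s Y)) A (l, m) = (if mdeg l < s then kap2 Y A (l, m) else 0)"
      unfolding lookup2_kappa kap2_def kappa_sum prod.case lookup2_mkw by simp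
    thus "lookup2 (kappa (mkw s Y)) A (l, m) = 0" by (simp add: that)
  qed
qed

text \<open>Modulo x_1 the middle differential is c times Kos, so the preimages from the strands
  have to be divided by c.\<close>

lemma scale_preimage:
  assumes "sup0 a b Y" "w = kap1 Y"
  shows "\<exists>Y'. sup0 a b Y' \<and> (kap2 Y = (\<lambda>_ _. 0) \<longrightarrow> kap2 Y' = (\<lambda>_ _. 0)) \<and> (eta2 Y = (\<lambda>_ _. 0) \<longrightarrow> eta2 Y' = (\<lambda>_ _. 0)) \<and>
     (\<forall>A p. w A p = c * kap1 Y' A p)"
proof (intro exI conjI impI allI)
  let ?Y = "\<lambda>A p. inverse c * Y A p"
  show "sup0 a b ?Y" using assms(1) unfolding sup0_def by auto
  show "kap2 ?Y = (\<lambda>_ _. 0)" if "kap2 Y = (\<lambda>_ _. 0)"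
    using kap2_lin[of "inverse c" Y "\<lambda>_ _. 0"] that by (intro ext) simp
  show "eta2 ?Y = (\<lambda>_ _. 0)" if "eta2 Y = (\<lambda>_ _. 0)"
    using eta2_lin[of "inverse c" Y "\<lambda>_ _. 0"] that by (intro ext) simp
  show "w A p = c * kap1 ?Y A p" for A p
    using kap1_lin[of "inverse c" Y "\<lambda>_ _. 0" A p] c0 by (simp add: assms(2))
qed

text \<open>Preimages modulo x_1 of the two components, truncated below degree s, combine to the
  element that \<open>exact_from_step\<close> asks for. The truncation loses nothing because the
  coefficients of z have degree at most s.\<close>

lemma lift:
  assumes YK: "sup0 (Suc a) (n - 1) YK" "eta2 YK = (\<lambda>_ _. 0)" "\<And>A p. lookup2_bar (Kpart z) A p = c * kap1 YK A p"
    and YL: "sup0 (Suc a) n YL" "kap2 YL = (\<lambda>_ _. 0)" "\<And>A p. lookup2_bar (Lpart z) A p = c * kap1 YL A p"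
    and dg: "deg_lt_all (Suc s) z" and a: "Suc (Suc a) < CARD('d)" and z: "z One = 0" "\<And>A. z (WC A) = 0"
  shows "\<exists>y\<in>latG n (Suc (Suc a)). deg_lt_all (Suc s) (G.bd (Suc (Suc a)) y) \<and> bar0 (\<lambda>k. z k - G.bd (Suc (Suc a)) y k)"
proof (intro bexI conjI)
  define y where "y = of_KL (mkw s YK) (mkw s YL)"
  have bd: "G.bd (Suc (Suc a)) y = G.bmid y" using a by (simp add: G.bd_def)
  show "y \<in> latG n (Suc (Suc a))"
    using a mkw_closed[OF YK(1)] mkw_closed[OF YL(1)] YK(2) YL(2) by (simp add: latG_def y_def)
  have "deg_lt_all s y" unfolding deg_lt_all_def
  proof
    fix k show "deg_lt s (y k)" by (cases k) (simp_all add: y_def mkw_def deg_lt_mkS deg_lt_0)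
  qed
  thus "deg_lt_all (Suc s) (G.bd (Suc (Suc a)) y)" unfolding bd by (rule deg_lt_all_bmid)
  show "bar0 (\<lambda>k. z k - G.bd (Suc (Suc a)) y k)"
    unfolding bar0_def bd
  proof (intro allI impI)
    fix k :: "'d coord" and l :: "'d mono" assume l: "Poly_Mapping.lookup l i1 = 0"
    have big: "\<not> mdeg l < Suc s \<Longrightarrow> Poly_Mapping.lookup (z k) l = 0" using dg unfolding deg_lt_all_def deg_lt_def by blast
    show "Poly_Mapping.lookup (z k - G.bmid y k) l = 0"
    proof (cases k)
      case (KC B m)
      have "Poly_Mapping.lookup (z k) l = c * kap1 YK B (l, m)" using YK(3)[of B "(l, m)"] l by (simp add: KC lookup2_bar_def Kpart_def)
      thus ?thesis using big unfolding KC lookup_minus lookup_bmid(1)[OF l] by (simp add: y_def lookup2_Kos_mkw)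
    next
      case (LC B m)
      have "Poly_Mapping.lookup (z k) l = c * kap1 YL B (l, m)" using YL(3)[of B "(l, m)"] l by (simp add: LC lookup2_bar_def Lpart_def)
      thus ?thesis using big unfolding LC lookup_minus lookup_bmid(2)[OF l] by (simp add: y_def lookup2_Kos_mkw)
    qed (simp_all add: z G.bmid_def)
  qed
qed

lemma bmid_cycle_bar:
  assumes "G.bmid z = (\<lambda>_. 0)" "\<And>A m. i1 \<in> A \<Longrightarrow> Kpart z A m = 0" "\<And>A m. i1 \<in> A \<Longrightarrow> Lpart z A m = 0"
  shows "kap1 (lookup2_bar (Kpart z)) = (\<lambda>_ _. 0)" "kap1 (lookup2_bar (Lpart z)) = (\<lambda>_ _. 0)"
proof -
  have 1: "c * lookup2 (KosX Xs (Kpart z)) B (l, m) = 0" "c * lookup2 (KosX Xs (Lpart z)) B (l, m) = 0"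
    if "Poly_Mapping.lookup l i1 = 0" for B l m
    unfolding lookup_bmid[OF that, symmetric] assms(1) by simp_all
  show "kap1 (lookup2_bar (Kpart z)) = (\<lambda>_ _. 0)"
    by (intro ext, clarify) (use 1 c0 in \<open>simp add: lookup2_bar_KosX assms(2)\<close>)
  show "kap1 (lookup2_bar (Lpart z)) = (\<lambda>_ _. 0)"
    by (intro ext, clarify) (use 1 c0 in \<open>simp add: lookup2_bar_KosX assms(3)\<close>)
qed

lemma lookup2_bar_ker:
  shows "eta w = (\<lambda>_ _. 0) \<Longrightarrow> eta2 (lookup2_bar w) = (\<lambda>_ _. 0)" "kappa w = (\<lambda>_ _. 0) \<Longrightarrow> kap2 (lookup2_bar w) = (\<lambda>_ _. 0)"
  by (intro ext, clarify, simp add: lookup2_bar_eta lookup2_bar_kappa, simp add: lookup2_def)+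

lemma exact_mid:
  assumes a: "Suc (Suc (Suc a)) < CARD('d)" and z: "z \<in> latG n (Suc (Suc a))" "G.bd (Suc (Suc a)) z = (\<lambda>_. 0)"
  shows "\<exists>y\<in>latG n (Suc (Suc (Suc a))). z = G.bd (Suc (Suc (Suc a))) y"
proof (rule exact_from_step[OF _ _ z])
  fix s z assume z: "z \<in> latG n (Suc (Suc a))" "G.bd (Suc (Suc a)) z = (\<lambda>_. 0)" and dg: "deg_lt_all (Suc s) z"
  have zz: "ext0 (Suc a) (n - 1) (Kpart z)" "eta (Kpart z) = (\<lambda>_ _. 0)" "ext0 (Suc a) n (Lpart z)" "kappa (Lpart z) = (\<lambda>_ _. 0)"
    "z One = 0" "\<And>A. z (WC A) = 0"
    using z a by (simp_all add: latG_def)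
  have "G.bmid z = (\<lambda>_. 0)" using z(2) a by (simp add: G.bd_def)
  note k1z = bmid_cycle_bar[OF this ext0_D[OF zz(1)] ext0_D[OF zz(3)]]
  have "\<exists>Y. sup0 (Suc (Suc a)) (n - 1) Y \<and> eta2 Y = (\<lambda>_ _. 0) \<and> lookup2_bar (Kpart z) = kap1 Y"
    by (rule K_exact[OF lookup2_bar_sup0[OF zz(1)] lookup2_bar_ker(1)[OF zz(2)]]) (use k1z a in auto)
  then obtain YK where YK: "sup0 (Suc (Suc a)) (n - 1) YK" "eta2 YK = (\<lambda>_ _. 0)" "\<And>A p. lookup2_bar (Kpart z) A p = c * kap1 YK A p"
    using scale_preimage by metis
  have "\<exists>Y. sup0 (Suc (Suc a)) n Y \<and> kap2 Y = (\<lambda>_ _. 0) \<and> lookup2_bar (Lpart z) = kap1 Y"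
    by (rule L_exact[OF lookup2_bar_sup0[OF zz(3)] lookup2_bar_ker(2)[OF zz(4)]]) (use k1z in auto)
  then obtain YL where YL: "sup0 (Suc (Suc a)) n YL" "kap2 YL = (\<lambda>_ _. 0)" "\<And>A p. lookup2_bar (Lpart z) A p = c * kap1 YL A p"
    using scale_preimage by metis
  show "\<exists>y\<in>latG n (Suc (Suc (Suc a))). deg_lt_all (Suc s) (G.bd (Suc (Suc (Suc a))) y) \<and> bar0 (\<lambda>k. z k - G.bd (Suc (Suc (Suc a))) y k)"
    by (rule lift[OF YK YL dg a]) (simp_all add: zz)
qed simp

end

section \<open>Exactness at the ends and the image of the first map\<close>

context std_data begin

lemma deg_lt_minus_mult:
  fixes f g :: "('d, 'k) S"
  assumes "deg_lt (t - k) f" "homogS (int k) g" shows "deg_lt t (f * g)"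
proof (cases "k \<le> t")
  case True
  thus ?thesis using deg_lt_mult_homog[OF assms] by simp
next
  case False
  hence "f = 0" using assms(1) by (intro poly_mapping_eqI) (auto simp: deg_lt_def)
  thus ?thesis by (simp add: deg_lt_0)
qed

lemma lookup_mult_Xp:
  "Poly_Mapping.lookup (f * G.Xp m) l = (if \<exists>l'. l = l' + m then Poly_Mapping.lookup f (l - m) else 0)"
proof (cases "\<exists>l'. l = l' + m")
  case True
  then obtain l' where l: "l = m + l'" by (auto simp: add.commute)
  show ?thesis unfolding Xp_single mult.commute[of f] l lookup_single_mult(1) by (auto simp: add.commute)
next
  case False
  hence "\<nexists>y. l = m + y" by (metis add.commute)
  with False show ?thesis unfolding Xp_single mult.commute[of f] by (simp add: lookup_single_mult(2))
qed

text \<open>The second summand of \<open>L_gen m\<close> is a multiple of x_1, which leaves c times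
  m.\<close>

lemma lookup_mult_L_gen:
  assumes "Poly_Mapping.lookup l i1 = 0" "m \<in> monoms0 n"
  shows "Poly_Mapping.lookup (f * G.L_gen m) l = c * (if \<exists>l'. l = l' + m then Poly_Mapping.lookup f (l - m) else 0)"
proof -
  have "f * G.L_gen m = constS c * (f * G.Xp m) - Xs i1 * (f * act (n - 1) G.q_dual (\<lambda>m. constS (ft m)) m)"
    using assms(2) by (simp add: G.L_gen_def algebra_simps)
  thus ?thesis by (simp add: lookup_minus lookup_Xs_mult_0[OF assms(1)] lookup_mult_Xp)
qed

text \<open>Modulo x_1 the \<open>L\<close>-part of a cycle vanishes: its preimage lies in the
  kernel of \<open>kap2\<close> in exterior degree d - 1, the rank of \<open>U\<^sub>0\<close>, and
  there this kernel is zero. The \<open>K\<close>-part is described by \<open>K_top\<close>, and its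
  function s is realized by a multiple of the top exterior basis vector.\<close>

lemma exact_top:
  assumes a: "a + 2 = CARD('d)" and z: "z \<in> latG n (Suc a)" "G.bd (Suc a) z = (\<lambda>_. 0)"
  shows "\<exists>y\<in>latG n (Suc (Suc a)). z = G.bd (Suc (Suc a)) y"
proof (rule exact_from_step[OF _ _ z])
  fix s z assume z: "z \<in> latG n (Suc a)" "G.bd (Suc a) z = (\<lambda>_. 0)" and dg: "deg_lt_all (Suc s) z"
  have a1: "a \<noteq> 0" "Suc a < CARD('d)" "2 \<le> Suc a" "Suc (Suc a) = CARD('d)" using a d3 by linarith+
  have zz: "ext0 a (n - 1) (Kpart z)" "eta (Kpart z) = (\<lambda>_ _. 0)" "ext0 a n (Lpart z)" "kappa (Lpart z) = (\<lambda>_ _. 0)"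
    "z One = 0" "\<And>A. z (WC A) = 0"
    using z a1 by (simp_all add: latG_def)
  have "G.bmid z = (\<lambda>_. 0)" using z(2) a1 by (simp add: G.bd_def)
  note k1z = bmid_cycle_bar[OF this ext0_D[OF zz(1)] ext0_D[OF zz(3)]]
  have "\<exists>sf. lookup2_bar (Kpart z) = kap1 (\<lambda>A (l, m). if A = -{i1} \<and> m \<in> monoms0 (n - 1) then (if \<exists>l'. l = l' + m then sf (l - m) else 0) else 0)"
    by (rule K_top[OF lookup2_bar_sup0[OF zz(1)] lookup2_bar_ker(1)[OF zz(2)]]) (use k1z a a1 in auto)
  then obtain sf where sf: "lookup2_bar (Kpart z) = kap1 (\<lambda>A (l, m). if A = -{i1} \<and> m \<in> monoms0 (n - 1) then (if \<exists>l'. l = l' + m then sf (l - m) else 0) else 0)" by blast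
  have "\<exists>Y. sup0 (Suc a) n Y \<and> kap2 Y = (\<lambda>_ _. 0) \<and> lookup2_bar (Lpart z) = kap1 Y"
    by (rule L_exact[OF lookup2_bar_sup0[OF zz(3)] lookup2_bar_ker(2)[OF zz(4)]]) (use k1z a1 in auto)
  then obtain Y where Y: "sup0 (Suc a) n Y" "kap2 Y = (\<lambda>_ _. 0)" "lookup2_bar (Lpart z) = kap1 Y" by blast
  have "Y = (\<lambda>_ _. 0)"
  proof -
    obtain V where V: "\<And>c. n = Suc c \<Longrightarrow> sup0 (Suc (Suc a)) c V" "Y = kap2 V"
      using kap2_exact[OF Y(1,2)] by auto
    have "n = Suc (n - 1)" using n2' by simp
    from V(1)[OF this] have "V A (l, m) = 0" for A l m
    proof -
      have "card A \<le> CARD('d) - 1" if "i1 \<notin> A"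
        using card_mono[of "-{i1}" A] that by (auto simp: card_Compl_i1)
      hence "\<not> (i1 \<notin> A \<and> card A = Suc (Suc a))" using a1 by auto
      thus ?thesis using V(1)[OF \<open>n = Suc (n - 1)\<close>] unfolding sup0_def by blast
    qed
    hence "V = (\<lambda>_ _. 0)" by (auto simp: fun_eq_iff)
    thus ?thesis by (simp add: V(2))
  qed
  hence L0: "lookup2_bar (Lpart z) = (\<lambda>_ _. 0)" by (simp add: Y(3))
  \<comment> \<open>\<open>L_gen\<close> has degree n, so the cutoff s + 1 for z becomes
    \<open>Suc s - n\<close> here, with \<sigma> = 0 if n > s. The factor \<open>inverse c\<close>
    compensates the value c m of \<open>L_gen m\<close> modulo x_1.\<close>
  define \<sigma> where "\<sigma> = mkS (Suc s - n) (\<lambda>l. inverse c * sf l)"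
  define y :: "'d coord \<Rightarrow> ('d, 'k) S" where "y = (\<lambda>k. if k = WC (-{i1}) then \<sigma> else 0)"
  have bd: "G.bd (Suc (Suc a)) y = G.btop y" unfolding a1(4) using d3 by (simp add: G.bd_def)
  have dy: "deg_lt (Suc s - n) (y k)" for k by (simp add: y_def \<sigma>_def deg_lt_mkS deg_lt_0)
  show "\<exists>y\<in>latG n (Suc (Suc a)). deg_lt_all (Suc s) (G.bd (Suc (Suc a)) y) \<and> bar0 (\<lambda>k. z k - G.bd (Suc (Suc a)) y k)"
  proof (intro bexI[of _ y] conjI)
    show "y \<in> latG n (Suc (Suc a))" unfolding a1(4) by (auto simp: latG_def y_def card_Compl_i1)
    show "deg_lt_all (Suc s) (G.bd (Suc (Suc a)) y)" unfolding bd deg_lt_all_def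
    proof
      fix k
      have "Suc s - n = s - (n - 1)" using n2' by simp
      hence 1: "deg_lt s (y k * G.q_dual m)" for k m using deg_lt_minus_mult[of s "n - 1", OF _ homogS_q_dual] dy by metis
      show "deg_lt (Suc s) (G.btop y k)"
        by (cases k) (auto simp: G.btop_def eta_sum kappa_sum proj0_def
          intro!: deg_lt_sum deg_lt_ext_sign deg_lt_minus_mult[OF dy homogS_L_gen] deg_lt_uminus deg_lt_Xs deg_lt_0 1)
    qed
    show "bar0 (\<lambda>k. z k - G.bd (Suc (Suc a)) y k)" unfolding bar0_def bd
    proof (intro allI impI)
      fix k :: "'d coord" and l :: "'d mono" assume l: "Poly_Mapping.lookup l i1 = 0"
      show "Poly_Mapping.lookup (z k - G.btop y k) l = 0"
      proof (cases k)
        case (KC B m)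
        define F :: "'d set \<Rightarrow> 'd mono \<Rightarrow> 'k" where "F A l = (if A = -{i1} \<and> m \<in> monoms0 (n - 1) then (if \<exists>l'. l = l' + m then sf (l - m) else 0) else 0)" for A l
        have "Poly_Mapping.lookup (z k) l = lookup2_bar (Kpart z) B (l, m)" using l by (simp add: KC lookup2_bar_def Kpart_def)
        also have "\<dots> = (\<Sum>j\<in>-B \<inter> Poly_Mapping.keys l. ext_sign j B * F (insert j B) (l - ei j))"
          unfolding sf kap1_def kappa_sum prod.case F_def ..
        finally have zk: "Poly_Mapping.lookup (z k) l = (\<Sum>j\<in>-B \<inter> Poly_Mapping.keys l. ext_sign j B * F (insert j B) (l - ei j))" .
        \<comment> \<open>The comparison is made term by term: the j-th term of the top differential
          against the j-th term of \<open>kap1\<close> in the description of z.\<close>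
        have t: "Poly_Mapping.lookup (y (WC (insert j B)) * G.L_gen (m + ei j)) l =
            (if mdeg l < Suc s \<and> j \<in> Poly_Mapping.keys l then F (insert j B) (l - ei j) else 0)" if j: "j \<in> -B" for j
        proof (cases "insert j B = -{i1} \<and> m \<in> monoms0 (n - 1)")
          case False
          have "y (WC (insert j B)) * G.L_gen (m + ei j) = 0"
          proof (cases "insert j B = -{i1}")
            case True
            hence "j \<noteq> i1" by auto
            hence "m + ei j \<notin> monoms0 n" using False True monoms0_add_ei[of j m "n - 1"] G.n_simps by auto
            thus ?thesis by (simp add: G.L_gen_def)
          qed (simp add: y_def)
          thus ?thesis using False by (auto simp: F_def)
        next
          case True
          hence ji: "j \<noteq> i1" by auto
          have m': "m + ei j \<in> monoms0 n" using True ji monoms0_add_ei[of j m "n - 1"] G.n_simps by simp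
          have eq: "(\<exists>l'. l = l' + (m + ei j)) \<longleftrightarrow> j \<in> Poly_Mapping.keys l \<and> (\<exists>l'. l - ei j = l' + m)" (is "?L \<longleftrightarrow> ?R")
          proof
            assume ?L then obtain l' where "l = l' + m + ei j" by (auto simp: add.assoc)
            thus ?R by (auto simp: keys_add_ei)
          next
            assume ?R then obtain l' where "l - ei j + ei j = l' + m + ei j" "j \<in> Poly_Mapping.keys l" by auto
            thus ?L by (auto simp: diff_ei_add add.assoc)
          qed
          have ll: "l - (m + ei j) = l - ei j - m" by (rule poly_mapping_eqI) (simp add: lookup_minus lookup_add)
          have dgm: "mdeg (l - (m + ei j)) < Suc s - n \<longleftrightarrow> mdeg l < Suc s" if L: "\<exists>l'. l = l' + (m + ei j)"
          proof -
            from L obtain l' where "l = l' + (m + ei j)" by blast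
            hence "mdeg l = mdeg (l - (m + ei j)) + n" using m' by (simp add: mdeg_add monoms0_def monoms_def)
            thus ?thesis by linarith
          qed
          have "y (WC (insert j B)) = \<sigma>" using True by (simp add: y_def)
          hence "Poly_Mapping.lookup (y (WC (insert j B)) * G.L_gen (m + ei j)) l =
            c * (if \<exists>l'. l = l' + (m + ei j) then Poly_Mapping.lookup \<sigma> (l - (m + ei j)) else 0)"
            using lookup_mult_L_gen[OF l m'] by simp
          also have "\<dots> = (if mdeg l < Suc s \<and> j \<in> Poly_Mapping.keys l then F (insert j B) (l - ei j) else 0)"
          proof (cases "\<exists>l'. l = l' + (m + ei j)")
            case L: True
            thus ?thesis using eq dgm[OF L] True c0 unfolding \<sigma>_def lookup_mkS F_def ll[symmetric] by auto
          next
            case L: False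
            thus ?thesis using eq unfolding F_def by auto
          qed
          finally show ?thesis .
        qed
        have "Poly_Mapping.lookup (G.btop y k) l = (\<Sum>j\<in>-B. ext_sign j B * Poly_Mapping.lookup (y (WC (insert j B)) * G.L_gen (m + ei j)) l)"
          by (simp add: KC G.btop_def eta_sum lookup_sum)
        also have "\<dots> = (\<Sum>j\<in>-B. if mdeg l < Suc s \<and> j \<in> Poly_Mapping.keys l then ext_sign j B * F (insert j B) (l - ei j) else 0)"
          by (rule sum.cong) (simp_all add: t)
        also have "\<dots> = (if mdeg l < Suc s then Poly_Mapping.lookup (z k) l else 0)"
          unfolding zk by (auto intro!: sum.mono_neutral_cong_right split: if_splits)
        also have "\<dots> = Poly_Mapping.lookup (z k) l" using dg unfolding deg_lt_all_def deg_lt_def by auto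
        finally show ?thesis by (simp add: lookup_minus)
      next
        case (LC B m)
        have "Poly_Mapping.lookup (z k) l = lookup2_bar (Lpart z) B (l, m)" using l by (simp add: LC lookup2_bar_def Lpart_def)
        hence "Poly_Mapping.lookup (z k) l = 0" by (simp add: L0)
        moreover have "Poly_Mapping.lookup (G.btop y k) l = 0"
          by (simp add: LC G.btop_def lookup_Xs_mult_0[OF l])
        ultimately show ?thesis by (simp add: lookup_minus)
      qed (simp_all add: zz G.btop_def)
    qed
  qed
qed simp

text \<open>Modulo x_1 one coordinate of the top differential is, up to sign and the factor c,
  multiplication by a power of another variable. So every cycle is divisible by x_1, and y = 0
  serves in the step.\<close>

lemma exact_last:
  assumes z: "z \<in> latG n (CARD('d))" "G.bd (CARD('d)) z = (\<lambda>_. 0)"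
  shows "\<exists>y\<in>latG n (Suc (CARD('d))). z = G.bd (Suc (CARD('d))) y"
proof (rule exact_from_step[OF _ _ z])
  fix s z assume z: "z \<in> latG n (CARD('d))" "G.bd (CARD('d)) z = (\<lambda>_. 0)" and dg: "deg_lt_all (Suc s) z"
  have btop: "G.btop z = (\<lambda>_. 0)" using z(2) d3 by (simp add: G.bd_def)
  have W: "z k \<noteq> 0 \<Longrightarrow> k = WC (-{i1})" for k
  proof -
    assume "z k \<noteq> 0"
    then obtain A where A: "k = WC A" "i1 \<notin> A" "card A = CARD('d) - 1" using z(1) d3 by (auto simp: latG_def)
    have "A = -{i1}" by (rule card_subset_eq) (use A in \<open>auto simp: card_Compl_i1\<close>)
    thus ?thesis using A by simp
  qed
  have "bar0 z" unfolding bar0_def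
  proof (intro allI impI)
    fix k and l :: "'d mono" assume l: "Poly_Mapping.lookup l i1 = 0"
    show "Poly_Mapping.lookup (z k) l = 0"
    proof (cases "k = WC (-{i1})")
      case False
      hence "z k = 0" using W by blast
      thus ?thesis by simp
    next
      case True
      have "card (-{i1 :: 'd}) \<noteq> 0" using d3 by (simp add: card_Compl_i1)
      then obtain i :: 'd where i: "i \<noteq> i1" by auto
      \<comment> \<open>This monomial and the full index set without i isolate the single term z
        times \<open>L_gen\<close> of the n-th power of x_i.\<close>
      define m :: "'d mono" where "m = Poly_Mapping.single i (n - 1)"
      define B where "B = -{i1} - {i}"
      have m0: "m \<in> monoms0 (n - 1)" using i by (simp add: m_def monoms0_def monoms_def mdeg_def lookup_single when_def)
      hence m': "m + ei i \<in> monoms0 n" using i monoms0_add_ei[of i m "n - 1"] G.n_simps by simp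
      have iB: "i \<notin> B" "insert i B = -{i1}" using i by (auto simp: B_def)
      have "G.btop z (KC B m) = (\<Sum>j\<in>{i}. ext_sign j B * (z (WC (insert j B)) * G.L_gen (m + ei j)))"
        unfolding G.btop_def of_KL_simps eta_sum
      proof (rule sum.mono_neutral_right)
        show "\<forall>j\<in>-B - {i}. ext_sign j B * (z (WC (insert j B)) * G.L_gen (m + ei j)) = 0"
        proof
          fix j assume "j \<in> -B - {i}"
          hence "j = i1" by (auto simp: B_def)
          hence "insert j B \<noteq> -{i1}" by blast
          hence "z (WC (insert j B)) = 0" using W by blast
          thus "ext_sign j B * (z (WC (insert j B)) * G.L_gen (m + ei j)) = 0" by simp
        qed
      qed (use iB in auto)
      also have "\<dots> = ext_sign i B * (z k * G.L_gen (m + ei i))" using iB True by simp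
      finally have e: "ext_sign i B * (z k * G.L_gen (m + ei i)) = G.btop z (KC B m)" ..
      have "Poly_Mapping.lookup (ext_sign i B * (z k * G.L_gen (m + ei i))) (l + (m + ei i)) = 0"
        unfolding e btop by simp
      moreover have "Poly_Mapping.lookup (l + (m + ei i)) i1 = 0" using l m' by (simp add: monoms0_def lookup_add)
      ultimately have h0: "ext_sign i B * (c * Poly_Mapping.lookup (z k) l) = 0"
        using lookup_mult_L_gen[OF _ m', of "l + (m + ei i)" "z k"] by auto
      have "c * Poly_Mapping.lookup (z k) l = ext_sign i B * (ext_sign i B * (c * Poly_Mapping.lookup (z k) l))" by simp
      also have "\<dots> = 0" by (simp only: h0 mult_zero_right)
      finally show ?thesis using c0 by simp
    qed
  qed
  thus "\<exists>y\<in>latG n (Suc (CARD('d))). deg_lt_all (Suc s) (G.bd (Suc (CARD('d))) y) \<and> bar0 (\<lambda>k. z k - G.bd (Suc (CARD('d))) y k)"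
    by (intro bexI[of _ "\<lambda>_. 0"]) (simp_all add: G.bd_zero zero_latG deg_lt_all_def deg_lt_0)
qed (use d3 in simp)

text \<open>The value of \<open>f(\<Phi>)\<close> at \<open>M\<close>.\<close>
definition pairing :: "('d, 'k) S \<Rightarrow> 'd mono \<Rightarrow> 'k" where
  "pairing f M = (\<Sum>l | mdeg l + mdeg M = 2 * n - 2. Poly_Mapping.lookup f l * ft (l + M + ei i1))"

lemma pairing_add: "pairing (f + g) M = pairing f M + pairing g M"
  by (simp add: pairing_def lookup_add distrib_right sum.distrib)
lemma pairing_0 [simp]: "pairing 0 M = 0" by (simp add: pairing_def)
lemma pairing_diff: "pairing (f - g) M = pairing f M - pairing g M"
  by (simp add: pairing_def lookup_minus left_diff_distrib sum_subtractf)
lemma pairing_sum: "pairing (sum f C) M = (\<Sum>i\<in>C. pairing (f i) M)"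
  by (induct C rule: infinite_finite_induct) (auto simp: pairing_add)
lemma pairing_constS: "pairing (constS e * f) M = e * pairing f M"
  by (simp add: pairing_def sum_distrib_left mult.assoc)

lemma pairing_Xp: "pairing (f * G.Xp m) M = pairing f (M + m)"
proof -
  have "pairing (f * G.Xp m) M = (\<Sum>l | mdeg l + mdeg M = 2 * n - 2 \<and> (\<exists>l'. l = l' + m). Poly_Mapping.lookup f (l - m) * ft (l + M + ei i1))"
    unfolding pairing_def lookup_mult_Xp using finite_mdeg_add_eq[of "mdeg M" "2 * n - 2"]
    by (intro sum.mono_neutral_cong_right) auto
  also have "\<dots> = pairing f (M + m)"
    unfolding pairing_def
    by (rule sum.reindex_bij_witness[of _ "\<lambda>l. l + m" "\<lambda>l. l - m"]) (auto simp: mdeg_add add_ac)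
  finally show ?thesis .
qed

lemma pairing_Xs: "pairing (Xs i * f) M = pairing f (M + ei i)"
  using pairing_Xp[of f "ei i" M] by (simp add: Xp_single Xs_def mult.commute)

lemma pairing_val: "pairing (G.val j \<mu>) M = (\<Sum>m\<in>monoms j. pairing (\<mu> m) (M + m))"
  by (simp add: G.val_def pairing_sum pairing_Xp)

text \<open>Contracting \<Phi> by q(\<nu>) returns c \<nu>, so contracting it by l q(\<nu>) returns
  c times the contraction of \<nu> by l. Summed over l this is the augmentation of the
  \<open>K\<close>-strand.\<close>

lemma pairing_val_q_fun: "pairing (G.val (n - 1) (G.q_fun p)) M = c * mcon (n - 1) (\<lambda>(l, m). Poly_Mapping.lookup (p m) l) M"
proof -
  let ?C = "{l :: 'd mono. mdeg l + mdeg M = n - 1}"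
  have "pairing (G.val (n - 1) (G.q_fun p)) M = (\<Sum>m\<in>monoms (n - 1). \<Sum>l\<in>?C. (\<Sum>N\<in>monoms (n - 1). Qk m N * Poly_Mapping.lookup (p N) l) * ft (l + (M + m) + ei i1))"
    unfolding pairing_val unfolding pairing_def
  proof (rule sum.cong[OF refl], rule sum.cong)
    fix m :: "'d mono" assume m: "m \<in> monoms (n - 1)"
    show "{l. mdeg l + mdeg (M + m) = 2 * n - 2} = ?C" using m n2' by (auto simp: mdeg_add monoms_def)
    fix l show "Poly_Mapping.lookup (G.q_fun p m) l * ft (l + (M + m) + ei i1) = (\<Sum>N\<in>monoms (n - 1). Qk m N * Poly_Mapping.lookup (p N) l) * ft (l + (M + m) + ei i1)"
      using m by (simp add: G.q_fun_def lookup_sum)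
  qed
  also have "\<dots> = (\<Sum>l\<in>?C. \<Sum>m\<in>monoms (n - 1). \<Sum>N\<in>monoms (n - 1). Poly_Mapping.lookup (p N) l * (Qk m N * ft (m + (l + M) + ei i1)))"
    by (subst sum.swap) (simp add: sum_distrib_right sum_distrib_left mult_ac add_ac)
  also have "\<dots> = (\<Sum>l\<in>?C. c * Poly_Mapping.lookup (p (l + M)) l)"
  proof (rule sum.cong[OF refl])
    fix l assume "l \<in> ?C"
    hence lM: "l + M \<in> monoms (n - 1)" by (simp add: monoms_def mdeg_add)
    have "(\<Sum>m\<in>monoms (n - 1). \<Sum>N\<in>monoms (n - 1). Poly_Mapping.lookup (p N) l * (Qk m N * ft (m + (l + M) + ei i1)))
      = (\<Sum>N\<in>monoms (n - 1). Poly_Mapping.lookup (p N) l * (if l + M = N then c else 0))"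
      by (subst sum.swap) (simp add: sum_distrib_left[symmetric] pqk[OF lM])
    thus "(\<Sum>m\<in>monoms (n - 1). \<Sum>N\<in>monoms (n - 1). Poly_Mapping.lookup (p N) l * (Qk m N * ft (m + (l + M) + ei i1))) = c * Poly_Mapping.lookup (p (l + M)) l"
      using lM by (simp add: if_distrib[of "\<lambda>x. _ * x"] mult.commute cong: if_cong)
  qed
  finally show ?thesis by (simp add: mcon_def sum_distrib_left)
qed

lemma latG_1D:
  fixes z :: "'d coord \<Rightarrow> ('d, 'k) S"
  assumes "z \<in> latG n 1"
  shows "ext0 0 (n - 1) (Kpart z)" "eta (Kpart z) = (\<lambda>_ _. 0)" "ext0 0 n (Lpart z)" "kappa (Lpart z) = (\<lambda>_ _. 0)"
    "z One = 0" "\<And>A. z (WC A) = 0"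
  using assms d3 by (simp_all add: latG_def)

text \<open>Contracting \<Phi> by x_1 q(k) gives \<delta> x_1(k), which is zero because k involves
  no x_1. Contracting it by x_1 q(v(\<Phi>~)) gives \<delta> v(\<Phi>), which cancels the
  contribution of \<delta> v.\<close>

lemma pairing_bfirst:
  assumes z: "z \<in> latG n 1"
  shows "pairing (G.bfirst z One) M = 0"
proof -
  let ?L = "Lpart z {}" and ?C = "{l :: 'd mono. mdeg l + mdeg (M + ei i1) = n - 1}"
  have "pairing (G.val n ?L) M = (\<Sum>m\<in>monoms n. \<Sum>l\<in>?C. Poly_Mapping.lookup (?L m) l * ft (l + (M + m) + ei i1))"
    unfolding pairing_val unfolding pairing_def
  proof (rule sum.cong[OF refl], rule sum.cong)
    fix m :: "'d mono" assume m: "m \<in> monoms n"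
    show "{l. mdeg l + mdeg (M + m) = 2 * n - 2} = ?C" using m n2' by (auto simp: mdeg_add monoms_def)
  qed simp
  also have "\<dots> = (\<Sum>l\<in>?C. \<Sum>m\<in>monoms n. Poly_Mapping.lookup (?L m) l * ft (m + (l + (M + ei i1))))"
    by (subst sum.swap) (simp add: add_ac)
  finally have 1: "pairing (G.val n ?L) M = (\<Sum>l\<in>?C. \<Sum>m\<in>monoms n. Poly_Mapping.lookup (?L m) l * ft (m + (l + (M + ei i1))))" .
  have "Poly_Mapping.lookup (G.Dz z {} (l + (M + ei i1))) l = - (\<Sum>m\<in>monoms n. Poly_Mapping.lookup (?L m) l * ft (m + (l + (M + ei i1))))" for l
  proof -
    have "Kpart z {} (l + (M + ei i1)) = 0"
      by (rule ext0_D[OF latG_1D(1)[OF z]]) (simp add: monoms0_def lookup_add lookup_ei)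
    thus ?thesis by (simp add: G.Dz_def act_def lookup_minus lookup_sum mult.commute[of _ "constS _"] mult.commute[of "ft _"])
  qed
  hence 2: "pairing (G.val (n - 1) (G.Uz z {})) (M + ei i1) = - c * pairing (G.val n ?L) M"
    unfolding G.Uz_def pairing_val_q_fun mcon_def 1 by (simp add: sum_negf)
  show ?thesis by (simp add: G.bfirst_def pairing_add pairing_constS pairing_Xs 2)
qed

lemma ext0_0: assumes "ext0 0 b w" shows "eta w = (\<lambda>_ _. 0)" "kappa w = (\<lambda>_ _. 0)" "KosX X w = (\<lambda>_ _. 0)"
proof -
  have "w (insert j B) m = 0" for j B m by (rule ext0_D[OF assms]) simp
  thus "eta w = (\<lambda>_ _. 0)" "kappa w = (\<lambda>_ _. 0)" "KosX X w = (\<lambda>_ _. 0)"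
    by (auto simp: fun_eq_iff eta_sum kappa_sum KosX_def ext_contract_def coef_mul_def)
qed

text \<open>Modulo x_1 the map b_1 is c times the evaluation of the \<open>L\<close>-part. This
  supplies the augmentation condition for \<open>L_exact\<close> but none for the
  \<open>K\<close>-part; the latter comes from a modification w of z whose \<open>L\<close>-part is
  divisible by x_1.\<close>

lemma exact_first:
  assumes z: "z \<in> latG n 1" "G.bd 1 z = (\<lambda>_. 0)"
  shows "\<exists>y\<in>latG n (Suc 1). z = G.bd (Suc 1) y"
proof (rule exact_from_step[OF _ _ z])
  fix s z assume z: "z \<in> latG n 1" "G.bd 1 z = (\<lambda>_. 0)" and dg: "deg_lt_all (Suc s) z"
  note zz = latG_1D[OF z(1)]
  have bfirst: "G.bfirst z = (\<lambda>_. 0)" using z(2) by (simp add: G.bd_def)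
  have k1z: "kap1 (lookup2_bar (Kpart z)) = (\<lambda>_ _. 0)" "kap1 (lookup2_bar (Lpart z)) = (\<lambda>_ _. 0)"
    by (intro ext, clarify, subst lookup2_bar_KosX, auto intro: ext0_D[OF zz(1)] ext0_D[OF zz(3)] simp: ext0_0(3)[OF zz(1)] ext0_0(3)[OF zz(3)] lookup2_def)+
  have ms: "msum (lookup2_bar (Lpart z) {}) = (\<lambda>_. 0)"
  proof
    fix N
    show "msum (lookup2_bar (Lpart z) {}) N = 0"
    proof (cases "Poly_Mapping.lookup N i1 = 0")
      case False
      have "lookup2_bar (Lpart z) {} p = 0" if "p \<in> {(l, m). l + m = N}" for p
      proof (rule ccontr)
        obtain l m where p: "p = (l, m)" by (cases p)
        assume "lookup2_bar (Lpart z) {} p \<noteq> 0"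
        hence "Poly_Mapping.lookup l i1 = 0" "m \<in> monoms0 n" using lookup2_bar_sup0[OF zz(3)] unfolding p sup0_def by blast+
        thus False using that False by (auto simp: p monoms0_def lookup_add)
      qed
      thus ?thesis unfolding msum_def by (intro sum.neutral ballI)
    next
      case True
      have "0 = Poly_Mapping.lookup (G.bfirst z One) N" by (simp add: bfirst)
      also have "\<dots> = c * Poly_Mapping.lookup (G.val n (Lpart z {})) N"
        by (simp add: G.bfirst_def lookup_add lookup_Xs_mult_0[OF True])
      finally have "0 = (\<Sum>m\<in>monoms n. if \<exists>l'. N = l' + m then Poly_Mapping.lookup (Lpart z {} m) (N - m) else 0)"
        using c0 by (simp add: G.val_def lookup_sum lookup_mult_Xp)
      also have "\<dots> = (\<Sum>m | m \<in> monoms n \<and> (\<exists>l'. N = l' + m). Poly_Mapping.lookup (Lpart z {} m) (N - m))"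
        by (intro sum.mono_neutral_cong_right) auto
      also have "\<dots> = (\<Sum>p | p \<in> {(l, m). l + m = N} \<and> snd p \<in> monoms n. lookup2_bar (Lpart z) {} p)"
      proof (rule sum.reindex_bij_witness[of _ snd "\<lambda>m. (N - m, m)"], goal_cases)
        case (5 m)
        then have "Poly_Mapping.lookup (N - m) i1 = 0" using True by (simp add: lookup_minus)
        thus ?case by (simp add: lookup2_bar_def)
      qed auto
      also have "\<dots> = msum (lookup2_bar (Lpart z) {}) N"
        unfolding msum_def
      proof (rule sum.mono_neutral_left[OF finite_add_eq])
        show "\<forall>p\<in>{(l, m). l + m = N} - {p \<in> {(l, m). l + m = N}. snd p \<in> monoms n}. lookup2_bar (Lpart z) {} p = 0"
        proof
          fix p assume p: "p \<in> {(l, m). l + m = N} - {p \<in> {(l, m). l + m = N}. snd p \<in> monoms n}"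
          obtain l m where lm: "p = (l, m)" by (cases p)
          have "Lpart z {} m = 0" by (rule ext0_D[OF zz(3)]) (use p in \<open>simp add: lm monoms0_def\<close>)
          thus "lookup2_bar (Lpart z) {} p = 0" by (simp add: lm lookup2_bar_def)
        qed
      qed auto
      finally show ?thesis by simp
    qed
  qed
  have "\<exists>Y. sup0 (Suc 0) n Y \<and> kap2 Y = (\<lambda>_ _. 0) \<and> lookup2_bar (Lpart z) = kap1 Y"
    by (rule L_exact[OF lookup2_bar_sup0[OF zz(3)] lookup2_bar_ker(2)[OF zz(4)] k1z(2) ms])
  then obtain YL where YL: "sup0 (Suc 0) n YL" "kap2 YL = (\<lambda>_ _. 0)" "\<And>A p. lookup2_bar (Lpart z) A p = c * kap1 YL A p"
    using scale_preimage by metis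
  define zL where "zL = of_KL (\<lambda>_ _. 0) (Lpart z)"
  have "deg_lt_all (Suc s) zL" unfolding deg_lt_all_def
  proof
    fix k show "deg_lt (Suc s) (zL k)" using dg by (cases k) (simp_all add: zL_def deg_lt_0 deg_lt_all_def Lpart_def)
  qed
  hence "\<exists>y\<in>latG n (Suc (Suc 0)). deg_lt_all (Suc s) (G.bd (Suc (Suc 0)) y) \<and> bar0 (\<lambda>k. zL k - G.bd (Suc (Suc 0)) y k)"
    by (intro lift[where YK="\<lambda>_ _. 0" and YL=YL]) (use YL d3 in \<open>simp_all add: zL_def sup0_def lookup2_bar_def case_prod_beta\<close>)
  then obtain y where y: "y \<in> latG n (Suc (Suc 0))" "bar0 (\<lambda>k. zL k - G.bd (Suc (Suc 0)) y k)" by blast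
  \<comment> \<open>Only the \<open>L\<close>-part of z has been lifted, so modulo x_1 the
    \<open>K\<close>-part of w is still that of z.\<close>
  define w where "w = (\<lambda>k. z k - G.bd (Suc (Suc 0)) y k)"
  have by': "G.bd (Suc (Suc 0)) y \<in> latG n 1" using G.bd_closed[OF y(1) _ d3] by (simp add: One_nat_def)
  have w: "w \<in> latG n 1" using latG_lin[OF by' z(1), of "-1"] by (simp add: w_def)
  note ww = latG_1D[OF w]
  have "G.bd 1 (G.bd (Suc (Suc 0)) y) = (\<lambda>_. 0)"
    using G.bd_bd[of y 1, unfolded One_nat_def, OF y(1) _ d3] by (simp add: One_nat_def)
  hence "G.bd 1 w = (\<lambda>_. 0)"
    using G.bd_lin[of 1 "-1" "G.bd (Suc (Suc 0)) y" z] z(2) by (intro ext) (simp add: w_def)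
  hence bfw: "G.bfirst w One = 0" by (simp add: G.bd_def)
  have Kw: "Poly_Mapping.lookup (Kpart w A m) l = Poly_Mapping.lookup (Kpart z A m) l" if "Poly_Mapping.lookup l i1 = 0" for A m l
    using y(2)[unfolded bar0_def, rule_format, OF that, of "KC A m"] by (simp add: Kpart_def w_def zL_def lookup_minus)
  have Lw: "Poly_Mapping.lookup (Lpart w A m) l = 0" if "Poly_Mapping.lookup l i1 = 0" for A m l
    using y(2)[unfolded bar0_def, rule_format, OF that, of "LC A m"] by (simp add: Lpart_def w_def zL_def)
  define v where "v = of_KL (\<lambda>_ _. 0) (\<lambda>A m. divX i1 (Lpart w A m))"
  have Lv: "Lpart w A m = Xs i1 * Lpart v A m" for A m
    unfolding v_def of_KL_simps by (rule Xs_divX[symmetric]) (rule Lw)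
  have v: "v \<in> latG n 1"
  proof -
    have e: "ext0 0 n (Lpart v)" unfolding ext0_def v_def of_KL_simps
      using ww(3) unfolding ext0_def by (metis divX_0)
    from ext0_0(2)[OF e] show ?thesis using e d3 by (simp add: latG_def ext0_zero v_def)
  qed
  have Dw: "G.Dz w {} = (\<lambda>m. Xs i1 * G.Dz v {} m + Kpart w {} m)"
  proof
    fix m
    have "act n (Lpart w {}) (\<lambda>m. constS (ft m)) m = Xs i1 * act n (Lpart v {}) (\<lambda>m. constS (ft m)) m"
      unfolding Lv by (rule lin_op_scale[OF lin_op_act])
    moreover have "Kpart v {} m = 0" by (simp add: v_def)
    ultimately show "G.Dz w {} m = Xs i1 * G.Dz v {} m + Kpart w {} m" by (simp add: G.Dz_def algebra_simps)
  qed
  have Uw: "G.Uz w {} = (\<lambda>M. Xs i1 * G.Uz v {} M + G.q_fun (Kpart w {}) M)"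
    unfolding G.Uz_def Dw by (intro ext) (rule lin_opD[OF G.lin_op_q_fun])
  \<comment> \<open>Now all of b_1(w) is visibly a multiple of x_1. Cancelling x_1 exposes the
    \<open>K\<close>-part, and \<open>pairing\<close> removes the remaining b_1(v).\<close>
  have "Xs i1 * (G.bfirst v One + G.val (n - 1) (G.q_fun (Kpart w {}))) = G.bfirst w One"
    unfolding G.bfirst_def Uw Lv[abs_def] lin_opD[OF G.lin_op_val] G.val_scale by (simp add: algebra_simps)
  hence "G.bfirst v One + G.val (n - 1) (G.q_fun (Kpart w {})) = 0" using bfw by (metis Xs_cancel)
  hence "pairing (G.val (n - 1) (G.q_fun (Kpart w {}))) N = 0" for N
    using pairing_bfirst[OF v, of N] pairing_add[of "G.bfirst v One" "G.val (n - 1) (G.q_fun (Kpart w {}))" N] by simp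
  hence mc: "mcon (n - 1) (\<lambda>(l, m). Poly_Mapping.lookup (Kpart w {} m) l) N = 0" for N
    using c0 by (simp add: pairing_val_q_fun)
  have "mcon (n - 1) (lookup2_bar (Kpart z) {}) = (\<lambda>_. 0)"
  proof
    fix N
    have "lookup2_bar (Kpart z) {} (l, l + N) = Poly_Mapping.lookup (Kpart w {} (l + N)) l" for l
    proof (cases "Poly_Mapping.lookup l i1 = 0")
      case True thus ?thesis by (simp add: lookup2_bar_def Kw)
    next
      case False
      have "Kpart w {} (l + N) = 0" by (rule ext0_D[OF ww(1)]) (use False in \<open>simp add: monoms0_def lookup_add\<close>)
      thus ?thesis using False by (simp add: lookup2_bar_def)
    qed
    thus "mcon (n - 1) (lookup2_bar (Kpart z) {}) N = 0" using mc[of N] by (simp add: mcon_def)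
  qed
  hence "\<exists>Y. sup0 (Suc 0) (n - 1) Y \<and> eta2 Y = (\<lambda>_ _. 0) \<and> lookup2_bar (Kpart z) = kap1 Y"
    by (intro K_exact[OF lookup2_bar_sup0[OF zz(1)] lookup2_bar_ker(1)[OF zz(2)] k1z(1)]) (use d3 in auto)
  then obtain YK where YK: "sup0 (Suc 0) (n - 1) YK" "eta2 YK = (\<lambda>_ _. 0)" "\<And>A p. lookup2_bar (Kpart z) A p = c * kap1 YK A p"
    using scale_preimage by metis
  \<comment> \<open>The element sought lifts both parts of z at once; w served only to obtain the
    augmentation condition.\<close>
  show "\<exists>y\<in>latG n (Suc 1). deg_lt_all (Suc s) (G.bd (Suc 1) y) \<and> bar0 (\<lambda>k. z k - G.bd (Suc 1) y k)"
    using lift[OF YK YL dg] zz d3 by (simp add: One_nat_def)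
qed simp

lemma exact:
  assumes r: "r \<ge> 1" and z: "z \<in> latG n r" "G.bd r z = (\<lambda>_. 0)"
  shows "\<exists>y\<in>latG n (Suc r). z = G.bd (Suc r) y"
proof -
  consider "r = 1" | "2 \<le> r" "Suc r < CARD('d)" | "2 \<le> r" "Suc r = CARD('d)" | "r = CARD('d)" | "r > CARD('d)" using r by linarith
  thus ?thesis
  proof cases
    case 1 thus ?thesis using exact_first z by simp
  next
    case 2
    hence "r = Suc (Suc (r - 2))" by simp
    then obtain a where "r = Suc (Suc a)" by blast
    thus ?thesis using exact_mid[of a z] 2 z by simp
  next
    case 3
    hence "r = Suc (r - 1)" by simp
    then obtain a where "r = Suc a" by blast
    thus ?thesis using exact_top[of a z] 3 z by simp
  next
    case 4 thus ?thesis using exact_last z by simp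
  next
    case 5
    hence "z = (\<lambda>_. 0)" using z(1) by (simp add: latG_def)
    thus ?thesis by (intro bexI[of _ "\<lambda>_. 0"]) (simp_all add: zero_latG G.bd_zero)
  qed
qed

section \<open>The ideal that is the image of b_1\<close>

definition im_bd1 :: "('d, 'k) S set" where
  "im_bd1 = {G.bd 1 z One | z. z \<in> latG n 1}"

lemma im_bd1_lin: "f \<in> im_bd1 \<Longrightarrow> g \<in> im_bd1 \<Longrightarrow> e * f + g \<in> im_bd1"
  unfolding im_bd1_def by (clarsimp simp: G.bd_lin[symmetric]) (metis latG_lin)
lemma im_bd1_0: "0 \<in> im_bd1"
proof -
  have "G.bd 1 (\<lambda>_. 0) One = 0" by (simp add: G.bd_zero)
  thus ?thesis unfolding im_bd1_def using zero_latG by (smt (verit) mem_Collect_eq)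
qed
lemma im_bd1_mult: "f \<in> im_bd1 \<Longrightarrow> e * f \<in> im_bd1" using im_bd1_lin[OF _ im_bd1_0] by simp
lemma im_bd1_add: "f \<in> im_bd1 \<Longrightarrow> g \<in> im_bd1 \<Longrightarrow> f + g \<in> im_bd1" using im_bd1_lin[of f g 1] by simp
lemma im_bd1_diff: "f \<in> im_bd1 \<Longrightarrow> g \<in> im_bd1 \<Longrightarrow> f - g \<in> im_bd1" using im_bd1_lin[of g f "-1"] by simp
lemma im_bd1_sum: "(\<And>i. i \<in> C \<Longrightarrow> f i \<in> im_bd1) \<Longrightarrow> sum f C \<in> im_bd1"
  by (induct C rule: infinite_finite_induct) (auto simp: im_bd1_0 im_bd1_add)

lemma im_bd1_pairing: "f \<in> im_bd1 \<Longrightarrow> pairing f M = 0"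
  unfolding im_bd1_def using pairing_bfirst by (auto simp: G.bd_def)

lemma im_bd1_gen1: assumes "M \<in> monoms0 (n - 1)" shows "Xs i1 * G.q_dual M \<in> im_bd1"
proof -
  define z :: "'d coord \<Rightarrow> ('d, 'k) S" where "z = of_KL (ind2 {} M) (\<lambda>_ _. 0)"
  have e: "ext0 0 (n - 1) (Kpart z)" "ext0 0 n (Lpart z)"
    unfolding z_def of_KL_simps by (rule ext0_ind2) (use assms in \<open>simp_all add: Qset_def ext0_zero\<close>)
  have z: "z \<in> latG n 1" using e ext0_0(1)[OF e(1)] ext0_0(2)[OF e(2)] d3 by (simp add: latG_def z_def)
  have M: "M \<in> monoms (n - 1)" using assms by (simp add: monoms0_def)
  have "G.Uz z {} = (\<lambda>N. if N \<in> monoms (n - 1) then constS (Qk N M) else 0)"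
    using M unfolding G.Uz_def G.Dz_def G.q_fun_def
    by (intro ext) (auto simp: z_def ind2_def act_def if_distrib[of "\<lambda>x. _ * x"] cong: if_cong)
  hence "G.bd 1 z One = Xs i1 * G.q_dual M"
    using M by (simp add: G.bd_def G.bfirst_def G.q_dual_def G.val_def z_def)
  thus ?thesis unfolding im_bd1_def using z by force
qed

lemma im_bd1_gen2: assumes "m \<in> monoms0 n" shows "G.L_gen m \<in> im_bd1"
proof -
  define z :: "'d coord \<Rightarrow> ('d, 'k) S" where "z = of_KL (\<lambda>_ _. 0) (ind2 {} m)"
  have e: "ext0 0 (n - 1) (Kpart z)" "ext0 0 n (Lpart z)"
    unfolding z_def of_KL_simps by (simp add: ext0_zero, rule ext0_ind2, use assms in \<open>simp add: Qset_def\<close>)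
  have z: "z \<in> latG n 1" using e ext0_0(1)[OF e(1)] ext0_0(2)[OF e(2)] d3 by (simp add: latG_def z_def)
  have m: "m \<in> monoms n" using assms by (simp add: monoms0_def)
  have D: "G.Dz z {} N = - constS (ft (m + N))" for N
    using m by (simp add: G.Dz_def z_def act_def ind2_def if_distrib[of "\<lambda>x. x * _"] cong: if_cong)
  have "G.val (n - 1) (G.Uz z {}) = (\<Sum>M\<in>monoms (n - 1). \<Sum>N\<in>monoms (n - 1). - (constS (Qk M N) * constS (ft (m + N)) * G.Xp M))"
    unfolding G.val_def G.Uz_def G.q_fun_def by (simp add: D sum_distrib_right sum_negf)
  also have "\<dots> = - act (n - 1) G.q_dual (\<lambda>m. constS (ft m)) m"
    by (subst sum.swap) (simp add: act_def G.q_dual_def sum_distrib_right sum_distrib_left sum_negf mult_ac add.commute)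
  finally have "G.bd 1 z One = G.L_gen m"
    using m assms by (simp add: G.bd_def G.bfirst_def G.L_gen_def G.val_def[of n] z_def ind2_def if_distrib[of "\<lambda>x. x * _"] cong: if_cong)
  thus ?thesis unfolding im_bd1_def using z by force
qed

definition low_form where "low_form g = (\<Sum>M\<in>monoms (n - 1). constS (g M) * G.Xp M)"

lemma low_form_sum: "low_form (\<lambda>N. \<Sum>M\<in>C. g M * h M N) = (\<Sum>M\<in>C. constS (g M) * low_form (h M))"
  by (simp add: low_form_def constS.hom_sum constS.hom_mult sum_distrib_right sum_distrib_left mult_ac) (rule sum.swap)

text \<open>For a monomial without x_1 the generator \<open>L_gen\<close> is c times the monomial
  minus x_1 times a form of degree n - 1. Any other monomial of degree n contains x_1
  already.\<close>

lemma Xp_reduce_n: assumes "l \<in> monoms n" shows "\<exists>g. G.Xp l - Xs i1 * low_form g \<in> im_bd1"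
proof (cases "Poly_Mapping.lookup l i1 = 0")
  case False
  then obtain M where M: "l = M + ei i1" using diff_ei_add[of i1 l] by (metis in_keys_iff)
  have "M \<in> monoms (n - 1)" using assms by (simp add: M monoms_def mdeg_add)
  hence "low_form (\<lambda>N. if N = M then 1 else 0) = G.Xp M"
    by (simp add: low_form_def if_distrib[of constS] if_distrib[of "\<lambda>x. x * _"] cong: if_cong)
  hence "G.Xp l - Xs i1 * low_form (\<lambda>N. if N = M then 1 else 0) = 0" by (simp add: M G.Xp_add_ei)
  thus ?thesis using im_bd1_0 by (intro exI[of _ "\<lambda>N. if N = M then 1 else 0"]) (simp only:)
next
  case True
  hence l: "l \<in> monoms0 n" using assms by (simp add: monoms0_def)
  define h where "h = (\<lambda>N. \<Sum>M\<in>monoms (n - 1). Qk N M * ft (M + l))"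
  have "act (n - 1) G.q_dual (\<lambda>m. constS (ft m)) l = low_form h"
    unfolding act_def low_form_def G.q_dual_def h_def
    by (simp add: sum_distrib_right constS.hom_sum constS.hom_mult, subst sum.swap, simp add: mult_ac)
  hence "G.L_gen l = constS c * G.Xp l - Xs i1 * low_form h" using l by (simp add: G.L_gen_def)
  hence "constS (inverse c) * (constS c * G.Xp l - Xs i1 * low_form h) \<in> im_bd1" using im_bd1_mult[OF im_bd1_gen2[OF l]] by simp
  moreover have "constS (inverse c) * constS c = (1 :: ('d, 'k) S)" using c0 by (simp flip: constS.hom_mult)
  \<comment> \<open>Over a one-element index set \<open>low_form_sum\<close> becomes the rule for a
    scalar factor.\<close>
  moreover have "low_form (\<lambda>N. \<Sum>u\<in>{()}. inverse c * h N) = constS (inverse c) * low_form h"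
    unfolding low_form_sum[of "\<lambda>_. inverse c" "\<lambda>_. h"] by simp
  moreover have "constS (inverse c) * (constS c * G.Xp l - Xs i1 * low_form h) =
    (constS (inverse c) * constS c) * G.Xp l - Xs i1 * (constS (inverse c) * low_form h)" by (simp add: algebra_simps)
  ultimately have "G.Xp l - Xs i1 * low_form (\<lambda>N. \<Sum>u\<in>{()}. inverse c * h N) \<in> im_bd1" by simp
  thus ?thesis by (rule exI[of _ "\<lambda>N. \<Sum>u\<in>{()}. inverse c * h N"])
qed

text \<open>Splitting off one variable x_i and using the induction leaves a power of x_1 times x_i
  times a form of degree n - 1. Each x_i M in it has degree n and yields one further factor
  x_1.\<close>

lemma Xp_reduce: "mdeg l = n + t \<Longrightarrow> \<exists>g. G.Xp l - Xs i1 ^ Suc t * low_form g \<in> im_bd1"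
proof (induction t arbitrary: l)
  case 0
  thus ?case using Xp_reduce_n[of l] by (simp add: monoms_def)
next
  case (Suc t)
  hence "l \<noteq> 0" by (auto simp: mdeg_def)
  then obtain i where "i \<in> Poly_Mapping.keys l" using keys_eq_empty by blast
  then obtain l' where l': "l = l' + ei i" using diff_ei_add by metis
  have "mdeg l' = n + t" using Suc.prems by (simp add: l' mdeg_add)
  then obtain g where g: "G.Xp l' - Xs i1 ^ Suc t * low_form g \<in> im_bd1" using Suc.IH by blast
  have "\<forall>M. \<exists>h. M \<in> monoms (n - 1) \<longrightarrow> G.Xp (M + ei i) - Xs i1 * low_form h \<in> im_bd1"
    using Xp_reduce_n n2' by (auto simp: monoms_def mdeg_add)
  then obtain h where h: "\<And>M. M \<in> monoms (n - 1) \<Longrightarrow> G.Xp (M + ei i) - Xs i1 * low_form (h M) \<in> im_bd1" by metis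
  define h' where "h' = (\<lambda>N. \<Sum>M\<in>monoms (n - 1). g M * h M N)"
  have "Xs i * (G.Xp l' - Xs i1 ^ Suc t * low_form g) + Xs i1 ^ Suc t * (\<Sum>M\<in>monoms (n - 1). constS (g M) * (G.Xp (M + ei i) - Xs i1 * low_form (h M))) \<in> im_bd1"
    by (intro im_bd1_add im_bd1_mult im_bd1_sum g h)
  also have "Xs i1 ^ Suc t * (\<Sum>M\<in>monoms (n - 1). constS (g M) * (G.Xp (M + ei i) - Xs i1 * low_form (h M)))
    = Xs i1 ^ Suc t * (Xs i * low_form g - Xs i1 * low_form h')"
    unfolding h'_def low_form_sum unfolding low_form_def[of g]
    by (simp add: right_diff_distrib sum_subtractf G.Xp_add_ei sum_distrib_left mult_ac)
  finally have "G.Xp l - Xs i1 ^ Suc (Suc t) * low_form h' \<in> im_bd1"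
    by (simp add: l' G.Xp_add_ei algebra_simps)
  thus ?case by (rule exI[of _ h'])
qed

lemma expand_Xp: "f = (\<Sum>l\<in>Poly_Mapping.keys f. constS (Poly_Mapping.lookup f l) * G.Xp l)"
proof -
  have "constS e * G.Xp l = Poly_Mapping.single l e" for e l by (simp add: Xp_single constS_def mult_single)
  thus ?thesis using poly_mapping_expand[of f] by simp
qed

lemma homog_reduce: assumes "homogS (int (n + t)) f" shows "\<exists>g. f - Xs i1 ^ Suc t * low_form g \<in> im_bd1"
proof -
  have "\<forall>l. \<exists>h. l \<in> Poly_Mapping.keys f \<longrightarrow> G.Xp l - Xs i1 ^ Suc t * low_form h \<in> im_bd1"
    using assms Xp_reduce unfolding homogS_def by (metis of_nat_eq_iff)
  then obtain h where h: "\<And>l. l \<in> Poly_Mapping.keys f \<Longrightarrow> G.Xp l - Xs i1 ^ Suc t * low_form (h l) \<in> im_bd1" by metis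
  have "(\<Sum>l\<in>Poly_Mapping.keys f. constS (Poly_Mapping.lookup f l) * (G.Xp l - Xs i1 ^ Suc t * low_form (h l))) \<in> im_bd1"
    by (intro im_bd1_sum im_bd1_mult h)
  also have "(\<Sum>l\<in>Poly_Mapping.keys f. constS (Poly_Mapping.lookup f l) * (G.Xp l - Xs i1 ^ Suc t * low_form (h l))) = f - Xs i1 ^ Suc t * low_form (\<lambda>N. \<Sum>l\<in>Poly_Mapping.keys f. Poly_Mapping.lookup f l * h l N)"
    unfolding low_form_sum using expand_Xp[of f] by (simp add: right_diff_distrib sum_subtractf sum_distrib_left mult_ac)
  finally show ?thesis by (rule exI[of _ "\<lambda>N. \<Sum>l\<in>Poly_Mapping.keys f. Poly_Mapping.lookup f l * h l N"])
qed

text \<open>The identity \<delta> g = q(g(\<Phi>)), expanded along the dual monomials.\<close>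

lemma low_form_q_dual:
  "constS c * low_form g = (\<Sum>N\<in>monoms (n - 1). constS (\<Sum>M\<in>monoms (n - 1). g M * ft (M + N + ei i1)) * G.q_dual N)"
proof -
  define \<nu> where "\<nu> N = (\<Sum>M\<in>monoms (n - 1). g M * ft (M + N + ei i1))" for N
  have 1: "(\<Sum>N\<in>monoms (n - 1). \<nu> N * Qk M N) = c * g M" if M: "M \<in> monoms (n - 1)" for M
  proof -
    have "(\<Sum>N\<in>monoms (n - 1). \<nu> N * Qk M N) = (\<Sum>K\<in>monoms (n - 1). g K * (\<Sum>N\<in>monoms (n - 1). Qk M N * ft (N + K + ei i1)))"
      by (simp add: \<nu>_def sum_distrib_right sum_distrib_left, subst sum.swap, simp add: mult_ac add_ac)
    also have "\<dots> = (\<Sum>K\<in>monoms (n - 1). g K * (if M = K then c else 0))"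
      by (rule sum.cong) (simp_all add: qpk[OF M])
    finally show ?thesis using M by (simp add: if_distrib[of "\<lambda>x. _ * x"] mult.commute cong: if_cong)
  qed
  have "(\<Sum>N\<in>monoms (n - 1). constS (\<nu> N) * G.q_dual N) =
    (\<Sum>M\<in>monoms (n - 1). constS (\<Sum>N\<in>monoms (n - 1). \<nu> N * Qk M N) * G.Xp M)"
    unfolding G.q_dual_def
    by (simp add: sum_distrib_left constS.hom_sum constS.hom_mult sum_distrib_right, subst sum.swap, simp add: mult_ac)
  also have "\<dots> = (\<Sum>M\<in>monoms (n - 1). constS (c * g M) * G.Xp M)" by (rule sum.cong) (simp_all add: 1)
  also have "\<dots> = constS c * low_form g" by (simp add: low_form_def constS.hom_mult sum_distrib_left mult_ac)
  finally show ?thesis by (simp add: \<nu>_def)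
qed

lemma pairing_constS_Xp: "pairing (constS e * G.Xp M) P = (if mdeg M + mdeg P = 2 * n - 2 then e * ft (M + P + ei i1) else 0)"
proof -
  have "constS e * G.Xp M = Poly_Mapping.single M e" by (simp add: Xp_single constS_def mult_single)
  hence "pairing (constS e * G.Xp M) P = (\<Sum>l | mdeg l + mdeg P = 2 * n - 2. if l = M then e * ft (M + P + ei i1) else 0)"
    unfolding pairing_def by (intro sum.cong) (auto simp: lookup_single when_def)
  thus ?thesis by (simp add: finite_mdeg_add_eq)
qed

lemma Xs_power: "Xs i ^ k = G.Xp (Poly_Mapping.single i k)"
proof (induct k)
  case (Suc k)
  have "Poly_Mapping.single i (Suc k) = Poly_Mapping.single i k + ei i" by (simp add: ei_def Suc_eq_plus1 flip: single_add)
  thus ?case by (simp add: Suc G.Xp_add_ei)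
qed (simp add: G.Xp_def)

text \<open>Modulo the image of \<open>b\<^sub>1\<close> one may take \<open>f = x\<^sub>1\<^bsup>t+1\<^esup> g\<close> with \<open>g\<close> a form of degree \<open>n - 1\<close>; write \<open>\<delta> g\<close> as \<open>q\<close> of \<open>\<nu> = g(\<Phi>)\<close>.
  Annihilating \<open>\<Phi>\<close> forces \<open>\<nu>\<close> to vanish at the monomials divisible by \<open>x\<^sub>1\<^bsup>t+1\<^esup>\<close>.\<close>
lemma ann_in_im_bd1:
  assumes f: "homogS (int (n + t)) f" "\<And>M. pairing f M = 0"
    and T: "\<And>N. N \<in> monoms (n - 1) \<Longrightarrow> Poly_Mapping.lookup N i1 \<le> t \<Longrightarrow> Xs i1 ^ Suc t * G.q_dual N \<in> im_bd1"
  shows "f \<in> im_bd1"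
proof -
  obtain g where g: "f - Xs i1 ^ Suc t * low_form g \<in> im_bd1" using homog_reduce[OF f(1)] by blast
  define \<nu> where "\<nu> N = (\<Sum>M\<in>monoms (n - 1). g M * ft (M + N + ei i1))" for N
  have "constS (\<nu> N) * (Xs i1 ^ Suc t * G.q_dual N) \<in> im_bd1" if N: "N \<in> monoms (n - 1)" for N
  proof (cases "Poly_Mapping.lookup N i1 \<le> t")
    case True show ?thesis by (rule im_bd1_mult[OF T[OF N True]])
  next
    case False
    \<comment> \<open>Here N is divisible by the power t + 1 of x_1. The coefficient of \<nu> at N
      is therefore the value at P of the contraction by that power times g, which vanishes.\<close>
    define P where "P = N - Poly_Mapping.single i1 (Suc t)"
    have P: "P + Poly_Mapping.single i1 (Suc t) = N"
      by (rule poly_mapping_eqI) (use False in \<open>auto simp: P_def lookup_add lookup_minus lookup_single when_def\<close>)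
    have "pairing (Xs i1 ^ Suc t * low_form g) P = 0"
      using pairing_diff[of f "Xs i1 ^ Suc t * low_form g" P] im_bd1_pairing[OF g] f(2) by simp
    hence "pairing (low_form g) N = 0" unfolding Xs_power mult.commute[of "G.Xp _"] pairing_Xp P .
    moreover have "pairing (low_form g) N = \<nu> N"
      unfolding low_form_def pairing_sum pairing_constS_Xp \<nu>_def using N n2' by (intro sum.cong) (auto simp: monoms_def)
    ultimately show ?thesis using im_bd1_0 by simp
  qed
  hence "(\<Sum>N\<in>monoms (n - 1). constS (\<nu> N) * (Xs i1 ^ Suc t * G.q_dual N)) \<in> im_bd1" by (rule im_bd1_sum)
  also have "(\<Sum>N\<in>monoms (n - 1). constS (\<nu> N) * (Xs i1 ^ Suc t * G.q_dual N)) = constS c * (Xs i1 ^ Suc t * low_form g)"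
  proof -
    have "constS c * (Xs i1 ^ Suc t * low_form g) = Xs i1 ^ Suc t * (\<Sum>N\<in>monoms (n - 1). constS (\<nu> N) * G.q_dual N)"
      unfolding \<nu>_def low_form_q_dual[symmetric] by (rule mult.left_commute)
    thus ?thesis by (simp add: sum_distrib_left mult_ac)
  qed
  finally have "constS (inverse c) * (constS c * (Xs i1 ^ Suc t * low_form g)) \<in> im_bd1" by (rule im_bd1_mult)
  moreover have "constS (inverse c) * constS c = (1 :: ('d, 'k) S)" using c0 by (simp flip: constS.hom_mult)
  ultimately have "Xs i1 ^ Suc t * low_form g \<in> im_bd1" by (simp flip: mult.assoc)
  from im_bd1_add[OF g this] show ?thesis by simp
qed

lemma pairing_q_dual: assumes "N \<in> monoms (n - 1)" shows "pairing (G.q_dual N) P = (if P = N then c else 0)"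
proof -
  have "pairing (G.q_dual N) P = (\<Sum>M\<in>monoms (n - 1). if mdeg M + mdeg P = 2 * n - 2 then Qk M N * ft (M + P + ei i1) else 0)"
    using assms by (simp add: G.q_dual_def pairing_sum pairing_constS_Xp)
  also have "\<dots> = (\<Sum>M\<in>monoms (n - 1). if P \<in> monoms (n - 1) then Qk M N * ft (M + P + ei i1) else 0)"
    using n2' by (intro sum.cong) (auto simp: monoms_def)
  also have "\<dots> = (if P = N then c else 0)"
    using assms pqk[of P N] by (cases "P \<in> monoms (n - 1)") auto
  finally show ?thesis .
qed

text \<open>Induction on the exponent of x_1 in N = M x_1. With N' = M x_i for another index i, both
  x_i \<open>q_dual N'\<close> and x_1 \<open>q_dual N\<close> contract \<Phi> to c times the dual
  of M, so their difference e contracts it to zero. As e has degree n, \<open>ann_in_im_bd1\<close>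
  applies with t = 0, where its last assumption concerns only monomials free of x_1; hence there is
  no circularity.\<close>

lemma q_dual_in_im_bd1: "N \<in> monoms (n - 1) \<Longrightarrow> Xs i1 ^ Suc (Poly_Mapping.lookup N i1) * G.q_dual N \<in> im_bd1"
proof (induction "Poly_Mapping.lookup N i1" arbitrary: N)
  case 0
  thus ?case using im_bd1_gen1[of N] by (simp add: monoms0_def)
next
  case (Suc j)
  have "i1 \<in> Poly_Mapping.keys N" using Suc.hyps(2) by (simp add: in_keys_iff)
  then obtain M where M: "N = M + ei i1" using diff_ei_add by metis
  have "card (-{i1 :: 'd}) \<noteq> 0" using d3 by (simp add: card_Compl_i1)
  then obtain i :: 'd where i: "i \<noteq> i1" by auto
  define N' where "N' = M + ei i"
  have N': "N' \<in> monoms (n - 1)" "Poly_Mapping.lookup N' i1 = j"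
    using Suc.prems Suc.hyps(2) i by (auto simp: N'_def M monoms_def mdeg_add lookup_add lookup_ei)
  define e where "e = Xs i * G.q_dual N' - Xs i1 * G.q_dual N"
  have "e \<in> im_bd1"
  proof (rule ann_in_im_bd1[of 0])
    have "homogS (int n) (Xs i * G.q_dual N)" for i N using homogS_mult[OF homogS_Xs homogS_q_dual, of i N] n2' by (simp add: of_nat_diff)
    thus "homogS (int (n + 0)) e" unfolding e_def by (simp add: homogS_diff)
    show "pairing e P = 0" for P
      unfolding e_def pairing_diff pairing_Xs pairing_q_dual[OF N'(1)] pairing_q_dual[OF Suc.prems] by (simp add: N'_def M)
    fix K :: "'d mono" assume "K \<in> monoms (n - 1)" "Poly_Mapping.lookup K i1 \<le> 0"
    thus "Xs i1 ^ Suc 0 * G.q_dual K \<in> im_bd1" using im_bd1_gen1[of K] by (simp add: monoms0_def)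
  qed
  have "Xs i1 ^ Suc j * G.q_dual N' \<in> im_bd1" using Suc.hyps(1)[of N'] N' by simp
  from im_bd1_diff[OF im_bd1_mult[OF this, of "Xs i"] im_bd1_mult[OF \<open>e \<in> im_bd1\<close>, of "Xs i1 ^ Suc j"]]
  have "Xs i * (Xs i1 ^ Suc j * G.q_dual N') - Xs i1 ^ Suc j * e \<in> im_bd1" .
  also have "Xs i * (Xs i1 ^ Suc j * G.q_dual N') - Xs i1 ^ Suc j * e = Xs i1 ^ Suc (Suc j) * G.q_dual N"
    by (simp add: e_def algebra_simps)
  finally show ?case using Suc.hyps(2) by simp
qed

text \<open>Homogeneous components may be treated separately, because the value of the contraction
  at M depends only on the component of degree 2n - 2 - deg M. Components of degree below n vanish
  by assumption.\<close>

lemma image_b1: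
  assumes nz: "\<And>j f. j < n \<Longrightarrow> homogS (int j) f \<Longrightarrow> (\<And>M. pairing f M = 0) \<Longrightarrow> f = 0"
  shows "f \<in> im_bd1 \<longleftrightarrow> (\<forall>M. pairing f M = 0)"
proof
  assume ann: "\<forall>M. pairing f M = 0"
  obtain s where s: "deg_lt s f" using deg_lt_bound by blast
  define H where "H t = mkS (Suc t) (\<lambda>l. if mdeg l = t then Poly_Mapping.lookup f l else 0)" for t
  have lH: "Poly_Mapping.lookup (H t) l = (if mdeg l = t then Poly_Mapping.lookup f l else 0)" for t l
    by (simp add: H_def lookup_mkS)
  have "f = (\<Sum>t<s. H t)"
  proof (rule poly_mapping_eqI)
    fix l show "Poly_Mapping.lookup f l = Poly_Mapping.lookup (\<Sum>t<s. H t) l"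
      using s by (auto simp: lookup_sum lH deg_lt_def)
  qed
  moreover have "H t \<in> im_bd1" for t
  proof -
    have hom: "homogS (int t) (H t)" by (auto simp: homogS_def in_keys_iff lH split: if_splits)
    have c0: "pairing (H t) M = 0" for M
    proof -
      have "pairing (H t) M = (\<Sum>l | mdeg l + mdeg M = 2 * n - 2. if t + mdeg M = 2 * n - 2 then Poly_Mapping.lookup f l * ft (l + M + ei i1) else 0)"
        unfolding pairing_def lH by (rule sum.cong) auto
      also have "\<dots> = (if t + mdeg M = 2 * n - 2 then pairing f M else 0)" by (simp add: pairing_def)
      finally show ?thesis using ann by simp
    qed
    show ?thesis
    proof (cases "t < n")
      case True
      thus ?thesis using nz[OF True hom c0] im_bd1_0 by simp
    next
      case False
      then obtain u where u: "t = n + u" using le_Suc_ex not_less by blast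
      show ?thesis
      proof (rule ann_in_im_bd1[of u])
        show "homogS (int (n + u)) (H t)" using hom u by simp
        fix N :: "'d mono" assume N: "N \<in> monoms (n - 1)" "Poly_Mapping.lookup N i1 \<le> u"
        then obtain v where v: "Suc u = v + Suc (Poly_Mapping.lookup N i1)" by (metis add.commute add_Suc_right le_Suc_ex)
        show "Xs i1 ^ Suc u * G.q_dual N \<in> im_bd1"
          unfolding v power_add mult.assoc by (rule im_bd1_mult[OF q_dual_in_im_bd1[OF N(1)]])
      qed (rule c0)
    qed
  qed
  ultimately show "f \<in> im_bd1" using im_bd1_sum[of "{..<s}" H] by simp
qed (simp add: im_bd1_pairing)

end

section \<open>Evaluation homomorphisms\<close>

definition mon_val :: "('v \<Rightarrow> 's::comm_ring_1) \<Rightarrow> ('v \<Rightarrow>\<^sub>0 nat) \<Rightarrow> 's" where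
  "mon_val h w = (\<Prod>v\<in>Poly_Mapping.keys w. h v ^ Poly_Mapping.lookup w v)"

text \<open>One evaluation serves three maps: \<open>evalR\<close> with integer coefficients, the
  automorphism of S over \<open>constS\<close>, and the surjection onto the algebra.\<close>

definition evalP :: "('a::comm_ring_1 \<Rightarrow> 's::comm_ring_1) \<Rightarrow> ('v \<Rightarrow> 's) \<Rightarrow> (('v \<Rightarrow>\<^sub>0 nat) \<Rightarrow>\<^sub>0 'a) \<Rightarrow> 's" where
  "evalP cf h f = (\<Sum>w\<in>Poly_Mapping.keys f. cf (Poly_Mapping.lookup f w) * mon_val h w)"

lemma mon_val_superset:
  assumes "finite F" "Poly_Mapping.keys w \<subseteq> F"
  shows "mon_val h w = (\<Prod>v\<in>F. h v ^ Poly_Mapping.lookup w v)"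
  unfolding mon_val_def by (rule prod.mono_neutral_left[OF assms]) (auto simp: in_keys_iff)

lemma mon_val_add: "mon_val h (w + w') = mon_val h w * mon_val h w'"
proof -
  let ?F = "Poly_Mapping.keys w \<union> Poly_Mapping.keys w'"
  have F: "finite ?F" "Poly_Mapping.keys (w + w') \<subseteq> ?F" "Poly_Mapping.keys w \<subseteq> ?F" "Poly_Mapping.keys w' \<subseteq> ?F"
    using keys_add[of w w'] by auto
  show ?thesis unfolding mon_val_superset[OF F(1,2)] mon_val_superset[OF F(1,3)] mon_val_superset[OF F(1,4)]
    by (simp add: lookup_add power_add prod.distrib)
qed

lemma mon_val_0 [simp]: "mon_val h 0 = 1" by (simp add: mon_val_def)

lemma mon_val_single: "mon_val h (Poly_Mapping.single v k) = h v ^ k"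
  by (cases "k = 0") (simp_all add: mon_val_def)

lemma mon_val_UNIV: "mon_val h w = (\<Prod>v\<in>UNIV. h v ^ Poly_Mapping.lookup w v)" for w :: "'v::finite \<Rightarrow>\<^sub>0 nat"
  by (rule mon_val_superset) auto

context
  fixes cf :: "'a::comm_ring_1 \<Rightarrow> 's::comm_ring_1"
  assumes cf: "comm_ring_hom cf"
begin

interpretation cf: comm_ring_hom cf by (rule cf)

lemma evalP_superset:
  assumes "finite F" "Poly_Mapping.keys f \<subseteq> F"
  shows "evalP cf h f = (\<Sum>w\<in>F. cf (Poly_Mapping.lookup f w) * mon_val h w)"
  unfolding evalP_def by (rule sum.mono_neutral_left[OF assms]) (auto simp: in_keys_iff)

lemma evalP_add: "evalP cf h (f + g) = evalP cf h f + evalP cf h g"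
proof -
  let ?F = "Poly_Mapping.keys f \<union> Poly_Mapping.keys g"
  have F: "finite ?F" "Poly_Mapping.keys (f + g) \<subseteq> ?F" "Poly_Mapping.keys f \<subseteq> ?F" "Poly_Mapping.keys g \<subseteq> ?F"
    using keys_add[of f g] by auto
  show ?thesis unfolding evalP_superset[OF F(1,2)] evalP_superset[OF F(1,3)] evalP_superset[OF F(1,4)]
    by (simp add: lookup_add cf.hom_add distrib_right sum.distrib)
qed

lemma evalP_single: "evalP cf h (Poly_Mapping.single w e) = cf e * mon_val h w"
  by (cases "e = 0") (simp_all add: evalP_def)

lemma evalP_0: "evalP cf h 0 = 0" by (simp add: evalP_def)

lemma evalP_sum: "evalP cf h (sum f C) = (\<Sum>i\<in>C. evalP cf h (f i))"
  by (induct C rule: infinite_finite_induct) (auto simp: evalP_0 evalP_add)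

lemma poly_mapping_expand': "f = (\<Sum>m\<in>Poly_Mapping.keys f. Poly_Mapping.single m (Poly_Mapping.lookup f m))"
  for f :: "'m \<Rightarrow>\<^sub>0 'a"
  by (rule poly_mapping_eqI) (auto simp: lookup_sum lookup_single when_def in_keys_iff)

lemma evalP_mult: "evalP cf h (f * g) = evalP cf h f * evalP cf h g"
proof -
  have "f * g = (\<Sum>m\<in>Poly_Mapping.keys f. Poly_Mapping.single m (Poly_Mapping.lookup f m)) *
      (\<Sum>m\<in>Poly_Mapping.keys g. Poly_Mapping.single m (Poly_Mapping.lookup g m))"
    by (subst (1) poly_mapping_expand'[of f], subst (1) poly_mapping_expand'[of g]) (rule refl)
  also have "\<dots> = (\<Sum>m\<in>Poly_Mapping.keys f. \<Sum>m'\<in>Poly_Mapping.keys g.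
      Poly_Mapping.single (m + m') (Poly_Mapping.lookup f m * Poly_Mapping.lookup g m'))"
    by (simp add: sum_product mult_single)
  finally show ?thesis
    by (simp add: evalP_sum evalP_single cf.hom_mult mon_val_add)
      (simp add: evalP_def sum_product mult_ac)
qed

lemma evalP_hom: "comm_ring_hom (evalP cf h)"
proof
  show "evalP cf h 1 = 1" using evalP_single[of h 0 1] by simp
qed (simp_all add: evalP_add evalP_mult evalP_0)

end

lemma evalP_constS: "evalP constS h (constS c) = constS c" for c :: "'k::field"
  using evalP_single[OF comm_ring_hom_constS, of h 0 c] by (simp add: constS_def)

lemma evalP_Xs: "evalP constS h (Xs i) = (h i :: ('e, 'k::field) S)"
  unfolding Xs_def ei_def evalP_single[OF comm_ring_hom_constS] by (simp add: mon_val_single)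

lemma evalR_evalP: "evalR h = evalP of_int h"
  by (intro ext) (simp add: evalR_def evalP_def mon_val_def)

lemma comm_ring_hom_of_int: "comm_ring_hom (of_int :: int \<Rightarrow> 's::comm_ring_1)"
  by unfold_locales auto

lemma evalR_hom: "comm_ring_hom (evalR h)"
  unfolding evalR_evalP by (rule evalP_hom[OF comm_ring_hom_of_int])

lemma evalR_Xvar: "evalR h (Xvar i) = h (Inl i)"
  unfolding evalR_evalP Xvar_def evalP_single[OF comm_ring_hom_of_int] by (simp add: mon_val_single)
lemma evalR_Tvar: "evalR h (Tvar m) = h (Inr m)"
  unfolding evalR_evalP Tvar_def evalP_single[OF comm_ring_hom_of_int] by (simp add: mon_val_single)

lemma hom_evalR: assumes "comm_ring_hom \<sigma>" shows "\<sigma> (evalR h P) = evalR (\<lambda>v. \<sigma> (h v)) P"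
proof -
  interpret s: comm_ring_hom \<sigma> by fact
  show ?thesis by (simp add: evalR_def s.hom_of_int s.hom_sum s.hom_mult s.hom_prod s.hom_power)
qed

text \<open>Three properties are propagated through the formulas in this form: membership in
  \<open>Rring n\<close>, being sent to a constant, and agreement of \<rho> with an
  evaluation.\<close>

definition subring :: "'r::comm_ring_1 set \<Rightarrow> bool" where
  "subring C \<longleftrightarrow> 1 \<in> C \<and> (\<forall>x\<in>C. \<forall>y\<in>C. x - y \<in> C \<and> x * y \<in> C)"

context
  fixes C :: "'r::comm_ring_1 set"
  assumes C: "subring C"
begin

lemma subring_1: "1 \<in> C" and subring_diff: "x \<in> C \<Longrightarrow> y \<in> C \<Longrightarrow> x - y \<in> C"
  and subring_mult: "x \<in> C \<Longrightarrow> y \<in> C \<Longrightarrow> x * y \<in> C"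
  using C by (auto simp: subring_def)
lemma subring_0: "0 \<in> C" using subring_diff[OF subring_1 subring_1] by simp
lemma subring_uminus: "x \<in> C \<Longrightarrow> - x \<in> C" using subring_diff[OF subring_0, of x] by simp
lemma subring_add: "x \<in> C \<Longrightarrow> y \<in> C \<Longrightarrow> x + y \<in> C" using subring_diff[of x "- y"] subring_uminus[of y] by simp
lemma subring_sum: "(\<And>i. i \<in> A \<Longrightarrow> f i \<in> C) \<Longrightarrow> sum f A \<in> C"
  by (induct A rule: infinite_finite_induct) (auto simp: subring_0 subring_add)
lemma subring_prod: "(\<And>i. i \<in> A \<Longrightarrow> f i \<in> C) \<Longrightarrow> prod f A \<in> C"
  by (induct A rule: infinite_finite_induct) (auto simp: subring_1 subring_mult)
lemma subring_power: "x \<in> C \<Longrightarrow> x ^ k \<in> C"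
  by (induct k) (auto simp: subring_1 subring_mult)
lemma subring_of_nat: "of_nat k \<in> C"
  by (induct k) (auto simp: subring_0 subring_1 subring_add)
lemma subring_of_int: "of_int k \<in> C"
  by (cases k rule: int_cases2) (auto simp: subring_of_nat subring_uminus)
lemma subring_ext_sign: "ext_sign i A \<in> C"
  unfolding ext_sign_def by (intro subring_power subring_uminus subring_1)

lemma subring_det:
  assumes A: "A \<in> carrier_mat N N" and e: "\<And>i j. i < N \<Longrightarrow> j < N \<Longrightarrow> A $$ (i, j) \<in> C"
  shows "det A \<in> C"
  unfolding det_def'[OF A]
proof (intro subring_sum subring_mult subring_prod subring_of_int)
  fix p i assume "p \<in> {p. p permutes {0..<N}}" "i \<in> {0..<N}"
  thus "A $$ (i, p i) \<in> C" using permutes_in_image[of p "{0..<N}" i] by (intro e) auto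
qed

lemma subring_adj_mat:
  assumes A: "A \<in> carrier_mat N N" and e: "\<And>i j. i < N \<Longrightarrow> j < N \<Longrightarrow> A $$ (i, j) \<in> C"
    and ij: "i < N" "j < N"
  shows "adj_mat A $$ (i, j) \<in> C"
proof -
  have "det (mat_delete A j i) \<in> C"
  proof (rule subring_det)
    show "mat_delete A j i \<in> carrier_mat (N - 1) (N - 1)" by (rule mat_delete_carrier[OF A])
    fix k l assume "k < N - 1" "l < N - 1"
    thus "mat_delete A j i $$ (k, l) \<in> C" using A by (auto simp: mat_delete_def intro!: e)
  qed
  thus ?thesis using A ij unfolding adj_mat_def cofactor_def
    by (simp add: subring_mult subring_power subring_uminus subring_1)
qed

end

lemma subring_Rring: "subring (Rring n :: 'd::finite R set)"
proof -
  have u: "- P \<in> Rring n" if "P \<in> Rring n" for P :: "'d R" using that by (simp add: Rring_def)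
  have a: "P + Q \<in> Rring n" if "P \<in> Rring n" "Q \<in> Rring n" for P Q :: "'d R"
    using that keys_add[of P Q] unfolding Rring_def by blast
  have "P * Q \<in> Rring n" if "P \<in> Rring n" "Q \<in> Rring n" for P Q :: "'d R"
    unfolding Rring_def
  proof (intro CollectI ballI allI impI)
    fix w m assume w: "w \<in> Poly_Mapping.keys (P * Q)" "Inr m \<in> Poly_Mapping.keys w"
    then obtain a b where ab: "w = a + b" "a \<in> Poly_Mapping.keys P" "b \<in> Poly_Mapping.keys Q" using keys_mult[of P Q] by auto
    hence "Inr m \<in> Poly_Mapping.keys a \<or> Inr m \<in> Poly_Mapping.keys b" using w(2) keys_add[of a b] by auto
    thus "mdeg m = 2 * n - 2" using that ab unfolding Rring_def by blast
  qed
  moreover have "1 \<in> (Rring n :: 'd R set)" by (simp add: Rring_def)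
  ultimately show ?thesis unfolding subring_def using a u by (metis diff_conv_add_uminus)
qed

lemma Xvar_Rring: "Xvar i \<in> Rring n" by (simp add: Rring_def Xvar_def)
lemma Tvar_Rring: "m \<in> monoms (2 * n - 2) \<Longrightarrow> Tvar m \<in> Rring n" by (simp add: Rring_def Tvar_def monoms_def)
lemma Phi_Rring: "Phi n m \<in> Rring n"
  by (simp add: Phi_def Tvar_Rring subring_0[OF subring_Rring])
lemma Phi_tilde_Rring: "n \<ge> 1 \<Longrightarrow> Phi_tilde n m \<in> Rring n" for m :: "'d::{finite,linorder} mono"
proof (cases "m \<in> monoms (2 * n - 1) \<and> Poly_Mapping.lookup m i1 > 0")
  case True
  assume "n \<ge> 1"
  from True have "mdeg (m - ei i1) + 1 = 2 * n - 1" using mdeg_add[of "m - ei i1" "ei i1"]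
    by (simp add: diff_ei_add in_keys_iff monoms_def)
  hence "m - ei i1 \<in> monoms (2 * n - 2)" by (simp add: monoms_def)
  with True show ?thesis by (simp add: Phi_tilde_def Tvar_Rring)
qed (auto simp: Phi_tilde_def subring_0[OF subring_Rring])

definition QR :: "nat \<Rightarrow> 'd::{finite,linorder} mono \<Rightarrow> 'd mono \<Rightarrow> 'd R" where
  "QR n M N = q_map n (unit_mono N) M"

lemma set_mlist: "set (mlist j) = monoms j" and distinct_mlist: "distinct (mlist j)"
  unfolding mlist_def by simp_all

lemma p_mat_carrier: "(p_mat n :: 'd::{finite,linorder} R mat) \<in> carrier_mat (length (mlist (n - 1) :: 'd mono list)) (length (mlist (n - 1) :: 'd mono list))"
  by (simp add: p_mat_def Let_def)

lemma p_mat_entry: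
  assumes "i < length (mlist (n - 1) :: 'd::{finite,linorder} mono list)" "j < length (mlist (n - 1) :: 'd mono list)"
  shows "p_mat n $$ (i, j) = (Phi n (mlist (n - 1) ! j + mlist (n - 1) ! i) :: 'd R)"
proof -
  have "mlist (n - 1) ! j \<in> (monoms (n - 1) :: 'd mono set)" using assms(2) set_mlist nth_mem by blast
  thus ?thesis using assms by (simp add: p_mat_def Let_def act_unit_mono)
qed

lemma sum_monoms_mlist:
  fixes f :: "'d::{finite,linorder} mono \<Rightarrow> 'r::comm_monoid_add"
  shows "(\<Sum>m\<in>monoms j. f m) = (\<Sum>i<length (mlist j :: 'd mono list). f (mlist j ! i))"
proof -
  have "bij_betw ((!) (mlist j)) {..<length (mlist j :: 'd mono list)} (set (mlist j :: 'd mono list))"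
    by (rule bij_betw_nth[OF distinct_mlist]) simp_all
  from sum.reindex_bij_betw[OF this, of f] show ?thesis by (simp add: set_mlist)
qed

lemma q_map_mlist:
  assumes i: "i < length (mlist (n - 1) :: 'd::{finite,linorder} mono list)"
  shows "q_map n \<nu> (mlist (n - 1) ! i) = (\<Sum>j<length (mlist (n - 1) :: 'd mono list). adj_mat (p_mat n) $$ (i, j) * \<nu> (mlist (n - 1) ! j) :: 'd R)"
proof -
  let ?ms = "mlist (n - 1) :: 'd mono list"
  have "q_map n \<nu> (?ms ! i) = (\<Sum>i'<length ?ms. if i' = i then \<Sum>j<length ?ms. adj_mat (p_mat n) $$ (i', j) * \<nu> (?ms ! j) else 0)"
    unfolding q_map_def Let_def
  proof (rule sum.cong[OF refl])
    fix i' assume "i' \<in> {..<length ?ms}"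
    hence "?ms ! i = ?ms ! i' \<longleftrightarrow> i' = i" using i by (auto simp: nth_eq_iff_index_eq[OF distinct_mlist])
    thus "(\<Sum>j<length ?ms. adj_mat (p_mat n) $$ (i', j) * \<nu> (?ms ! j) * unit_mono (?ms ! i') (?ms ! i)) =
        (if i' = i then (\<Sum>j<length ?ms. adj_mat (p_mat n) $$ (i', j) * \<nu> (?ms ! j)) else 0)"
      by (cases "i' = i") (simp_all add: unit_mono_def)
  qed
  thus ?thesis using i by simp
qed

lemma q_map_outside: "M \<notin> monoms (n - 1) \<Longrightarrow> q_map n \<nu> M = 0" for M :: "'d::{finite,linorder} mono"
proof -
  assume M: "M \<notin> monoms (n - 1)"
  have "mlist (n - 1) ! i \<noteq> M" if "i < length (mlist (n - 1) :: 'd mono list)" for i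
    using that M set_mlist nth_mem by metis
  thus ?thesis unfolding q_map_def Let_def by (intro sum.neutral ballI) (auto simp: unit_mono_def)
qed

lemma q_map_expand:
  fixes \<nu> :: "'d::{finite,linorder} mono \<Rightarrow> 'd R"
  shows "q_map n \<nu> M = (if M \<in> monoms (n - 1) then \<Sum>N\<in>monoms (n - 1). QR n M N * \<nu> N else 0)"
proof (cases "M \<in> monoms (n - 1)")
  case True
  let ?ms = "mlist (n - 1) :: 'd mono list"
  obtain i where i: "i < length ?ms" "M = ?ms ! i" using True set_mlist in_set_conv_nth by metis
  have "QR n M (?ms ! j) = adj_mat (p_mat n) $$ (i, j)" if j: "j < length ?ms" for j
  proof -
    have "QR n M (?ms ! j) = (\<Sum>j'<length ?ms. if j' = j then adj_mat (p_mat n) $$ (i, j') else 0)"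
      unfolding QR_def i(2) q_map_mlist[OF i(1)]
      by (rule sum.cong) (use j in \<open>auto simp: unit_mono_def nth_eq_iff_index_eq[OF distinct_mlist]\<close>)
    thus ?thesis using j by simp
  qed
  thus ?thesis using True by (simp add: sum_monoms_mlist i(2) q_map_mlist[OF i(1)])
qed (simp add: q_map_outside)

lemma QR_adj:
  assumes "i < length (mlist (n - 1) :: 'd::{finite,linorder} mono list)" "j < length (mlist (n - 1) :: 'd mono list)"
  shows "QR n (mlist (n - 1) ! i) (mlist (n - 1) ! j) = (adj_mat (p_mat n) $$ (i, j) :: 'd R)"
proof -
  have "QR n (mlist (n - 1) ! i) (mlist (n - 1) ! j) = (\<Sum>j'<length (mlist (n - 1) :: 'd mono list). if j' = j then adj_mat (p_mat n) $$ (i, j') else 0 :: 'd R)"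
    unfolding QR_def q_map_mlist[OF assms(1)]
    by (rule sum.cong) (use assms in \<open>auto simp: unit_mono_def nth_eq_iff_index_eq[OF distinct_mlist]\<close>)
  thus ?thesis using assms by simp
qed

lemma subring_delta: assumes C: "subring C" "\<And>m. Phi n m \<in> C" shows "delta n \<in> C"
  unfolding delta_def by (rule subring_det[OF C(1) p_mat_carrier]) (simp add: p_mat_entry C)

lemma subring_QR:
  fixes M N :: "'d::{finite,linorder} mono"
  assumes C: "subring C" "\<And>m :: 'd mono. Phi n m \<in> C" shows "QR n M N \<in> C"
proof (cases "M \<in> monoms (n - 1) \<and> N \<in> monoms (n - 1)")
  case True
  let ?ms = "mlist (n - 1) :: 'd mono list"
  obtain i j where "i < length ?ms" "M = ?ms ! i" "j < length ?ms" "N = ?ms ! j" using True set_mlist in_set_conv_nth by metis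
  thus ?thesis by (simp add: QR_adj subring_adj_mat[OF C(1) p_mat_carrier] p_mat_entry C)
next
  case False
  have "QR n M N = 0"
  proof (cases "M \<in> monoms (n - 1)")
    case True
    hence "unit_mono N K = (0 :: 'd R)" if "K \<in> monoms (n - 1)" for K using False that by (auto simp: unit_mono_def)
    hence "(\<Sum>K\<in>monoms (n - 1). QR n M K * unit_mono N K) = 0" by simp
    thus ?thesis unfolding QR_def[of n M N] q_map_expand[of n "unit_mono N"] by (simp add: True)
  qed (simp add: QR_def q_map_outside)
  thus ?thesis using subring_0[OF C(1)] by simp
qed

lemma Phi_tilde_shift:
  assumes "n \<ge> 2" "M \<in> monoms (n - 1)" "N \<in> monoms (n - 1)"
  shows "Phi_tilde n (M + N + ei i1) = (Phi n (M + N) :: 'd::{finite,linorder} R)"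
proof -
  have "M + N + ei i1 - ei i1 = M + N" by simp
  moreover have "mdeg M + mdeg N = 2 * n - 2" "mdeg M + mdeg N + 1 = 2 * n - 1" using assms by (auto simp: monoms_def)
  ultimately show ?thesis by (simp add: Phi_tilde_def Phi_def monoms_def mdeg_add lookup_add lookup_ei)
qed

text \<open>The two assumptions on Q are the two products of p with its adjugate. The first is
  \<open>q_map_Phi\<close>.\<close>

lemma generic_data_R:
  assumes n: "n \<ge> 2" shows "generic_data n (QR n) (delta n) (Phi_tilde n :: 'd::{finite,linorder} mono \<Rightarrow> 'd R)"
proof
  fix N N' :: "'d mono" assume N: "N \<in> monoms (n - 1)" "N' \<in> monoms (n - 1)"
  have "(\<Sum>M\<in>monoms (n - 1). QR n M N' * Phi_tilde n (M + N + ei i1)) = act (n - 1) (q_map n (unit_mono N')) (Phi n) N"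
    unfolding act_def QR_def by (rule sum.cong) (simp_all add: Phi_tilde_shift[OF n _ N(1)])
  thus "(\<Sum>M\<in>monoms (n - 1). QR n M N' * Phi_tilde n (M + N + ei i1)) = (if N = N' then delta n else 0)"
    unfolding q_map_Phi[OF N(1)] by (simp add: unit_mono_def)
  let ?ms = "mlist (n - 1) :: 'd mono list"
  obtain i where i: "i < length ?ms" "N = ?ms ! i" using N set_mlist in_set_conv_nth by metis
  obtain j where j: "j < length ?ms" "N' = ?ms ! j" using N set_mlist in_set_conv_nth by metis
  note adj = adj_mat[OF p_mat_carrier[of n, where 'd='d]]
  have "(\<Sum>M\<in>monoms (n - 1). QR n N M * Phi_tilde n (M + N' + ei i1)) = (\<Sum>M\<in>monoms (n - 1). QR n N M * Phi n (M + N'))"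
    by (rule sum.cong) (simp_all add: Phi_tilde_shift[OF n _ N(2)])
  also have "\<dots> = (\<Sum>k<length ?ms. adj_mat (p_mat n) $$ (i, k) * p_mat n $$ (k, j))"
    unfolding sum_monoms_mlist by (rule sum.cong) (auto simp: i(2) j(2) QR_adj[OF i(1)] p_mat_entry[OF _ j(1)] add.commute)
  also have "\<dots> = (adj_mat (p_mat n) * p_mat n :: 'd R mat) $$ (i, j)"
    using i(1) j(1) carrier_matD[OF p_mat_carrier[of n, where 'd='d]] carrier_matD[OF adj(1)]
    by (simp add: scalar_prod_def atLeast0LessThan)
  also have "\<dots> = (if N = N' then delta n else 0)"
    unfolding adj(3) using i j by (simp add: delta_def nth_eq_iff_index_eq[OF distinct_mlist])
  finally show "(\<Sum>M\<in>monoms (n - 1). QR n N M * Phi_tilde n (M + N' + ei i1)) = (if N = N' then delta n else 0)" .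
next
  fix m :: "'d mono" assume "Phi_tilde n m \<noteq> 0"
  thus "m \<in> monoms (2 * n - 1)" by (auto simp: Phi_tilde_def split: if_splits)
qed (rule n)

lemma value_R_unit: "m \<in> monoms j \<Longrightarrow> value_R j (unit_mono m) = (\<Prod>i\<in>UNIV. Xvar i ^ Poly_Mapping.lookup m i)"
  by (simp add: value_R_def unit_mono_def if_distrib[of "\<lambda>x. x * _"] cong: if_cong)

text \<open>The two descriptions differ in grouping: by linearity of q the terms in k and in
  v(\<Phi>~) are collected in u. In the last differential the sums over monomials expand a function
  in indicator functions.\<close>

lemma b_map_bd:
  fixes z :: "'d::{finite,linorder} coord \<Rightarrow> 'd R"
  assumes n: "n \<ge> 2"
  shows "b_map n r z = generic_data.bd n Xvar (QR n) (delta n) (Phi_tilde n) r z"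
proof -
  interpret R: generic_data n "Xvar :: 'd \<Rightarrow> 'd R" "QR n" "delta n" "Phi_tilde n" by (rule generic_data_R[OF n])
  have q: "q_map n \<nu> = R.q_fun \<nu>" for \<nu> by (intro ext) (simp add: q_map_expand R.q_fun_def)
  have v: "value_R j \<mu> = R.val j \<mu>" for j \<mu> by (simp add: value_R_def R.val_def R.Xp_def)
  have K: "Kos = KosX (Xvar :: 'd \<Rightarrow> 'd R)" by (rule Kos_eq_KosX)
  have U: "R.Uz z A M = R.q_fun (Kpart z A) M - R.q_fun (act n (Lpart z A) (Phi_tilde n)) M" for A M
    unfolding R.Uz_def R.Dz_def using lin_op_diff[OF R.lin_op_q_fun] by blast
  have f: "b_first n z = R.bfirst z"
  proof
    fix k
    have U': "R.Uz z {} = (\<lambda>M. R.q_fun (Kpart z {}) M - R.q_fun (act n (Lpart z {}) (Phi_tilde n)) M)" by (intro ext) (rule U)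
    show "b_first n z k = R.bfirst z k"
      by (simp add: b_first_def Let_def R.bfirst_def q v U' R.val_diff algebra_simps)
  qed
  have m: "b_mid n z = R.bmid z"
  proof -
    have a: "act (n - 1) (R.Uz z A) \<nu> m = act (n - 1) (R.q_fun (Kpart z A)) \<nu> m - act (n - 1) (R.q_fun (act n (Lpart z A) (Phi_tilde n))) \<nu> m" for A \<nu> m
      unfolding U[abs_def] by (rule lin_op_diff[OF lin_op_act])
    have p: "proj0 (R.Uz z A) m = proj0 (R.q_fun (Kpart z A)) m - proj0 (R.q_fun (act n (Lpart z A) (Phi_tilde n))) m" for A m
      unfolding U[abs_def] by (rule lin_op_diff[OF lin_op_proj0])
    show ?thesis
      unfolding b_mid_def Let_def R.bmid_def q K a p eta_diff kappa_diff
      by (rule arg_cong2[where f=of_KL]; intro ext; simp add: algebra_simps)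
  qed
  have T: "R.val (n - 1) (R.q_fun (unit_mono M)) = R.q_dual M" if "M \<in> monoms (n - 1)" for M
    using that by (simp add: R.val_def R.q_fun_def R.q_dual_def unit_mono_def if_distrib[of "\<lambda>x. _ * x"] cong: if_cong)
  have W: "R.val (n - 1) (R.q_fun (act n (unit_mono m) (Phi_tilde n))) = act (n - 1) R.q_dual (Phi_tilde n) m" if "m \<in> monoms n" for m
  proof -
    have "R.val (n - 1) (R.q_fun (act n (unit_mono m) (Phi_tilde n))) = (\<Sum>M\<in>monoms (n - 1). \<Sum>N\<in>monoms (n - 1). QR n M N * Phi_tilde n (m + N) * R.Xp M)"
      by (simp add: R.val_def R.q_fun_def act_unit_mono[OF that] sum_distrib_right)
    also have "\<dots> = act (n - 1) R.q_dual (Phi_tilde n) m"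
      by (subst sum.swap) (simp add: act_def R.q_dual_def sum_distrib_right sum_distrib_left mult_ac add.commute)
    finally show ?thesis .
  qed
  have l: "b_last n z = R.btop z"
  proof -
    have g: "(\<lambda>A l. z (WC A) * R.L_gen l) = (\<lambda>A l. \<Sum>m\<in>monoms0 n. R.L_gen m * (z (WC A) * unit_mono m l))"
    proof (intro ext)
      fix A l
      have "(\<Sum>m\<in>monoms0 n. R.L_gen m * (z (WC A) * unit_mono m l)) = (\<Sum>m\<in>monoms0 n. if l = m then z (WC A) * R.L_gen l else 0)"
        by (rule sum.cong) (auto simp: unit_mono_def)
      also have "\<dots> = z (WC A) * R.L_gen l" by (auto simp: R.L_gen_def)
      finally show "z (WC A) * R.L_gen l = (\<Sum>m\<in>monoms0 n. R.L_gen m * (z (WC A) * unit_mono m l))" ..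
    qed
    have t: "(\<lambda>A l. z (WC A) * proj0 R.q_dual l) = (\<lambda>A l. \<Sum>m\<in>monoms0 (n - 1). R.q_dual m * (z (WC A) * unit_mono m l))"
    proof (intro ext)
      fix A l
      have "(\<Sum>m\<in>monoms0 (n - 1). R.q_dual m * (z (WC A) * unit_mono m l)) = (\<Sum>m\<in>monoms0 (n - 1). if l = m then z (WC A) * R.q_dual l else 0)"
        by (rule sum.cong) (auto simp: unit_mono_def)
      also have "\<dots> = z (WC A) * proj0 R.q_dual l" by (auto simp: proj0_def R.q_dual_def monoms0_def)
      finally show "z (WC A) * proj0 R.q_dual l = (\<Sum>m\<in>monoms0 (n - 1). R.q_dual m * (z (WC A) * unit_mono m l))" ..
    qed
    have 1: "delta n * value_R n (unit_mono m) - Xvar i1 * value_R (n - 1) (q_map n (act n (unit_mono m) (Phi_tilde n))) = R.L_gen m"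
      if "m \<in> monoms0 n" for m
      using that W[of m] by (simp add: R.L_gen_def q v[of "n - 1"] value_R_unit monoms0_def R.Xp_def)
    have 2: "value_R (n - 1) (q_map n (unit_mono m)) = R.q_dual m" if "m \<in> monoms0 (n - 1)" for m
      using that T[of m] by (simp add: q v monoms0_def)
    show ?thesis
      unfolding b_last_def Let_def R.btop_def g t lin2_sum[OF lin2_eta] lin2_sum[OF lin2_kappa]
      by (rule arg_cong2[where f=of_KL]; intro ext; simp add: 1 2 sum_distrib_left sum_negf mult.assoc)
  qed
  show ?thesis unfolding b_map_def R.bd_def f m l ..
qed

section \<open>Change of rings and restriction to subrings\<close>

locale data_hom = A: generic_data n X Q dl Ft + B: generic_data n X' Q' dl' Ft' + comm_ring_hom hom
  for n and X :: "'d::{finite,linorder} \<Rightarrow> 'r::comm_ring_1" and Q dl Ft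
    and X' :: "'d \<Rightarrow> 's::comm_ring_1" and Q' dl' Ft' and hom :: "'r \<Rightarrow> 's" +
  assumes hX: "hom (X i) = X' i" and hQ: "hom (Q M N) = Q' M N" and hdl: "hom dl = dl'" and hFt: "hom (Ft m) = Ft' m"
begin

text \<open>Every differential is a ring expression with integer coefficients in X, Q, \<delta>,
  \<Phi>~ and the coordinates of z.\<close>

lemma hom_bd: "hom (A.bd r z k) = B.bd r (\<lambda>k. hom (z k)) k"
proof -
  have act: "hom (act j \<mu> \<nu> m) = act j (\<lambda>m. hom (\<mu> m)) (\<lambda>m. hom (\<nu> m)) m" for j \<mu> \<nu> m
    by (simp add: act_def hom_sum hom_mult)
  have Xp: "hom (A.Xp m) = B.Xp m" for m by (simp add: A.Xp_def B.Xp_def hom_prod hom_power hX)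
  have val: "hom (A.val j \<mu>) = B.val j (\<lambda>m. hom (\<mu> m))" for j \<mu> by (simp add: A.val_def B.val_def hom_sum hom_mult Xp)
  have KL: "hom (Kpart z A m) = Kpart (\<lambda>k. hom (z k)) A m" "hom (Lpart z A m) = Lpart (\<lambda>k. hom (z k)) A m" for A m
    by (simp_all add: Kpart_def Lpart_def)
  have U: "hom (A.Uz z A M) = B.Uz (\<lambda>k. hom (z k)) A M" for A M
    by (simp add: A.Uz_def B.Uz_def A.q_fun_def B.q_fun_def A.Dz_def B.Dz_def hom_sum hom_mult hom_minus hQ act KL hFt)
  have Kos: "hom (KosX X w B m) = KosX X' (\<lambda>A m. hom (w A m)) B m" for w :: "'d set \<Rightarrow> 'd mono \<Rightarrow> 'r" and B m
    by (simp add: KosX_def ext_contract_def coef_mul_def hom_sum hom_mult hom_ext_sign hX)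
  have proj: "hom (proj0 \<mu> m) = proj0 (\<lambda>m. hom (\<mu> m)) m" for \<mu> m by (simp add: proj0_def)
  have q_dual: "hom (A.q_dual M) = B.q_dual M" for M by (simp add: A.q_dual_def B.q_dual_def hom_sum hom_mult hQ Xp)
  have L_gen: "hom (A.L_gen m) = B.L_gen m" for m by (simp add: A.L_gen_def B.L_gen_def hom_mult hom_minus hdl hX Xp act q_dual hFt)
  have "hom (A.bfirst z k) = B.bfirst (\<lambda>k. hom (z k)) k"
    by (simp add: A.bfirst_def B.bfirst_def hom_add hom_mult hdl hX val KL U)
  moreover have "hom (A.bmid z k) = B.bmid (\<lambda>k. hom (z k)) k"
    by (cases k) (simp_all add: A.bmid_def B.bmid_def hom_minus hom_mult hdl hX Kos KL U hom_eta hom_kappa act proj hFt)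
  moreover have "hom (A.btop z k) = B.btop (\<lambda>k. hom (z k)) k"
    by (cases k) (simp_all add: A.btop_def B.btop_def hom_mult hom_uminus hX hom_eta hom_kappa L_gen proj q_dual)
  ultimately show ?thesis by (simp add: A.bd_def B.bd_def)
qed

end

context generic_data begin

lemma bd_subring:
  assumes C: "subring C" and h: "\<And>i. X i \<in> C" "\<And>M N. Q M N \<in> C" "dl \<in> C" "\<And>m. Ft m \<in> C" and z: "\<And>k. z k \<in> C"
  shows "bd r z k \<in> C"
proof -
  note I = subring_sum[OF C] subring_mult[OF C] subring_diff[OF C] subring_add[OF C] subring_uminus[OF C] subring_prod[OF C]
    subring_power[OF C] subring_ext_sign[OF C] subring_0[OF C]
  have Xp: "Xp m \<in> C" for m unfolding Xp_def by (intro I h)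
  have U: "Uz z A M \<in> C" for A M
    unfolding Uz_def q_fun_def Dz_def act_def Kpart_def Lpart_def by (auto intro!: I h z)
  have q_dual: "q_dual M \<in> C" for M unfolding q_dual_def by (auto intro!: I h Xp)
  have L_gen: "L_gen m \<in> C" for m unfolding L_gen_def act_def by (auto intro!: I h Xp q_dual)
  have "bfirst z k \<in> C" unfolding bfirst_def val_def Lpart_def by (auto intro!: I h z Xp U)
  moreover have "bmid z k \<in> C"
    by (cases k) (auto simp: bmid_def KosX_def ext_contract_def coef_mul_def eta_sum kappa_sum act_def proj0_def Kpart_def Lpart_def intro!: I h z U)
  moreover have "btop z k \<in> C"
    by (cases k) (auto simp: btop_def eta_sum kappa_sum proj0_def simp del: mult_minus_left intro!: I h z L_gen q_dual)
  ultimately show ?thesis by (simp add: bd_def I)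
qed

end

section \<open>Specialization at a Macaulay inverse system\<close>

definition vec_elt :: "('c \<Rightarrow> int) list \<Rightarrow> 'r::comm_ring_1 vec \<Rightarrow> 'c \<Rightarrow> 'r" where
  "vec_elt es v = (\<lambda>k. \<Sum>i<length es. v $ i * of_int ((es ! i) k))"

lemma latG_sum: "(\<And>i. i \<in> C \<Longrightarrow> z i \<in> latG n r) \<Longrightarrow> (\<lambda>k. \<Sum>i\<in>C. c i * z i k) \<in> latG n r"
proof (induct C rule: infinite_finite_induct)
  case (insert i C)
  have "(\<lambda>k. c i * z i k + (\<Sum>i\<in>C. c i * z i k)) \<in> latG n r"
    by (rule latG_lin) (use insert in auto)
  thus ?case using insert by simp
qed (simp_all add: zero_latG)

text \<open>\<open>t\<close> is the system of integral coordinate forms from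
  \<open>base_change_coords\<close>. Coordinates over the generic ring and over S are given by the
  same forms.\<close>

locale lattice_coords =
  fixes n r :: nat and es :: "('d::{finite,linorder} coord \<Rightarrow> int) list" and t :: "nat \<Rightarrow> 'd coord \<Rightarrow> int"
  assumes n1: "n \<ge> 1" and basis: "lattice_basis es (lattice n r)"
    and t1: "\<And>i j. i < length es \<Longrightarrow> j < length es \<Longrightarrow> (\<Sum>p\<in>latQ n r. t i p * (es ! j) p) = (if i = j then 1 else 0)"
    and t2: "\<And>p k. p \<in> latQ n r \<Longrightarrow> latd p k = (\<Sum>i<length es. t i p * (es ! i) k)"
begin

definition coord_vec :: "('d coord \<Rightarrow> 'r::comm_ring_1) \<Rightarrow> 'r vec" where
  "coord_vec z = vec (length es) (\<lambda>i. \<Sum>p\<in>latQ n r. of_int (t i p) * z p)"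

lemma coord_vec_carrier: "coord_vec z \<in> carrier_vec (length es)"
  by (simp add: coord_vec_def)

lemma es_latG: "i < length es \<Longrightarrow> (\<lambda>k. of_int ((es ! i) k)) \<in> latG n r"
  by (rule of_int_latG) (use basis in \<open>auto simp: lattice_basis_def\<close>)

lemma vec_elt_latG: "vec_elt es v \<in> latG n r"
  unfolding vec_elt_def by (rule latG_sum) (simp add: es_latG)

lemma coord_vec_vec_elt:
  fixes v :: "'r::comm_ring_1 vec"
  assumes v: "v \<in> carrier_vec (length es)" shows "coord_vec (vec_elt es v) = v"
proof (rule eq_vecI)
  fix i assume "i < dim_vec v"
  hence i: "i < length es" using v by simp
  have "coord_vec (vec_elt es v) $ i = (\<Sum>j<length es. v $ j * of_int (\<Sum>p\<in>latQ n r. t i p * (es ! j) p))"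
    using i by (simp add: coord_vec_def vec_elt_def sum_distrib_left, subst sum.swap, simp add: mult_ac)
  also have "\<dots> = (\<Sum>j<length es. if i = j then v $ j else 0)"
    by (rule sum.cong) (use i t1 in auto)
  finally show "coord_vec (vec_elt es v) $ i = v $ i" using i by simp
qed (use v in \<open>simp add: coord_vec_def\<close>)

lemma vec_elt_coord_vec:
  assumes "z \<in> latG n r" shows "vec_elt es (coord_vec z) = z"
proof
  fix k
  show "vec_elt es (coord_vec z) k = z k"
    using base_change_expand[where Q="latQ n r" and d=latd and N="length es" and t=t and es=es and z=z, OF t2 latG_expand[OF assms n1], of k]
    by (simp add: vec_elt_def coord_vec_def)
qed

lemma vec_elt_inj: "v \<in> carrier_vec (length es) \<Longrightarrow> w \<in> carrier_vec (length es) \<Longrightarrow> vec_elt es v = vec_elt es w \<Longrightarrow> v = w"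
  using coord_vec_vec_elt by metis

end

lemma lattice_coords_exist:
  fixes es :: "('d::{finite,linorder} coord \<Rightarrow> int) list"
  assumes n: "n \<ge> 1" and b: "lattice_basis es (lattice n r)"
  shows "\<exists>t. lattice_coords n r es t"
proof -
  have 0: "(\<lambda>_. 0) \<in> (lattice n r :: ('d coord \<Rightarrow> int) set)" by (simp add: lattice_eq_latG zero_latG)
  have "z = (\<lambda>k. \<Sum>p\<in>latQ n r. z p * latd p k)" if "z \<in> lattice n r" for z :: "'d coord \<Rightarrow> int"
    using latG_expand[OF _ n, of z] that by (simp add: lattice_eq_latG)
  from base_change_coords[OF b 0 finite_latQ latd_in_lattice[OF _ n] this]
  obtain t where "\<forall>i<length es. \<forall>j<length es. (\<Sum>p\<in>latQ n r. t i p * (es ! j) p) = (if i = j then 1 else 0)"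
    "\<forall>p\<in>latQ n r. \<forall>k. latd p k = (\<Sum>i<length es. t i p * (es ! i) k)" by blast
  thus ?thesis using n b by (intro exI[of _ t]) (unfold_locales, auto)
qed

lemma lattice_basis_length_0:
  fixes es :: "('d::{finite,linorder} coord \<Rightarrow> int) list"
  assumes b: "lattice_basis es (lattice n r)" and r: "r > CARD('d)" shows "es = []"
proof (rule ccontr)
  assume "es \<noteq> []"
  have 0: "(\<lambda>_. 0) \<in> (lattice n r :: ('d coord \<Rightarrow> int) set)" by (simp add: lattice_eq_latG zero_latG)
  have "es ! 0 \<in> lattice n r" using b \<open>es \<noteq> []\<close> by (auto simp: lattice_basis_def)
  hence "es ! 0 = (\<lambda>_. 0)" using r by (simp add: lattice_def)
  hence "(\<Sum>i<length es. (if i = 0 then 1 else 0) * (es ! i) k) = 0" for k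
    by (simp add: if_distrib[of "\<lambda>x. x * _"] cong: if_cong)
  from lattice_basis_indep[OF b 0 this, of 0] \<open>es \<noteq> []\<close> show False by simp
qed

text \<open>A second basis vector would contradict the duality of \<open>t\<close> with the basis,
  since all vectors live in the one coordinate \<open>One\<close>. The same duality exhibits the
  remaining value as a unit.\<close>

lemma lattice_basis_0:
  fixes es :: "('d::{finite,linorder} coord \<Rightarrow> int) list"
  assumes n: "n \<ge> 1" and b: "lattice_basis es (lattice n 0)" shows "length es = 1" "\<exists>u. u * (es ! 0) One = 1"
proof -
  obtain t where "lattice_coords n 0 es t" using lattice_coords_exist[OF n b] by blast
  then interpret lattice_coords n 0 es t .
  have Q: "latQ n 0 = {One :: 'd coord}" by (simp add: latQ_def)
  have "latd One (One :: 'd coord) = (\<Sum>i<length es. t i One * (es ! i) One)" by (rule t2) (simp add: Q)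
  hence "length es \<noteq> 0" by (auto simp: latd_def)
  moreover have "\<not> 2 \<le> length es"
  proof
    assume "2 \<le> length es"
    hence "0 < length es" "1 < length es" by linarith+
    hence "t 0 One * (es ! 0) One = 1" "t 0 One * (es ! 1) One = 0" "t 1 One * (es ! 1) One = 1"
      using t1[of 0 0] t1[of 0 1] t1[of 1 1] by (simp_all add: Q del: length_greater_0_conv)
    thus False by auto
  qed
  ultimately show l: "length es = 1" by linarith
  show "\<exists>u. u * (es ! 0) One = 1" using t1[of 0 0] l by (auto simp: Q)
qed

lemma vec_elt_mult_mat:
  fixes A :: "'r::comm_ring_1 mat"
  assumes A: "A \<in> carrier_mat (length es') (length es)" and v: "v \<in> carrier_vec (length es)"
    and lin: "\<And>c z w k. F (\<lambda>k. c * z k + w k) k = c * F z k + F w k"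
    and col: "\<And>j. j < length es \<Longrightarrow> F (\<lambda>k. of_int ((es ! j) k)) = (\<lambda>k. \<Sum>i<length es'. A $$ (i, j) * of_int ((es' ! i) k))"
  shows "vec_elt es' (A *\<^sub>v v) = F (vec_elt es v)"
proof
  fix k
  have "lin_op F" unfolding lin_op_def using lin by blast
  from lin_op_sum[OF this] have "F (vec_elt es v) k = (\<Sum>j<length es. v $ j * F (\<lambda>k. of_int ((es ! j) k)) k)"
    unfolding vec_elt_def .
  also have "\<dots> = (\<Sum>j<length es. v $ j * (\<Sum>i<length es'. A $$ (i, j) * of_int ((es' ! i) k)))"
    by (rule sum.cong) (simp_all add: col)
  also have "\<dots> = (\<Sum>i<length es'. (\<Sum>j<length es. A $$ (i, j) * v $ j) * of_int ((es' ! i) k))"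
    by (simp add: sum_distrib_left sum_distrib_right, subst sum.swap, simp add: mult_ac)
  also have "\<dots> = vec_elt es' (A *\<^sub>v v) k"
    unfolding vec_elt_def using A v by (intro sum.cong) (auto simp: scalar_prod_def atLeast0LessThan)
  finally show "vec_elt es' (A *\<^sub>v v) k = F (vec_elt es v) k" ..
qed

lemma mat_ker_map:
  assumes h: "comm_ring_hom \<sigma>" and b: "bij \<sigma>"
  shows "mat_ker (map_mat \<sigma> A) = map_vec \<sigma> ` mat_ker A"
proof -
  interpret s: comm_ring_hom \<sigma> by (rule h)
  have A: "A \<in> carrier_mat (dim_row A) (dim_col A)" by simp
  have inj: "\<sigma> x = 0 \<longleftrightarrow> x = 0" for x using b by (metis bij_pointE s.hom_zero)
  show ?thesis
  proof
    show "map_vec \<sigma> ` mat_ker A \<subseteq> mat_ker (map_mat \<sigma> A)"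
      by (auto simp: mat_ker_def s.mult_mat_vec_hom[OF A, symmetric])
    show "mat_ker (map_mat \<sigma> A) \<subseteq> map_vec \<sigma> ` mat_ker A"
    proof
      fix v assume v: "v \<in> mat_ker (map_mat \<sigma> A)"
      define w where "w = map_vec (inv_into UNIV \<sigma>) v"
      have vw: "v = map_vec \<sigma> w" using b by (auto simp: w_def bij_is_surj surj_f_inv_f)
      have w: "w \<in> carrier_vec (dim_col A)" using v by (auto simp: w_def mat_ker_def)
      have "map_vec \<sigma> (A *\<^sub>v w) = 0\<^sub>v (dim_row A)" using v by (simp add: s.mult_mat_vec_hom[OF A w] vw[symmetric] mat_ker_def)
      hence "(A *\<^sub>v w) $ i = 0" if "i < dim_row A" for i
        using that inj by (metis dim_mult_mat_vec index_map_vec(1) index_zero_vec(1))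
      hence "A *\<^sub>v w = 0\<^sub>v (dim_row A)" by (intro eq_vecI) auto
      thus "v \<in> map_vec \<sigma> ` mat_ker A" using w vw by (auto simp: mat_ker_def)
    qed
  qed
qed

lemma mat_image_map:
  assumes h: "comm_ring_hom \<sigma>" and b: "bij \<sigma>"
  shows "mat_image (map_mat \<sigma> A) = map_vec \<sigma> ` mat_image A"
proof -
  interpret s: comm_ring_hom \<sigma> by (rule h)
  have A: "A \<in> carrier_mat (dim_row A) (dim_col A)" by simp
  have "carrier_vec (dim_col A) = map_vec \<sigma> ` carrier_vec (dim_col A)"
  proof
    show "carrier_vec (dim_col A) \<subseteq> map_vec \<sigma> ` carrier_vec (dim_col A)"
    proof
      fix v :: "'b vec" assume v: "v \<in> carrier_vec (dim_col A)"
      have "v = map_vec \<sigma> (map_vec (inv_into UNIV \<sigma>) v)" using b by (auto simp: bij_is_surj surj_f_inv_f)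
      thus "v \<in> map_vec \<sigma> ` carrier_vec (dim_col A)" using v by (intro image_eqI[of _ _ "map_vec (inv_into UNIV \<sigma>) v"]) auto
    qed
  qed auto
  thus ?thesis unfolding mat_image_def by (auto simp: image_image s.mult_mat_vec_hom[OF A] intro!: image_cong)
qed

lemma mon_val_Xs: "mon_val Xs w = (Poly_Mapping.single w 1 :: ('d::finite, 'k::field) S)"
proof (induction "mdeg w" arbitrary: w)
  case 0
  hence "w = 0" by (simp add: mdeg_eq_0_iff)
  thus ?case by simp
next
  case (Suc k)
  then obtain i where i: "i \<in> Poly_Mapping.keys w" using mdeg_eq_0_iff[of w] keys_eq_empty by force
  define w' where "w' = w - ei i"
  have w: "w = w' + ei i" using i by (simp add: w'_def diff_ei_add)
  have "mon_val Xs w' = (Poly_Mapping.single w' 1 :: ('d, 'k) S)" using Suc by (simp add: w mdeg_add)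
  moreover have "mon_val Xs (ei i) = (Xs i :: ('d, 'k) S)" by (simp add: ei_def mon_val_single)
  ultimately show ?case unfolding w mon_val_add by (simp add: Xs_def mult_single)
qed

lemma evalP_Xs_id: "evalP constS Xs f = (f :: ('d::finite, 'k::field) S)"
proof -
  have "evalP constS Xs f = (\<Sum>w\<in>Poly_Mapping.keys f. Poly_Mapping.single w (Poly_Mapping.lookup f w))"
    by (simp add: evalP_def mon_val_Xs constS_def mult_single)
  thus ?thesis using poly_mapping_expand[of f] by simp
qed

lemma hom_evalP:
  assumes "comm_ring_hom \<tau>" "\<And>c. \<tau> (constS c) = constS c"
  shows "\<tau> (evalP constS h f) = evalP constS (\<lambda>i. \<tau> (h i)) f"
proof -
  interpret comm_ring_hom \<tau> by fact
  show ?thesis by (simp add: evalP_def mon_val_def hom_sum hom_mult hom_prod hom_power assms(2))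
qed

lemma homogS_mult_eq: "homogS s f \<Longrightarrow> homogS t g \<Longrightarrow> r = s + t \<Longrightarrow> homogS r (f * g)" for f g :: "('d::finite, 'k::field) S"
  using homogS_mult by blast

lemma homogS_prod:
  fixes f :: "'i \<Rightarrow> ('d::finite, 'k::field) S"
  shows "(\<And>i. i \<in> C \<Longrightarrow> homogS (g i) (f i)) \<Longrightarrow> finite C \<Longrightarrow> homogS (\<Sum>i\<in>C. g i) (\<Prod>i\<in>C. f i)"
  by (rotate_tac, induct C rule: finite_induct) (auto simp: homogS_1 intro: homogS_mult)

lemma homogS_power: "homogS s f \<Longrightarrow> homogS (int k * s) (f ^ k)" for f :: "('d::finite, 'k::field) S"
proof (induct k)
  case (Suc k)
  thus ?case using homogS_mult[of s f "int k * s" "f ^ k"] by (simp add: algebra_simps)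
qed (simp add: homogS_1)

lemma homog1_expand:
  fixes f :: "('d::finite, 'k::field) S"
  assumes "homogS 1 f" shows "f = (\<Sum>j\<in>UNIV. constS (Poly_Mapping.lookup f (ei j)) * Xs j)"
proof -
  have k: "Poly_Mapping.keys f \<subseteq> range ei"
  proof
    fix l assume "l \<in> Poly_Mapping.keys f"
    hence l: "mdeg l = 1" using assms by (simp add: homogS_def)
    hence "l \<noteq> 0" by (auto simp: mdeg_def)
    then obtain i where "i \<in> Poly_Mapping.keys l" using keys_eq_empty by blast
    then obtain l' where l': "l = l' + ei i" using diff_ei_add by metis
    hence "l' = 0" using l by (simp add: mdeg_add mdeg_eq_0_iff)
    thus "l \<in> range ei" using l' by simp
  qed
  have inj: "inj (ei :: 'd \<Rightarrow> 'd mono)"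
  proof (rule injI)
    fix i j :: 'd assume "ei i = ei j"
    hence "Poly_Mapping.lookup (ei i) i = Poly_Mapping.lookup (ei j) i" by simp
    thus "i = j" by (simp add: lookup_ei split: if_splits)
  qed
  have "f = (\<Sum>l\<in>Poly_Mapping.keys f. Poly_Mapping.single l (Poly_Mapping.lookup f l))" by (rule poly_mapping_expand)
  also have "\<dots> = (\<Sum>l\<in>range ei. Poly_Mapping.single l (Poly_Mapping.lookup f l))"
    by (rule sum.mono_neutral_left) (use k in \<open>auto simp: in_keys_iff\<close>)
  also have "\<dots> = (\<Sum>j\<in>UNIV. constS (Poly_Mapping.lookup f (ei j)) * Xs j)"
    unfolding sum.reindex[OF inj] by (simp add: constS_def Xs_def mult_single)
  finally show ?thesis .
qed

context std_data begin

text \<open>The values of \<delta>, Q and \<Phi>~ are constants, so degrees come only from Kos, from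
  the factor x_1, from the evaluation of monomials, and from \<open>q_dual\<close> and
  \<open>L_gen\<close>.\<close>

lemma homogS_bd:
  assumes z: "\<And>k. homogS 0 (z k)"
  shows "r = 1 \<Longrightarrow> homogS (int n) (G.bd r z k)" "2 \<le> r \<Longrightarrow> r < CARD('d) \<Longrightarrow> homogS 1 (G.bd r z k)"
    "r = CARD('d) \<Longrightarrow> homogS (int n) (G.bd r z k)"
proof -
  have zc: "homogS 0 (f * constS e)" if "homogS 0 f" for f :: "('d, 'k) S" and e
    using that homogS_mult_eq[OF that homogS_constS] by simp
  have U: "homogS 0 (G.Uz z A M)" for A M
    unfolding G.Uz_def G.q_fun_def G.Dz_def act_def Kpart_def Lpart_def
    by (auto intro!: homogS_sum homogS_constS_mult homogS_diff homogS_0 zc z)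
  have val: "homogS (int j) (G.val j \<mu>)" if "\<And>m. homogS 0 (\<mu> m)" for j \<mu>
    unfolding G.val_def by (intro homogS_sum homogS_mult_eq[OF that homogS_Xp]) (simp add: monoms_def)
  have n1: "int n = 1 + int (n - 1)" using n2' by simp
  show "homogS (int n) (G.bd r z k)" if "r = 1"
    using that by (auto simp: G.bd_def G.bfirst_def Lpart_def intro!: homogS_add homogS_0 homogS_constS_mult val z U homogS_mult_eq[OF homogS_Xs val n1])
  have X: "homogS 0 f \<Longrightarrow> homogS 1 (Xs i * f)" for f :: "('d, 'k) S" and i by (rule homogS_mult_eq[OF homogS_Xs]) auto
  have "homogS 1 (G.bmid z k)"
    by (cases k) (auto simp: G.bmid_def KosX_def ext_contract_def coef_mul_def Kpart_def Lpart_def eta_sum kappa_sum act_def proj0_def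
      intro!: homogS_diff homogS_constS_mult homogS_sum X homogS_ext_sign z homogS_0 U zc)
  thus "homogS 1 (G.bd r z k)" if "2 \<le> r" "r < CARD('d)" using that by (simp add: G.bd_def)
  have zg: "homogS (int n) (z k * G.L_gen m)" for k m by (rule homogS_mult_eq[OF z homogS_L_gen]) simp
  have zt: "homogS (int (n - 1)) (z k * proj0 G.q_dual m)" for k m
    by (rule homogS_mult_eq[OF z, of "int (n - 1)"]) (auto simp: proj0_def homogS_q_dual homogS_0)
  have "homogS (int n) (G.btop z k)"
    by (cases k) (auto simp: G.btop_def eta_sum kappa_sum homogS_0
      intro!: homogS_sum homogS_ext_sign zg zt homogS_uminus homogS_mult_eq[OF homogS_Xs _ n1])
  thus "homogS (int n) (G.bd r z k)" if "r = CARD('d)" using that d3 by (simp add: G.bd_def)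
qed

end

locale gorenstein_data =
  fixes scale :: "'k::field \<Rightarrow> 'a::comm_ring_1 \<Rightarrow> 'a" and G :: "nat \<Rightarrow> 'a set" and a :: "'d::{finite,linorder} \<Rightarrow> 'a"
    and n :: nat and x1 x1s :: "'d \<Rightarrow> int" and x :: "'d \<Rightarrow> 'd \<Rightarrow> int"
    and \<alpha> :: "('d \<Rightarrow> 'k) \<Rightarrow> ('d, 'k) S" and \<phi> :: "('d, 'k) S \<Rightarrow> 'k"
  assumes alg: "standard_graded_algebra scale G" and a: "basis_deg1 scale G a"
    and ld: "least_degree {f. nat_surj scale a f = 0} n"
    and d3: "3 \<le> CARD('d)" and n2: "2 \<le> n"
    and x1: "(\<Sum>l\<in>UNIV. x1s l * x1 l) = 1" and ab: "adapted_basis x1 x1s x"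
    and iso: "linear_iso_deg1 \<alpha>"
    and dp: "\<phi> \<in> divided_power_dual (2 * n - 2)" and ann: "annS \<phi> = {f. nat_surj scale a f = 0}"
begin

text \<open>Subtracting t x_1, where t is the value of \<open>x1s\<close> at u, moves u into the
  kernel of \<open>x1s\<close>.\<close>

lemma x_span: "\<exists>b. u = (\<lambda>l. \<Sum>i\<in>UNIV. b i * x i l)"
proof -
  define t where "t = (\<Sum>l\<in>UNIV. x1s l * u l)"
  have "(\<Sum>l\<in>UNIV. x1s l * (u l - t * x1 l)) = t - t * (\<Sum>l\<in>UNIV. x1s l * x1 l)"
    by (simp add: t_def right_diff_distrib sum_subtractf sum_distrib_left mult_ac)
  hence "(\<Sum>l\<in>UNIV. x1s l * (u l - t * x1 l)) = 0" by (simp add: x1)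
  then obtain b where b: "b i1 = 0" "(\<lambda>l. u l - t * x1 l) = (\<lambda>l. \<Sum>i\<in>UNIV. b i * x i l)"
    using ab unfolding adapted_basis_def by meson
  have "u l = (\<Sum>i\<in>UNIV. (b(i1 := t)) i * x i l)" for l
  proof -
    have "(\<Sum>i\<in>UNIV. (b(i1 := t)) i * x i l) = (\<Sum>i\<in>UNIV. b i * x i l + (if i = i1 then t * x i l else 0))"
      by (rule sum.cong) (auto simp: b(1))
    also have "\<dots> = (\<Sum>i\<in>UNIV. b i * x i l) + t * x1 l" using ab by (simp add: sum.distrib adapted_basis_def)
    finally show ?thesis using fun_cong[OF b(2), of l] by simp
  qed
  thus ?thesis by blast
qed

text \<open>Applying \<open>x1s\<close> isolates the coefficient at \<open>i1\<close>, and the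
  uniqueness of expansions in its kernel settles the others.\<close>

lemma x_indep: assumes "\<And>l. (\<Sum>i\<in>UNIV. b i * x i l) = 0" shows "b i = 0"
proof -
  have "0 = (\<Sum>l\<in>UNIV. x1s l * (\<Sum>i\<in>UNIV. b i * x i l))" using assms by simp
  also have "\<dots> = (\<Sum>i\<in>UNIV. b i * (\<Sum>l\<in>UNIV. x1s l * x i l))"
    by (simp add: sum_distrib_left, subst sum.swap, simp add: mult_ac)
  also have "\<dots> = (\<Sum>i\<in>UNIV. if i = i1 then b i else 0)"
    by (rule sum.cong) (use ab x1 in \<open>auto simp: adapted_basis_def\<close>)
  finally have b1: "b i1 = 0" by simp
  define P where "P c \<longleftrightarrow> c i1 = 0 \<and> (\<lambda>_. 0) = (\<lambda>l. \<Sum>i\<in>UNIV. c i * x i l)" for c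
  have "\<forall>u. (\<Sum>l\<in>UNIV. x1s l * u l) = 0 \<longrightarrow> (\<exists>!c. c i1 = 0 \<and> u = (\<lambda>l. \<Sum>i\<in>UNIV. c i * x i l))"
    using ab unfolding adapted_basis_def by (elim conjE)
  from this[THEN spec, of "\<lambda>_. 0"] have "\<exists>!c. P c" unfolding P_def by simp
  moreover have "P b" using b1 assms by (simp add: P_def)
  moreover have "P (\<lambda>_. 0)" by (simp add: P_def)
  ultimately have "b = (\<lambda>_. 0)" by blast
  thus ?thesis by simp
qed

text \<open>Expanding the standard basis gives an inverse matrix on one side, and independence makes
  it two-sided. Its integrality lets the basis pass to every field.\<close>

lemma x_inverse: "\<exists>c. (\<forall>l k. (\<Sum>i\<in>UNIV. c l i * x i k) = (if l = k then 1 else 0)) \<and> (\<forall>i j. (\<Sum>l\<in>UNIV. x i l * c l j) = (if i = j then 1 else 0))"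
proof -
  have "\<forall>l. \<exists>b. (\<lambda>k. if l = k then 1 else 0) = (\<lambda>k. \<Sum>i\<in>UNIV. b i * x i k)" by (rule allI, rule x_span)
  from choice[OF this] obtain c where c: "\<And>l. (\<lambda>k. if l = k then 1 else 0) = (\<lambda>k. \<Sum>i\<in>UNIV. c l i * x i k)" by auto
  hence c': "(\<Sum>i\<in>UNIV. c l i * x i k) = (if l = k then 1 else 0)" for l k using fun_cong[OF c, of l k] by simp
  have "(\<Sum>l\<in>UNIV. x i l * c l j) - (if i = j then 1 else 0) = 0" for i j
  proof (rule x_indep[of "\<lambda>j. (\<Sum>l\<in>UNIV. x i l * c l j) - (if i = j then 1 else 0)"])
    fix k
    have "(\<Sum>j\<in>UNIV. (\<Sum>l\<in>UNIV. x i l * c l j) * x j k) = (\<Sum>l\<in>UNIV. x i l * (\<Sum>j\<in>UNIV. c l j * x j k))"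
      by (simp add: sum_distrib_left sum_distrib_right, subst sum.swap, simp add: mult_ac)
    also have "\<dots> = x i k" by (simp add: c' if_distrib[of "\<lambda>x. _ * x"] cong: if_cong)
    finally show "(\<Sum>j\<in>UNIV. ((\<Sum>l\<in>UNIV. x i l * c l j) - (if i = j then 1 else 0)) * x j k) = 0"
      by (simp add: left_diff_distrib sum_subtractf if_distrib[of "\<lambda>x. x * _"] cong: if_cong)
  qed
  thus ?thesis using c' by (intro exI[of _ c]) auto
qed

definition y where "y i = \<alpha> (one_tensor (x i))"
definition \<sigma> where "\<sigma> = evalP constS y"

lemma sigma_hom: "comm_ring_hom \<sigma>" unfolding \<sigma>_def by (rule evalP_hom[OF comm_ring_hom_constS])

sublocale s: comm_ring_hom \<sigma> by (rule sigma_hom)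

lemma sigma_constS: "\<sigma> (constS e) = constS e" unfolding \<sigma>_def by (rule evalP_constS)
lemma sigma_Xs: "\<sigma> (Xs i) = y i" unfolding \<sigma>_def by (rule evalP_Xs)

lemma alpha_sum: "\<alpha> (\<lambda>l. \<Sum>i\<in>C. b i * w i l) = (\<Sum>i\<in>C. constS (b i) * \<alpha> (w i))"
proof -
  have add: "\<alpha> (\<lambda>i. v i + w i) = \<alpha> v + \<alpha> w" and sc: "\<alpha> (\<lambda>i. c * v i) = constS c * \<alpha> v" for v w c
    using iso unfolding linear_iso_deg1_def by blast+
  have z: "\<alpha> (\<lambda>_. 0) = 0" using sc[of 0 "\<lambda>_. 0"] by (simp add: constS_def)
  show ?thesis
  proof (induct C rule: infinite_finite_induct)
    case (insert i C)
    thus ?case using add[of "\<lambda>l. b i * w i l" "\<lambda>l. \<Sum>i\<in>C. b i * w i l"] by (simp add: sc)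
  qed (simp_all add: z)
qed

lemma alpha_homog: "homogS 1 (\<alpha> v)" and alpha_inj: "\<alpha> v = \<alpha> w \<Longrightarrow> v = w"
  and alpha_surj: "homogS 1 f \<Longrightarrow> \<exists>v. \<alpha> v = f"
proof -
  have b: "bij_betw \<alpha> UNIV {f. homogS 1 f}" using iso unfolding linear_iso_deg1_def by blast
  show "homogS 1 (\<alpha> v)" using bij_betwE[OF b] by blast
  show "\<alpha> v = \<alpha> w \<Longrightarrow> v = w" using bij_betw_imp_inj_on[OF b] by (auto dest: injD)
  show "homogS 1 f \<Longrightarrow> \<exists>v. \<alpha> v = f" using bij_betw_imp_surj_on[OF b] by (metis (mono_tags) imageE mem_Collect_eq)
qed

text \<open>As \<open>x\<close> is invertible over the integers, the vectors
  \<open>one_tensor (x i)\<close> form a basis over k in every characteristic. The inverse \<tau>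
  sends each variable to the linear form whose coefficients are the coordinates of its
  \<alpha>-preimage in this basis.\<close>

lemma sigma_bij: "bij \<sigma>"
proof -
  obtain c where c: "\<And>l k. (\<Sum>i\<in>UNIV. c l i * x i k) = (if l = k then 1 else 0)" "\<And>i j. (\<Sum>l\<in>UNIV. x i l * c l j) = (if i = j then 1 else 0)"
    using x_inverse by blast
  have "\<forall>j. \<exists>v. \<alpha> v = Xs j" using alpha_surj homogS_Xs by blast
  then obtain v where v: "\<And>j. \<alpha> (v j) = Xs j" by metis
  define t where "t j i = (\<Sum>l\<in>UNIV. v j l * of_int (c l i))" for j i
  have vt: "v j = (\<lambda>k. \<Sum>i\<in>UNIV. t j i * one_tensor (x i) k)" for j
  proof
    fix k
    have "(\<Sum>i\<in>UNIV. t j i * one_tensor (x i) k) = (\<Sum>l\<in>UNIV. v j l * of_int (\<Sum>i\<in>UNIV. c l i * x i k))"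
      by (simp add: t_def one_tensor_def sum_distrib_left sum_distrib_right, subst sum.swap, simp add: mult_ac)
    thus "v j k = (\<Sum>i\<in>UNIV. t j i * one_tensor (x i) k)" by (simp add: c if_distrib[of "\<lambda>x. _ * x"] if_distrib[of of_int] cong: if_cong)
  qed
  define \<tau> where "\<tau> = evalP constS (\<lambda>j. \<Sum>i\<in>UNIV. constS (t j i) * Xs i :: ('d, 'k) S)"
  have tau: "comm_ring_hom \<tau>" unfolding \<tau>_def by (rule evalP_hom[OF comm_ring_hom_constS])
  interpret tau: comm_ring_hom \<tau> by (rule tau)
  have tc: "\<tau> (constS e) = constS e" for e unfolding \<tau>_def by (rule evalP_constS)
  have tX: "\<tau> (Xs j) = (\<Sum>i\<in>UNIV. constS (t j i) * Xs i)" for j unfolding \<tau>_def by (rule evalP_Xs)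
  have "\<sigma> (\<Sum>i\<in>UNIV. constS (t j i) * Xs i) = Xs j" for j
  proof -
    have "\<sigma> (\<Sum>i\<in>UNIV. constS (t j i) * Xs i) = (\<Sum>i\<in>UNIV. constS (t j i) * y i)"
      by (simp add: s.hom_sum s.hom_mult sigma_constS sigma_Xs)
    also have "\<dots> = \<alpha> (\<lambda>k. \<Sum>i\<in>UNIV. t j i * one_tensor (x i) k)" unfolding y_def by (rule alpha_sum[symmetric])
    also have "\<dots> = Xs j" using vt[of j] v[of j] by simp
    finally show ?thesis .
  qed
  hence st: "\<sigma> (\<tau> f) = f" for f
    unfolding \<tau>_def hom_evalP[OF sigma_hom sigma_constS] by (simp only: evalP_Xs_id)
  have ty: "\<tau> (y i) = Xs i" for i
  proof -
    define s where "s j = Poly_Mapping.lookup (y i) (ei j)" for j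
    have ys: "y i = (\<Sum>j\<in>UNIV. constS (s j) * Xs j)" unfolding s_def by (rule homog1_expand) (simp add: y_def alpha_homog)
    also have "\<dots> = \<alpha> (\<lambda>l. \<Sum>j\<in>UNIV. s j * v j l)" by (simp add: alpha_sum v)
    finally have sv: "(\<lambda>l. \<Sum>j\<in>UNIV. s j * v j l) = one_tensor (x i)" using alpha_inj unfolding y_def by metis
    have "(\<Sum>j\<in>UNIV. s j * t j k) = (if i = k then 1 else 0)" for k
    proof -
      have "(\<Sum>j\<in>UNIV. s j * t j k) = (\<Sum>l\<in>UNIV. (\<Sum>j\<in>UNIV. s j * v j l) * of_int (c l k))"
        by (simp add: t_def sum_distrib_left sum_distrib_right, subst sum.swap, simp add: mult_ac)
      also have "\<dots> = of_int (\<Sum>l\<in>UNIV. x i l * c l k)" using fun_cong[OF sv] by (simp add: one_tensor_def)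
      finally show ?thesis by (simp add: c)
    qed
    hence "(\<Sum>k\<in>UNIV. constS (\<Sum>j\<in>UNIV. s j * t j k) * Xs k) = (\<Sum>k\<in>UNIV. if i = k then Xs k else 0 :: ('d, 'k) S)"
      by (intro sum.cong) auto
    hence "(\<Sum>k\<in>UNIV. constS (\<Sum>j\<in>UNIV. s j * t j k) * Xs k) = (Xs i :: ('d, 'k) S)" by simp
    moreover have "\<tau> (y i) = (\<Sum>k\<in>UNIV. constS (\<Sum>j\<in>UNIV. s j * t j k) * Xs k)"
      unfolding ys by (simp add: tau.hom_sum tau.hom_mult tc tX constS.hom_sum constS.hom_mult sum_distrib_left sum_distrib_right mult.assoc)
       (rule sum.swap)
    ultimately show ?thesis by simp
  qed
  have ts: "\<tau> (\<sigma> f) = f" for f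
    unfolding \<sigma>_def hom_evalP[OF tau tc] by (simp only: ty evalP_Xs_id)
  show ?thesis by (rule o_bij[of \<tau>]) (auto simp: st ts fun_eq_iff)
qed

lemma mon_val_y: "mon_val y l = sym_alpha x \<alpha> l"
  by (simp add: mon_val_UNIV sym_alpha_def y_def)

lemma homogS_sym: "homogS (int (mdeg l)) (sym_alpha x \<alpha> l)"
proof -
  have "homogS (\<Sum>i\<in>UNIV. int (Poly_Mapping.lookup l i) * 1) (sym_alpha x \<alpha> l)"
    unfolding sym_alpha_def by (intro homogS_prod homogS_power alpha_homog) auto
  thus ?thesis by (simp add: mdeg_def)
qed

lemma sigma_homog: assumes "homogS t f" shows "homogS t (\<sigma> f)"
  unfolding \<sigma>_def evalP_def mon_val_y
proof (intro homogS_sum homogS_constS_mult)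
  fix l assume "l \<in> Poly_Mapping.keys f"
  hence "t = int (mdeg l)" using assms by (simp add: homogS_def)
  thus "homogS t (sym_alpha x \<alpha> l)" using homogS_sym by simp
qed

lemma phi_add: "\<phi> (f + g) = \<phi> f + \<phi> g" and phi_scale: "\<phi> (constS c * f) = c * \<phi> f"
  and phi_deg: "l \<noteq> 2 * n - 2 \<Longrightarrow> homogS (int l) f \<Longrightarrow> \<phi> f = 0"
  using dp unfolding divided_power_dual_def by blast+

lemma phi_0: "\<phi> 0 = 0" using phi_scale[of 0 0] by simp
lemma phi_sum: "\<phi> (sum f C) = (\<Sum>i\<in>C. \<phi> (f i))"
  by (induct C rule: infinite_finite_induct) (auto simp: phi_add phi_0)

lemma phi_sigma: "\<phi> (\<sigma> f) = (\<Sum>l | mdeg l = 2 * n - 2. Poly_Mapping.lookup f l * \<phi> (sym_alpha x \<alpha> l))"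
proof -
  have "\<phi> (\<sigma> f) = (\<Sum>l\<in>Poly_Mapping.keys f. Poly_Mapping.lookup f l * \<phi> (sym_alpha x \<alpha> l))"
    by (simp add: \<sigma>_def evalP_def mon_val_y phi_sum phi_scale)
  also have "\<dots> = (\<Sum>l\<in>Poly_Mapping.keys f \<inter> {l. mdeg l = 2 * n - 2}. Poly_Mapping.lookup f l * \<phi> (sym_alpha x \<alpha> l))"
    by (rule sum.mono_neutral_right) (auto intro: phi_deg[OF _ homogS_sym])
  also have "\<dots> = (\<Sum>l | mdeg l = 2 * n - 2. Poly_Mapping.lookup f l * \<phi> (sym_alpha x \<alpha> l))"
    using finite_monoms[of "2 * n - 2"] by (intro sum.mono_neutral_left) (auto simp: monoms_def in_keys_iff)
  finally show ?thesis .
qed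

text \<open>This keeps the scalars assigned by \<phi> but replaces the images of the x_i by the
  variables. Since \<sigma> fixes constants, following it by \<sigma> gives the evaluation that
  agrees with \<rho>.\<close>

definition h0 where "h0 = case_sum Xs (\<lambda>m. constS (\<phi> (sym_alpha x \<alpha> m)))"
definition \<rho>0 where "\<rho>0 = evalR h0"
definition ft where "ft m = (if m \<in> monoms (2 * n - 1) \<and> Poly_Mapping.lookup m i1 > 0 then \<phi> (sym_alpha x \<alpha> (m - ei i1)) else 0)"
text \<open>Taking constant terms loses nothing: the elements with constant image form a subring
  containing all values of \<Phi>, hence also \<delta> and the entries of q.\<close>

definition cc where "cc = Poly_Mapping.lookup (\<rho>0 (delta n)) 0"
definition Qk where "Qk M N = Poly_Mapping.lookup (\<rho>0 (QR n M N)) 0"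

lemma rho0_hom: "comm_ring_hom \<rho>0" unfolding \<rho>0_def by (rule evalR_hom)

sublocale r0: comm_ring_hom \<rho>0 by (rule rho0_hom)

lemma subring_const: "subring {P. \<exists>e. \<rho>0 P = constS e}"
  unfolding subring_def by (auto simp: r0.hom_minus r0.hom_mult simp flip: constS.hom_minus constS.hom_mult) (metis constS.hom_one)

lemma rho0_Phi: "\<rho>0 (Phi n m) = constS (if m \<in> monoms (2 * n - 2) then \<phi> (sym_alpha x \<alpha> m) else 0)"
  by (simp add: Phi_def \<rho>0_def[symmetric]) (simp add: \<rho>0_def evalR_Tvar h0_def)

lemma rho0_Phi_tilde: "\<rho>0 (Phi_tilde n m) = constS (ft m)"
  by (simp add: Phi_tilde_def ft_def) (simp add: \<rho>0_def evalR_Tvar h0_def)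

lemma const_eq: "\<exists>e. P = constS e \<Longrightarrow> P = constS (Poly_Mapping.lookup P 0)"
  by (auto simp: constS_def)

lemma rho0_delta: "\<rho>0 (delta n) = constS cc"
  unfolding cc_def by (rule const_eq) (use subring_delta[OF subring_const] rho0_Phi in blast)

lemma rho0_QR: "\<rho>0 (QR n M N) = constS (Qk M N)"
  unfolding Qk_def by (rule const_eq) (use subring_QR[OF subring_const] rho0_Phi in blast)

lemma constS_inj: "constS e = (constS e' :: ('d, 'k) S) \<Longrightarrow> e = e'"
  by (metis constS_def lookup_single_eq)

lemma rho0_Xvar: "\<rho>0 (Xvar i) = Xs i" by (simp add: \<rho>0_def evalR_Xvar h0_def)

text \<open>\<sigma> is onto and \<phi> is linear, so the contraction need only be tested against
  images of monomials.\<close>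

lemma ann_iff: "\<sigma> f \<in> annS \<phi> \<longleftrightarrow> (\<forall>M. \<phi> (\<sigma> (f * Poly_Mapping.single M 1)) = 0)"
proof
  assume "\<sigma> f \<in> annS \<phi>"
  thus "\<forall>M. \<phi> (\<sigma> (f * Poly_Mapping.single M 1)) = 0" by (auto simp: annS_def contractS_def s.hom_mult fun_eq_iff)
next
  assume h: "\<forall>M. \<phi> (\<sigma> (f * Poly_Mapping.single M 1)) = 0"
  have "\<phi> (\<sigma> f * g) = 0" for g
  proof -
    obtain g' where g: "g = \<sigma> g'" using sigma_bij by (metis bij_pointE)
    have "f * g' = (\<Sum>m\<in>Poly_Mapping.keys g'. constS (Poly_Mapping.lookup g' m) * (f * Poly_Mapping.single m 1))"
    proof -
      have e: "constS e * (f * Poly_Mapping.single m 1) = f * Poly_Mapping.single m e" for e m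
        unfolding mult.left_commute[of "constS e" f] by (simp add: constS_def mult_single)
      show ?thesis unfolding e sum_distrib_left[symmetric] poly_mapping_expand[of g', symmetric] ..
    qed
    hence "\<sigma> f * g = \<sigma> (\<Sum>m\<in>Poly_Mapping.keys g'. constS (Poly_Mapping.lookup g' m) * (f * Poly_Mapping.single m 1))"
      by (simp only: g s.hom_mult[symmetric])
    thus ?thesis using h by (simp add: s.hom_sum s.hom_mult[of "constS _"] sigma_constS phi_sum phi_scale)
  qed
  thus "\<sigma> f \<in> annS \<phi>" by (auto simp: annS_def contractS_def)
qed

lemma no_low_degree: "j < n \<Longrightarrow> homogS (int j) f \<Longrightarrow> \<sigma> f \<in> annS \<phi> \<Longrightarrow> f = 0"
proof -
  assume "j < n" "homogS (int j) f" "\<sigma> f \<in> annS \<phi>"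
  hence "\<sigma> f = 0" using ld sigma_homog[of "int j" f] unfolding ann least_degree_def by blast
  thus "f = 0" using sigma_bij by (metis bij_pointE s.hom_zero)
qed

lemma cc_nonzero: "cc \<noteq> 0"
proof
  assume c0: "cc = 0"
  let ?ms = "mlist (n - 1) :: 'd mono list"
  let ?N = "length ?ms"
  \<comment> \<open>A kernel vector is obtained from a vanishing determinant over a field, so the
    specialized matrix of p is rewritten with entries in k.\<close>
  define A where "A = mat ?N ?N (\<lambda>(i, j). \<phi> (sym_alpha x \<alpha> (?ms ! j + ?ms ! i)))"
  have A: "A \<in> carrier_mat ?N ?N" by (simp add: A_def)
  have ms: "?ms ! i \<in> monoms (n - 1)" if "i < ?N" for i using that set_mlist nth_mem by blast
  have "map_mat \<rho>0 (p_mat n) = map_mat constS A"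
  proof (rule eq_matI)
    fix i j assume ij: "i < dim_row (map_mat constS A)" "j < dim_col (map_mat constS A)"
    hence ij': "i < ?N" "j < ?N" by (simp_all add: A_def)
    have "?ms ! j + ?ms ! i \<in> monoms (2 * n - 2)" using ms[OF ij'(1)] ms[OF ij'(2)] n2 by (auto simp: monoms_def mdeg_add)
    thus "map_mat \<rho>0 (p_mat n) $$ (i, j) = map_mat constS A $$ (i, j)"
      using ij' carrier_matD[OF p_mat_carrier[of n, where 'd='d]] by (simp add: p_mat_entry rho0_Phi A_def)
  qed (use carrier_matD[OF p_mat_carrier[of n, where 'd='d]] in \<open>simp_all add: A_def\<close>)
  hence "det (map_mat \<rho>0 (p_mat n)) = det (map_mat constS A)" by simp
  hence "(constS cc :: ('d, 'k) S) = constS (det A)" unfolding r0.hom_det constS.hom_det delta_def[symmetric] rho0_delta .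
  hence "det A = 0" using c0 constS_inj by metis
  then obtain v where v: "v \<in> carrier_vec ?N" "v \<noteq> 0\<^sub>v ?N" "A *\<^sub>v v = 0\<^sub>v ?N"
    using det_0_iff_vec_prod_zero_field[OF A] by blast
  define f where "f = (\<Sum>j<?N. Poly_Mapping.single (?ms ! j) (v $ j))"
  have lf: "Poly_Mapping.lookup f (?ms ! j) = v $ j" if "j < ?N" for j
  proof -
    have "Poly_Mapping.lookup f (?ms ! j) = (\<Sum>i<?N. if i = j then v $ i else 0)"
      unfolding f_def lookup_sum by (rule sum.cong) (use that in \<open>auto simp: lookup_single when_def nth_eq_iff_index_eq[OF distinct_mlist]\<close>)
    thus ?thesis using that by simp
  qed
  have fh: "homogS (int (n - 1)) f" unfolding f_def
    by (intro homogS_sum) (use ms in \<open>auto simp: homogS_def monoms_def split: if_splits\<close>)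
  have "\<sigma> f \<in> annS \<phi>" unfolding ann_iff
  proof
    fix M
    have fs: "f * Poly_Mapping.single M 1 = (\<Sum>j<?N. Poly_Mapping.single (?ms ! j + M) (v $ j))"
      by (simp add: f_def sum_distrib_right mult_single)
    have ss: "\<sigma> (Poly_Mapping.single w e) = constS e * sym_alpha x \<alpha> w" for w e
      unfolding \<sigma>_def evalP_single[OF comm_ring_hom_constS] mon_val_y ..
    have e: "\<phi> (\<sigma> (f * Poly_Mapping.single M 1)) = (\<Sum>j<?N. v $ j * \<phi> (sym_alpha x \<alpha> (?ms ! j + M)))"
      unfolding fs s.hom_sum ss phi_sum phi_scale ..
    show "\<phi> (\<sigma> (f * Poly_Mapping.single M 1)) = 0"
    proof (cases "M \<in> monoms (n - 1)")
      case True
      then obtain i where i: "i < ?N" "M = ?ms ! i" using set_mlist in_set_conv_nth by metis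
      have "(A *\<^sub>v v) $ i = 0" using v(3) i(1) by simp
      thus ?thesis unfolding e using i v(1) by (simp add: A_def scalar_prod_def atLeast0LessThan mult.commute)
    next
      case False
      \<comment> \<open>For M of any other degree the product does not have degree 2n - 2, so \<phi>
        vanishes on it.\<close>
      have "\<phi> (sym_alpha x \<alpha> (?ms ! j + M)) = 0" if "j < ?N" for j
        by (rule phi_deg[OF _ homogS_sym]) (use ms[OF that] False n2 in \<open>auto simp: monoms_def mdeg_add\<close>)
      thus ?thesis unfolding e by simp
    qed
  qed
  hence "f = 0" using no_low_degree[OF _ fh] n2 by simp
  hence "v $ j = 0" if "j < ?N" for j using lf[OF that] by simp
  hence "v = 0\<^sub>v ?N" using v(1) by (intro eq_vecI) auto
  with v(2) show False by simp
qed

sublocale R: generic_data n "Xvar :: 'd \<Rightarrow> 'd R" "QR n" "delta n" "Phi_tilde n" by (rule generic_data_R[OF n2])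

sublocale SD: std_data n Qk cc ft
proof
  fix N N' :: "'d mono" assume N: "N \<in> monoms (n - 1)" "N' \<in> monoms (n - 1)"
  have "\<rho>0 (\<Sum>M\<in>monoms (n - 1). QR n M N' * Phi_tilde n (M + N + ei i1)) = \<rho>0 (if N = N' then delta n else 0)"
    unfolding R.pq[OF N] ..
  hence "constS (\<Sum>M\<in>monoms (n - 1). Qk M N' * ft (M + N + ei i1)) = (constS (if N = N' then cc else 0) :: ('d, 'k) S)"
    by (simp add: r0.hom_sum r0.hom_mult rho0_QR rho0_Phi_tilde rho0_delta constS.hom_sum constS.hom_mult)
  thus "(\<Sum>M\<in>monoms (n - 1). Qk M N' * ft (M + N + ei i1)) = (if N = N' then cc else 0)" by (rule constS_inj)
  have "\<rho>0 (\<Sum>M\<in>monoms (n - 1). QR n N M * Phi_tilde n (M + N' + ei i1)) = \<rho>0 (if N = N' then delta n else 0)"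
    unfolding R.qp[OF N] ..
  hence "constS (\<Sum>M\<in>monoms (n - 1). Qk N M * ft (M + N' + ei i1)) = (constS (if N = N' then cc else 0) :: ('d, 'k) S)"
    by (simp add: r0.hom_sum r0.hom_mult rho0_QR rho0_Phi_tilde rho0_delta constS.hom_sum constS.hom_mult)
  thus "(\<Sum>M\<in>monoms (n - 1). Qk N M * ft (M + N' + ei i1)) = (if N = N' then cc else 0)" by (rule constS_inj)
next
  fix m assume "ft m \<noteq> 0" thus "m \<in> monoms (2 * n - 1)" by (auto simp: ft_def split: if_splits)
qed (use n2 d3 cc_nonzero in auto)

text \<open>Both sides are sums over degree 2n - 2; the shift by \<open>ei i1\<close> in
  \<open>pairing\<close> undoes the shift in \<open>ft\<close>.\<close>

lemma pairing_phi: "SD.pairing f M = \<phi> (\<sigma> (f * Poly_Mapping.single M 1))"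
proof -
  have "\<phi> (\<sigma> (f * Poly_Mapping.single M 1)) = (\<Sum>l | mdeg l = 2 * n - 2 \<and> (\<exists>l'. l = l' + M). Poly_Mapping.lookup f (l - M) * \<phi> (sym_alpha x \<alpha> l))"
    unfolding phi_sigma SD.Xp_single[symmetric] SD.lookup_mult_Xp
    using finite_monoms[of "2 * n - 2"] by (intro sum.mono_neutral_cong_right) (auto simp: monoms_def)
  also have "\<dots> = SD.pairing f M"
    unfolding SD.pairing_def
  proof (rule sum.reindex_bij_witness[of _ "\<lambda>l. l + M" "\<lambda>l. l - M"], goal_cases)
    case (5 l)
    then obtain l' where l: "l = l' + M" "mdeg l' + mdeg M = 2 * n - 2" by (auto simp: mdeg_add)
    have "l' + M + ei i1 - ei i1 = l' + M" by simp
    moreover have "mdeg l' + mdeg M + 1 = 2 * n - 1" using l n2 by linarith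
    ultimately show ?case unfolding l(1) by (simp add: ft_def monoms_def mdeg_add lookup_add lookup_ei)
  qed (auto simp: mdeg_add)
  finally show ?thesis ..
qed

lemma image_ann: "f \<in> SD.im_bd1 \<longleftrightarrow> \<sigma> f \<in> annS \<phi>"
proof -
  have "f \<in> SD.im_bd1 \<longleftrightarrow> (\<forall>M. SD.pairing f M = 0)"
    by (rule SD.image_b1) (use no_low_degree in \<open>auto simp: ann_iff pairing_phi\<close>)
  thus ?thesis by (simp add: ann_iff pairing_phi)
qed

end

section \<open>The resolution\<close>

lemma mon_val_vars: "mon_val (\<lambda>v. Poly_Mapping.single (Poly_Mapping.single v 1) 1) w = (Poly_Mapping.single w 1 :: ('v \<Rightarrow>\<^sub>0 nat) \<Rightarrow>\<^sub>0 'r::comm_ring_1)"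
proof -
  have p: "(Poly_Mapping.single (Poly_Mapping.single v 1) 1 :: ('v \<Rightarrow>\<^sub>0 nat) \<Rightarrow>\<^sub>0 'r) ^ k = Poly_Mapping.single (Poly_Mapping.single v k) 1" for v k
    by (induct k) (simp_all add: mult_single single_add[symmetric] plus_1_eq_Suc)
  have "(\<Prod>v\<in>F. Poly_Mapping.single (g v) 1 :: ('v \<Rightarrow>\<^sub>0 nat) \<Rightarrow>\<^sub>0 'r) = Poly_Mapping.single (\<Sum>v\<in>F. g v) 1" for F :: "'v set" and g
    by (induct F rule: infinite_finite_induct) (simp_all add: mult_single)
  thus ?thesis using poly_mapping_expand[of w] by (simp only: mon_val_def p)
qed

text \<open>Every polynomial is its own value at the variables. So a subring containing the
  variables that occur in P contains P.\<close>

lemma evalR_vars: "evalR (\<lambda>v. Poly_Mapping.single (Poly_Mapping.single v 1) 1) P = P"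
proof -
  have e: "of_int e * Poly_Mapping.single w 1 = (Poly_Mapping.single w e :: 'd R)" for e w
    unfolding single_of_int[symmetric] by (simp add: mult_single)
  show ?thesis unfolding evalR_evalP evalP_def mon_val_vars e poly_mapping_expand[of P, symmetric] ..
qed

context gorenstein_data begin

lemma pi_hom: "comm_ring_hom (nat_surj scale a)"
proof -
  interpret V: vector_space scale using alg unfolding standard_graded_algebra_def by (elim conjE)
  have sc: "scale c x * y = scale c (x * y)" for c x y using alg unfolding standard_graded_algebra_def by blast
  have c: "comm_ring_hom (\<lambda>c. scale c 1)"
    by unfold_locales (simp_all add: V.scale_left_distrib sc)
  have "nat_surj scale a = evalP (\<lambda>c. scale c 1) a"
    by (rule ext) (simp add: nat_surj_def evalP_def sc mon_val_UNIV)
  thus ?thesis using evalP_hom[OF c, of a] by simp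
qed

text \<open>The image is a subspace closed under products that contains \<open>G 0\<close> and
  \<open>G 1\<close>, hence every \<open>G i\<close>, because the algebra is generated in degree
  one.\<close>

lemma pi_surj: "\<exists>f. nat_surj scale a f = z"
proof -
  interpret V: vector_space scale using alg unfolding standard_graded_algebra_def by (elim conjE)
  interpret p: comm_ring_hom "nat_surj scale a" by (rule pi_hom)
  have sc: "scale c x * y = scale c (x * y)" for c x y using alg unfolding standard_graded_algebra_def by blast
  have pc: "nat_surj scale a (constS c) = scale c 1" for c
    by (cases "c = 0") (simp_all add: nat_surj_def constS_def)
  have pX: "nat_surj scale a (Xs i) = a i" for i
    by (simp add: nat_surj_def Xs_def ei_def lookup_single when_def if_distrib[of "\<lambda>k. _ ^ k"] prod.delta cong: if_cong)
  let ?H = "range (nat_surj scale a)"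
  have add: "x + y \<in> ?H" and mult: "x * y \<in> ?H" if "x \<in> ?H" "y \<in> ?H" for x y
    using that by (auto simp flip: p.hom_add p.hom_mult)
  have "scale c x \<in> ?H" if "x \<in> ?H" for c x
    using mult[OF rangeI[of _ "constS c"] that] by (simp add: pc sc)
  moreover have H0: "0 \<in> ?H" using p.hom_zero by (metis rangeI)
  ultimately have H: "V.subspace ?H" using add by (simp add: V.subspace_def)
  have "range a \<subseteq> ?H" using pX by (metis image_subsetI rangeI)
  hence G1: "G 1 \<subseteq> ?H" using V.span_minimal[OF _ H] a unfolding basis_deg1_def by blast
  have Gi: "G i \<subseteq> ?H" for i
  proof (induct i)
    case 0
    have "G 0 = range (\<lambda>c. scale c 1)" using alg unfolding standard_graded_algebra_def by (elim conjE)
    thus ?case using pc by (metis image_subsetI rangeI)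
  next
    case (Suc i)
    have "{x * y | x y. x \<in> G 1 \<and> y \<in> G i} \<subseteq> ?H" using mult G1 Suc by blast
    moreover have "\<forall>i. G (Suc i) = V.span {x * y | x y. x \<in> G 1 \<and> y \<in> G i}"
      using alg unfolding standard_graded_algebra_def by (elim conjE)
    ultimately show ?case using V.span_minimal[OF _ H] by simp
  qed
  have "\<forall>x. \<exists>!c. (\<forall>i. c i \<in> G i) \<and> finite {i. c i \<noteq> 0} \<and> x = (\<Sum>i | c i \<noteq> 0. c i)"
    using alg unfolding standard_graded_algebra_def by (elim conjE)
  from ex1_implies_ex[OF this[THEN spec, of z]] obtain c where c: "\<forall>i. c i \<in> G i" "z = (\<Sum>i | c i \<noteq> 0. c i)" by (elim exE conjE)
  have "z \<in> ?H" unfolding c(2) by (rule V.subspace_sum[OF H]) (use c(1) Gi in blast)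
  thus ?thesis by auto
qed

lemma one_in_G0: "1 \<in> G 0"
proof -
  interpret V: vector_space scale using alg unfolding standard_graded_algebra_def by (elim conjE)
  have "G 0 = range (\<lambda>c. scale c 1)" using alg unfolding standard_graded_algebra_def by (elim conjE)
  thus ?thesis using V.scale_one[of 1] by (metis rangeI)
qed

definition rho_vals where "rho_vals = case_sum (\<lambda>i. \<alpha> (one_tensor (x i))) (\<lambda>m. constS (\<phi> (sym_alpha x \<alpha> m)))"

lemma evalR_sigma: "evalR rho_vals P = \<sigma> (\<rho>0 P)"
proof -
  have "(\<lambda>v. \<sigma> (h0 v)) = rho_vals"
    by (rule ext) (simp add: h0_def rho_vals_def sigma_Xs sigma_constS y_def split: sum.split)
  thus ?thesis by (simp add: \<rho>0_def hom_evalR[OF sigma_hom])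
qed

text \<open>\<open>\<rho>\<close> is a homomorphism only on \<open>Rring n\<close>, and nothing is known about its values elsewhere.\<close>
lemma rho_eq:
  assumes c: "corresponds n x \<alpha> \<phi> \<rho>" and P: "P \<in> Rring n"
  shows "\<rho> P = evalR rho_vals P"
proof -
  interpret e: comm_ring_hom "evalR rho_vals" by (rule evalR_hom)
  note R = subring_Rring[of n, where 'd='d]
  have r1: "\<rho> 1 = 1" and rm: "\<rho> (P * Q) = \<rho> P * \<rho> Q" and ra: "\<rho> (P + Q) = \<rho> P + \<rho> Q"
    if "P \<in> Rring n" "Q \<in> Rring n" for P Q
    using c that unfolding corresponds_def by blast+
  have rX: "\<rho> (\<Sum>i\<in>UNIV. of_int (c i) * Xvar i) = \<alpha> (one_tensor (\<lambda>l. \<Sum>i\<in>UNIV. c i * x i l))" for c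
    using c unfolding corresponds_def by blast
  have rT: "\<rho> (\<Sum>m\<in>monoms (2 * n - 2). of_int (c m) * Tvar m) =
      constS (\<phi> (\<Sum>m\<in>monoms (2 * n - 2). of_int (c m) * sym_alpha x \<alpha> m))" for c
    using c unfolding corresponds_def by blast
  have rd: "\<rho> (P - Q) = \<rho> P - \<rho> Q" if "P \<in> Rring n" "Q \<in> Rring n" for P Q
    using ra[OF subring_diff[OF R that] that(2)] by simp
  define C where "C = {P \<in> Rring n. \<rho> P = evalR rho_vals P}"
  have C: "subring C" unfolding subring_def C_def
    using r1[OF P P] rd rm subring_1[OF R] subring_diff[OF R] subring_mult[OF R] by (simp add: e.hom_minus e.hom_mult)
  have X: "Xvar i \<in> C" for i
  proof -
    have "\<rho> (\<Sum>j\<in>UNIV. of_int (if j = i then 1 else 0) * Xvar j) = \<alpha> (one_tensor (\<lambda>l. \<Sum>j\<in>UNIV. (if j = i then 1 else 0) * x j l))"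
      by (rule rX)
    hence "\<rho> (Xvar i) = \<alpha> (one_tensor (x i))" by (simp add: if_distrib[of of_int] if_distrib[of "\<lambda>x. x * _"] cong: if_cong)
    thus ?thesis by (simp add: C_def Xvar_Rring evalR_Xvar rho_vals_def)
  qed
  have T: "Tvar m \<in> C" if m: "m \<in> monoms (2 * n - 2)" for m
  proof -
    have "\<rho> (\<Sum>m'\<in>monoms (2 * n - 2). of_int (if m' = m then 1 else 0) * Tvar m') =
      constS (\<phi> (\<Sum>m'\<in>monoms (2 * n - 2). of_int (if m' = m then 1 else 0) * sym_alpha x \<alpha> m'))"
      by (rule rT)
    hence "\<rho> (Tvar m) = constS (\<phi> (sym_alpha x \<alpha> m))"
      using m by (simp add: if_distrib[of of_int] if_distrib[of "\<lambda>x. x * _"] cong: if_cong)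
    thus ?thesis using m by (simp add: C_def Tvar_Rring evalR_Tvar rho_vals_def)
  qed
  have v: "Poly_Mapping.single (Poly_Mapping.single v 1) 1 \<in> C" if "w \<in> Poly_Mapping.keys P" "v \<in> Poly_Mapping.keys w" for v w
  proof (cases v)
    case (Inl i)
    thus ?thesis using X[of i] by (simp add: Xvar_def)
  next
    case (Inr m)
    hence "m \<in> monoms (2 * n - 2)" using P that unfolding Rring_def monoms_def by blast
    thus ?thesis using T[of m] Inr by (simp add: Tvar_def)
  qed
  have "evalR (\<lambda>v. Poly_Mapping.single (Poly_Mapping.single v 1) 1) P \<in> C"
    unfolding evalR_def using v
    by (intro subring_sum[OF C] subring_mult[OF C] subring_of_int[OF C] subring_prod[OF C] subring_power[OF C])
  thus ?thesis by (simp only: evalR_vars) (simp add: C_def)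
qed

end

lemma homogS_of_int_mult: "homogS t f \<Longrightarrow> homogS t (of_int e * f)" for f :: "('d::finite, 'k::field) S"
  using homogS_constS_mult[of t f "of_int e"] by (simp add: constS.hom_of_int)

locale gorenstein_bases = gorenstein_data scale G a n x1 x1s x \<alpha> \<phi>
  for scale :: "'k::field \<Rightarrow> 'a::comm_ring_1 \<Rightarrow> 'a" and G and a :: "'d::{finite,linorder} \<Rightarrow> 'a" and n x1 x1s x \<alpha> \<phi> +
  fixes \<rho> and E :: "nat \<Rightarrow> ('d coord \<Rightarrow> int) list" and T
  assumes rho: "corresponds n x \<alpha> \<phi> \<rho>" and T: "lattice_coords n r (E r) (T r)"
begin

sublocale C: lattice_coords n r "E r" "T r" for r by (rule T)

definition bd_mat where "bd_mat r = mat (length (E (r - 1))) (length (E r)) (\<lambda>(i, j). C.coord_vec (r - 1) (R.bd r (\<lambda>k. of_int ((E r ! j) k))) $ i)"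

lemma bd_mat_carrier: "bd_mat r \<in> carrier_mat (length (E (r - 1))) (length (E r))"
  by (simp add: bd_mat_def)

lemma bd_E: "r \<ge> 1 \<Longrightarrow> j < length (E r) \<Longrightarrow> R.bd r (\<lambda>k. of_int ((E r ! j) k)) \<in> latG n (r - 1)"
  by (rule R.bd_closed[OF C.es_latG _ d3])

lemma bd_mat_col:
  assumes "r \<ge> 1" "j < length (E r)"
  shows "R.bd r (\<lambda>k. of_int ((E r ! j) k)) = (\<lambda>k. \<Sum>i<length (E (r - 1)). bd_mat r $$ (i, j) * of_int ((E (r - 1) ! i) k))"
proof -
  have "vec_elt (E (r - 1)) (C.coord_vec (r - 1) (R.bd r (\<lambda>k. of_int ((E r ! j) k)))) = R.bd r (\<lambda>k. of_int ((E r ! j) k))"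
    by (rule C.vec_elt_coord_vec[OF bd_E[OF assms]])
  thus ?thesis using assms(2) by (simp add: vec_elt_def bd_mat_def)
qed

lemma bd_mat_matrices: "complex_matrices n E bd_mat"
  unfolding complex_matrices_def b_map_bd[OF n2] using bd_mat_carrier bd_mat_col by blast

text \<open>A lattice basis stays independent over the generic ring, so the columns are determined.
  This reduces statements about all admissible matrices to \<open>bd_mat\<close>.\<close>

lemma matrices_bd_mat:
  assumes D: "complex_matrices n E D" and r: "r \<ge> 1" shows "D r = bd_mat r"
proof (rule eq_matI)
  have c: "D r \<in> carrier_mat (length (E (r - 1))) (length (E r))"
    and col: "\<And>j. j < length (E r) \<Longrightarrow> b_map n r (\<lambda>k. of_int ((E r ! j) k)) =
           (\<lambda>k. \<Sum>i<length (E (r - 1)). D r $$ (i, j) * of_int ((E (r - 1) ! i) k))"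
    using D r unfolding complex_matrices_def by blast+
  fix i j assume "i < dim_row (bd_mat r)" "j < dim_col (bd_mat r)"
  hence ij: "i < length (E (r - 1))" "j < length (E r)" by (simp_all add: bd_mat_def)
  have "vec_elt (E (r - 1)) (col (D r) j) = R.bd r (\<lambda>k. of_int ((E r ! j) k))"
    unfolding b_map_bd[OF n2, symmetric] col[OF ij(2)] using c ij(2) by (simp add: vec_elt_def)
  hence "col (D r) j = C.coord_vec (r - 1) (R.bd r (\<lambda>k. of_int ((E r ! j) k)))"
    using C.coord_vec_vec_elt[OF carrier_vecI, of "col (D r) j" "r - 1"] c by simp
  hence "col (D r) j $ i = C.coord_vec (r - 1) (R.bd r (\<lambda>k. of_int ((E r ! j) k))) $ i" by simp
  thus "D r $$ (i, j) = bd_mat r $$ (i, j)" using ij c by (simp add: bd_mat_def)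
qed (use D r in \<open>auto simp: complex_matrices_def bd_mat_def\<close>)

text \<open>The entries are integral linear forms in the values of the differentials, all of whose
  ingredients lie in the subring.\<close>

lemma bd_mat_Rring:
  assumes "i < length (E (r - 1))" "j < length (E r)" shows "bd_mat r $$ (i, j) \<in> Rring n"
proof -
  note R = subring_Rring[of n, where 'd='d]
  have "R.bd r (\<lambda>k. of_int ((E r ! j) k)) p \<in> Rring n" for p
    by (rule R.bd_subring[OF R]) (auto simp: Xvar_Rring subring_QR[OF R Phi_Rring] subring_delta[OF R Phi_Rring] subring_of_int[OF R]
      intro: Phi_tilde_Rring[OF C.n1])
  thus ?thesis using assms
    by (simp add: bd_mat_def C.coord_vec_def subring_sum[OF R] subring_mult[OF R] subring_of_int[OF R])
qed

definition std_mat where "std_mat r = map_mat \<rho>0 (bd_mat r)"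

lemma std_mat_carrier: "std_mat r \<in> carrier_mat (length (E (r - 1))) (length (E r))"
  by (simp add: std_mat_def bd_mat_carrier)

lemma hom_bd_E: "\<rho>0 (R.bd r (\<lambda>k. of_int ((E r ! j) k)) k) = SD.G.bd r (\<lambda>k. of_int ((E r ! j) k)) k"
proof -
  interpret dh: data_hom n Xvar "QR n" "delta n" "Phi_tilde n" Xs "\<lambda>M N. constS (Qk M N)" "constS cc" "\<lambda>m. constS (ft m)" \<rho>0
    by unfold_locales (simp_all add: rho0_Xvar rho0_QR rho0_delta rho0_Phi_tilde)
  show ?thesis by (simp add: dh.hom_bd r0.hom_of_int)
qed

lemma vec_elt_std_mat:
  assumes r: "r \<ge> 1" and v: "v \<in> carrier_vec (length (E r))"
  shows "vec_elt (E (r - 1)) (std_mat r *\<^sub>v v) = SD.G.bd r (vec_elt (E r) v)"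
proof (rule vec_elt_mult_mat[OF std_mat_carrier v])
  show "SD.G.bd r (\<lambda>k. c * z k + w k) k = c * SD.G.bd r z k + SD.G.bd r w k" for c z w k by (rule SD.G.bd_lin)
  fix j assume j: "j < length (E r)"
  have "\<rho>0 (R.bd r (\<lambda>k. of_int ((E r ! j) k)) k) = (\<Sum>i<length (E (r - 1)). std_mat r $$ (i, j) * of_int ((E (r - 1) ! i) k))" for k
    unfolding bd_mat_col[OF r j] using j carrier_matD[OF bd_mat_carrier[of r]]
    by (simp add: std_mat_def r0.hom_sum r0.hom_mult r0.hom_of_int)
  thus "SD.G.bd r (\<lambda>k. of_int ((E r ! j) k)) = (\<lambda>k. \<Sum>i<length (E (r - 1)). std_mat r $$ (i, j) * of_int ((E (r - 1) ! i) k))"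
    unfolding hom_bd_E by (rule ext)
qed

lemma vec_elt_0: "vec_elt es (0\<^sub>v (length es)) = (\<lambda>_. 0)"
  by (simp add: vec_elt_def)

lemma std_mat_exact:
  assumes r: "r \<ge> 1" shows "mat_ker (std_mat r) = mat_image (std_mat (Suc r))"
proof -
  note c = std_mat_carrier[of r] std_mat_carrier[of "Suc r", simplified]
  have Mw: "std_mat (Suc r) *\<^sub>v w \<in> carrier_vec (length (E r))" if "w \<in> carrier_vec (length (E (Suc r)))" for w
    using c(2) that by simp
  have vM: "vec_elt (E r) (std_mat (Suc r) *\<^sub>v w) = SD.G.bd (Suc r) (vec_elt (E (Suc r)) w)" if "w \<in> carrier_vec (length (E (Suc r)))" for w
    using vec_elt_std_mat[of "Suc r" w] that by simp
  show ?thesis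
  proof (intro equalityI subsetI)
    fix v assume "v \<in> mat_ker (std_mat r)"
    hence v: "v \<in> carrier_vec (length (E r))" "std_mat r *\<^sub>v v = 0\<^sub>v (length (E (r - 1)))" using c by (auto simp: mat_ker_def)
    have "SD.G.bd r (vec_elt (E r) v) = (\<lambda>_. 0)" using vec_elt_std_mat[OF r v(1)] v(2) by (simp add: vec_elt_0)
    then obtain z where z: "z \<in> latG n (Suc r)" "vec_elt (E r) v = SD.G.bd (Suc r) z"
      using SD.exact[OF r C.vec_elt_latG] by blast
    define w where "w = C.coord_vec (Suc r) z"
    have w: "w \<in> carrier_vec (length (E (Suc r)))" "vec_elt (E (Suc r)) w = z"
      by (simp_all add: w_def C.coord_vec_carrier C.vec_elt_coord_vec z(1))
    have "v = std_mat (Suc r) *\<^sub>v w" by (rule C.vec_elt_inj[OF v(1) Mw[OF w(1)]]) (simp add: vM[OF w(1)] w(2) z(2))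
    thus "v \<in> mat_image (std_mat (Suc r))" using w(1) c by (auto simp: mat_image_def)
  next
    fix v assume "v \<in> mat_image (std_mat (Suc r))"
    then obtain w where w: "w \<in> carrier_vec (length (E (Suc r)))" "v = std_mat (Suc r) *\<^sub>v w" using c by (auto simp: mat_image_def)
    have v: "v \<in> carrier_vec (length (E r))" using Mw w by simp
    have "vec_elt (E (r - 1)) (std_mat r *\<^sub>v v) = (\<lambda>_. 0)"
      unfolding vec_elt_std_mat[OF r v] unfolding w(2) vM[OF w(1)] by (rule SD.G.bd_bd[OF C.vec_elt_latG r d3])
    hence "std_mat r *\<^sub>v v = 0\<^sub>v (length (E (r - 1)))"
      using c(1) v by (intro C.vec_elt_inj[of _ "r - 1"]) (auto simp: vec_elt_0)
    thus "v \<in> mat_ker (std_mat r)" using c v by (simp add: mat_ker_def)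
  qed
qed

text \<open>The degree jumps are n at both ends and 1 in between. Their positivity is the source of
  minimality.\<close>

lemma std_mat_homog:
  assumes r: "r \<ge> 1" and ij: "i < length (E (r - 1))" "j < length (E r)"
  shows "homogS (base_change_degrees n E r ! j - base_change_degrees n E (r - 1) ! i) (std_mat r $$ (i, j))"
    "base_change_degrees n E r ! j - base_change_degrees n E (r - 1) ! i \<ge> 1"
proof -
  let ?g = "base_change_degrees n E r ! j - base_change_degrees n E (r - 1) ! i"
  have std_mat: "std_mat r $$ (i, j) = (\<Sum>p\<in>latQ n (r - 1). of_int (T (r - 1) i p) * SD.G.bd r (\<lambda>k. of_int ((E r ! j) k)) p)"
    using ij by (simp add: std_mat_def bd_mat_def C.coord_vec_def r0.hom_sum r0.hom_mult r0.hom_of_int hom_bd_E)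
  let ?z = "\<lambda>k. of_int ((E r ! j) k) :: ('d, 'k) S"
  have h0: "homogS 0 (?z k)" for k
    using homogS_of_int_mult[OF homogS_1, of "(E r ! j) k"] by simp
  \<comment> \<open>Beyond d the lattice is zero and the matrices have no columns.\<close>
  have rd: "r \<le> CARD('d)" using lattice_basis_length_0[OF C.basis[of r]] ij(2) by (cases "r > CARD('d)") auto
  consider "r = 1" | "2 \<le> r" "r < CARD('d)" | "r = CARD('d)" using r rd by linarith
  hence "(?g = int n \<and> (r = 1 \<or> r = CARD('d))) \<or> (?g = 1 \<and> 2 \<le> r \<and> r < CARD('d))"
  proof cases
    case 1 thus ?thesis using ij d3 by (simp add: base_change_degrees_def)
  next
    case 2
    hence "r - 1 < CARD('d)" by linarith
    with 2 show ?thesis using ij by (simp add: base_change_degrees_def of_nat_diff)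
  next
    case 3 thus ?thesis using ij d3 by (simp add: base_change_degrees_def of_nat_diff)
  qed
  note g = this
  have "homogS ?g (SD.G.bd r ?z p)" for p
    using g SD.homogS_bd[where z="?z" and r=r and k=p, OF h0] by auto
  thus "homogS ?g (std_mat r $$ (i, j))" unfolding std_mat by (intro homogS_sum homogS_of_int_mult)
  show "?g \<ge> 1" using g n2 by auto
qed

text \<open>The basis vector of the rank one module \<open>B\<^sub>0\<close> may be -1 as well as 1;
  the integer u cancels this unit.\<close>

lemma std_mat_image_1:
  assumes v: "v \<in> carrier_vec (length (E 0))"
  shows "v \<in> mat_image (std_mat 1) \<longleftrightarrow> v $ 0 \<in> SD.im_bd1"
proof -
  obtain u where l: "length (E 0) = 1" and u: "u * (E 0 ! 0) One = 1"
    using lattice_basis_0[OF C.n1 C.basis[of 0]] by blast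
  define e :: "('d, 'k) S" where "e = of_int ((E 0 ! 0) One)"
  have ue: "of_int u * e = 1" unfolding e_def of_int_mult[symmetric] u by simp
  have vF: "vec_elt (E 0) w One = w $ 0 * e" for w :: "('d, 'k) S vec" by (simp add: vec_elt_def e_def l One_nat_def)
  have uwe: "of_int u * (w * e) = w" for w using ue by (simp add: mult.left_commute)
  note c = std_mat_carrier[of 1, simplified]
  have vM: "(std_mat 1 *\<^sub>v w) $ 0 * e = SD.G.bd 1 (vec_elt (E 1) w) One" if "w \<in> carrier_vec (length (E 1))" for w
    using fun_cong[OF vec_elt_std_mat[of 1 w], of One] that by (simp add: vF)
  show ?thesis
  proof
    assume "v \<in> mat_image (std_mat 1)"
    then obtain w where w: "w \<in> carrier_vec (length (E 1))" "v = std_mat 1 *\<^sub>v w" using c by (auto simp: mat_image_def)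
    have "v $ 0 * e \<in> SD.im_bd1" unfolding w(2) vM[OF w(1)] SD.im_bd1_def using C.vec_elt_latG by blast
    from SD.im_bd1_mult[OF this, of "of_int u"] show "v $ 0 \<in> SD.im_bd1" by (simp only: uwe)
  next
    assume "v $ 0 \<in> SD.im_bd1"
    hence "v $ 0 * e \<in> SD.im_bd1" using SD.im_bd1_mult[of "v $ 0" e] by (simp add: mult.commute)
    then obtain z where z: "z \<in> latG n 1" "v $ 0 * e = SD.G.bd 1 z One" unfolding SD.im_bd1_def by blast
    define w where "w = C.coord_vec 1 z"
    have w: "w \<in> carrier_vec (length (E 1))" "vec_elt (E 1) w = z" by (simp_all add: w_def C.coord_vec_carrier C.vec_elt_coord_vec z(1))
    have "(std_mat 1 *\<^sub>v w) $ 0 * e = v $ 0 * e" unfolding vM[OF w(1)] w(2) z(2) ..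
    hence "(std_mat 1 *\<^sub>v w) $ 0 = v $ 0" using uwe by metis
    hence "v = std_mat 1 *\<^sub>v w" using v c l by (intro eq_vecI) auto
    thus "v \<in> mat_image (std_mat 1)" using w(1) c by (auto simp: mat_image_def)
  qed
qed

context
  fixes D assumes D: "complex_matrices n E D"
begin

lemma base_change_entry:
  assumes "r \<ge> 1" "i < length (E (r - 1))" "j < length (E r)"
  shows "base_change_matrices \<rho> D r $$ (i, j) = evalR rho_vals (D r $$ (i, j))" "D r $$ (i, j) \<in> Rring n"
  using assms rho_eq[OF rho bd_mat_Rring[OF assms(2,3)]] carrier_matD[OF bd_mat_carrier[of r]] bd_mat_Rring[OF assms(2,3)]
  by (simp_all add: base_change_matrices_def matrices_bd_mat[OF D])

lemma base_change_std_mat: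
  assumes r: "r \<ge> 1" shows "base_change_matrices \<rho> D r = map_mat \<sigma> (std_mat r)"
proof (rule eq_matI)
  fix i j assume "i < dim_row (map_mat \<sigma> (std_mat r))" "j < dim_col (map_mat \<sigma> (std_mat r))"
  hence ij: "i < length (E (r - 1))" "j < length (E r)" using carrier_matD[OF std_mat_carrier[of r]] by simp_all
  show "base_change_matrices \<rho> D r $$ (i, j) = map_mat \<sigma> (std_mat r) $$ (i, j)"
    using base_change_entry(1)[OF r ij] ij carrier_matD[OF bd_mat_carrier[of r]] matrices_bd_mat[OF D r]
    by (simp add: std_mat_def evalR_sigma)
qed (simp_all add: base_change_matrices_def std_mat_def matrices_bd_mat[OF D r])

lemma resolution:
  "minimal_homogeneous_resolution (nat_surj scale a) G (base_change_degrees n E) (base_change_matrices \<rho> D)"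
proof -
  let ?F = "base_change_degrees n E" and ?M = "base_change_matrices \<rho> D" and ?\<pi> = "nat_surj scale a"
  have lF: "length (?F r) = length (E r)" for r by (simp add: base_change_degrees_def)
  have cM: "?M r \<in> carrier_mat (length (E (r - 1))) (length (E r))" if "r \<ge> 1" for r
    using std_mat_carrier[of r] base_change_std_mat[OF that] by simp
  have hM: "homogS (?F r ! j - ?F (r - 1) ! i) (?M r $$ (i, j))" if "r \<ge> 1" "i < length (E (r - 1))" "j < length (E r)" for r i j
    using sigma_homog[OF std_mat_homog(1)[OF that]] base_change_std_mat[OF that(1)] carrier_matD[OF std_mat_carrier[of r]] that by simp
  have ex: "mat_ker (?M r) = mat_image (?M (Suc r))" if "r \<ge> 1" for r
    using std_mat_exact[OF that] base_change_std_mat[of r] base_change_std_mat[of "Suc r"] that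
    by (simp add: mat_ker_map[OF sigma_hom sigma_bij] mat_image_map[OF sigma_hom sigma_bij])
  have l: "length (E 0) = 1" using lattice_basis_0(1)[OF C.n1 C.basis[of 0]] .
  have au: "augmentation ?\<pi> [1] v = ?\<pi> (v $ 0)" for v by (simp add: augmentation_def)
  have img: "v \<in> mat_image (?M 1) \<longleftrightarrow> ?\<pi> (v $ 0) = 0" if v: "v \<in> carrier_vec 1" for v
  proof -
    define w where "w = map_vec (inv_into UNIV \<sigma>) v"
    have vw: "v = map_vec \<sigma> w" using sigma_bij by (auto simp: w_def bij_is_surj surj_f_inv_f)
    have w: "w \<in> carrier_vec 1" using v by (simp add: w_def)
    have k: "map_vec (inv_into UNIV \<sigma>) (map_vec \<sigma> w') = w'" for w'
      using sigma_bij by (intro eq_vecI) (simp_all add: bij_is_inj)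
    have inj: "w' = w" if e: "map_vec \<sigma> w' = map_vec \<sigma> w" for w'
    proof -
      have "w' = map_vec (inv_into UNIV \<sigma>) (map_vec \<sigma> w')" by (rule k[symmetric])
      also have "\<dots> = w" unfolding e by (rule k)
      finally show ?thesis .
    qed
    have "v \<in> mat_image (?M 1) \<longleftrightarrow> w \<in> mat_image (std_mat 1)"
    proof -
      have "mat_image (?M 1) = map_vec \<sigma> ` mat_image (std_mat 1)"
        using base_change_std_mat[of 1] by (simp add: mat_image_map[OF sigma_hom sigma_bij])
      thus ?thesis by (auto simp only: vw dest: inj[OF sym])
    qed
    also have "\<dots> \<longleftrightarrow> \<sigma> (w $ 0) \<in> annS \<phi>" using std_mat_image_1[of w] w l by (simp add: image_ann)
    also have "\<dots> \<longleftrightarrow> ?\<pi> (v $ 0) = 0" using w by (simp add: ann vw)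
    finally show ?thesis .
  qed
  have img_c: "mat_image (?M 1) \<subseteq> carrier_vec 1" using cM[of 1] l by (auto simp: mat_image_def)
  have "homogeneous_free_resolution ?\<pi> G ?F ?M"
    unfolding homogeneous_free_resolution_def
  proof (intro conjI allI impI)
    show "homogeneous_maps ?F ?M" unfolding homogeneous_maps_def lF using cM hM by blast
    show "\<exists>g. length g = length (?F 0) \<and> (\<forall>i<length g. g ! i \<in> (if ?F 0 ! i \<ge> 0 then G (nat (?F 0 ! i)) else {0})) \<and>
        augmentation ?\<pi> g ` carrier_vec (length (?F 0)) = UNIV \<and>
        {v \<in> carrier_vec (length (?F 0)). augmentation ?\<pi> g v = 0} = mat_image (?M 1)"
    proof (rule exI[of _ "[1]"], intro conjI)
      show "\<forall>i<length [1]. [1] ! i \<in> (if ?F 0 ! i \<ge> 0 then G (nat (?F 0 ! i)) else {0})"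
        using l one_in_G0 by (simp add: base_change_degrees_def)
      have "\<exists>v\<in>carrier_vec 1. ?\<pi> (v $ 0) = z" for z
      proof -
        obtain f where "?\<pi> f = z" using pi_surj by blast
        thus ?thesis by (intro bexI[of _ "vec 1 (\<lambda>_. f)"]) simp_all
      qed
      hence "\<exists>v\<in>carrier_vec 1. z = augmentation ?\<pi> [1] v" for z unfolding au by metis
      thus "augmentation ?\<pi> [1] ` carrier_vec (length (?F 0)) = UNIV" unfolding lF l by (simp add: image_def)
      show "{v \<in> carrier_vec (length (?F 0)). augmentation ?\<pi> [1] v = 0} = mat_image (?M 1)"
        using img img_c by (auto simp: lF l au)
    qed (simp add: lF l)
  qed (rule ex)
  moreover have "Poly_Mapping.lookup (?M r $$ (i, j)) 0 = 0" if r: "r \<ge> 1" and "i < dim_row (?M r)" "j < dim_col (?M r)" for r i j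
  proof -
    have ij: "i < length (E (r - 1))" "j < length (E r)" using that carrier_matD[OF cM[OF r]] by simp_all
    \<comment> \<open>A constant term would have degree 0, whereas the entry is homogeneous of
      degree at least 1.\<close>
    have "0 \<notin> Poly_Mapping.keys (?M r $$ (i, j))"
      using hM[OF r ij] std_mat_homog(2)[OF r ij] by (auto simp: homogS_def mdeg_def)
    thus ?thesis by (simp add: in_keys_iff)
  qed
  ultimately show ?thesis unfolding minimal_homogeneous_resolution_def by blast
qed

end

end

theorem corollary6p18:
  fixes scale :: "'k::field \<Rightarrow> 'a::comm_ring_1 \<Rightarrow> 'a"
    and G :: "nat \<Rightarrow> 'a set"
    and a :: "'d::{finite,linorder} \<Rightarrow> 'a"
    and n :: nat
    and x1 x1s :: "'d \<Rightarrow> int"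
    and x :: "'d \<Rightarrow> 'd \<Rightarrow> int"
    and \<alpha> :: "('d \<Rightarrow> 'k) \<Rightarrow> ('d, 'k) S"
    and \<phi> :: "('d, 'k) S \<Rightarrow> 'k"
    and \<rho> :: "'d R \<Rightarrow> ('d, 'k) S"
  defines "\<pi> \<equiv> nat_surj scale a"
  defines "I \<equiv> {f. \<pi> f = 0}"
  assumes "artinian_gorenstein scale G"
    and "basis_deg1 scale G a"
    and "least_degree I n"
    and "3 \<le> CARD('d)" and "2 \<le> n"
    and "(\<Sum>l\<in>UNIV. x1s l * x1 l) = 1" and "adapted_basis x1 x1s x"
    and "linear_iso_deg1 \<alpha>"
    and "\<phi> \<in> divided_power_dual (2 * n - 2)" and "annS \<phi> = I"
    and "corresponds n x \<alpha> \<phi> \<rho>"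
    and "\<exists>F M. minimal_homogeneous_resolution \<pi> G F M \<and> gorenstein_linear F"
  shows "(\<exists>E :: nat \<Rightarrow> ('d coord \<Rightarrow> int) list. complex_bases n E) \<and>
    (\<forall>E :: nat \<Rightarrow> ('d coord \<Rightarrow> int) list. complex_bases n E \<longrightarrow>
      (\<exists>D. complex_matrices n E D) \<and>
      (\<forall>D. complex_matrices n E D \<longrightarrow>
        minimal_homogeneous_resolution \<pi> G (base_change_degrees n E) (base_change_matrices \<rho> D) \<and>
        (\<forall>r\<ge>1. \<forall>i<dim_row (D r). \<forall>j<dim_col (D r).
           D r $$ (i, j) \<in> Rring n \<and>
           base_change_matrices \<rho> D r $$ (i, j) =
             evalR (case_sum (\<lambda>i. \<alpha> (one_tensor (x i))) (\<lambda>m. constS (\<phi> (sym_alpha x \<alpha> m))))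
               (D r $$ (i, j)))))"
proof -
  interpret gd: gorenstein_data scale G a n x1 x1s x \<alpha> \<phi>
    using assms by unfold_locales (simp_all add: artinian_gorenstein_def)
  have n1: "n \<ge> 1" using assms by simp
  have "\<exists>E :: nat \<Rightarrow> ('d coord \<Rightarrow> int) list. complex_bases n E"
    unfolding complex_bases_def using lattice_has_basis[OF n1] by (intro choice) blast
  moreover have "(\<exists>D. complex_matrices n E D) \<and>
      (\<forall>D. complex_matrices n E D \<longrightarrow>
        minimal_homogeneous_resolution \<pi> G (base_change_degrees n E) (base_change_matrices \<rho> D) \<and>
        (\<forall>r\<ge>1. \<forall>i<dim_row (D r). \<forall>j<dim_col (D r).
           D r $$ (i, j) \<in> Rring n \<and>
           base_change_matrices \<rho> D r $$ (i, j) = evalR gd.rho_vals (D r $$ (i, j))))"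
    if E: "complex_bases n E" for E :: "nat \<Rightarrow> ('d coord \<Rightarrow> int) list"
  proof -
    have "\<forall>r. \<exists>t. lattice_coords n r (E r) t"
      using E lattice_coords_exist[OF n1] unfolding complex_bases_def by blast
    then obtain T where T: "\<And>r. lattice_coords n r (E r) (T r)" by metis
    interpret gb: gorenstein_bases scale G a n x1 x1s x \<alpha> \<phi> \<rho> E T
      by (intro gorenstein_bases.intro gorenstein_bases_axioms.intro gd.gorenstein_data_axioms T)
        (use assms in blast)
    have "\<forall>r\<ge>1. \<forall>i<dim_row (D r). \<forall>j<dim_col (D r).
           D r $$ (i, j) \<in> Rring n \<and>
           base_change_matrices \<rho> D r $$ (i, j) = evalR gd.rho_vals (D r $$ (i, j))"
      if D: "complex_matrices n E D" for D
    proof (intro allI impI)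
      fix r i j assume r: "1 \<le> r" "i < dim_row (D r)" "j < dim_col (D r)"
      have "D r \<in> carrier_mat (length (E (r - 1))) (length (E r))"
        using D r unfolding complex_matrices_def by blast
      hence "i < length (E (r - 1))" "j < length (E r)" using r by auto
      thus "D r $$ (i, j) \<in> Rring n \<and> base_change_matrices \<rho> D r $$ (i, j) = evalR gd.rho_vals (D r $$ (i, j))"
        using gb.base_change_entry[OF D r(1)] by blast
    qed
    thus ?thesis using gb.bd_mat_matrices gb.resolution unfolding \<pi>_def by blast
  qed
  ultimately show ?thesis unfolding gd.rho_vals_def by blast
qed

end
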